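(* Let $T>0$ be any finite time horizon and let $x_1\in\mathbb R^{n_1}$, $x_2\in\mathbb R^{n_2}$. Assume: (i) $\Delta_2$ is invertible; (ii) the algebraic Riccati equation $A_{22}^*P+PA_{22}+P\Delta_2P+Q_2=0$ admits a solution $\overline P_{22}\in\mathbb S^{n_2}$ such that all eigenvalues of $S:=A_{22}+\Delta_2\overline P_{22}$ have strictly negative real parts; (iii) the differential Riccati equation $\frac{d\overline P_{11}}{dt}+\widetilde A^*\overline P_{11}+\overline P_{11}\widetilde A+\overline P_{11}M\overline P_{11}+N=0$ on $[0,T]$, $\overline P_{11}(T)=0$, admits a unique solution $\overline P_{11}\in C([0,T];\mathbb S^{n_1})$; (iv) there is $\gamma>0$ with $\frac12(S^*+S)\le-\gamma I$; (v) for some $\delta\in(0,\gamma)$, $-\overline P_{22}$ lies in the interior of the closed ball $B_{\delta,q_2}$. Then there exists a Tikhonov threshold $\epsilon^*$ (defined in the context) such that for all $0<\epsilon<\epsilon^*$, $$J^\epsilon(x_1,x_2;\widehat u_1^\epsilon,\widehat u_2^\epsilon)-J^\epsilon(x_1,x_2;\overline u_1^\epsilon,\overline u_2^\epsilon)=O(\epsilon),$$ where $(\widehat u_1^\epsilon,\widehat u_2^\epsilon)$ is the feedback saddle point and $(\overline u_1^\epsilon,\overline u_2^\epsilon)$ the approximate feedback saddle point, both defined in the context.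
   Context: Notation: $M^*$ is the transpose of $M$; $\mathbb S^m$ is the space of symmetric $m\times m$ real matrices; matrices carry the inner product $\langle M,N\rangle=\mathrm{tr}(M^*N)$ and norm $|M|=\langle M,M\rangle^{1/2}$. $O(\epsilon)$ denotes a quantity bounded in norm by $C\epsilon$ for all $0<\epsilon<\epsilon^*$, with $C$ independent of $\epsilon$ (and of $t$, when the quantity depends on $t\in[0,T]$). Data: $n_1,n_2,k_1,k_2,m_1,m_2\ge1$ are integers; for $i,j\in\{1,2\}$, $A_{ij}\in\mathbb R^{n_i\times n_j}$, $B_{ij}\in\mathbb R^{n_i\times k_j}$, $\sigma_i\in\mathbb R^{n_i\times m_i}$, $Q_i\in\mathbb S^{n_i}$ are constant matrices. $W_1,W_2$ are independent $m_1$- and $m_2$-dimensional Brownian motions on $[0,T]$ on a complete probability space $(\Omega,\mathcal F,\mathbb P)$, with filtration their augmented natural filtration. $\mathbb A_T^{k}$ is the space of predictable processes in $L^2(\Omega\times[0,T];\mathbb R^k)$. The perturbation parameter satisfies $0<\epsilon\le1$. Put $\Delta_1=B_{11}B_{11}^*-B_{12}B_{12}^*$, $\Delta=B_{11}B_{21}^*-B_{12}B_{22}^*$, $\Delta_2=B_{21}B_{21}^*-B_{22}B_{22}^*$. Game: for $(u_1,u_2)\in\mathbb A_T^{k_1}\times\mathbb A_T^{k_2}$ the state solves $dX_1=[A_{11}X_1+A_{12}X_2^\epsilon+B_{11}u_1+B_{12}u_2]dt+\sigma_1dW_1$, $dX_2^\epsilon=\frac1\epsilon[A_{21}X_1+A_{22}X_2^\epsilon+B_{21}u_1+B_{22}u_2]dt+\frac{\sigma_2}{\sqrt\epsilon}dW_2$,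 $X_1(0)=x_1$, $X_2^\epsilon(0)=x_2$, and $J^\epsilon(x_1,x_2;u_1,u_2)=\frac12\mathbb E\int_0^T[\langle Q_1X_1,X_1\rangle+\langle Q_2X_2^\epsilon,X_2^\epsilon\rangle-|u_1|^2+|u_2|^2]dt$ (Player 1 maximises, Player 2 minimises). Full system: $\frac{dP_{11}^\epsilon}{dt}+f(P_{11}^\epsilon,P_{12}^\epsilon,P_{22}^\epsilon,\epsilon)=0$, $\epsilon\frac{dP_{12}^\epsilon}{dt}+g_1(P_{11}^\epsilon,P_{12}^\epsilon,P_{22}^\epsilon,\epsilon)=0$, $\epsilon\frac{dP_{22}^\epsilon}{dt}+g_2(P_{11}^\epsilon,P_{12}^\epsilon,P_{22}^\epsilon,\epsilon)=0$ on $[0,T]$, with $P_{11}^\epsilon(T)=0$, $P_{12}^\epsilon(T)=0$, $P_{22}^\epsilon(T)=0$, where $f(P_{11},P_{12},P_{22},\epsilon)=A_{11}^*P_{11}+A_{21}^*P_{12}^*+P_{11}A_{11}+P_{12}A_{21}+P_{11}\Delta_1P_{11}+P_{12}\Delta^*P_{11}+P_{11}\Delta P_{12}^*+P_{12}\Delta_2P_{12}^*+Q_1$; $g_1(P_{11},P_{12},P_{22},\epsilon)=\epsilon A_{11}^*P_{12}+A_{21}^*P_{22}+P_{11}A_{12}+P_{12}A_{22}+\epsilon P_{11}\Delta_1P_{12}+\epsilon P_{12}\Delta^*P_{12}+P_{11}\Delta P_{22}+P_{12}\Delta_2P_{22}$; $g_2(P_{11},P_{12},P_{22},\epsilon)=\epsilon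 A_{12}^*P_{12}+A_{22}^*P_{22}+\epsilon P_{12}^*A_{12}+P_{22}A_{22}+\epsilon^2P_{12}^*\Delta_1P_{12}+\epsilon P_{12}^*\Delta P_{22}+\epsilon P_{22}\Delta^*P_{12}+P_{22}\Delta_2P_{22}+Q_2$. Coefficients of the reduced differential Riccati equation: with $\Lambda=A_{22}^*\Delta_2^{-1}A_{22}-Q_2$ (which is invertible under (i) and (ii)), $\widetilde A=A_{11}-\Delta\Delta_2^{-1}[\Delta_2-A_{22}\Lambda^{-1}A_{22}^*]\Delta_2^{-1}A_{21}-A_{12}\Lambda^{-1}A_{22}^*\Delta_2^{-1}A_{21}$; $M=\Delta_1+A_{12}\Lambda^{-1}A_{12}^*-\Delta\Delta_2^{-1}A_{22}\Lambda^{-1}A_{12}^*-A_{12}\Lambda^{-1}A_{22}^*\Delta_2^{-1}\Delta^*-\Delta\Delta_2^{-1}[\Delta_2-A_{22}\Lambda^{-1}A_{22}^*]\Delta_2^{-1}\Delta^*$; $N=Q_1-A_{21}^*\Delta_2^{-1}[\Delta_2-A_{22}\Lambda^{-1}A_{22}^*]\Delta_2^{-1}A_{21}$. For $0<\delta<\gamma$ let $\mathcal R_\delta=\{P\in\mathbb S^{n_2}:\frac12[(S+\Delta_2P)^*+(S+\Delta_2P)]\le\delta I\}$; $B_{\delta,q_2}$ is the largest closed ball centred at $0$ in $\mathbb S^{n_2}$ contained in $\mathcal R_\delta$, and $q_2$ is its radius. Let $h(P_{11})=-(A_{21}^*\overline P_{22}+P_{11}A_{12}+P_{11}\Delta\overline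 P_{22})(A_{22}+\Delta_2\overline P_{22})^{-1}$ and $\overline P_{12}(t)=h(\overline P_{11}(t))$. The boundary-layer system on $\tau\ge0$ is $\frac{d\widehat P_{12}}{d\tau}=g_1(0,\widehat P_{12}+h(0),\widehat P_{22}+\overline P_{22},0)$, $\widehat P_{12}(0)=-h(0)$; $\frac{d\widehat P_{22}}{d\tau}=g_2(0,\widehat P_{12}+h(0),\widehat P_{22}+\overline P_{22},0)$, $\widehat P_{22}(0)=-\overline P_{22}$. Tikhonov threshold: a number $\epsilon^*\in(0,1]$ such that for all $0<\epsilon<\epsilon^*$ the full system has a unique solution $(P_{11}^\epsilon,P_{12}^\epsilon,P_{22}^\epsilon)\in C([0,T];\mathbb S^{n_1})\times C([0,T];\mathbb R^{n_1\times n_2})\times C([0,T];\mathbb S^{n_2})$, and, uniformly in $t\in[0,T]$, $P_{11}^\epsilon(t)-\overline P_{11}(t)=O(\epsilon)$, $P_{12}^\epsilon(t)-\overline P_{12}(t)-\widehat P_{12}((T-t)/\epsilon)=O(\epsilon)$, $P_{22}^\epsilon(t)-\overline P_{22}-\widehat P_{22}((T-t)/\epsilon)=O(\epsilon)$. Feedback saddle point: $\widehat u_1^\epsilon=[B_{11}^*P_{11}^\epsilon+B_{21}^*(P_{12}^\epsilon)^*]\widehat X_1^\epsilon+[\epsilon B_{11}^*P_{12}^\epsilon+B_{21}^*P_{22}^\epsilon]\widehat X_2^\epsilon$, $\widehat u_2^\epsilon=-[B_{12}^*P_{11}^\epsilon+B_{22}^*(P_{12}^\epsilon)^*]\widehat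 X_1^\epsilon-[\epsilon B_{12}^*P_{12}^\epsilon+B_{22}^*P_{22}^\epsilon]\widehat X_2^\epsilon$, where $(\widehat X_1^\epsilon,\widehat X_2^\epsilon)$ is the state process under these closed-loop controls. Approximate feedback saddle point: $\overline u_1^\epsilon=[B_{11}^*\overline P_{11}+B_{21}^*\overline P_{12}^*]\overline X_1^\epsilon+B_{21}^*\overline P_{22}\overline X_2^\epsilon$, $\overline u_2^\epsilon=-[B_{12}^*\overline P_{11}+B_{22}^*\overline P_{12}^*]\overline X_1^\epsilon-B_{22}^*\overline P_{22}\overline X_2^\epsilon$, where $(\overline X_1^\epsilon,\overline X_2^\epsilon)$ is the state process under these closed-loop controls. *)

theory Defs
  imports "HOL-Probability.Probability"
begin

notation transpose ("_\<^sup>T" [1000] 999)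

section \<open>Matrices\<close>

definition symmetric_matrices :: "(real^'n^'n) set" where
  "symmetric_matrices = {P. P\<^sup>T = P}"

definition complex_eigenvalue :: "real^'n^'n \<Rightarrow> complex \<Rightarrow> bool" where
  "complex_eigenvalue S z \<longleftrightarrow>
     (\<exists>v :: complex^'n. v \<noteq> 0 \<and> (\<chi> i j. complex_of_real (S $ i $ j)) *v v = z *s v)"

text \<open>The Loewner order; it is only applied to symmetric matrices.\<close>

definition loewner_le :: "real^'n^'n \<Rightarrow> real^'n^'n \<Rightarrow> bool" where
  "loewner_le X Y \<longleftrightarrow> (\<forall>v. v \<bullet> (X *v v) \<le> v \<bullet> (Y *v v))"

definition sym_part :: "real^'n^'n \<Rightarrow> real^'n^'n" where
  "sym_part X = (1/2) *\<^sub>R (X\<^sup>T + X)"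


section \<open>Data of the game\<close>

text \<open>The norm of \<open>real^'n^'m\<close> is the Frobenius norm. A matrix with \<open>a\<close> rows and \<open>b\<close> columns
  has type \<open>real^'b^'a\<close>.\<close>

record ('n1::finite, 'n2::finite, 'k1::finite, 'k2::finite, 'm1::finite, 'm2::finite) lq_game =
  A11 :: "real^'n1^'n1"
  A12 :: "real^'n2^'n1"
  A21 :: "real^'n1^'n2"
  A22 :: "real^'n2^'n2"
  B11 :: "real^'k1^'n1"
  B12 :: "real^'k2^'n1"
  B21 :: "real^'k1^'n2"
  B22 :: "real^'k2^'n2"
  sigma1 :: "real^'m1^'n1"
  sigma2 :: "real^'m2^'n2"
  Q1 :: "real^'n1^'n1"
  Q2 :: "real^'n2^'n2"

definition Delta1 :: "('n1::finite,'n2::finite,'k1::finite,'k2::finite,'m1::finite,'m2::finite) lq_game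
    \<Rightarrow> real^'n1^'n1" where
  "Delta1 G = B11 G ** (B11 G)\<^sup>T - B12 G ** (B12 G)\<^sup>T"

definition Delta :: "('n1::finite,'n2::finite,'k1::finite,'k2::finite,'m1::finite,'m2::finite) lq_game
    \<Rightarrow> real^'n2^'n1" where
  "Delta G = B11 G ** (B21 G)\<^sup>T - B12 G ** (B22 G)\<^sup>T"

definition Delta2 :: "('n1::finite,'n2::finite,'k1::finite,'k2::finite,'m1::finite,'m2::finite) lq_game
    \<Rightarrow> real^'n2^'n2" where
  "Delta2 G = B21 G ** (B21 G)\<^sup>T - B22 G ** (B22 G)\<^sup>T"


section \<open>The full Riccati system\<close>

definition riccati_f ::
  "('n1::finite,'n2::finite,'k1::finite,'k2::finite,'m1::finite,'m2::finite) lq_game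
    \<Rightarrow> real^'n1^'n1 \<Rightarrow> real^'n2^'n1 \<Rightarrow> real^'n2^'n2 \<Rightarrow> real \<Rightarrow> real^'n1^'n1" where
  "riccati_f G P11 P12 P22 \<epsilon> =
     (A11 G)\<^sup>T ** P11 + (A21 G)\<^sup>T ** P12\<^sup>T + P11 ** A11 G + P12 ** A21 G
     + P11 ** Delta1 G ** P11 + P12 ** (Delta G)\<^sup>T ** P11
     + P11 ** Delta G ** P12\<^sup>T + P12 ** Delta2 G ** P12\<^sup>T + Q1 G"

definition riccati_g1 ::
  "('n1::finite,'n2::finite,'k1::finite,'k2::finite,'m1::finite,'m2::finite) lq_game
    \<Rightarrow> real^'n1^'n1 \<Rightarrow> real^'n2^'n1 \<Rightarrow> real^'n2^'n2 \<Rightarrow> real \<Rightarrow> real^'n2^'n1" where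
  "riccati_g1 G P11 P12 P22 \<epsilon> =
     \<epsilon> *\<^sub>R ((A11 G)\<^sup>T ** P12) + (A21 G)\<^sup>T ** P22 + P11 ** A12 G + P12 ** A22 G
     + \<epsilon> *\<^sub>R (P11 ** Delta1 G ** P12) + \<epsilon> *\<^sub>R (P12 ** (Delta G)\<^sup>T ** P12)
     + P11 ** Delta G ** P22 + P12 ** Delta2 G ** P22"

definition riccati_g2 ::
  "('n1::finite,'n2::finite,'k1::finite,'k2::finite,'m1::finite,'m2::finite) lq_game
    \<Rightarrow> real^'n1^'n1 \<Rightarrow> real^'n2^'n1 \<Rightarrow> real^'n2^'n2 \<Rightarrow> real \<Rightarrow> real^'n2^'n2" where
  "riccati_g2 G P11 P12 P22 \<epsilon> =
     \<epsilon> *\<^sub>R ((A12 G)\<^sup>T ** P12) + (A22 G)\<^sup>T ** P22 + \<epsilon> *\<^sub>R (P12\<^sup>T ** A12 G) + P22 ** A22 G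
     + (\<epsilon>^2) *\<^sub>R (P12\<^sup>T ** Delta1 G ** P12) + \<epsilon> *\<^sub>R (P12\<^sup>T ** Delta G ** P22)
     + \<epsilon> *\<^sub>R (P22 ** (Delta G)\<^sup>T ** P12) + P22 ** Delta2 G ** P22 + Q2 G"

text \<open>Solutions are functions on all of \<open>real\<close> of which only the values on \<open>{0..T}\<close> matter;
  the derivatives at the end points are one-sided. Continuity is implied.\<close>

definition full_solution ::
  "('n1::finite,'n2::finite,'k1::finite,'k2::finite,'m1::finite,'m2::finite) lq_game
    \<Rightarrow> real \<Rightarrow> real \<Rightarrow> (real \<Rightarrow> real^'n1^'n1) \<Rightarrow> (real \<Rightarrow> real^'n2^'n1) \<Rightarrow> (real \<Rightarrow> real^'n2^'n2) \<Rightarrow> bool"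
  where
  "full_solution G T \<epsilon> P11 P12 P22 \<longleftrightarrow>
     (\<forall>t\<in>{0..T}. P11 t \<in> symmetric_matrices \<and> P22 t \<in> symmetric_matrices
       \<and> (\<exists>D11 D12 D22.
            (P11 has_vector_derivative D11) (at t within {0..T})
          \<and> (P12 has_vector_derivative D12) (at t within {0..T})
          \<and> (P22 has_vector_derivative D22) (at t within {0..T})
          \<and> D11 + riccati_f G (P11 t) (P12 t) (P22 t) \<epsilon> = 0
          \<and> \<epsilon> *\<^sub>R D12 + riccati_g1 G (P11 t) (P12 t) (P22 t) \<epsilon> = 0
          \<and> \<epsilon> *\<^sub>R D22 + riccati_g2 G (P11 t) (P12 t) (P22 t) \<epsilon> = 0))
     \<and> P11 T = 0 \<and> P12 T = 0 \<and> P22 T = 0"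

definition full_unique_solution ::
  "('n1::finite,'n2::finite,'k1::finite,'k2::finite,'m1::finite,'m2::finite) lq_game
    \<Rightarrow> real \<Rightarrow> real \<Rightarrow> (real \<Rightarrow> real^'n1^'n1) \<Rightarrow> (real \<Rightarrow> real^'n2^'n1) \<Rightarrow> (real \<Rightarrow> real^'n2^'n2) \<Rightarrow> bool"
  where
  "full_unique_solution G T \<epsilon> P11 P12 P22 \<longleftrightarrow>
     full_solution G T \<epsilon> P11 P12 P22
     \<and> (\<forall>R11 R12 R22. full_solution G T \<epsilon> R11 R12 R22 \<longrightarrow>
          (\<forall>t\<in>{0..T}. R11 t = P11 t \<and> R12 t = P12 t \<and> R22 t = P22 t))"


section \<open>The reduced problem\<close>

definition fast_are ::
  "('n1::finite,'n2::finite,'k1::finite,'k2::finite,'m1::finite,'m2::finite) lq_game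
    \<Rightarrow> real^'n2^'n2 \<Rightarrow> bool" where
  "fast_are G P \<longleftrightarrow> (A22 G)\<^sup>T ** P + P ** A22 G + P ** Delta2 G ** P + Q2 G = 0"

definition fast_S ::
  "('n1::finite,'n2::finite,'k1::finite,'k2::finite,'m1::finite,'m2::finite) lq_game
    \<Rightarrow> real^'n2^'n2 \<Rightarrow> real^'n2^'n2" where
  "fast_S G Pb22 = A22 G + Delta2 G ** Pb22"

definition Lambda ::
  "('n1::finite,'n2::finite,'k1::finite,'k2::finite,'m1::finite,'m2::finite) lq_game
    \<Rightarrow> real^'n2^'n2" where
  "Lambda G = (A22 G)\<^sup>T ** matrix_inv (Delta2 G) ** A22 G - Q2 G"

text \<open>The bracket that occurs in each of the three reduced coefficients, together with the two
  factors enclosing it.\<close>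

definition reduced_bracket ::
  "('n1::finite,'n2::finite,'k1::finite,'k2::finite,'m1::finite,'m2::finite) lq_game
    \<Rightarrow> real^'n2^'n2" where
  "reduced_bracket G =
     matrix_inv (Delta2 G) ** (Delta2 G - A22 G ** matrix_inv (Lambda G) ** (A22 G)\<^sup>T)
       ** matrix_inv (Delta2 G)"

definition reduced_A ::
  "('n1::finite,'n2::finite,'k1::finite,'k2::finite,'m1::finite,'m2::finite) lq_game
    \<Rightarrow> real^'n1^'n1" where
  "reduced_A G = A11 G - Delta G ** reduced_bracket G ** A21 G
     - A12 G ** matrix_inv (Lambda G) ** (A22 G)\<^sup>T ** matrix_inv (Delta2 G) ** A21 G"

definition reduced_M ::
  "('n1::finite,'n2::finite,'k1::finite,'k2::finite,'m1::finite,'m2::finite) lq_game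
    \<Rightarrow> real^'n1^'n1" where
  "reduced_M G = Delta1 G + A12 G ** matrix_inv (Lambda G) ** (A12 G)\<^sup>T
     - Delta G ** matrix_inv (Delta2 G) ** A22 G ** matrix_inv (Lambda G) ** (A12 G)\<^sup>T
     - A12 G ** matrix_inv (Lambda G) ** (A22 G)\<^sup>T ** matrix_inv (Delta2 G) ** (Delta G)\<^sup>T
     - Delta G ** reduced_bracket G ** (Delta G)\<^sup>T"

definition reduced_N ::
  "('n1::finite,'n2::finite,'k1::finite,'k2::finite,'m1::finite,'m2::finite) lq_game
    \<Rightarrow> real^'n1^'n1" where
  "reduced_N G = Q1 G - (A21 G)\<^sup>T ** reduced_bracket G ** A21 G"

definition reduced_solution ::
  "('n1::finite,'n2::finite,'k1::finite,'k2::finite,'m1::finite,'m2::finite) lq_game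
    \<Rightarrow> real \<Rightarrow> (real \<Rightarrow> real^'n1^'n1) \<Rightarrow> bool" where
  "reduced_solution G T P \<longleftrightarrow>
     (\<forall>t\<in>{0..T}. P t \<in> symmetric_matrices
       \<and> (\<exists>D. (P has_vector_derivative D) (at t within {0..T})
            \<and> D + (reduced_A G)\<^sup>T ** P t + P t ** reduced_A G + P t ** reduced_M G ** P t
                + reduced_N G = 0))
     \<and> P T = 0"

definition reduced_unique_solution ::
  "('n1::finite,'n2::finite,'k1::finite,'k2::finite,'m1::finite,'m2::finite) lq_game
    \<Rightarrow> real \<Rightarrow> (real \<Rightarrow> real^'n1^'n1) \<Rightarrow> bool" where
  "reduced_unique_solution G T P \<longleftrightarrow>
     reduced_solution G T P
     \<and> (\<forall>R. reduced_solution G T R \<longrightarrow> (\<forall>t\<in>{0..T}. R t = P t))"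

definition slow_manifold ::
  "('n1::finite,'n2::finite,'k1::finite,'k2::finite,'m1::finite,'m2::finite) lq_game
    \<Rightarrow> real^'n2^'n2 \<Rightarrow> real^'n1^'n1 \<Rightarrow> real^'n2^'n1" where
  "slow_manifold G Pb22 P11 =
     - (((A21 G)\<^sup>T ** Pb22 + P11 ** A12 G + P11 ** Delta G ** Pb22)
         ** matrix_inv (A22 G + Delta2 G ** Pb22))"


section \<open>The boundary layer and Tikhonov thresholds\<close>

definition boundary_layer_solution ::
  "('n1::finite,'n2::finite,'k1::finite,'k2::finite,'m1::finite,'m2::finite) lq_game
    \<Rightarrow> real^'n2^'n2 \<Rightarrow> (real \<Rightarrow> real^'n2^'n1) \<Rightarrow> (real \<Rightarrow> real^'n2^'n2) \<Rightarrow> bool" where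
  "boundary_layer_solution G Pb22 Ph12 Ph22 \<longleftrightarrow>
     (\<forall>\<tau>\<in>{0..}.
        (Ph12 has_vector_derivative
           riccati_g1 G 0 (Ph12 \<tau> + slow_manifold G Pb22 0) (Ph22 \<tau> + Pb22) 0) (at \<tau> within {0..})
      \<and> (Ph22 has_vector_derivative
           riccati_g2 G 0 (Ph12 \<tau> + slow_manifold G Pb22 0) (Ph22 \<tau> + Pb22) 0) (at \<tau> within {0..}))
     \<and> Ph12 0 = - slow_manifold G Pb22 0 \<and> Ph22 0 = - Pb22"

text \<open>The set \<open>stability_region G Pb22 \<delta>\<close> is \<open>\<R>\<^sub>\<delta>\<close>; the ball \<open>sym_cball r\<close> is taken in the space of
  symmetric matrices.\<close>

definition stability_region ::
  "('n1::finite,'n2::finite,'k1::finite,'k2::finite,'m1::finite,'m2::finite) lq_game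
    \<Rightarrow> real^'n2^'n2 \<Rightarrow> real \<Rightarrow> (real^'n2^'n2) set" where
  "stability_region G Pb22 \<delta> =
     {P \<in> symmetric_matrices. loewner_le (sym_part (fast_S G Pb22 + Delta2 G ** P)) (mat \<delta>)}"

definition sym_cball :: "real \<Rightarrow> (real^'n^'n) set" where
  "sym_cball r = {P \<in> symmetric_matrices. norm P \<le> r}"

definition largest_ball_radius ::
  "('n1::finite,'n2::finite,'k1::finite,'k2::finite,'m1::finite,'m2::finite) lq_game
    \<Rightarrow> real^'n2^'n2 \<Rightarrow> real \<Rightarrow> real \<Rightarrow> bool" where
  "largest_ball_radius G Pb22 \<delta> q \<longleftrightarrow>
     0 \<le> q \<and> sym_cball q \<subseteq> stability_region G Pb22 \<delta>
     \<and> (\<forall>r\<ge>0. sym_cball r \<subseteq> stability_region G Pb22 \<delta> \<longrightarrow> r \<le> q)"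

text \<open>The boundary-layer solution is unique because the right-hand sides are polynomial, so its
  existential quantification below refers to one determined pair of functions.\<close>

definition tikhonov_threshold ::
  "('n1::finite,'n2::finite,'k1::finite,'k2::finite,'m1::finite,'m2::finite) lq_game
    \<Rightarrow> real \<Rightarrow> real^'n2^'n2 \<Rightarrow> (real \<Rightarrow> real^'n1^'n1) \<Rightarrow> real \<Rightarrow> bool" where
  "tikhonov_threshold G T Pb22 Pb11 \<epsilon>s \<longleftrightarrow>
     0 < \<epsilon>s \<and> \<epsilon>s \<le> 1
     \<and> (\<forall>\<epsilon>. 0 < \<epsilon> \<and> \<epsilon> < \<epsilon>s \<longrightarrow> (\<exists>P11 P12 P22. full_unique_solution G T \<epsilon> P11 P12 P22))
     \<and> (\<exists>Ph12 Ph22. boundary_layer_solution G Pb22 Ph12 Ph22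
         \<and> (\<exists>C. \<forall>\<epsilon> P11 P12 P22. 0 < \<epsilon> \<and> \<epsilon> < \<epsilon>s \<and> full_solution G T \<epsilon> P11 P12 P22 \<longrightarrow>
              (\<forall>t\<in>{0..T}.
                 norm (P11 t - Pb11 t) \<le> C * \<epsilon>
               \<and> norm (P12 t - slow_manifold G Pb22 (Pb11 t) - Ph12 ((T - t) / \<epsilon>)) \<le> C * \<epsilon>
               \<and> norm (P22 t - Pb22 - Ph22 ((T - t) / \<epsilon>)) \<le> C * \<epsilon>)))"


section \<open>Brownian motion, filtration and admissible controls\<close>

definition path_events :: "'o measure \<Rightarrow> (real \<Rightarrow> 'o \<Rightarrow> real^'m) \<Rightarrow> real \<Rightarrow> 'o set set" where
  "path_events \<Omega> W t = {W s -` A \<inter> space \<Omega> | s A. 0 \<le> s \<and> s \<le> t \<and> A \<in> sets borel}"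

text \<open>Standard Brownian motion on \<open>{0..T}\<close>: increments are independent of the past and have
  independent centred Gaussian coordinates whose variance is the time increment.\<close>

definition brownian_motion :: "'o measure \<Rightarrow> real \<Rightarrow> (real \<Rightarrow> 'o \<Rightarrow> real^'m) \<Rightarrow> bool" where
  "brownian_motion \<Omega> T W \<longleftrightarrow>
     (\<forall>t\<in>{0..T}. W t \<in> borel_measurable \<Omega>)
     \<and> (AE \<omega> in \<Omega>. W 0 \<omega> = 0)
     \<and> (AE \<omega> in \<Omega>. continuous_on {0..T} (\<lambda>t. W t \<omega>))
     \<and> (\<forall>s t. 0 \<le> s \<and> s < t \<and> t \<le> T \<longrightarrow>
          prob_space.indep_set \<Omega> (sigma_sets (space \<Omega>) (path_events \<Omega> W s))
            {(\<lambda>\<omega>. W t \<omega> - W s \<omega>) -` A \<inter> space \<Omega> | A. A \<in> sets borel}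
        \<and> prob_space.indep_vars \<Omega> (\<lambda>_. borel) (\<lambda>i \<omega>. (W t \<omega> - W s \<omega>) $ i) UNIV
        \<and> (\<forall>i. distributed \<Omega> lborel (\<lambda>\<omega>. (W t \<omega> - W s \<omega>) $ i) (normal_density 0 (sqrt (t - s)))))"

definition augmented_filtration ::
  "'o measure \<Rightarrow> (real \<Rightarrow> 'o \<Rightarrow> real^'m1) \<Rightarrow> (real \<Rightarrow> 'o \<Rightarrow> real^'m2) \<Rightarrow> real \<Rightarrow> 'o measure" where
  "augmented_filtration \<Omega> W1 W2 t =
     sigma (space \<Omega>) (path_events \<Omega> W1 t \<union> path_events \<Omega> W2 t \<union> null_sets \<Omega>)"

definition predictable_sigma :: "'o measure \<Rightarrow> (real \<Rightarrow> 'o measure) \<Rightarrow> real \<Rightarrow> (real \<times> 'o) measure" where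
  "predictable_sigma \<Omega> F T =
     sigma ({0..T} \<times> space \<Omega>)
       ({{0} \<times> A | A. A \<in> sets (F 0)}
        \<union> {{s<..t} \<times> A | s t A. 0 \<le> s \<and> s \<le> t \<and> t \<le> T \<and> A \<in> sets (F s)})"

text \<open>The space \<open>\<bbbA>\<^sub>T\<^sup>k\<close>.\<close>

definition admissible ::
  "'o measure \<Rightarrow> (real \<Rightarrow> 'o measure) \<Rightarrow> real \<Rightarrow> (real \<Rightarrow> 'o \<Rightarrow> real^'k) \<Rightarrow> bool" where
  "admissible \<Omega> F T u \<longleftrightarrow>
     (\<lambda>(t, \<omega>). u t \<omega>) \<in> borel_measurable (predictable_sigma \<Omega> F T)
     \<and> integrable (restrict_space lborel {0..T} \<Otimes>\<^sub>M \<Omega>) (\<lambda>(t, \<omega>). (norm (u t \<omega>))\<^sup>2)"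


section \<open>State equation, cost and feedback controls\<close>

text \<open>The noise is additive, so the state equation in integrated form involves no stochastic
  integral other than \<open>\<integral>\<^sub>0\<^sup>t \<sigma> dW = \<sigma> (W(t) - W(0))\<close>.\<close>

definition state_process ::
  "('n1::finite,'n2::finite,'k1::finite,'k2::finite,'m1::finite,'m2::finite) lq_game
    \<Rightarrow> real \<Rightarrow> 'o measure \<Rightarrow> (real \<Rightarrow> 'o \<Rightarrow> real^'m1) \<Rightarrow> (real \<Rightarrow> 'o \<Rightarrow> real^'m2)
    \<Rightarrow> real \<Rightarrow> real^'n1 \<Rightarrow> real^'n2 \<Rightarrow> (real \<Rightarrow> 'o \<Rightarrow> real^'k1) \<Rightarrow> (real \<Rightarrow> 'o \<Rightarrow> real^'k2)
    \<Rightarrow> (real \<Rightarrow> 'o \<Rightarrow> real^'n1) \<Rightarrow> (real \<Rightarrow> 'o \<Rightarrow> real^'n2) \<Rightarrow> bool" where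
  "state_process G T \<Omega> W1 W2 \<epsilon> x1 x2 u1 u2 X1 X2 \<longleftrightarrow>
     (\<forall>t\<in>{0..T}. X1 t \<in> borel_measurable (augmented_filtration \<Omega> W1 W2 t)
               \<and> X2 t \<in> borel_measurable (augmented_filtration \<Omega> W1 W2 t))
     \<and> (AE \<omega> in \<Omega>. continuous_on {0..T} (\<lambda>t. X1 t \<omega>) \<and> continuous_on {0..T} (\<lambda>t. X2 t \<omega>)
         \<and> (\<forall>t\<in>{0..T}.
              X1 t \<omega> = x1
                + (LINT s:{0..t}|lborel. A11 G *v X1 s \<omega> + A12 G *v X2 s \<omega>
                                       + B11 G *v u1 s \<omega> + B12 G *v u2 s \<omega>)
                + sigma1 G *v (W1 t \<omega> - W1 0 \<omega>)
            \<and> X2 t \<omega> = x2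
                + (1 / \<epsilon>) *\<^sub>R (LINT s:{0..t}|lborel. A21 G *v X1 s \<omega> + A22 G *v X2 s \<omega>
                                       + B21 G *v u1 s \<omega> + B22 G *v u2 s \<omega>)
                + (1 / sqrt \<epsilon>) *\<^sub>R (sigma2 G *v (W2 t \<omega> - W2 0 \<omega>))))"

definition running_cost ::
  "('n1::finite,'n2::finite,'k1::finite,'k2::finite,'m1::finite,'m2::finite) lq_game
    \<Rightarrow> real \<Rightarrow> 'o measure \<Rightarrow> (real \<Rightarrow> 'o \<Rightarrow> real^'k1) \<Rightarrow> (real \<Rightarrow> 'o \<Rightarrow> real^'k2)
    \<Rightarrow> (real \<Rightarrow> 'o \<Rightarrow> real^'n1) \<Rightarrow> (real \<Rightarrow> 'o \<Rightarrow> real^'n2) \<Rightarrow> real" where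
  "running_cost G T \<Omega> u1 u2 X1 X2 =
     (1/2) * prob_space.expectation \<Omega> (\<lambda>\<omega>. LINT t:{0..T}|lborel.
        (Q1 G *v X1 t \<omega>) \<bullet> X1 t \<omega> + (Q2 G *v X2 t \<omega>) \<bullet> X2 t \<omega>
          - (norm (u1 t \<omega>))\<^sup>2 + (norm (u2 t \<omega>))\<^sup>2)"

text \<open>The cost \<open>J\<^sup>\<epsilon>(x\<^sub>1,x\<^sub>2;u\<^sub>1,u\<^sub>2)\<close>. The state belonging to admissible controls is unique up to
  indistinguishability, which determines the value.\<close>

definition cost_J ::
  "('n1::finite,'n2::finite,'k1::finite,'k2::finite,'m1::finite,'m2::finite) lq_game
    \<Rightarrow> real \<Rightarrow> 'o measure \<Rightarrow> (real \<Rightarrow> 'o \<Rightarrow> real^'m1) \<Rightarrow> (real \<Rightarrow> 'o \<Rightarrow> real^'m2)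
    \<Rightarrow> real \<Rightarrow> real^'n1 \<Rightarrow> real^'n2 \<Rightarrow> (real \<Rightarrow> 'o \<Rightarrow> real^'k1) \<Rightarrow> (real \<Rightarrow> 'o \<Rightarrow> real^'k2) \<Rightarrow> real" where
  "cost_J G T \<Omega> W1 W2 \<epsilon> x1 x2 u1 u2 =
     (THE c. \<exists>X1 X2. state_process G T \<Omega> W1 W2 \<epsilon> x1 x2 u1 u2 X1 X2
                   \<and> c = running_cost G T \<Omega> u1 u2 X1 X2)"

definition saddle_u1 ::
  "('n1::finite,'n2::finite,'k1::finite,'k2::finite,'m1::finite,'m2::finite) lq_game
    \<Rightarrow> real \<Rightarrow> (real \<Rightarrow> real^'n1^'n1) \<Rightarrow> (real \<Rightarrow> real^'n2^'n1) \<Rightarrow> (real \<Rightarrow> real^'n2^'n2)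
    \<Rightarrow> (real \<Rightarrow> 'o \<Rightarrow> real^'n1) \<Rightarrow> (real \<Rightarrow> 'o \<Rightarrow> real^'n2) \<Rightarrow> real \<Rightarrow> 'o \<Rightarrow> real^'k1" where
  "saddle_u1 G \<epsilon> P11 P12 P22 X1 X2 t \<omega> =
     ((B11 G)\<^sup>T ** P11 t + (B21 G)\<^sup>T ** (P12 t)\<^sup>T) *v X1 t \<omega>
     + (\<epsilon> *\<^sub>R ((B11 G)\<^sup>T ** P12 t) + (B21 G)\<^sup>T ** P22 t) *v X2 t \<omega>"

definition saddle_u2 ::
  "('n1::finite,'n2::finite,'k1::finite,'k2::finite,'m1::finite,'m2::finite) lq_game
    \<Rightarrow> real \<Rightarrow> (real \<Rightarrow> real^'n1^'n1) \<Rightarrow> (real \<Rightarrow> real^'n2^'n1) \<Rightarrow> (real \<Rightarrow> real^'n2^'n2)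
    \<Rightarrow> (real \<Rightarrow> 'o \<Rightarrow> real^'n1) \<Rightarrow> (real \<Rightarrow> 'o \<Rightarrow> real^'n2) \<Rightarrow> real \<Rightarrow> 'o \<Rightarrow> real^'k2" where
  "saddle_u2 G \<epsilon> P11 P12 P22 X1 X2 t \<omega> =
     - (((B12 G)\<^sup>T ** P11 t + (B22 G)\<^sup>T ** (P12 t)\<^sup>T) *v X1 t \<omega>)
     - (\<epsilon> *\<^sub>R ((B12 G)\<^sup>T ** P12 t) + (B22 G)\<^sup>T ** P22 t) *v X2 t \<omega>"

definition approx_u1 ::
  "('n1::finite,'n2::finite,'k1::finite,'k2::finite,'m1::finite,'m2::finite) lq_game
    \<Rightarrow> real^'n2^'n2 \<Rightarrow> (real \<Rightarrow> real^'n1^'n1)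
    \<Rightarrow> (real \<Rightarrow> 'o \<Rightarrow> real^'n1) \<Rightarrow> (real \<Rightarrow> 'o \<Rightarrow> real^'n2) \<Rightarrow> real \<Rightarrow> 'o \<Rightarrow> real^'k1" where
  "approx_u1 G Pb22 Pb11 X1 X2 t \<omega> =
     ((B11 G)\<^sup>T ** Pb11 t + (B21 G)\<^sup>T ** (slow_manifold G Pb22 (Pb11 t))\<^sup>T) *v X1 t \<omega>
     + ((B21 G)\<^sup>T ** Pb22) *v X2 t \<omega>"

definition approx_u2 ::
  "('n1::finite,'n2::finite,'k1::finite,'k2::finite,'m1::finite,'m2::finite) lq_game
    \<Rightarrow> real^'n2^'n2 \<Rightarrow> (real \<Rightarrow> real^'n1^'n1)
    \<Rightarrow> (real \<Rightarrow> 'o \<Rightarrow> real^'n1) \<Rightarrow> (real \<Rightarrow> 'o \<Rightarrow> real^'n2) \<Rightarrow> real \<Rightarrow> 'o \<Rightarrow> real^'k2" where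
  "approx_u2 G Pb22 Pb11 X1 X2 t \<omega> =
     - (((B12 G)\<^sup>T ** Pb11 t + (B22 G)\<^sup>T ** (slow_manifold G Pb22 (Pb11 t))\<^sup>T) *v X1 t \<omega>)
     - ((B22 G)\<^sup>T ** Pb22) *v X2 t \<omega>"

text \<open>The processes \<open>u1\<close>, \<open>u2\<close> are the controls generated by the feedback laws \<open>\<phi>1\<close>, \<open>\<phi>2\<close>, that is,
  these laws evaluated along the state that the controls themselves produce.\<close>

definition feedback_controls ::
  "('n1::finite,'n2::finite,'k1::finite,'k2::finite,'m1::finite,'m2::finite) lq_game
    \<Rightarrow> real \<Rightarrow> 'o measure \<Rightarrow> (real \<Rightarrow> 'o \<Rightarrow> real^'m1) \<Rightarrow> (real \<Rightarrow> 'o \<Rightarrow> real^'m2)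
    \<Rightarrow> real \<Rightarrow> real^'n1 \<Rightarrow> real^'n2
    \<Rightarrow> ((real \<Rightarrow> 'o \<Rightarrow> real^'n1) \<Rightarrow> (real \<Rightarrow> 'o \<Rightarrow> real^'n2) \<Rightarrow> real \<Rightarrow> 'o \<Rightarrow> real^'k1)
    \<Rightarrow> ((real \<Rightarrow> 'o \<Rightarrow> real^'n1) \<Rightarrow> (real \<Rightarrow> 'o \<Rightarrow> real^'n2) \<Rightarrow> real \<Rightarrow> 'o \<Rightarrow> real^'k2)
    \<Rightarrow> (real \<Rightarrow> 'o \<Rightarrow> real^'k1) \<Rightarrow> (real \<Rightarrow> 'o \<Rightarrow> real^'k2) \<Rightarrow> bool" where
  "feedback_controls G T \<Omega> W1 W2 \<epsilon> x1 x2 \<phi>1 \<phi>2 u1 u2 \<longleftrightarrow>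
     admissible \<Omega> (augmented_filtration \<Omega> W1 W2) T u1
     \<and> admissible \<Omega> (augmented_filtration \<Omega> W1 W2) T u2
     \<and> (\<exists>X1 X2. state_process G T \<Omega> W1 W2 \<epsilon> x1 x2 u1 u2 X1 X2
              \<and> u1 = \<phi>1 X1 X2 \<and> u2 = \<phi>2 X1 X2)"

end

theory Submission
  imports Defs
begin

text \<open>In reversed time the Riccati system is a slow-fast system whose fast part is linearised by \<open>S\<close>.
  On \<open>\<R>\<^sub>\<delta>\<close> the fast flow contracts, so the boundary layer decays exponentially, and energy estimates
  for the difference to slow solution plus boundary layer, closed by a bootstrap argument, show that a
  small \<open>\<epsilon>\<^sup>*\<close> is a Tikhonov threshold.

  For the costs, let \<open>H(t)\<close> be the block matrix with blocks \<open>P\<^sub>1\<^sub>1, \<epsilon>P\<^sub>1\<^sub>2, \<epsilon>P\<^sub>1\<^sub>2\<^sup>T, \<epsilon>P\<^sub>2\<^sub>2\<close>. For any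
  linear feedback the derivative of \<open>\<bbbE>\<langle>X, H X\<rangle>\<close> can be computed without stochastic
  integrals, because the noise is additive. Completing the square, the cost becomes a constant that does
  not depend on the feedback plus the time integral of the expected squares of the gain defects applied
  to \<open>X\<close>. The saddle point has no defect; the approximate gains have a defect of order
  \<open>\<epsilon> + exp (- k (T - t) / \<epsilon>)\<close>, whose integral is \<open>O(\<epsilon>)\<close>. Weighted second
  moments, with the weights \<open>exp (- \<lambda> t) (\<bar>X\<^sub>1\<bar>\<^sup>2 + \<epsilon> \<bar>X\<^sub>2\<bar>\<^sup>2)\<close> and
  \<open>exp (\<gamma> t / \<epsilon>) \<bar>X\<^sub>2\<bar>\<^sup>2\<close>, bound the state of the approximate loop uniformly
  in \<open>\<epsilon>\<close>.\<close>


section \<open>Differential equations and differential inequalities\<close>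

text \<open>The two closed loops are never compared path by path. Both costs are expressed with the
  same Riccati solution, so the gap is a time integral along the approximate loop alone, whose fast
  drift matrix is the constant \<open>S / \<epsilon>\<close>. Inside the terminal layer the
  approximate gains are wrong by an amount of order one; only the width of the layer, of order
  \<open>\<epsilon>\<close>, saves the estimate. The same balance governs the Riccati part. In
  reversed time \<open>s\<close> the slow error is driven by the layer, which is not small, and may
  grow at the rate \<open>exp (- k s / \<epsilon>) / \<epsilon>\<close>; this is harmless because
  the integral of that rate is bounded independently of \<open>\<epsilon>\<close>. Products of the
  layer with quantities that vanish at \<open>s = 0\<close> gain an order from
  \<open>s exp (- k s / \<epsilon>) \<le> \<epsilon> / k\<close>. Solutions on the whole horizon
  come from projecting onto a closed ball of matrices, where polynomial fields are Lipschitz, and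
  showing that the projection never acts. Second moments require only an ordinary product rule,
  because the state minus the noise is differentiable along each path.\<close>

lemma continuous_on_lipschitz_compose:
  fixes F :: "real \<Rightarrow> 'a::real_normed_vector \<Rightarrow> 'b::real_normed_vector"
  assumes lip: "\<And>t x y. t \<in> S \<Longrightarrow> norm (F t x - F t y) \<le> L * norm (x - y)"
    and cont: "\<And>x. continuous_on S (\<lambda>t. F t x)"
    and y: "continuous_on S y"
  shows "continuous_on S (\<lambda>t. F t (y t))"
  unfolding continuous_on_def
proof
  fix t assume t: "t \<in> S"
  have "((\<lambda>s. F s (y t)) \<longlongrightarrow> F t (y t)) (at t within S)"
    using cont[of "y t"] t by (auto simp: continuous_on_def)
  moreover have "((\<lambda>s. F s (y s) - F s (y t)) \<longlongrightarrow> 0) (at t within S)"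
  proof (rule Lim_null_comparison)
    show "\<forall>\<^sub>F s in at t within S. norm (F s (y s) - F s (y t)) \<le> L * norm (y s - y t)"
      using lip by (auto simp: eventually_at_filter)
    have "((\<lambda>s. L * norm (y s - y t)) \<longlongrightarrow> L * norm (y t - y t)) (at t within S)"
      using y t by (intro tendsto_intros) (auto simp: continuous_on_def)
    then show "((\<lambda>s. L * norm (y s - y t)) \<longlongrightarrow> 0) (at t within S)" by simp
  qed
  ultimately have "((\<lambda>s. F s (y t) + (F s (y s) - F s (y t))) \<longlongrightarrow> F t (y t) + 0) (at t within S)"
    by (rule tendsto_add)
  then show "((\<lambda>s. F s (y s)) \<longlongrightarrow> F t (y t)) (at t within S)" by simp
qed

text \<open>Picard iteration for \<open>y t = exp (- K t) x t\<close>: the weight makes the integral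
  operator a contraction on the whole half-line at once, without gluing local solutions. The bound
  on \<open>F t 0\<close> keeps the operator inside the bounded functions.\<close>

theorem picard_lindeloef_halfline:
  fixes F :: "real \<Rightarrow> 'a::banach \<Rightarrow> 'a"
  assumes lip: "\<And>t x y. 0 \<le> t \<Longrightarrow> norm (F t x - F t y) \<le> L * norm (x - y)"
    and cont: "\<And>x. continuous_on {0..} (\<lambda>t. F t x)"
    and bd: "\<And>t. 0 \<le> t \<Longrightarrow> norm (F t 0) \<le> c"
  shows "\<exists>x. x 0 = x0 \<and> (\<forall>t\<ge>0. (x has_vector_derivative F t (x t)) (at t within {0..}))"
proof -
  define M where "M = max L 0"
  have M0: "M \<ge> 0" and LM: "L \<le> M" by (auto simp: M_def)
  have lipM: "norm (F t x - F t y) \<le> M * norm (x - y)" if "0 \<le> t" for t x y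
    using lip[OF that, of x y] mult_right_mono[OF LM norm_ge_zero[of "x - y"]] by linarith
  have c0: "c \<ge> 0" using bd[of 0] norm_ge_zero[of "F 0 0"] by linarith
  \<comment> \<open>Any rate above the Lipschitz constant works; the contraction factor is
    \<open>M / K\<close>.\<close>
  define K where "K = M + 1"
  have K0: "K > 0" using M0 by (simp add: K_def)
  define I where "I y t = integral {0..t} (\<lambda>r. F r (exp (K*r) *\<^sub>R y r))" for y :: "real \<Rightarrow> 'a" and t
  \<comment> \<open>Freezing time at \<open>max 0 t\<close> extends the operator to all of
    \<open>real\<close>, since bounded continuous functions live on the whole type.\<close>
  define Q where "Q y t = exp (- K * max 0 t) *\<^sub>R (x0 + I y (max 0 t))" for y :: "real \<Rightarrow> 'a" and t
  have Fcont: "continuous_on {0..} (\<lambda>r. F r (exp (K*r) *\<^sub>R y r))" if "continuous_on UNIV y" for y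
    by (rule continuous_on_lipschitz_compose[where L = L])
       (auto intro!: lip cont continuous_intros continuous_on_subset[OF that])
  have Fcont': "continuous_on {0..t} (\<lambda>r. F r (exp (K*r) *\<^sub>R y r))" if "continuous_on UNIV y" for y t
    by (rule continuous_on_subset[OF Fcont[OF that]]) auto
  have Fint: "(\<lambda>r. F r (exp (K*r) *\<^sub>R y r)) integrable_on {0..t}" if "continuous_on UNIV y" for y t
    using Fcont'[OF that] by (rule integrable_continuous_interval)
  have expint: "((\<lambda>r. d * exp (K*r)) has_integral d * (exp (K*t) - 1) / K) {0..t}" if "t \<ge> 0" for t d
  proof -
    have "((\<lambda>r. d * exp (K*r)) has_integral d * exp (K*t) / K - d * exp (K*0) / K) {0..t}"
      using that K0
      by (intro fundamental_theorem_of_calculus)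
         (auto intro!: derivative_eq_intros simp: has_real_derivative_iff_has_vector_derivative[symmetric])
    then show ?thesis by (simp add: diff_divide_distrib right_diff_distrib)
  qed
  have Ider: "(I y has_vector_derivative F t (exp (K*t) *\<^sub>R y t)) (at t within {0..})"
    if "continuous_on UNIV y" "t \<ge> 0" for y t
  proof -
    have "(I y has_vector_derivative F t (exp (K*t) *\<^sub>R y t)) (at t within {0..t+1})"
      unfolding I_def using that by (intro integral_has_vector_derivative Fcont') auto
    moreover have "at t within {0..} = at t within {0..t+1}"
      by (rule at_within_nhd[where S = "{..<t+1}"]) (use that in auto)
    ultimately show ?thesis by simp
  qed
  have Icont: "continuous_on {0..} (I y)" if "continuous_on UNIV y" for y
    unfolding continuous_on_eq_continuous_within
    using Ider[OF that] has_vector_derivative_continuous by (metis atLeast_iff)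
  have Qbc: "Q y \<in> bcontfun" if "y \<in> bcontfun" for y
  proof -
    have yc: "continuous_on UNIV y" and "bounded (range y)" using that by (auto simp: bcontfun_def)
    then obtain b where b: "norm (y t) \<le> b" for t by (auto simp: bounded_iff)
    have b0: "b \<ge> 0" using b[of 0] norm_ge_zero[of "y 0"] by linarith
    have "continuous_on UNIV (\<lambda>t. I y (max 0 t))"
      by (rule continuous_on_compose2[OF Icont[OF yc]]) (auto intro!: continuous_intros)
    then have "continuous_on UNIV (Q y)" unfolding Q_def by (intro continuous_intros)
    moreover have "norm (Q y t) \<le> norm x0 + (c + M * b) / K" for t
    proof -
      define s where "s = max 0 t"
      have s: "s \<ge> 0" by (simp add: s_def)
      have "norm (F r (exp (K*r) *\<^sub>R y r)) \<le> (c + M * b) * exp (K*r)" if "r \<in> {0..s}" for r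
      proof -
        have "norm (F r (exp (K*r) *\<^sub>R y r)) \<le> norm (F r 0) + norm (F r (exp (K*r) *\<^sub>R y r) - F r 0)"
          by (metis add.commute diff_add_cancel norm_triangle_ineq)
        also have "\<dots> \<le> c + M * (exp (K*r) * b)"
          using bd[of r] lipM[of r "exp (K*r) *\<^sub>R y r" 0] that b[of r] M0
            mult_left_mono[of "exp (K*r) * norm (y r)" "exp (K*r) * b" M] by fastforce
        also have "\<dots> \<le> c * exp (K*r) + M * (exp (K*r) * b)"
          using c0 K0 that mult_left_mono[of 1 "exp (K*r)" c] by simp
        finally show ?thesis by (simp add: algebra_simps)
      qed
      then have "norm (I y s) \<le> integral {0..s} (\<lambda>r. (c + M*b) * exp (K*r))"
        unfolding I_def
        by (intro integral_norm_bound_integral Fint[OF yc] has_integral_integrable[OF expint[OF s]])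
      also have "\<dots> = (c + M*b) * (exp (K * s) - 1) / K"
        by (rule integral_unique[OF expint[OF s]])
      also have "\<dots> \<le> (c + M*b) * exp (K * s) / K"
        using K0 c0 M0 b0 by (intro divide_right_mono mult_left_mono) auto
      finally have I: "norm (I y s) \<le> (c + M*b) / K * exp (K * s)" by simp
      have "norm (Q y t) \<le> exp (-K * s) * (norm x0 + norm (I y s))"
        unfolding Q_def s_def[symmetric] by (simp add: norm_triangle_ineq)
      also have "\<dots> \<le> exp (-K * s) * norm x0 + exp (-K * s) * ((c + M*b) / K * exp (K * s))"
        using mult_left_mono[OF I, of "exp (-K * s)"] by (simp add: distrib_left)
      also have "exp (-K * s) * ((c + M*b) / K * exp (K * s)) = (c + M*b) / K * (exp (-K * s) * exp (K * s))"
        by (rule mult.left_commute)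
      also have "\<dots> = (c + M*b) / K" by (simp add: exp_add[symmetric])
      also have "exp (-K * s) * norm x0 \<le> 1 * norm x0"
        using K0 s by (intro mult_right_mono) auto
      finally show ?thesis by simp
    qed
    ultimately show ?thesis by (auto simp: bcontfun_def bounded_iff)
  qed
  define Q' where "Q' g = Bcontfun (Q (apply_bcontfun g))" for g
  have Q'app: "apply_bcontfun (Q' g) = Q (apply_bcontfun g)" for g
    unfolding Q'_def by (rule Bcontfun_inverse[OF Qbc]) (rule apply_bcontfun)
  have "\<exists>!g. Q' g = g"
  proof (rule banach_fix_type[where c = "M / K"])
    show "0 \<le> M / K" "M / K < 1" using M0 K0 by (auto simp: K_def)
    show "\<forall>g h. dist (Q' g) (Q' h) \<le> M / K * dist g h"
    proof (intro allI)
      fix g h :: "real \<Rightarrow>\<^sub>C 'a"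
      let ?g = "apply_bcontfun g" and ?h = "apply_bcontfun h"
      have gc: "continuous_on UNIV ?g" and hc: "continuous_on UNIV ?h"
        using apply_bcontfun[of g] apply_bcontfun[of h] by (auto simp: bcontfun_def)
      show "dist (Q' g) (Q' h) \<le> M / K * dist g h"
      proof (rule dist_bound)
        fix t :: real
        define s where "s = max 0 t"
        have s: "s \<ge> 0" by (simp add: s_def)
        have "norm (F r (exp (K*r) *\<^sub>R ?g r) - F r (exp (K*r) *\<^sub>R ?h r)) \<le> (M * dist g h) * exp (K*r)"
          if "r \<in> {0..s}" for r
        proof -
          have "norm (F r (exp (K*r) *\<^sub>R ?g r) - F r (exp (K*r) *\<^sub>R ?h r))
             \<le> M * norm (exp (K*r) *\<^sub>R ?g r - exp (K*r) *\<^sub>R ?h r)"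
            using lipM that by auto
          also have "norm (exp (K*r) *\<^sub>R ?g r - exp (K*r) *\<^sub>R ?h r) = exp (K*r) * dist (?g r) (?h r)"
            by (simp add: dist_norm scaleR_diff_right[symmetric])
          also have "M * (exp (K*r) * dist (?g r) (?h r)) \<le> M * (exp (K*r) * dist g h)"
            using M0 dist_bounded[of g r h] by (intro mult_left_mono) auto
          finally show ?thesis by (simp add: algebra_simps)
        qed
        then have "norm (integral {0..s} (\<lambda>r. F r (exp (K*r) *\<^sub>R ?g r) - F r (exp (K*r) *\<^sub>R ?h r)))
            \<le> integral {0..s} (\<lambda>r. (M * dist g h) * exp (K*r))"
          by (intro integral_norm_bound_integral integrable_diff Fint[OF gc] Fint[OF hc]
              has_integral_integrable[OF expint[OF s]])
        also have "\<dots> = (M * dist g h) * (exp (K * s) - 1) / K"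
          by (rule integral_unique[OF expint[OF s]])
        finally have "norm (integral {0..s} (\<lambda>r. F r (exp (K*r) *\<^sub>R ?g r) - F r (exp (K*r) *\<^sub>R ?h r)))
            \<le> (M * dist g h) * (exp (K * s) - 1) / K" .
        then have 1: "norm (I ?g s - I ?h s) \<le> (M * dist g h) * (exp (K * s) - 1) / K"
          unfolding I_def using Fint[OF gc] Fint[OF hc] by (simp add: integral_diff)
        also have "\<dots> \<le> (M * dist g h) * exp (K * s) / K"
          using K0 M0 by (intro divide_right_mono mult_left_mono) auto
        finally have 1: "norm (I ?g s - I ?h s) \<le> (M * dist g h) / K * exp (K * s)" by simp
        have "dist (Q ?g t) (Q ?h t) = exp (-K * s) * norm (I ?g s - I ?h s)"
          unfolding Q_def s_def[symmetric] by (simp add: dist_norm scaleR_diff_right[symmetric])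
        also have "\<dots> \<le> exp (-K * s) * ((M * dist g h) / K * exp (K * s))"
          using 1 by (intro mult_left_mono) auto
        also have "\<dots> = (M * dist g h) / K * (exp (-K * s) * exp (K * s))"
          by (rule mult.left_commute)
        also have "\<dots> = M / K * dist g h" by (simp add: exp_add[symmetric])
        finally show "dist (apply_bcontfun (Q' g) t) (apply_bcontfun (Q' h) t) \<le> M / K * dist g h"
          by (simp add: Q'app)
      qed
    qed
  qed
  then obtain g where g: "Q' g = g" by auto
  define y where "y = apply_bcontfun g"
  have yc: "continuous_on UNIV y"
    using apply_bcontfun[of g] by (auto simp: bcontfun_def y_def)
  have yQ: "y t = Q y t" for t using Q'app[of g] g by (simp add: y_def)
  define x where "x t = x0 + I y t" for t
  have xy: "x t = exp (K*t) *\<^sub>R y t" if "t \<ge> 0" for t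
    using yQ[of t] that by (simp add: Q_def x_def exp_minus)
  have "x 0 = x0" by (simp add: x_def I_def)
  moreover have "(x has_vector_derivative F t (x t)) (at t within {0..})" if "t \<ge> 0" for t
  proof -
    have "(x has_vector_derivative 0 + F t (exp (K*t) *\<^sub>R y t)) (at t within {0..})"
      unfolding x_def by (intro derivative_intros Ider yc that)
    then show ?thesis using xy[OF that] by simp
  qed
  ultimately show ?thesis by blast
qed

text \<open>\<open>B - v exp (- A)\<close> is nondecreasing. The majorant \<open>B\<close> of the
  weighted source is a parameter, so that each application can supply an explicit primitive.\<close>

lemma gronwall_differential:
  fixes v A B :: "real \<Rightarrow> real"
  assumes v: "\<And>t. t \<in> {0..T} \<Longrightarrow> (v has_real_derivative v' t) (at t within {0..T})"
    and A: "\<And>t. t \<in> {0..T} \<Longrightarrow> (A has_real_derivative a t) (at t within {0..T})"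
    and B: "\<And>t. t \<in> {0..T} \<Longrightarrow> (B has_real_derivative \<beta> t) (at t within {0..T})"
    and le: "\<And>t. t \<in> {0..T} \<Longrightarrow> v' t \<le> a t * v t + b t"
    and b: "\<And>t. t \<in> {0..T} \<Longrightarrow> b t * exp (- A t) \<le> \<beta> t"
    and t: "t \<in> {0..T}"
  shows "v t \<le> exp (A t) * (v 0 * exp (- A 0) + B t - B 0)"
proof -
  define z where "z s = B s - v s * exp (- A s)" for s
  have z': "(z has_real_derivative \<beta> s - (v' s * exp (- A s) - v s * (a s * exp (- A s)))) (at s within {0..T})"
    if "s \<in> {0..T}" for s
    unfolding z_def using v[OF that] A[OF that] B[OF that]
    by (auto intro!: derivative_eq_intros)
  have "z 0 \<le> z t"
  proof (rule DERIV_nonneg_imp_increasing_open[of 0 t z])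
    show "0 \<le> t" using t by auto
    show "continuous_on {0..t} z"
      unfolding continuous_on_eq_continuous_within
      using z' t by (meson DERIV_continuous DERIV_subset atLeastAtMost_iff atLeastatMost_subset_iff order_trans order_refl)
    fix s assume s: "0 < s" "s < t"
    then have "at s within {0..T} = at s" using t by (intro at_within_interior) auto
    then have "(z has_real_derivative \<beta> s - (v' s * exp (- A s) - v s * (a s * exp (- A s)))) (at s)"
      using z'[of s] s t by auto
    moreover have "(v' s - a s * v s) * exp (- A s) \<le> b s * exp (- A s)"
      using le[of s] s t by (intro mult_right_mono) auto
    then have "0 \<le> \<beta> s - (v' s * exp (- A s) - v s * (a s * exp (- A s)))"
      using b[of s] s t by (simp add: algebra_simps)
    ultimately show "\<exists>y. (z has_real_derivative y) (at s) \<and> 0 \<le> y" by blast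
  qed
  then have "v t * exp (- A t) \<le> v 0 * exp (- A 0) + B t - B 0" by (simp add: z_def)
  then have "exp (A t) * (v t * exp (- A t)) \<le> exp (A t) * (v 0 * exp (- A 0) + B t - B 0)"
    by (intro mult_left_mono) auto
  then show ?thesis by (simp add: exp_minus field_simps)
qed

text \<open>The disturbance \<open>c exp (- \<kappa> t / \<epsilon>) / \<epsilon>\<close> has
  integral at most \<open>c / \<kappa>\<close> for every \<open>\<epsilon>\<close> and only costs
  the factor \<open>exp (c / \<kappa>)\<close>; against the damping
  \<open>\<gamma> / \<epsilon>\<close> the source \<open>b / \<epsilon>\<close> accumulates to
  \<open>b / \<gamma>\<close>.\<close>

lemma gronwall_fast_stable:
  fixes v :: "real \<Rightarrow> real"
  assumes v: "\<And>t. t \<in> {0..T} \<Longrightarrow> (v has_real_derivative v' t) (at t within {0..T})"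
    and le: "\<And>t. t \<in> {0..T} \<Longrightarrow> v' t \<le> (1/\<epsilon>) * ((- \<gamma> + c * exp (- \<kappa> * t / \<epsilon>)) * v t + b)"
    and pos: "0 < \<epsilon>" "0 < \<gamma>" "0 < \<kappa>" "0 \<le> c" "0 \<le> b" "0 \<le> v 0"
    and t: "t \<in> {0..T}"
  shows "v t \<le> exp (c / \<kappa>) * (v 0 + b / \<gamma>)"
proof -
  define A where "A s = - \<gamma> * s / \<epsilon> - c / \<kappa> * exp (- \<kappa> * s / \<epsilon>)" for s
  \<comment> \<open>\<open>- A s\<close> is at most
    \<open>c / \<kappa> + \<gamma> s / \<epsilon>\<close>, and \<open>B\<close> is the explicit
    primitive of the source weighted with this bound.\<close>
  define B where "B s = b * exp (c/\<kappa>) / \<gamma> * exp (\<gamma> * s / \<epsilon>)" for s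
  have "v t \<le> exp (A t) * (v 0 * exp (- A 0) + B t - B 0)"
  proof (rule gronwall_differential[OF v, where A = A and B = B
        and a = "\<lambda>s. (1/\<epsilon>) * (- \<gamma> + c * exp (- \<kappa> * s / \<epsilon>))" and b = "\<lambda>_. b / \<epsilon>"
        and \<beta> = "\<lambda>s. b * exp (c/\<kappa>) / \<epsilon> * exp (\<gamma> * s / \<epsilon>)"])
    fix s assume s: "s \<in> {0..T}"
    show "(A has_real_derivative (1/\<epsilon>) * (- \<gamma> + c * exp (- \<kappa> * s / \<epsilon>))) (at s within {0..T})"
      unfolding A_def using pos by (auto intro!: derivative_eq_intros simp: field_simps)
    show "(B has_real_derivative b * exp (c/\<kappa>) / \<epsilon> * exp (\<gamma> * s / \<epsilon>)) (at s within {0..T})"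
      unfolding B_def using pos by (auto intro!: derivative_eq_intros simp: field_simps)
    show "v' s \<le> (1/\<epsilon>) * (- \<gamma> + c * exp (- \<kappa> * s / \<epsilon>)) * v s + b / \<epsilon>"
      using le[OF s] by (simp add: algebra_simps add_divide_distrib)
    have "- A s \<le> c / \<kappa> + \<gamma> * s / \<epsilon>"
      unfolding A_def using pos s mult_left_mono[of "exp (- \<kappa> * s / \<epsilon>)" 1 "c/\<kappa>"] by auto
    then have "exp (- A s) \<le> exp (c / \<kappa>) * exp (\<gamma> * s / \<epsilon>)" by (simp add: exp_add[symmetric])
    then have "b / \<epsilon> * exp (- A s) \<le> b / \<epsilon> * (exp (c / \<kappa>) * exp (\<gamma> * s / \<epsilon>))"
      using pos by (intro mult_left_mono) auto
    then show "b / \<epsilon> * exp (- A s) \<le> b * exp (c/\<kappa>) / \<epsilon> * exp (\<gamma> * s / \<epsilon>)" by simp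
  qed (use t in auto)
  also have "\<dots> \<le> exp (A t) * (v 0 * exp (c/\<kappa>) + B t)"
    using pos by (intro mult_left_mono) (auto simp: A_def B_def)
  also have "\<dots> = exp (c/\<kappa>) * (v 0 * exp (A t) + b / \<gamma> * exp (A t + \<gamma> * t / \<epsilon>))"
    by (simp add: B_def algebra_simps exp_add)
  also have "\<dots> \<le> exp (c/\<kappa>) * (v 0 * 1 + b / \<gamma> * 1)"
    using pos t by (intro mult_left_mono add_mono) (auto simp: A_def intro: order_trans[of _ 0])
  finally show ?thesis by simp
qed

text \<open>Without damping, coefficients of size \<open>1 / \<epsilon>\<close> are still affordable
  when they carry the layer factor, because
  \<open>exp (- \<kappa> t / \<epsilon>) / \<epsilon>\<close> integrates to at most
  \<open>1 / \<kappa>\<close>.\<close>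

lemma gronwall_layer:
  fixes v :: "real \<Rightarrow> real"
  assumes v: "\<And>t. t \<in> {0..T} \<Longrightarrow> (v has_real_derivative v' t) (at t within {0..T})"
    and le: "\<And>t. t \<in> {0..T} \<Longrightarrow> v' t \<le> (p + q / \<epsilon> * exp (- \<kappa> * t / \<epsilon>)) * v t + (r + w / \<epsilon> * exp (- \<kappa> * t / \<epsilon>))"
    and pos: "0 < \<epsilon>" "0 < \<kappa>" "0 \<le> p" "0 \<le> q" "0 \<le> r" "0 \<le> w" "0 \<le> v 0"
    and t: "t \<in> {0..T}"
  shows "v t \<le> exp (p * T + q / \<kappa>) * (v 0 + r * T + w / \<kappa>)"
proof -
  define A where "A s = p * s + q / \<kappa> * (1 - exp (- \<kappa> * s / \<epsilon>))" for s
  define B where "B s = r * s + w / \<kappa> * (1 - exp (- \<kappa> * s / \<epsilon>))" for s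
  have A0: "0 \<le> A s" if "s \<in> {0..T}" for s
    unfolding A_def using that pos by (intro add_nonneg_nonneg mult_nonneg_nonneg) auto
  have "v t \<le> exp (A t) * (v 0 * exp (- A 0) + B t - B 0)"
  proof (rule gronwall_differential[OF v, where A = A and B = B
        and a = "\<lambda>s. (p + q / \<epsilon> * exp (- \<kappa> * s / \<epsilon>))" and b = "\<lambda>s. (r + w / \<epsilon> * exp (- \<kappa> * s / \<epsilon>))"
        and \<beta> = "\<lambda>s. (r + w / \<epsilon> * exp (- \<kappa> * s / \<epsilon>))"])
    fix s assume s: "s \<in> {0..T}"
    show "(A has_real_derivative (p + q / \<epsilon> * exp (- \<kappa> * s / \<epsilon>))) (at s within {0..T})"
      unfolding A_def using pos by (auto intro!: derivative_eq_intros simp: field_simps)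
    show "(B has_real_derivative (r + w / \<epsilon> * exp (- \<kappa> * s / \<epsilon>))) (at s within {0..T})"
      unfolding B_def using pos by (auto intro!: derivative_eq_intros simp: field_simps)
    show "v' s \<le> (p + q / \<epsilon> * exp (- \<kappa> * s / \<epsilon>)) * v s + (r + w / \<epsilon> * exp (- \<kappa> * s / \<epsilon>))"
      using le[OF s] .
    have "(r + w / \<epsilon> * exp (- \<kappa> * s / \<epsilon>)) * exp (- A s) \<le> (r + w / \<epsilon> * exp (- \<kappa> * s / \<epsilon>)) * 1"
      using pos A0[OF s] by (intro mult_left_mono) auto
    then show "(r + w / \<epsilon> * exp (- \<kappa> * s / \<epsilon>)) * exp (- A s) \<le> (r + w / \<epsilon> * exp (- \<kappa> * s / \<epsilon>))" by simp
  qed (use t in auto)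
  also have "\<dots> \<le> exp (p * T + q / \<kappa>) * (v 0 + r * T + w / \<kappa>)"
  proof (intro mult_mono)
    have "p * t \<le> p * T" "r * t \<le> r * T" using t pos by (auto intro: mult_left_mono)
    moreover have "q / \<kappa> * (1 - exp (- \<kappa> * t / \<epsilon>)) \<le> q / \<kappa> * 1" "w / \<kappa> * (1 - exp (- \<kappa> * t / \<epsilon>)) \<le> w / \<kappa> * 1"
      using pos by (intro mult_left_mono; simp)+
    ultimately show "exp (A t) \<le> exp (p * T + q / \<kappa>)"
      "v 0 * exp (- A 0) + B t - B 0 \<le> v 0 + r * T + w / \<kappa>"
      by (auto simp: A_def B_def)
    have "0 \<le> B t" unfolding B_def using t pos by (intro add_nonneg_nonneg mult_nonneg_nonneg) auto
    then show "0 \<le> v 0 * exp (- A 0) + B t - B 0" using pos by (simp add: A_def B_def)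
  qed auto
  finally show ?thesis .
qed

text \<open>Continuity argument at the first time where \<open>\<phi>\<close> reaches
  \<open>b\<close>: up to and including that time \<open>\<phi> \<le> b\<close>, by a limit from the
  left, and \<open>step\<close> makes the inequality strict there.\<close>

lemma bootstrap_bound:
  fixes \<phi> :: "real \<Rightarrow> real"
  assumes cont: "continuous_on {0..T} \<phi>" and "\<phi> 0 < b"
    and step: "\<And>t. t \<in> {0..T} \<Longrightarrow> (\<And>s. s \<in> {0..t} \<Longrightarrow> \<phi> s \<le> b) \<Longrightarrow> \<phi> t < b"
    and t: "t \<in> {0..T}"
  shows "\<phi> t < b"
proof (rule ccontr)
  assume "\<not> \<phi> t < b"
  define S where "S = {s \<in> {0..T}. b \<le> \<phi> s}"
  have "closed S"
  proof -
    have "S = {0..T} \<inter> \<phi> -` {b..}" by (auto simp: S_def)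
    then show ?thesis using continuous_on_closed_vimage[of "{0..T}" \<phi>] cont by (metis Int_commute closed_atLeast closed_atLeastAtMost)
  qed
  moreover have "S \<noteq> {}" using t \<open>\<not> \<phi> t < b\<close> by (auto simp: S_def)
  moreover have "bdd_below S" by (auto simp: S_def bdd_below_def)
  ultimately have inf: "Inf S \<in> S" by (rule closed_contains_Inf[rotated 2])
  define s where "s = Inf S"
  have s: "s \<in> {0..T}" "b \<le> \<phi> s" using inf by (auto simp: s_def S_def)
  have below: "\<phi> r < b" if "r \<in> {0..<s}" for r
  proof (rule ccontr)
    assume "\<not> \<phi> r < b"
    then have "r \<in> S" using that s by (auto simp: S_def)
    then have "s \<le> r" unfolding s_def by (intro cInf_lower) (auto simp: S_def bdd_below_def)
    then show False using that by auto
  qed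
  have "s > 0" using s \<open>\<phi> 0 < b\<close> by (cases "s = 0") auto
  have "\<phi> s \<le> b"
  proof (rule tendsto_upperbound[where F = "at s within {0..<s}"])
    have "continuous_on {0..s} \<phi>" using cont s by (auto intro: continuous_on_subset)
    then have "(\<phi> \<longlongrightarrow> \<phi> s) (at s within {0..s})" using \<open>s > 0\<close> by (auto simp: continuous_on_def)
    then show "(\<phi> \<longlongrightarrow> \<phi> s) (at s within {0..<s})" by (rule tendsto_within_subset) auto
    show "\<forall>\<^sub>F r in at s within {0..<s}. \<phi> r \<le> b"
      using below by (auto simp: eventually_at_filter intro!: always_eventually less_imp_le)
    show "at s within {0..<s} \<noteq> bot"
      using \<open>s > 0\<close> by (simp add: trivial_limit_within islimpt_greaterThanLessThan2 islimpt_Ico)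
  qed
  then have "\<phi> s < b" using below s
    by (intro step) (metis atLeastAtMost_iff atLeastLessThan_iff less_le)+
  then show False using s by simp
qed

lemma has_vector_derivative_reverse:
  assumes "(f has_vector_derivative D) (at (T - s) within {0..T})"
  shows "((\<lambda>s. f (T - s)) has_vector_derivative - D) (at s within {0..T::real})"
proof -
  have "((\<lambda>s. T - s) has_vector_derivative - 1) (at s within {0..T})"
    by (auto intro!: derivative_eq_intros)
  moreover have "(\<lambda>s. T - s) ` {0..T} = {0..T}"
    by simp
  ultimately have "((f \<circ> (\<lambda>s. T - s)) has_vector_derivative (- 1) *\<^sub>R D) (at s within {0..T})"
    using assms by (intro vector_diff_chain_within) auto
  then show ?thesis by (simp add: o_def)
qed

lemma has_vector_derivative_norm_square:
  fixes f :: "real \<Rightarrow> 'a::real_inner"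
  assumes "(f has_vector_derivative D) (at t within S)"
  shows "((\<lambda>t. (norm (f t))\<^sup>2) has_real_derivative 2 * inner (f t) D) (at t within S)"
proof -
  have "((\<lambda>t. inner (f t) (f t)) has_vector_derivative inner (f t) D + inner D (f t)) (at t within S)"
    by (rule bounded_bilinear.has_vector_derivative[OF bounded_bilinear_inner assms assms])
  then show ?thesis
    by (simp add: power2_norm_eq_inner inner_commute has_real_derivative_iff_has_vector_derivative)
qed

section \<open>Maps that are Lipschitz on bounded sets, and uniqueness for their differential
  equations\<close>

definition lipschitz_on_balls :: "('a::real_normed_vector \<Rightarrow> 'b::real_normed_vector) \<Rightarrow> bool" where
  "lipschitz_on_balls f \<longleftrightarrow> (\<forall>R. \<exists>L\<ge>0. \<forall>x y. norm x \<le> R \<longrightarrow> norm y \<le> R \<longrightarrow> norm (f x - f y) \<le> L * norm (x - y))"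

named_theorems lob_intros

lemma lobE:
  assumes "lipschitz_on_balls f"
  obtains L where "L \<ge> 0"
    "\<And>x y. norm x \<le> R \<Longrightarrow> norm y \<le> R \<Longrightarrow> norm (f x - f y) \<le> L * norm (x - y)"
  using assms unfolding lipschitz_on_balls_def by blast

lemma lob_const [lob_intros]: "lipschitz_on_balls (\<lambda>x. c)"
  by (auto simp: lipschitz_on_balls_def intro!: exI[of _ 0])

lemma lob_linear:
  assumes "bounded_linear f" shows "lipschitz_on_balls f"
proof -
  obtain K where "\<And>x. norm (f x) \<le> norm x * K" "K > 0"
    using bounded_linear.pos_bounded[OF assms] by auto
  then have "norm (f x - f y) \<le> K * norm (x - y)" for x y
    using assms by (metis linear_diff bounded_linear.linear mult.commute)
  then show ?thesis unfolding lipschitz_on_balls_def using \<open>K > 0\<close> by (intro allI exI[of _ K]) auto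
qed

lemma lob_add [lob_intros]:
  assumes "lipschitz_on_balls f" "lipschitz_on_balls g" shows "lipschitz_on_balls (\<lambda>x. f x + g x)"
  unfolding lipschitz_on_balls_def
proof
  fix R
  obtain L where L: "L \<ge> 0"
    "\<And>x y. norm x \<le> R \<Longrightarrow> norm y \<le> R \<Longrightarrow> norm (f x - f y) \<le> L * norm (x - y)"
    using lobE[where f = f and R = R] assms by blast
  obtain M where M: "M \<ge> 0"
    "\<And>x y. norm x \<le> R \<Longrightarrow> norm y \<le> R \<Longrightarrow> norm (g x - g y) \<le> M * norm (x - y)"
    using lobE[where f = g and R = R] assms by blast
  have "norm (f x + g x - (f y + g y)) \<le> (L + M) * norm (x - y)" if "norm x \<le> R" "norm y \<le> R" for x y
    using L(2)[OF that] M(2)[OF that] norm_triangle_ineq[of "f x - f y" "g x - g y"]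
    by (simp add: algebra_simps)
  then show "\<exists>L\<ge>0. \<forall>x y. norm x \<le> R \<longrightarrow> norm y \<le> R \<longrightarrow> norm (f x + g x - (f y + g y)) \<le> L * norm (x - y)"
    using L M by (intro exI[of _ "L + M"]) auto
qed

lemma lob_bounded:
  assumes "lipschitz_on_balls f"
  obtains B where "B \<ge> 0" "\<And>x. norm x \<le> R \<Longrightarrow> norm (f x) \<le> B"
proof -
  obtain L where L: "L \<ge> 0" "\<And>x y. norm x \<le> \<bar>R\<bar> \<Longrightarrow> norm y \<le> \<bar>R\<bar> \<Longrightarrow> norm (f x - f y) \<le> L * norm (x - y)"
    using lobE[OF assms, of "\<bar>R\<bar>"] by blast
  have "norm (f x) \<le> norm (f 0) + L * \<bar>R\<bar>" if "norm x \<le> R" for x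
    using L(2)[of x 0] that mult_left_mono[OF _ L(1), of "norm x" "\<bar>R\<bar>"] norm_triangle_ineq[of "f x - f 0" "f 0"]
    by fastforce
  then show thesis using L(1) by (intro that[of "norm (f 0) + L * \<bar>R\<bar>"]) auto
qed

text \<open>On each ball both factors are bounded as well as Lipschitz. With this rule every
  polynomial matrix field can be treated by \<open>lob_intros\<close>.\<close>

lemma lob_bilinear:
  assumes "bounded_bilinear b" "lipschitz_on_balls f" "lipschitz_on_balls g"
  shows "lipschitz_on_balls (\<lambda>x. b (f x) (g x))"
  unfolding lipschitz_on_balls_def
proof
  fix R
  interpret bounded_bilinear b by fact
  obtain K where K: "K \<ge> 0" "\<And>x y. norm (b x y) \<le> norm x * norm y * K"
    using nonneg_bounded by blast
  obtain Bf where Bf: "Bf \<ge> 0" "\<And>x. norm x \<le> R \<Longrightarrow> norm (f x) \<le> Bf" using lob_bounded[OF assms(2)] by metis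
  obtain Bg where Bg: "Bg \<ge> 0" "\<And>x. norm x \<le> R \<Longrightarrow> norm (g x) \<le> Bg" using lob_bounded[OF assms(3)] by metis
  obtain L where L: "L \<ge> 0"
    "\<And>x y. norm x \<le> R \<Longrightarrow> norm y \<le> R \<Longrightarrow> norm (f x - f y) \<le> L * norm (x - y)"
    using lobE[where f = f and R = R] assms by blast
  obtain M where M: "M \<ge> 0"
    "\<And>x y. norm x \<le> R \<Longrightarrow> norm y \<le> R \<Longrightarrow> norm (g x - g y) \<le> M * norm (x - y)"
    using lobE[where f = g and R = R] assms by blast
  have "norm (b (f x) (g x) - b (f y) (g y)) \<le> ((L * Bg + Bf * M) * K) * norm (x - y)"
    if xy: "norm x \<le> R" "norm y \<le> R" for x y
  proof -
    have "b (f x) (g x) - b (f y) (g y) = b (f x - f y) (g x) + b (f y) (g x - g y)"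
      by (simp add: diff_left diff_right)
    then have "norm (b (f x) (g x) - b (f y) (g y)) \<le> norm (f x - f y) * norm (g x) * K + norm (f y) * norm (g x - g y) * K"
      using K(2)[of "f x - f y" "g x"] K(2)[of "f y" "g x - g y"] norm_triangle_ineq[of "b (f x - f y) (g x)" "b (f y) (g x - g y)"]
      by simp
    also have "\<dots> \<le> (L * norm (x - y)) * Bg * K + Bf * (M * norm (x - y)) * K"
      using L M Bf Bg K xy by (intro add_mono mult_right_mono mult_mono) auto
    finally show ?thesis by (simp add: algebra_simps)
  qed
  then show "\<exists>L\<ge>0. \<forall>x y. norm x \<le> R \<longrightarrow> norm y \<le> R \<longrightarrow> norm (b (f x) (g x) - b (f y) (g y)) \<le> L * norm (x - y)"
    using L M Bf Bg K by (intro exI[of _ "(L * Bg + Bf * M) * K"]) auto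
qed

lemma lob_linear_compose:
  assumes h: "bounded_linear h" and f: "lipschitz_on_balls f"
  shows "lipschitz_on_balls (\<lambda>x. h (f x))"
  unfolding lipschitz_on_balls_def
proof
  fix R
  obtain K where K: "\<And>x. norm (h x) \<le> norm x * K" "K > 0"
    using bounded_linear.pos_bounded[OF h] by auto
  obtain L where L: "L \<ge> 0"
    "\<And>x y. norm x \<le> R \<Longrightarrow> norm y \<le> R \<Longrightarrow> norm (f x - f y) \<le> L * norm (x - y)"
    using lobE[OF f, of R] by blast
  have "norm (h (f x) - h (f y)) \<le> (L * K) * norm (x - y)" if "norm x \<le> R" "norm y \<le> R" for x y
    using K(1)[of "f x - f y"] mult_right_mono[OF L(2)[OF that] less_imp_le[OF K(2)]]
    by (simp add: linear_diff[OF bounded_linear.linear[OF h]] mult_ac)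
  then show "\<exists>L\<ge>0. \<forall>x y. norm x \<le> R \<longrightarrow> norm y \<le> R \<longrightarrow> norm (h (f x) - h (f y)) \<le> L * norm (x - y)"
    using L K by (intro exI[of _ "L * K"]) auto
qed

lemma lob_scaleR [lob_intros]: "lipschitz_on_balls f \<Longrightarrow> lipschitz_on_balls (\<lambda>x. c *\<^sub>R f x)"
  by (rule lob_linear_compose[OF bounded_linear_scaleR_right])

lemma lob_fst [lob_intros]: "lipschitz_on_balls f \<Longrightarrow> lipschitz_on_balls (\<lambda>x. fst (f x))"
  by (rule lob_linear_compose[OF bounded_linear_fst])

lemma lob_snd [lob_intros]: "lipschitz_on_balls f \<Longrightarrow> lipschitz_on_balls (\<lambda>x. snd (f x))"
  by (rule lob_linear_compose[OF bounded_linear_snd])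

lemma lob_id [lob_intros]: "lipschitz_on_balls (\<lambda>x. x)"
  by (rule lob_linear[OF bounded_linear_ident])

lemma lob_Pair [lob_intros]:
  assumes "lipschitz_on_balls f" "lipschitz_on_balls g"
  shows "lipschitz_on_balls (\<lambda>x. (f x, g x))"
proof -
  have "lipschitz_on_balls (\<lambda>x. (f x, 0) + (0, g x))"
    by (intro lob_add lob_linear_compose[OF _ assms(1)] lob_linear_compose[OF _ assms(2)]
        bounded_linear_Pair bounded_linear_zero bounded_linear_ident)
  then show ?thesis by simp
qed

text \<open>On a compact interval both solutions stay in one ball, where \<open>F\<close> has a
  uniform Lipschitz constant; Gronwall then applies to the squared distance.\<close>

lemma ode_unique:
  fixes F :: "'a::real_inner \<Rightarrow> 'a"
  assumes F: "lipschitz_on_balls F"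
    and x: "\<And>t. t \<in> {0..T} \<Longrightarrow> (x has_vector_derivative F (x t)) (at t within {0..T})"
    and y: "\<And>t. t \<in> {0..T} \<Longrightarrow> (y has_vector_derivative F (y t)) (at t within {0..T})"
    and eq: "x 0 = y 0" and t: "t \<in> {0..T}"
  shows "x t = y t"
proof -
  have c: "continuous_on {0..T} x" "continuous_on {0..T} y"
    unfolding continuous_on_eq_continuous_within
    using x y has_vector_derivative_continuous by blast+
  obtain Rx where Rx: "\<And>t. t \<in> {0..T} \<Longrightarrow> norm (x t) \<le> Rx"
    using compact_imp_bounded[OF compact_continuous_image[OF c(1) compact_Icc]]
    by (metis bounded_iff image_eqI)
  obtain Ry where Ry: "\<And>t. t \<in> {0..T} \<Longrightarrow> norm (y t) \<le> Ry"
    using compact_imp_bounded[OF compact_continuous_image[OF c(2) compact_Icc]]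
    by (metis bounded_iff image_eqI)
  obtain L where L: "L \<ge> 0"
    "\<And>x y. norm x \<le> max Rx Ry \<Longrightarrow> norm y \<le> max Rx Ry \<Longrightarrow> norm (F x - F y) \<le> L * norm (x - y)"
    using lobE[OF F, of "max Rx Ry"] by blast
  have "(norm (x t - y t))\<^sup>2 \<le> exp (2 * L * t) * ((norm (x 0 - y 0))\<^sup>2 * exp (- (2 * L * 0)) + 0 - 0)"
  proof (rule gronwall_differential[where v = "\<lambda>t. (norm (x t - y t))\<^sup>2" and b = "\<lambda>_. 0" and \<beta> = "\<lambda>_. 0" and a = "\<lambda>_. 2 * L", OF _ _ _ _ _ t])
    fix s assume s: "s \<in> {0..T}"
    show "((\<lambda>t. (norm (x t - y t))\<^sup>2) has_real_derivative 2 * inner (x s - y s) (F (x s) - F (y s))) (at s within {0..T})"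
      by (intro has_vector_derivative_norm_square derivative_intros x y s)
    have "inner (x s - y s) (F (x s) - F (y s)) \<le> norm (x s - y s) * norm (F (x s) - F (y s))"
      by (rule norm_cauchy_schwarz)
    also have "\<dots> \<le> norm (x s - y s) * (L * norm (x s - y s))"
      using Rx[OF s] Ry[OF s] by (intro mult_left_mono L) auto
    finally show "2 * inner (x s - y s) (F (x s) - F (y s)) \<le> 2 * L * (norm (x s - y s))\<^sup>2 + 0"
      by (simp add: power2_eq_square algebra_simps)
  qed (auto intro!: derivative_eq_intros)
  then show ?thesis using eq by simp
qed

section \<open>Matrices\<close>

lemma transpose_add [simp]: "(A + B)\<^sup>T = A\<^sup>T + (B::real^'n^'m)\<^sup>T"
  by (vector transpose_def)
lemma transpose_diff [simp]: "(A - B)\<^sup>T = A\<^sup>T - (B::real^'n^'m)\<^sup>T"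
  by (vector transpose_def)
lemma transpose_minus [simp]: "(- A)\<^sup>T = - (A::real^'n^'m)\<^sup>T"
  by (vector transpose_def)
lemma transpose_scaleR [simp]: "(c *\<^sub>R A)\<^sup>T = c *\<^sub>R (A::real^'n^'m)\<^sup>T"
  by (vector transpose_def)
lemma transpose_zero [simp]: "(0::real^'n^'m)\<^sup>T = 0"
  by (vector transpose_def)

text \<open>Cauchy-Schwarz row by row. The constant one for the Frobenius norm keeps dimension
  factors out of the Riccati estimates.\<close>

lemma norm_matrix_mult: "norm (A ** B) \<le> norm A * norm (B :: real^'k^'n)" for A :: "real^'n^'m"
proof -
  have row: "norm ((A ** B) $ i) \<le> norm (A $ i) * norm B" for i
  proof -
    have "(A ** B) $ i = (\<Sum>k\<in>UNIV. A $ i $ k *\<^sub>R B $ k)"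
      by (simp add: vec_eq_iff matrix_matrix_mult_def)
    then have "norm ((A ** B) $ i) \<le> (\<Sum>k\<in>UNIV. \<bar>A $ i $ k\<bar> * norm (B $ k))"
      using norm_sum[of "\<lambda>k. A $ i $ k *\<^sub>R B $ k" UNIV] by simp
    also have "\<dots> \<le> L2_set (\<lambda>k. A $ i $ k) UNIV * L2_set (\<lambda>k. norm (B $ k)) UNIV"
      using L2_set_mult_ineq[of "\<lambda>k. A $ i $ k" "\<lambda>k. norm (B $ k)" UNIV] by simp
    also have "\<dots> = norm (A $ i) * norm B" by (simp add: norm_vec_def L2_set_def)
    finally show ?thesis .
  qed
  have "norm (A ** B) \<le> L2_set (\<lambda>i. norm (A $ i) * norm B) UNIV"
    unfolding norm_vec_def[of "A ** B"] using row by (intro L2_set_mono) auto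
  also have "\<dots> = norm A * norm B" by (simp add: norm_vec_def[of A] L2_set_left_distrib)
  finally show ?thesis .
qed

lemma bounded_bilinear_matrix_mult: "bounded_bilinear (\<lambda>(A::real^'n^'m) (B :: real^'k^'n). A ** B)"
proof
  show "\<exists>K. \<forall>(A::real^'n^'m) (B :: real^'k^'n). norm (A ** B) \<le> norm A * norm B * K"
    by (intro exI[of _ 1] allI) (simp add: norm_matrix_mult)
qed (simp_all add: vec_eq_iff matrix_matrix_mult_def sum.distrib algebra_simps sum_distrib_left)

lemma inner_transpose [simp]: "inner (A\<^sup>T) (B\<^sup>T) = inner A (B::real^'n^'m)"
  unfolding inner_vec_def by (subst sum.swap) (simp add: transpose_def)

lemma norm_transpose [simp]: "norm (A\<^sup>T) = norm (A::real^'n^'m)"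
  by (simp add: norm_eq_sqrt_inner)

lemma bounded_linear_transpose: "bounded_linear (\<lambda>A::real^'n^'m. A\<^sup>T)"
  by standard (auto intro!: exI[of _ 1])

lemma lob_matrix_mult [lob_intros]:
  "lipschitz_on_balls f \<Longrightarrow> lipschitz_on_balls g \<Longrightarrow> lipschitz_on_balls (\<lambda>x. (f x :: real^'n^'m) ** (g x :: real^'k^'n))"
  by (rule lob_bilinear[OF bounded_bilinear_matrix_mult])

lemma lob_transpose [lob_intros]:
  "lipschitz_on_balls f \<Longrightarrow> lipschitz_on_balls (\<lambda>x. (f x :: real^'n^'m)\<^sup>T)"
  by (rule lob_linear_compose[OF bounded_linear_transpose])

lemmas continuous_on_matrix_mult [continuous_intros] =
  bounded_bilinear.continuous_on[OF bounded_bilinear_matrix_mult]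
lemmas continuous_on_matrix_transpose [continuous_intros] =
  bounded_linear.continuous_on[OF bounded_linear_transpose]
lemmas has_vector_derivative_transpose =
  bounded_linear.has_vector_derivative[OF bounded_linear_transpose]

text \<open>Right multiplication by \<open>S\<close> acts on each row of \<open>E\<close> as
  \<open>S\<^sup>T\<close>, and a quadratic form sees only the symmetric part; summing over the rows
  gives the Frobenius inner product.\<close>

lemma inner_dissipative_right:
  fixes E :: "real^'n^'m" and S :: "real^'n^'n"
  assumes "loewner_le (sym_part S) (mat c)"
  shows "inner E (E ** S) \<le> c * (norm E)\<^sup>2"
proof -
  have quad: "v \<bullet> (S\<^sup>T *v v) \<le> c * (v \<bullet> v)" for v
  proof -
    have "v \<bullet> (sym_part S *v v) \<le> v \<bullet> ((mat c :: real^'n^'n) *v v)"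
      using assms by (simp add: loewner_le_def)
    also have "(mat c :: real^'n^'n) *v v = c *\<^sub>R v"
      by (simp add: vec_eq_iff matrix_vector_mult_def mat_def if_distrib[where f = "\<lambda>x. x * _"] cong: if_cong)
    finally have 1: "v \<bullet> (sym_part S *v v) \<le> c * (v \<bullet> v)" by simp
    have "v \<bullet> (S *v v) = v \<bullet> (S\<^sup>T *v v)"
      by (metis dot_lmul_matrix inner_commute transpose_matrix_vector vector_transpose_matrix)
    then have "v \<bullet> (sym_part S *v v) = v \<bullet> (S\<^sup>T *v v)"
      by (simp add: sym_part_def scaleR_matrix_vector_assoc[symmetric] matrix_vector_mult_add_rdistrib inner_add_right)
    with 1 show ?thesis by simp
  qed
  have row: "(E ** S) $ i = S\<^sup>T *v (E $ i)" for i
    by (simp add: vec_eq_iff matrix_matrix_mult_def matrix_vector_mult_def transpose_def mult.commute)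
  have "inner E (E ** S) = (\<Sum>i\<in>UNIV. E $ i \<bullet> (S\<^sup>T *v (E $ i)))"
    by (simp add: inner_vec_def[of E] row)
  also have "\<dots> \<le> (\<Sum>i\<in>UNIV. c * (E $ i \<bullet> E $ i))" by (intro sum_mono quad)
  also have "\<dots> = c * (norm E)\<^sup>2"
    by (simp add: power2_norm_eq_inner inner_vec_def[of E E] sum_distrib_left)
  finally show ?thesis .
qed

lemma inner_dissipative_left:
  fixes E :: "real^'m^'n" and S :: "real^'n^'n"
  assumes "loewner_le (sym_part S) (mat c)"
  shows "inner E (S\<^sup>T ** E) \<le> c * (norm E)\<^sup>2"
  using inner_dissipative_right[OF assms, of "E\<^sup>T"] inner_transpose[of E "S\<^sup>T ** E"]
  by (simp add: matrix_transpose_mul)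

lemma loewner_le_uminus_mat: "loewner_le X (- mat c) \<longleftrightarrow> loewner_le X (mat (- c))"
  for X :: "real^'n^'n"
proof -
  have "(- mat c :: real^'n^'n) = mat (- c)" by (simp add: vec_eq_iff mat_def)
  then show ?thesis by simp
qed

lemma matrix_inv_cancel:
  assumes "invertible (A::real^'n^'n)"
  shows "A ** matrix_inv A = mat 1" "matrix_inv A ** A = mat 1"
  using someI_ex[of "\<lambda>A'. A ** A' = mat 1 \<and> A' ** A = mat 1"] assms
  unfolding matrix_inv_def invertible_def by auto

lemma matrix_inv_unique:
  assumes "A ** B = mat 1" "B ** A = mat 1"
  shows "matrix_inv A = (B :: real^'n^'n)"
  using assms matrix_inv_cancel[of A] unfolding invertible_def
  by (metis matrix_mul_assoc matrix_mul_lid matrix_mul_rid)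

text \<open>The form of cancellation that fires once products are associated to the right, as
  \<open>matrix_mult_algebra\<close> does.\<close>

lemma mult_cancel_mat: "A ** B = mat 1 \<Longrightarrow> A ** (B ** X) = (X :: real^'k^'n)"
  for A :: "real^'m^'n"
  by (simp add: matrix_mul_assoc)

lemmas matrix_mult_algebra =
  bounded_bilinear.add_left[OF bounded_bilinear_matrix_mult]
  bounded_bilinear.add_right[OF bounded_bilinear_matrix_mult]
  bounded_bilinear.diff_left[OF bounded_bilinear_matrix_mult]
  bounded_bilinear.diff_right[OF bounded_bilinear_matrix_mult]
  bounded_bilinear.minus_left[OF bounded_bilinear_matrix_mult]
  bounded_bilinear.minus_right[OF bounded_bilinear_matrix_mult]
  bounded_bilinear.zero_left[OF bounded_bilinear_matrix_mult]
  bounded_bilinear.zero_right[OF bounded_bilinear_matrix_mult]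
  bounded_bilinear.scaleR_left[OF bounded_bilinear_matrix_mult]
  bounded_bilinear.scaleR_right[OF bounded_bilinear_matrix_mult]
  matrix_mul_assoc[symmetric] matrix_transpose_mul

text \<open>On a kernel vector of \<open>S\<^sup>T\<close> the quadratic form would be zero, against
  its strict negativity.\<close>

lemma invertible_of_loewner_neg:
  fixes S :: "real^'n^'n"
  assumes "0 < \<gamma>" "loewner_le (sym_part S) (- mat \<gamma>)"
  shows "invertible S"
proof -
  have inj: "v = 0" if "S\<^sup>T *v v = 0" for v :: "real^'n"
  proof -
    \<comment> \<open>All rows equal \<open>v\<close>, so that the matrix inequality speaks about a
      single vector.\<close>
    define E :: "real^'n^'n" where "E = (\<chi> i. v)"
    have "(E ** S) $ i = S\<^sup>T *v v" for i
      by (simp add: E_def vec_eq_iff matrix_matrix_mult_def matrix_vector_mult_def transpose_def mult.commute)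
    then have "E ** S = 0" using that by (simp add: vec_eq_iff)
    then have "0 \<le> - \<gamma> * (norm E)\<^sup>2"
      using inner_dissipative_right[of S "- \<gamma>" E] assms by (simp add: loewner_le_uminus_mat)
    then have "E = 0" using assms(1) by (simp add: mult_le_0_iff)
    then show "v = 0" by (simp add: E_def vec_eq_iff)
  qed
  have "\<exists>B. B ** S\<^sup>T = mat 1"
    unfolding matrix_left_invertible_ker using inj by blast
  then have "invertible (S\<^sup>T)" by (simp add: invertible_left_inverse)
  then show ?thesis by (metis transpose_invertible transpose_transpose)
qed

section \<open>The Riccati fields near the fast equilibrium and on the slow manifold\<close>

lemma symmetric_matricesD: "A \<in> symmetric_matrices \<Longrightarrow> A\<^sup>T = A"
  by (simp add: symmetric_matrices_def)

lemma Delta1_sym [simp]: "(Delta1 G)\<^sup>T = Delta1 G" by (simp add: Delta1_def matrix_transpose_mul)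
lemma Delta2_sym [simp]: "(Delta2 G)\<^sup>T = Delta2 G" by (simp add: Delta2_def matrix_transpose_mul)

locale fast_stable =
  fixes G :: "('n1::finite,'n2::finite,'k1::finite,'k2::finite,'m1::finite,'m2::finite) lq_game"
    and Pb22 :: "real^'n2^'n2" and \<gamma> :: real
  assumes Q_sym: "Q1 G \<in> symmetric_matrices" "Q2 G \<in> symmetric_matrices"
    and inv_Delta2: "invertible (Delta2 G)"
    and Pb22_sym: "Pb22 \<in> symmetric_matrices"
    and are: "fast_are G Pb22"
    and gamma: "0 < \<gamma>"
    and stable: "loewner_le (sym_part (fast_S G Pb22)) (- mat \<gamma>)"
begin

abbreviation "S \<equiv> fast_S G Pb22"
abbreviation "h \<equiv> slow_manifold G Pb22"

lemma Pb22_T [simp]: "Pb22\<^sup>T = Pb22" using Pb22_sym by (rule symmetric_matricesD)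
lemma Q1_T [simp]: "(Q1 G)\<^sup>T = Q1 G" using Q_sym(1) by (rule symmetric_matricesD)
lemma Q2_T [simp]: "(Q2 G)\<^sup>T = Q2 G" using Q_sym(2) by (rule symmetric_matricesD)

lemma inv_S: "invertible S" using invertible_of_loewner_neg[OF gamma stable] .

lemma A22_eq: "A22 G = S - Delta2 G ** Pb22" by (simp add: fast_S_def)

lemma Q2_eq: "Q2 G = - ((A22 G)\<^sup>T ** Pb22) - Pb22 ** A22 G - Pb22 ** (Delta2 G ** Pb22)"
proof -
  have "(A22 G)\<^sup>T ** Pb22 + Pb22 ** A22 G + Pb22 ** Delta2 G ** Pb22 + Q2 G = 0"
    using are by (simp add: fast_are_def)
  then show ?thesis by (simp add: algebra_simps matrix_mul_assoc eq_neg_iff_add_eq_0)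
qed

lemma S_T: "S\<^sup>T = (A22 G)\<^sup>T + Pb22 ** Delta2 G"
  by (simp add: fast_S_def matrix_transpose_mul)

text \<open>Eliminating \<open>Q2 G\<close> by the algebraic Riccati equation factorises
  \<open>Lambda G\<close> as \<open>S\<^sup>T ** (matrix_inv (Delta2 G) ** S)\<close>, so its
  invertibility comes from that of \<open>S\<close> and \<open>Delta2 G\<close>.\<close>

lemma matrix_inv_Lambda:
  "matrix_inv (Lambda G) = matrix_inv S ** (Delta2 G ** (matrix_inv S)\<^sup>T)"
proof -
  let ?D = "Delta2 G" and ?K = "matrix_inv S" and ?Di = "matrix_inv (Delta2 G)"
  note c = matrix_inv_cancel[OF inv_Delta2] matrix_inv_cancel[OF inv_S]
  have ct: "S\<^sup>T ** ?K\<^sup>T = mat 1" "?K\<^sup>T ** S\<^sup>T = mat 1"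
    using c(3,4) by (metis matrix_transpose_mul transpose_mat)+
  have L: "Lambda G = S\<^sup>T ** (?Di ** S)"
    unfolding Lambda_def Q2_eq A22_eq
    by (simp add: matrix_mult_algebra c mult_cancel_mat[OF c(1)] mult_cancel_mat[OF c(2)])
  show ?thesis
    by (rule matrix_inv_unique)
      (simp_all add: L matrix_mul_assoc[symmetric] mult_cancel_mat[OF c(1)] mult_cancel_mat[OF c(2)]
         mult_cancel_mat[OF c(3)] mult_cancel_mat[OF c(4)] mult_cancel_mat[OF ct(1)] mult_cancel_mat[OF ct(2)] c ct)
qed

lemma h_eq: "h X = - (((A21 G)\<^sup>T ** Pb22 + X ** A12 G + X ** Delta G ** Pb22) ** matrix_inv S)"
  by (simp add: slow_manifold_def fast_S_def)

text \<open>This is \<open>riccati_g1 = 0\<close> at \<open>\<epsilon> = 0\<close> with the fast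
  block resting at \<open>Pb22\<close>: on the slow manifold the fast equation for
  \<open>P12\<close> is in equilibrium.\<close>

lemma h_mult_S: "h X ** S = - ((A21 G)\<^sup>T ** Pb22 + X ** A12 G + X ** (Delta G ** Pb22))"
  unfolding h_eq by (simp add: matrix_mult_algebra matrix_inv_cancel[OF inv_S])

text \<open>Both sides are rewritten in terms of \<open>matrix_inv S\<close> and
  \<open>Pb22\<close>: after inserting \<open>A22 G = S - Delta2 G ** Pb22\<close> and the
  factorised \<open>Lambda G\<close>, every \<open>matrix_inv (Delta2 G)\<close> cancels and the
  rest is expansion. \<open>Y\<close> and \<open>e\<close> are arbitrary because the slow field
  contains neither \<open>P22\<close> nor \<open>\<epsilon>\<close>.\<close>

theorem riccati_f_on_slow_manifold:
  assumes X: "X\<^sup>T = X"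
  shows "riccati_f G X (h X) Y e
    = (reduced_A G)\<^sup>T ** X + X ** reduced_A G + X ** reduced_M G ** X + reduced_N G"
proof -
  let ?D = "Delta2 G" and ?K = "matrix_inv S" and ?Di = "matrix_inv (Delta2 G)"
  note c = matrix_inv_cancel[OF inv_Delta2] matrix_inv_cancel[OF inv_S]
  have ct: "S\<^sup>T ** ?K\<^sup>T = mat 1" "?K\<^sup>T ** S\<^sup>T = mat 1"
    using c(3,4) by (metis matrix_transpose_mul transpose_mat)+
  note cc = c ct mult_cancel_mat[OF c(1)] mult_cancel_mat[OF c(2)] mult_cancel_mat[OF c(3)] mult_cancel_mat[OF c(4)]
    mult_cancel_mat[OF ct(1)] mult_cancel_mat[OF ct(2)]
  have rb: "reduced_bracket G = Pb22 ** ?K + ?K\<^sup>T ** Pb22 - Pb22 ** (?K ** (?D ** (?K\<^sup>T ** Pb22)))"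
    unfolding reduced_bracket_def matrix_inv_Lambda A22_eq by (simp add: matrix_mult_algebra cc)
  have LA: "matrix_inv (Lambda G) ** ((A22 G)\<^sup>T ** (?Di ** Z)) = ?K ** Z - ?K ** (?D ** (?K\<^sup>T ** (Pb22 ** Z)))" for Z :: "real^'z^'n2"
    unfolding matrix_inv_Lambda A22_eq by (simp add: matrix_mult_algebra cc)
  have AL: "?Di ** (A22 G ** (matrix_inv (Lambda G) ** Z)) = ?K\<^sup>T ** Z - Pb22 ** (?K ** (?D ** (?K\<^sup>T ** Z)))" for Z :: "real^'z^'n2"
    unfolding matrix_inv_Lambda A22_eq by (simp add: matrix_mult_algebra cc)
  have A: "reduced_A G = A11 G - Delta G ** (reduced_bracket G ** A21 G)
     - A12 G ** (?K ** A21 G - ?K ** (?D ** (?K\<^sup>T ** (Pb22 ** A21 G))))"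
    unfolding reduced_A_def by (simp add: matrix_mul_assoc[symmetric] LA)
  have M: "reduced_M G = Delta1 G + A12 G ** (?K ** (?D ** (?K\<^sup>T ** (A12 G)\<^sup>T)))
     - Delta G ** (?K\<^sup>T ** (A12 G)\<^sup>T - Pb22 ** (?K ** (?D ** (?K\<^sup>T ** (A12 G)\<^sup>T))))
     - A12 G ** (?K ** (Delta G)\<^sup>T - ?K ** (?D ** (?K\<^sup>T ** (Pb22 ** (Delta G)\<^sup>T))))
     - Delta G ** (reduced_bracket G ** (Delta G)\<^sup>T)"
    unfolding reduced_M_def
    by (simp add: matrix_mul_assoc[symmetric] LA AL) (simp add: matrix_inv_Lambda matrix_mul_assoc)
  have N: "reduced_N G = Q1 G - (A21 G)\<^sup>T ** (reduced_bracket G ** A21 G)"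
    unfolding reduced_N_def by (simp add: matrix_mul_assoc)
  show ?thesis
    unfolding A M N rb riccati_f_def h_eq
    by (simp add: matrix_mult_algebra X algebra_simps)
qed

text \<open>The constant term is the algebraic Riccati equation for \<open>Pb22\<close> and drops
  out, so the shifted fast block obeys a homogeneous Riccati equation with linear part given by
  \<open>S\<close>.\<close>

lemma riccati_g2_layer:
  assumes "p\<^sup>T = p"
  shows "riccati_g2 G X Y (p + Pb22) 0 = S\<^sup>T ** p + p ** S + p ** (Delta2 G ** p)"
  unfolding riccati_g2_def Q2_eq S_T by (simp add: fast_S_def matrix_mult_algebra algebra_simps)

text \<open>Around equilibrium plus layer there are four groups: the layer's own field, the
  linearisation along the layer, a quadratic term in the error, and a remainder with the factor
  \<open>\<epsilon>\<close>. \<open>Z\<close> is free because at \<open>\<epsilon> = 0\<close> the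
  field depends on \<open>P22\<close> only.\<close>

lemma riccati_g2_expand:
  assumes "p\<^sup>T = p" "E\<^sup>T = E"
  shows "riccati_g2 G X12 Y (Pb22 + p + E) \<epsilon> = riccati_g2 G 0 Z (p + Pb22) 0
    + (S + Delta2 G ** p)\<^sup>T ** E + E ** (S + Delta2 G ** p) + E ** (Delta2 G ** E)
    + \<epsilon> *\<^sub>R ((A12 G)\<^sup>T ** Y + Y\<^sup>T ** A12 G + \<epsilon> *\<^sub>R (Y\<^sup>T ** (Delta1 G ** Y))
        + Y\<^sup>T ** (Delta G ** (Pb22 + p + E)) + (Pb22 + p + E) ** ((Delta G)\<^sup>T ** Y))"
  unfolding riccati_g2_def S_T using assms
  by (simp add: fast_S_def matrix_mult_algebra algebra_simps power2_eq_square)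

text \<open>Given \<open>p\<close>, this is linear in \<open>y\<close> with dissipative part
  \<open>S\<close> and a source proportional to \<open>p\<close>; the constant part cancels by
  \<open>h_mult_S\<close>.\<close>

lemma riccati_g1_layer:
  "riccati_g1 G 0 (y + h 0) (p + Pb22) 0
    = y ** (S + Delta2 G ** p) + ((A21 G)\<^sup>T + h 0 ** Delta2 G) ** p"
proof -
  have "riccati_g1 G 0 (y + h 0) (p + Pb22) 0
    = (y ** (S + Delta2 G ** p) + ((A21 G)\<^sup>T + h 0 ** Delta2 G) ** p) + (h 0 ** S + (A21 G)\<^sup>T ** Pb22)"
    unfolding riccati_g1_def by (simp add: fast_S_def matrix_mult_algebra algebra_simps)
  then show ?thesis by (simp add: h_mult_S matrix_mult_algebra)
qed

text \<open>The only part of the remainder that carries neither an error nor an explicit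
  \<open>\<epsilon>\<close> is \<open>p\<close> multiplied by terms in \<open>a\<close> and
  \<open>h a - h 0\<close>; it is small along the solution because \<open>a\<close> vanishes where
  the layer lives. The equilibrium terms cancel by \<open>h_mult_S\<close>.\<close>

lemma riccati_g1_expand:
  assumes a: "a\<^sup>T = a"
  shows "riccati_g1 G (a + E11) (h a + y + E12) (Pb22 + p + E22) \<epsilon> = riccati_g1 G 0 (y + h 0) (p + Pb22) 0
    + E12 ** (S + Delta2 G ** p) + E12 ** (Delta2 G ** E22)
    + ((a ** Delta G + (h a - h 0) ** Delta2 G) ** p
       + E11 ** (A12 G + Delta G ** (Pb22 + p + E22))
       + ((A21 G)\<^sup>T + a ** Delta G + (h a + y) ** Delta2 G) ** E22
       + \<epsilon> *\<^sub>R ((A11 G)\<^sup>T ** (h a + y + E12) + (a + E11) ** (Delta1 G ** (h a + y + E12))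
           + (h a + y + E12) ** ((Delta G)\<^sup>T ** (h a + y + E12))))" (is "?l = ?r")
proof -
  have "?l = ?r + (h a ** S + (A21 G)\<^sup>T ** Pb22 + a ** A12 G + a ** (Delta G ** Pb22))"
    unfolding riccati_g1_layer
    unfolding riccati_g1_def by (simp add: fast_S_def matrix_mult_algebra algebra_simps)
  then show ?thesis by (simp add: h_mult_S)
qed

lemma h_diff: "h X - h Y = - ((X - Y) ** ((A12 G + Delta G ** Pb22) ** matrix_inv S))"
  unfolding h_eq by (simp add: matrix_mult_algebra algebra_simps)

end

section \<open>The boundary layer\<close>

lemma symmetric_matrices_subspace: "subspace (symmetric_matrices :: (real^'n^'n) set)"
  by (auto simp: subspace_def symmetric_matrices_def)

lemma closed_symmetric_matrices: "closed (symmetric_matrices :: (real^'n^'n) set)"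
  by (rule closed_subspace[OF symmetric_matrices_subspace])

lemma interior_sym_cball_norm_less:
  fixes P :: "real^'a^'a"
  assumes "P \<in> (top_of_set symmetric_matrices) interior_of (sym_cball q)"
  shows "norm P < q"
proof -
  obtain U where U: "openin (top_of_set symmetric_matrices) U" "P \<in> U" "U \<subseteq> sym_cball q"
    using assms by (auto simp: interior_of_def)
  then have PS: "P \<in> symmetric_matrices" using openin_subset by fastforce
  obtain d where d: "d > 0" "\<And>X. X \<in> symmetric_matrices \<Longrightarrow> dist X P < d \<Longrightarrow> X \<in> U"
    using U(1,2) unfolding openin_euclidean_subtopology_iff by blast
  \<comment> \<open>Moving along \<open>P\<close> itself raises the norm by exactly
    \<open>d / 2\<close>; at \<open>P = 0\<close> any nonzero symmetric direction serves.\<close>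
  define D where "D = (if P = 0 then mat 1 else P)"
  have D: "D \<noteq> 0" "D \<in> symmetric_matrices"
  proof -
    have "(mat 1 :: real^'a^'a) \<noteq> 0" by (simp add: vec_eq_iff mat_def)
    then show "D \<noteq> 0" by (simp add: D_def)
    show "D \<in> symmetric_matrices" using PS by (simp add: D_def symmetric_matrices_def)
  qed
  define X where "X = P + (d / (2 * norm D)) *\<^sub>R D"
  have "X \<in> symmetric_matrices"
    unfolding X_def using PS D by (intro subspace_add subspace_scale symmetric_matrices_subspace)
  moreover have "dist X P < d" using d(1) D by (simp add: X_def dist_norm)
  ultimately have "X \<in> sym_cball q" using d(2) U(3) by blast
  then have "norm X \<le> q" by (simp add: sym_cball_def)
  moreover have "norm X = norm P + d / 2"
  proof (cases "P = 0")
    case True then show ?thesis using d D by (simp add: X_def)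
  next
    case False
    then have "X = (1 + d / (2 * norm P)) *\<^sub>R P" by (simp add: X_def D_def algebra_simps)
    then have "norm X = \<bar>1 + d / (2 * norm P)\<bar> * norm P" by (metis norm_scaleR)
    also have "\<bar>1 + d / (2 * norm P)\<bar> = 1 + d / (2 * norm P)" using d(1) by simp
    finally show ?thesis using False by (simp add: distrib_right)
  qed
  ultimately show ?thesis using d(1) by simp
qed

text \<open>Symmetry of the velocity alone makes the skew part \<open>x\<^sup>T - x\<close>
  constant. It is applied to projected fields, whose values are symmetric before anything is known
  about \<open>x\<close>.\<close>

lemma has_vector_derivative_symmetric:
  fixes x :: "real \<Rightarrow> real^'n^'n"
  assumes "\<And>t. 0 \<le> t \<Longrightarrow> (x has_vector_derivative D t) (at t within {0..})"
    and "\<And>t. 0 \<le> t \<Longrightarrow> (D t)\<^sup>T = D t" "(x 0)\<^sup>T = x 0" "0 \<le> t"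
  shows "(x t)\<^sup>T = x t"
proof -
  have "\<And>s. s \<in> {0..} \<Longrightarrow> ((\<lambda>s. (x s)\<^sup>T - x s) has_vector_derivative (D s)\<^sup>T - D s) (at s within {0..})"
    by (intro derivative_intros has_vector_derivative_transpose assms) auto
  then have "\<And>s. s \<in> {0..} \<Longrightarrow> ((\<lambda>s. (x s)\<^sup>T - x s) has_vector_derivative 0) (at s within {0..})"
    using assms(2) by simp
  then obtain c where "\<And>s. s \<in> {0..} \<Longrightarrow> (x s)\<^sup>T - x s = c"
    using has_vector_derivative_zero_constant[of "{0..}" "\<lambda>s. (x s)\<^sup>T - x s"] by blast
  from this[of 0] this[of t] show ?thesis using assms(3,4) by simp
qed

locale layer_data = fast_stable +
  fixes \<delta> q2 :: real
  assumes delta: "0 < \<delta>" "\<delta> < \<gamma>"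
    and radius: "largest_ball_radius G Pb22 \<delta> q2"
    and interior: "- Pb22 \<in> (top_of_set symmetric_matrices) interior_of (sym_cball q2)"
begin

lemma stable_on_ball: "loewner_le (sym_part (S + Delta2 G ** p)) (mat \<delta>)" if "p\<^sup>T = p" "norm p \<le> q2"
  using radius that by (auto simp: largest_ball_radius_def stability_region_def sym_cball_def symmetric_matrices_def)

text \<open>The field is split into \<open>S\<^sup>T ** p\<close> and
  \<open>p ** (S + Delta2 G ** p)\<close>: the first part contributes the rate
  \<open>- \<gamma>\<close>, the second at most \<open>\<delta>\<close> as long as \<open>p\<close>
  stays in the ball.\<close>

lemma fast_decay:
  assumes "\<And>\<tau>. \<tau> \<in> {0..t} \<Longrightarrow> norm (p \<tau>) \<le> q2" "\<And>\<tau>. \<tau> \<in> {0..t} \<Longrightarrow> (p \<tau>)\<^sup>T = p \<tau>"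
    and der: "\<And>\<tau>. \<tau> \<in> {0..t} \<Longrightarrow>
      (p has_vector_derivative S\<^sup>T ** p \<tau> + p \<tau> ** S + p \<tau> ** (Delta2 G ** p \<tau>)) (at \<tau> within {0..t})"
    and "0 \<le> t"
  shows "(norm (p t))\<^sup>2 \<le> (norm (p 0))\<^sup>2 * exp (- 2 * (\<gamma> - \<delta>) * t)"
proof -
  have "(norm (p t))\<^sup>2 \<le> exp (- 2 * (\<gamma> - \<delta>) * t) * ((norm (p 0))\<^sup>2 * exp (- (- 2 * (\<gamma> - \<delta>) * 0)) + 0 - 0)"
  proof (rule gronwall_differential[where v = "\<lambda>t. (norm (p t))\<^sup>2" and b = "\<lambda>_. 0" and \<beta> = "\<lambda>_. 0" and a = "\<lambda>_. - 2 * (\<gamma> - \<delta>)" and T = t])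
    fix s assume s: "s \<in> {0..t}"
    show "((\<lambda>t. (norm (p t))\<^sup>2) has_real_derivative 2 * inner (p s) (S\<^sup>T ** p s + p s ** S + p s ** (Delta2 G ** p s))) (at s within {0..t})"
      by (intro has_vector_derivative_norm_square der s)
    have "inner (p s) (S\<^sup>T ** p s) \<le> - \<gamma> * (norm (p s))\<^sup>2"
      using inner_dissipative_left stable by (metis loewner_le_uminus_mat)
    moreover have "inner (p s) (p s ** (S + Delta2 G ** p s)) \<le> \<delta> * (norm (p s))\<^sup>2"
      by (intro inner_dissipative_right stable_on_ball assms s)
    ultimately show "2 * inner (p s) (S\<^sup>T ** p s + p s ** S + p s ** (Delta2 G ** p s)) \<le> - 2 * (\<gamma> - \<delta>) * (norm (p s))\<^sup>2 + 0"
      by (simp add: inner_add_right matrix_mult_algebra algebra_simps)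
  qed (use \<open>0 \<le> t\<close> in \<open>auto intro!: derivative_eq_intros\<close>)
  then show ?thesis by (simp add: mult.commute)
qed

lemma layer22_exists:
  "\<exists>p. p 0 = - Pb22 \<and> (\<forall>\<tau>\<ge>0. (p \<tau>)\<^sup>T = p \<tau>
     \<and> norm (p \<tau>) \<le> norm Pb22 * exp (- (\<gamma> - \<delta>) * \<tau>)
     \<and> (p has_vector_derivative S\<^sup>T ** p \<tau> + p \<tau> ** S + p \<tau> ** (Delta2 G ** p \<tau>)) (at \<tau> within {0..}))"
proof -
  define F where "F p = S\<^sup>T ** p + p ** S + p ** (Delta2 G ** p)" for p
  define K where "K = (sym_cball q2 :: (real^'b^'b) set)"
  have lessq: "norm Pb22 < q2" using interior_sym_cball_norm_less[OF interior] by simp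
  have Keq: "K = cball 0 q2 \<inter> symmetric_matrices" by (auto simp: K_def sym_cball_def)
  have K: "convex K" "closed K" "K \<noteq> {}"
  proof -
    show "convex K" "closed K"
      unfolding Keq by (intro convex_Int convex_cball subspace_imp_convex symmetric_matrices_subspace
          closed_Int closed_cball closed_symmetric_matrices)+
    have "- Pb22 \<in> K" using lessq Pb22_sym by (simp add: Keq symmetric_matrices_def)
    then show "K \<noteq> {}" by blast
  qed
  \<comment> \<open>Nearest-point projection onto the convex set \<open>K\<close> is nonexpansive,
    so \<open>F\<close> after \<open>\<rho>\<close> is globally Lipschitz and has a solution for all
    times; \<open>bound\<close> shows that \<open>\<rho>\<close> never moves this solution.\<close>
  define \<rho> where "\<rho> = closest_point K"
  have \<rho>K: "\<rho> x \<in> K" for x unfolding \<rho>_def by (rule closest_point_in_set[OF K(2,3)])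
  have \<rho>id: "x \<in> K \<Longrightarrow> \<rho> x = x" for x unfolding \<rho>_def by (rule closest_point_self)
  have Kn: "x \<in> K \<Longrightarrow> norm x \<le> q2" "x \<in> K \<Longrightarrow> x\<^sup>T = x" for x by (auto simp: Keq symmetric_matrices_def)
  have "lipschitz_on_balls F" unfolding F_def by (intro lob_intros)
  then obtain L where L: "L \<ge> 0"
    "\<And>x y. norm x \<le> q2 \<Longrightarrow> norm y \<le> q2 \<Longrightarrow> norm (F x - F y) \<le> L * norm (x - y)"
    using lobE[where f = F and R = q2] by blast
  have lip: "norm (F (\<rho> x) - F (\<rho> y)) \<le> L * norm (x - y)" for x y
  proof -
    have "norm (F (\<rho> x) - F (\<rho> y)) \<le> L * norm (\<rho> x - \<rho> y)" by (intro L Kn \<rho>K)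
    also have "norm (\<rho> x - \<rho> y) \<le> norm (x - y)"
      using closest_point_lipschitz[OF K, of x y] by (simp add: \<rho>_def dist_norm)
    finally show ?thesis using L(1) by (simp add: mult_left_mono)
  qed
  obtain p where p0: "p 0 = - Pb22"
    and p: "\<And>t. t \<ge> 0 \<Longrightarrow> (p has_vector_derivative F (\<rho> (p t))) (at t within {0..})"
    using picard_lindeloef_halfline[of "\<lambda>_ x. F (\<rho> x)" L "norm (F (\<rho> 0))" "- Pb22"] lip by auto
  have FT: "(F x)\<^sup>T = F x" if "x\<^sup>T = x" for x
    unfolding F_def using that by (simp add: matrix_transpose_mul matrix_mul_assoc algebra_simps)
  have sym: "(p t)\<^sup>T = p t" if "t \<ge> 0" for t
    by (rule has_vector_derivative_symmetric[OF p _ _ that]) (auto simp: p0 FT Kn \<rho>K)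
  \<comment> \<open>As long as the path has stayed in the ball the projection is inactive and
    \<open>fast_decay\<close> applies; since \<open>norm Pb22 < q2\<close>, this closes the
    bootstrap below.\<close>
  have decay: "norm (p t) \<le> norm Pb22 * exp (- (\<gamma> - \<delta>) * t)"
    if "0 \<le> t" "\<And>s. s \<in> {0..t} \<Longrightarrow> norm (p s) \<le> q2" for t
  proof -
    have "p s \<in> K" if "s \<in> {0..t}" for s
      using that \<open>\<And>s. s \<in> {0..t} \<Longrightarrow> norm (p s) \<le> q2\<close> sym by (auto simp: Keq symmetric_matrices_def)
    then have "(p has_vector_derivative F (p s)) (at s within {0..t})" if "s \<in> {0..t}" for s
      using p[of s] \<rho>id[of "p s"] that by (auto intro: has_vector_derivative_within_subset)
    then have "(norm (p t))\<^sup>2 \<le> (norm (p 0))\<^sup>2 * exp (- 2 * (\<gamma> - \<delta>) * t)"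
      using that sym by (intro fast_decay) (auto simp: F_def)
    also have "\<dots> = (norm Pb22 * exp (- (\<gamma> - \<delta>) * t))\<^sup>2"
      by (simp add: p0 power_mult_distrib exp_double[symmetric])
    finally show ?thesis by (rule power2_le_imp_le) simp
  qed
  have bound: "norm (p t) < q2" if "0 \<le> t" for t
  proof (rule bootstrap_bound[where T = t and \<phi> = "\<lambda>t. norm (p t)"])
    have "continuous_on {0..t} p"
      unfolding continuous_on_eq_continuous_within
      by (metis p has_vector_derivative_continuous continuous_within_subset atLeastAtMost_iff atLeast_iff subsetI)
    then show "continuous_on {0..t} (\<lambda>t. norm (p t))" by (intro continuous_intros)
    show "norm (p 0) < q2" using lessq p0 by simp
    fix s assume s: "s \<in> {0..t}" "\<And>r. r \<in> {0..s} \<Longrightarrow> norm (p r) \<le> q2"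
    then have "norm (p s) \<le> norm Pb22 * exp (- (\<gamma> - \<delta>) * s)" by (intro decay) auto
    also have "\<dots> \<le> norm Pb22 * 1" using s delta by (intro mult_left_mono) (auto intro: mult_nonpos_nonneg)
    finally show "norm (p s) < q2" using lessq by simp
  qed (use that in auto)
  have pK: "p t \<in> K" if "0 \<le> t" for t
    using bound[OF that] sym[OF that] by (auto simp: Keq symmetric_matrices_def)
  have "(p has_vector_derivative F (p t)) (at t within {0..})" if "0 \<le> t" for t
    using p[OF that] \<rho>id[OF pK[OF that]] by simp
  moreover have "norm (p t) \<le> norm Pb22 * exp (- (\<gamma> - \<delta>) * t)" if "0 \<le> t" for t
    using bound that by (intro decay) (auto intro: less_imp_le)
  ultimately show ?thesis using p0 sym unfolding F_def by blast
qed

lemma stable_right: "inner E (E ** S) \<le> - \<gamma> * (norm E)\<^sup>2" for E :: "real^'b^'z"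
  using inner_dissipative_right stable by (metis loewner_le_uminus_mat)

lemma stable_left: "inner E (S\<^sup>T ** E) \<le> - \<gamma> * (norm E)\<^sup>2" for E :: "real^'z^'b"
  using inner_dissipative_left stable by (metis loewner_le_uminus_mat)

lemma inner_mult_le: "inner E (E ** X) \<le> norm X * (norm E)\<^sup>2" for E :: "real^'y^'z" and X :: "real^'y^'y"
proof -
  have "inner E (E ** X) \<le> norm E * (norm E * norm X)"
    by (meson norm_cauchy_schwarz norm_matrix_mult mult_left_mono norm_ge_zero order_trans)
  then show ?thesis by (simp add: power2_eq_square mult_ac)
qed

text \<open>With \<open>p\<close> known, the equation for \<open>y\<close> is linear with bounded
  coefficients, hence solvable for all times. Its decay comes from the damping by \<open>S\<close>,
  while the coupling to \<open>p\<close> is integrable in time.\<close>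

theorem boundary_layer_exists:
  obtains y p c k where "boundary_layer_solution G Pb22 y p" "0 < k" "0 \<le> c"
    "\<And>\<tau>. 0 \<le> \<tau> \<Longrightarrow> (p \<tau>)\<^sup>T = p \<tau>"
    "\<And>\<tau>. 0 \<le> \<tau> \<Longrightarrow> norm (p \<tau>) \<le> c * exp (- k * \<tau>)"
    "\<And>\<tau>. 0 \<le> \<tau> \<Longrightarrow> norm (y \<tau>) \<le> c * exp (- k * \<tau>)"
proof -
  define \<kappa> where "\<kappa> = \<gamma> - \<delta>"
  have \<kappa>: "0 < \<kappa>" "\<kappa> < \<gamma>" using delta by (auto simp: \<kappa>_def)
  obtain p where p0: "p 0 = - Pb22" and psym: "\<And>\<tau>. 0 \<le> \<tau> \<Longrightarrow> (p \<tau>)\<^sup>T = p \<tau>"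
    and pdecay: "\<And>\<tau>. 0 \<le> \<tau> \<Longrightarrow> norm (p \<tau>) \<le> norm Pb22 * exp (- \<kappa> * \<tau>)"
    and pder: "\<And>\<tau>. 0 \<le> \<tau> \<Longrightarrow> (p has_vector_derivative S\<^sup>T ** p \<tau> + p \<tau> ** S + p \<tau> ** (Delta2 G ** p \<tau>)) (at \<tau> within {0..})"
    using layer22_exists unfolding \<kappa>_def by blast
  have pcont: "continuous_on {0..} p"
    unfolding continuous_on_eq_continuous_within using pder has_vector_derivative_continuous by (metis atLeast_iff)
  have pb: "norm (p \<tau>) \<le> norm Pb22" if "0 \<le> \<tau>" for \<tau>
    using pdecay[OF that] mult_left_mono[of "exp (- \<kappa> * \<tau>)" 1 "norm Pb22"] that \<kappa>(1) by fastforce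
  define Z where "Z = (A21 G)\<^sup>T + h 0 ** Delta2 G"
  define F where "F \<tau> x = x ** (S + Delta2 G ** p \<tau>) + Z ** p \<tau>" for \<tau> x
  define L where "L = norm S + norm (Delta2 G) * norm Pb22"
  obtain y where y0: "y 0 = - h 0" and yder: "\<And>t. t \<ge> 0 \<Longrightarrow> (y has_vector_derivative F t (y t)) (at t within {0..})"
  proof -
    have "\<exists>x. x 0 = - h 0 \<and> (\<forall>t\<ge>0. (x has_vector_derivative F t (x t)) (at t within {0..}))"
    proof (rule picard_lindeloef_halfline[where L = L and c = "norm Z * norm Pb22"])
      fix t :: real and x x' assume t: "0 \<le> t"
      have "F t x - F t x' = (x - x') ** (S + Delta2 G ** p t)"
        by (simp add: F_def matrix_mult_algebra algebra_simps)
      then have "norm (F t x - F t x') \<le> norm (x - x') * norm (S + Delta2 G ** p t)"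
        using norm_matrix_mult by metis
      also have "\<dots> \<le> norm (x - x') * L"
        unfolding L_def using norm_triangle_ineq[of S "Delta2 G ** p t"] norm_matrix_mult[of "Delta2 G" "p t"]
          mult_left_mono[OF pb[OF t], of "norm (Delta2 G)"] by (intro mult_left_mono) auto
      finally show "norm (F t x - F t x') \<le> L * norm (x - x')"
        by (simp add: mult.commute)
      show "norm (F t 0) \<le> norm Z * norm Pb22"
        using norm_matrix_mult[of Z "p t"] mult_left_mono[OF pb[OF t], of "norm Z"]
        by (simp add: F_def matrix_mult_algebra)
    next
      fix x show "continuous_on {0..} (\<lambda>t. F t x)"
        unfolding F_def by (intro continuous_intros pcont)
    qed
    then show thesis using that by blast
  qed
  have sol: "boundary_layer_solution G Pb22 y p"
    unfolding boundary_layer_solution_def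
    using y0 p0 yder pder psym by (auto simp: riccati_g1_layer riccati_g2_layer F_def Z_def)
  define d where "d = 2 * norm (Delta2 G) * norm Pb22"
  define C where "C = norm Z * norm Pb22"
  \<comment> \<open>Of the damping \<open>2 \<gamma>\<close> of \<open>(norm (y t))\<^sup>2\<close>
    one half pays for the weight, since \<open>\<kappa> < \<gamma>\<close>, and the other for the
    source by Young's inequality. So the square decays at the rate \<open>\<kappa>\<close>, and
    \<open>y\<close> itself at \<open>\<kappa> / 2\<close>.\<close>
  define w where "w t = exp (\<kappa> * t) * (norm (y t))\<^sup>2" for t
  have wbound: "w t \<le> exp (0 * t + d / \<kappa>) * (w 0 + 0 * t + (C\<^sup>2 / \<gamma>) / \<kappa>)" if "0 \<le> t" for t
  \<comment> \<open>The layer is followed in its own time, hence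
    \<open>\<epsilon> = 1\<close>.\<close>
  proof (rule gronwall_layer[where \<epsilon> = 1 and T = t])
    fix s assume s: "s \<in> {0..t}"
    define n where "n = norm (y s)"
    have yd: "(y has_vector_derivative F s (y s)) (at s within {0..t})"
      using yder[of s] s by (auto intro: has_vector_derivative_within_subset)
    have e': "((\<lambda>s. exp (\<kappa> * s)) has_real_derivative \<kappa> * exp (\<kappa> * s)) (at s within {0..t})"
      by (auto intro!: derivative_eq_intros)
    show "(w has_real_derivative \<kappa> * exp (\<kappa> * s) * n\<^sup>2 + exp (\<kappa> * s) * (2 * inner (y s) (F s (y s)))) (at s within {0..t})"
      unfolding w_def n_def
      by (rule DERIV_cong[OF DERIV_mult'[OF e' has_vector_derivative_norm_square[OF yd]]]) (simp add: algebra_simps)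
    define e where "e = exp (- \<kappa> * s)"
    have e: "0 < e" "exp (\<kappa> * s) * e = 1" by (auto simp: e_def exp_add[symmetric])
    have 1: "inner (y s) (y s ** S) \<le> - \<gamma> * n\<^sup>2" unfolding n_def by (rule stable_right)
    have "inner (y s) (y s ** (Delta2 G ** p s)) \<le> norm (Delta2 G ** p s) * n\<^sup>2"
      unfolding n_def by (rule inner_mult_le)
    also have "norm (Delta2 G ** p s) \<le> norm (Delta2 G) * (norm Pb22 * e)"
      using norm_matrix_mult[of "Delta2 G" "p s"] mult_left_mono[OF pdecay[of s], of "norm (Delta2 G)"] s
      by (simp add: e_def)
    finally have 2: "2 * inner (y s) (y s ** (Delta2 G ** p s)) \<le> d * e * n\<^sup>2"
      by (simp add: d_def mult_right_mono)
    have "inner (y s) (Z ** p s) \<le> n * norm (Z ** p s)" unfolding n_def by (rule norm_cauchy_schwarz)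
    also have "norm (Z ** p s) \<le> norm Z * (norm Pb22 * e)"
      using norm_matrix_mult[of Z "p s"] mult_left_mono[OF pdecay[of s], of "norm Z"] s
      by (simp add: e_def)
    finally have 3: "inner (y s) (Z ** p s) \<le> n * (C * e)"
      by (simp add: C_def n_def mult_left_mono)
    have "0 \<le> (\<gamma> * n - C * e)\<^sup>2 / \<gamma>" using gamma by simp
    also have "\<dots> = \<gamma> * n\<^sup>2 - 2 * n * (C * e) + C\<^sup>2 / \<gamma> * e\<^sup>2"
      using gamma by (simp add: power2_eq_square field_simps)
    finally have 4: "2 * (n * (C * e)) \<le> \<gamma> * n\<^sup>2 + C\<^sup>2 / \<gamma> * e\<^sup>2" by simp
    have "\<kappa> * n\<^sup>2 \<le> \<gamma> * n\<^sup>2" using \<kappa> by (intro mult_right_mono) auto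
    with 1 2 3 4 have "\<kappa> * n\<^sup>2 + 2 * inner (y s) (F s (y s)) \<le> d * e * n\<^sup>2 + C\<^sup>2 / \<gamma> * e\<^sup>2"
      by (simp add: F_def matrix_mult_algebra inner_add_right)
    then have "exp (\<kappa> * s) * (\<kappa> * n\<^sup>2 + 2 * inner (y s) (F s (y s))) \<le> exp (\<kappa> * s) * (d * e * n\<^sup>2 + C\<^sup>2 / \<gamma> * e\<^sup>2)"
      by (intro mult_left_mono) auto
    also have "\<dots> = d * e * w s + C\<^sup>2 / \<gamma> * e * (exp (\<kappa> * s) * e)"
      by (simp add: w_def n_def power2_eq_square algebra_simps)
    finally show "\<kappa> * exp (\<kappa> * s) * n\<^sup>2 + exp (\<kappa> * s) * (2 * inner (y s) (F s (y s)))
        \<le> (0 + d / 1 * exp (- \<kappa> * s / 1)) * w s + (0 + (C\<^sup>2 / \<gamma>) / 1 * exp (- \<kappa> * s / 1))"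
      unfolding e(2) by (simp add: e_def algebra_simps)
  qed (use that \<kappa> gamma in \<open>auto simp: d_def w_def\<close>)
  define W where "W = exp (d / \<kappa>) * (w 0 + (C\<^sup>2 / \<gamma>) / \<kappa>)"
  have W0: "0 \<le> W" unfolding W_def using \<kappa> gamma by (auto simp: w_def)
  have ydecay: "norm (y t) \<le> sqrt W * exp (- (\<kappa>/2) * t)" if "0 \<le> t" for t
  proof -
    have "exp (- \<kappa> * t) * w t \<le> exp (- \<kappa> * t) * W"
      using wbound[OF that] by (intro mult_left_mono) (auto simp: W_def)
    then have "(norm (y t))\<^sup>2 \<le> W * exp (- \<kappa> * t)"
      by (simp add: w_def mult.assoc[symmetric] exp_add[symmetric] mult.commute)
    also have "\<dots> = (sqrt W * exp (- (\<kappa>/2) * t))\<^sup>2"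
      using W0 by (simp add: power_mult_distrib exp_double[symmetric])
    finally show ?thesis by (rule power2_le_imp_le) (use W0 in simp)
  qed
  have pdecay': "norm (p t) \<le> norm Pb22 * exp (- (\<kappa>/2) * t)" if "0 \<le> t" for t
  proof -
    have "norm Pb22 * exp (- \<kappa> * t) \<le> norm Pb22 * exp (- (\<kappa>/2) * t)"
      using \<kappa> that by (intro mult_left_mono) auto
    then show ?thesis using pdecay[OF that] by simp
  qed
  show thesis
  proof (rule that[OF sol, where k = "\<kappa>/2" and c = "sqrt W + norm Pb22"])
    show "0 < \<kappa>/2" "0 \<le> sqrt W + norm Pb22" using \<kappa> W0 by auto
    show "(p t)\<^sup>T = p t" if "0 \<le> t" for t using psym that .
    show "norm (p t) \<le> (sqrt W + norm Pb22) * exp (- (\<kappa>/2) * t)" if "0 \<le> t" for t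
      using pdecay'[OF that] W0 by (simp add: distrib_right add_increasing)
    show "norm (y t) \<le> (sqrt W + norm Pb22) * exp (- (\<kappa>/2) * t)" if "0 \<le> t" for t
      using ydecay[OF that] by (simp add: distrib_right add_increasing2)
  qed
qed

end

section \<open>Singular perturbation of the Riccati system\<close>

text \<open>\<open>v\<close> and \<open>w\<close> stand for the squared slow and fast errors.
  \<open>w\<close> enters \<open>v'\<close> undamped, but adding a multiple of order
  \<open>\<epsilon>\<close> of \<open>w\<close> to \<open>v\<close> turns the damping
  \<open>\<gamma> / \<epsilon>\<close> into one of order one, which pays for it. The constant is
  built with \<open>T'\<close> so that it is the same for all intervals inside the horizon.\<close>

lemma two_scale_estimate:
  fixes v w :: "real \<Rightarrow> real"
  assumes v: "\<And>t. t \<in> {0..T} \<Longrightarrow> (v has_real_derivative v' t) (at t within {0..T})"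
    and w: "\<And>t. t \<in> {0..T} \<Longrightarrow> (w has_real_derivative w' t) (at t within {0..T})"
    and v_le: "\<And>t. t \<in> {0..T} \<Longrightarrow> v' t \<le> C * (v t + w t + exp (- k * t / \<epsilon>) * v t / \<epsilon> + \<epsilon> * exp (- k * t / \<epsilon>))"
    and w_le: "\<And>t. t \<in> {0..T} \<Longrightarrow> w' t \<le> (1/\<epsilon>) * ((- \<gamma> + d * exp (- k * t / \<epsilon>)) * w t + D * (v t + \<epsilon>\<^sup>2))"
    and nonneg: "\<And>t. t \<in> {0..T} \<Longrightarrow> 0 \<le> v t" "\<And>t. t \<in> {0..T} \<Longrightarrow> 0 \<le> w t"
    and zero: "v 0 = 0" "w 0 = 0"
    and pos: "0 < \<epsilon>" "0 < \<gamma>" "0 < k" "0 \<le> C" "0 \<le> d" "0 \<le> D"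
    and t: "t \<in> {0..T}" and T': "T \<le> T'"
  defines "K \<equiv> C / (\<gamma> * exp (- d / k))"
  defines "A \<equiv> exp ((C + K * D) * T' + C / k) * (K * D * T' + C / k)"
  shows "v t \<le> A * \<epsilon>\<^sup>2 \<and> w t \<le> exp (d / k) * (D * (A + 1) / \<gamma>) * \<epsilon>\<^sup>2"
proof -
  have K0: "0 \<le> K" unfolding K_def using pos by simp
  have T0: "0 \<le> T" using t by auto
  define e where "e s = exp (- k * s / \<epsilon>)" for s
  \<comment> \<open>Integrating factor for the growth
    \<open>d exp (- k s / \<epsilon>) / \<epsilon>\<close> in the fast inequality; it stays between
    \<open>exp (- d / k)\<close> and one.\<close>
  define \<beta> where "\<beta> s = exp (- (d / k) * (1 - e s))" for s
  have e': "(e has_real_derivative - (k / \<epsilon>) * e s) (at s within {0..T})" for s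
    unfolding e_def using pos by (auto intro!: derivative_eq_intros)
  have \<beta>': "(\<beta> has_real_derivative - (d / \<epsilon>) * e s * \<beta> s) (at s within {0..T})" for s
    unfolding \<beta>_def using pos by (auto intro!: derivative_eq_intros e')
  have e01: "0 < e s" "e s \<le> 1" if "s \<in> {0..T}" for s using that pos by (auto simp: e_def)
  have \<beta>b: "exp (- d / k) \<le> \<beta> s" "\<beta> s \<le> 1" "0 < \<beta> s" if "s \<in> {0..T}" for s
  proof -
    have "(d/k) * (1 - e s) \<le> (d/k) * 1"
      using e01[OF that] pos by (intro mult_left_mono) auto
    moreover have "0 \<le> (d/k) * (1 - e s)"
      using e01[OF that] pos by (intro mult_nonneg_nonneg) auto
    ultimately show "exp (- d / k) \<le> \<beta> s" "\<beta> s \<le> 1" by (auto simp: \<beta>_def)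
    show "0 < \<beta> s" by (simp add: \<beta>_def)
  qed
  \<comment> \<open>\<open>K\<close> satisfies \<open>K \<gamma> exp (- d / k) = C\<close>, so the
    damping of the second term absorbs \<open>C w\<close>.\<close>
  define u where "u s = v s + K * \<epsilon> * (\<beta> s * w s)" for s
  have vA: "v t \<le> A * \<epsilon>\<^sup>2" if t: "t \<in> {0..T}" for t
  proof -
    have "u t \<le> exp ((C + K * D) * T + C / k) * (u 0 + (K * D * \<epsilon>\<^sup>2) * T + (C * \<epsilon>\<^sup>2) / k)"
    proof (rule gronwall_layer[where \<epsilon> = \<epsilon>])
      fix s assume s: "s \<in> {0..T}"
      show "(u has_real_derivative v' s + K * \<epsilon> * (\<beta> s * w' s + - (d / \<epsilon>) * e s * \<beta> s * w s)) (at s within {0..T})"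
        unfolding u_def by (auto intro!: derivative_eq_intros v w s \<beta>')
      have "\<beta> s * w' s \<le> \<beta> s * ((1/\<epsilon>) * ((- \<gamma> + d * e s) * w s + D * (v s + \<epsilon>\<^sup>2)))"
        using w_le[OF s] \<beta>b[OF s] by (intro mult_left_mono) (auto simp: e_def)
      then have "\<epsilon> * (\<beta> s * w' s + - (d / \<epsilon>) * e s * \<beta> s * w s)
          \<le> \<epsilon> * (\<beta> s * ((1/\<epsilon>) * ((- \<gamma> + d * e s) * w s + D * (v s + \<epsilon>\<^sup>2))) + - (d / \<epsilon>) * e s * \<beta> s * w s)"
        using pos by (intro mult_left_mono) auto
      also have "\<dots> = - \<gamma> * \<beta> s * w s + \<beta> s * (D * (v s + \<epsilon>\<^sup>2))"
        using pos by (simp add: field_simps)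
      also have "\<beta> s * (D * (v s + \<epsilon>\<^sup>2)) \<le> 1 * (D * (v s + \<epsilon>\<^sup>2))"
        using \<beta>b[OF s] nonneg[OF s] pos by (intro mult_right_mono) auto
      finally have "K * (\<epsilon> * (\<beta> s * w' s + - (d / \<epsilon>) * e s * \<beta> s * w s))
          \<le> K * (- \<gamma> * \<beta> s * w s + D * (v s + \<epsilon>\<^sup>2))"
        using K0 by (intro mult_left_mono) auto
      moreover have "C * w s \<le> K * (\<gamma> * \<beta> s * w s)"
      proof -
        have "C * w s = K * (\<gamma> * exp (- d / k) * w s)" using pos by (simp add: K_def)
        also have "\<dots> \<le> K * (\<gamma> * \<beta> s * w s)"
          using K0 pos \<beta>b[OF s] nonneg[OF s] by (intro mult_left_mono mult_right_mono) auto
        finally show ?thesis .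
      qed
      moreover have "v' s \<le> C * (v s + w s + e s * v s / \<epsilon> + \<epsilon> * e s)"
        using v_le[OF s] by (simp only: e_def)
      moreover define Y where "Y = \<beta> s * w' s + - (d / \<epsilon>) * e s * \<beta> s * w s"
      ultimately have "v' s + K * (\<epsilon> * Y)
         \<le> K * (- \<gamma> * \<beta> s * w s + D * (v s + \<epsilon>\<^sup>2)) + K * (\<gamma> * \<beta> s * w s)
           + C * v s + C * (e s * v s / \<epsilon>) + C * (\<epsilon> * e s)"
        by (simp add: distrib_left)
      then have "v' s + K * \<epsilon> * (\<beta> s * w' s + - (d / \<epsilon>) * e s * \<beta> s * w s)
         \<le> (C + K * D + C / \<epsilon> * e s) * v s + (K * D * \<epsilon>\<^sup>2 + C * \<epsilon> * e s)"
        unfolding Y_def[symmetric] by (simp add: algebra_simps)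
      also have "\<dots> \<le> (C + K * D + C / \<epsilon> * e s) * u s + (K * D * \<epsilon>\<^sup>2 + C * \<epsilon> * e s)"
      proof -
        have "v s \<le> u s" unfolding u_def using K0 pos \<beta>b[OF s] nonneg[OF s] by simp
        moreover have "0 \<le> C + K * D + C / \<epsilon> * e s" using K0 pos e01[OF s] by simp
        ultimately show ?thesis by (simp add: mult_left_mono)
      qed
      \<comment> \<open>Read as a layer source of weight \<open>C \<epsilon>\<^sup>2\<close>, this
        contributes only order \<open>\<epsilon>\<^sup>2\<close> to the squared error.\<close>
      also have "C * \<epsilon> * e s = (C * \<epsilon>\<^sup>2) / \<epsilon> * e s" using pos by (simp add: power2_eq_square)
      finally show "v' s + K * \<epsilon> * (\<beta> s * w' s + - (d / \<epsilon>) * e s * \<beta> s * w s)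
         \<le> (C + K * D + C / \<epsilon> * exp (- k * s / \<epsilon>)) * u s + (K * D * \<epsilon>\<^sup>2 + (C * \<epsilon>\<^sup>2) / \<epsilon> * exp (- k * s / \<epsilon>))"
        by (simp add: e_def)
    qed (use t pos K0 zero in \<open>auto simp: u_def\<close>)
    also have "\<dots> = exp ((C + K * D) * T + C / k) * (K * D * T + C / k) * \<epsilon>\<^sup>2"
      using zero by (simp add: u_def algebra_simps)
    also have "\<dots> \<le> A * \<epsilon>\<^sup>2"
      unfolding A_def using pos K0 T' T0
      by (intro mult_right_mono mult_mono) (auto intro!: mult_left_mono)
    finally have "u t \<le> A * \<epsilon>\<^sup>2" .
    moreover have "v t \<le> u t" unfolding u_def using K0 pos \<beta>b[OF t] nonneg[OF t] by simp
    ultimately show ?thesis by simp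
  qed
  have vt: "v t \<le> A * \<epsilon>\<^sup>2" using vA t .
  have A0: "0 \<le> A" unfolding A_def using K0 pos T' T0 by simp
  have "w t \<le> exp (d / k) * (w 0 + (D * (A + 1) * \<epsilon>\<^sup>2) / \<gamma>)"
  proof (rule gronwall_fast_stable[OF w _ _ _ _ _ _ _ t])
    fix s assume s: "s \<in> {0..T}"
    have "D * (v s + \<epsilon>\<^sup>2) \<le> D * (A * \<epsilon>\<^sup>2 + \<epsilon>\<^sup>2)" using vA[OF s] pos by (intro mult_left_mono) auto
    also have "\<dots> = D * (A + 1) * \<epsilon>\<^sup>2" by (simp add: algebra_simps)
    finally have "(1/\<epsilon>) * ((- \<gamma> + d * exp (- k * s / \<epsilon>)) * w s + D * (v s + \<epsilon>\<^sup>2))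
       \<le> (1/\<epsilon>) * ((- \<gamma> + d * exp (- k * s / \<epsilon>)) * w s + D * (A + 1) * \<epsilon>\<^sup>2)"
      using pos by (intro mult_left_mono) auto
    then show "w' s \<le> (1/\<epsilon>) * ((- \<gamma> + d * exp (- k * s / \<epsilon>)) * w s + D * (A + 1) * \<epsilon>\<^sup>2)"
      using w_le[OF s] by linarith
  qed (use pos A0 zero in auto)
  then have "w t \<le> exp (d / k) * (D * (A + 1) / \<gamma>) * \<epsilon>\<^sup>2" using zero by simp
  with vt show ?thesis ..
qed

text \<open>From \<open>x \<le> exp x\<close>. A factor that vanishes linearly where the layer
  starts thus gains one order of \<open>\<epsilon>\<close>.\<close>

lemma exp_layer_linear:
  fixes k s \<epsilon> :: real
  assumes "0 < k" "0 < \<epsilon>" shows "s * exp (- k * s / \<epsilon>) \<le> \<epsilon> / k"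
proof -
  have "k * s / \<epsilon> \<le> exp (k * s / \<epsilon>)" using exp_ge_add_one_self[of "k * s / \<epsilon>"] by linarith
  then have "k * s / \<epsilon> * exp (- (k * s / \<epsilon>)) \<le> exp (k * s / \<epsilon>) * exp (- (k * s / \<epsilon>))"
    by (intro mult_right_mono) auto
  then show ?thesis using assms by (simp add: exp_add[symmetric] field_simps)
qed

lemma norm_triple_ge:
  "norm x \<le> norm (x, y, z)" "norm y \<le> norm (x, y, z)" "norm z \<le> norm (x, y, z)"
  using norm_fst_le[of x "(y, z)"] order_trans[OF norm_fst_le[of y z] norm_snd_le[of "(y, z)" x]]
    order_trans[OF norm_snd_le[of z y] norm_snd_le[of "(y, z)" x]] by auto

lemma young: fixes a b g :: real assumes "0 < g" shows "2 * (a * b) \<le> g * a\<^sup>2 + b\<^sup>2 / g"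
proof -
  have "0 \<le> (g * a - b)\<^sup>2 / g" using assms by simp
  also have "\<dots> = g * a\<^sup>2 - 2 * (a * b) + b\<^sup>2 / g"
    using assms by (simp add: power2_eq_square field_simps)
  finally show ?thesis by simp
qed

locale tikhonov_data = layer_data +
  fixes T :: real and Pb11 and y p and c k :: real
  assumes T: "0 < T"
    and reduced: "reduced_solution G T Pb11"
    and layer: "boundary_layer_solution G Pb22 y p"
    and k: "0 < k" and c: "0 \<le> c"
    and p_sym: "\<And>\<tau>. 0 \<le> \<tau> \<Longrightarrow> (p \<tau>)\<^sup>T = p \<tau>"
    and p_decay: "\<And>\<tau>. 0 \<le> \<tau> \<Longrightarrow> norm (p \<tau>) \<le> c * exp (- k * \<tau>)"
    and y_decay: "\<And>\<tau>. 0 \<le> \<tau> \<Longrightarrow> norm (y \<tau>) \<le> c * exp (- k * \<tau>)"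
begin

definition "a s = Pb11 (T - s)"

lemma a_sym: "s \<in> {0..T} \<Longrightarrow> (a s)\<^sup>T = a s"
  using reduced by (auto simp: reduced_solution_def a_def symmetric_matrices_def)

lemma a_0: "a 0 = 0" using reduced by (simp add: reduced_solution_def a_def)

lemma a_deriv: "s \<in> {0..T} \<Longrightarrow> (a has_vector_derivative riccati_f G (a s) (h (a s)) 0 0) (at s within {0..T})"
proof -
  assume s: "s \<in> {0..T}"
  then have "T - s \<in> {0..T}" by auto
  then obtain D where D: "(Pb11 has_vector_derivative D) (at (T - s) within {0..T})"
    "D + (reduced_A G)\<^sup>T ** a s + a s ** reduced_A G + a s ** reduced_M G ** a s + reduced_N G = 0"
    using reduced unfolding reduced_solution_def a_def by blast
  then have "- D = riccati_f G (a s) (h (a s)) 0 0"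
    unfolding riccati_f_on_slow_manifold[OF a_sym[OF s]]
    by (simp add: add_eq_0_iff algebra_simps)
  then show ?thesis using has_vector_derivative_reverse[OF D(1)] by (simp add: a_def[abs_def])
qed

definition "Lh = norm ((A12 G + Delta G ** Pb22) ** matrix_inv S)"

lemma Lh_nonneg: "0 \<le> Lh" by (simp add: Lh_def)

lemma h_lipschitz: "norm (h X - h Y) \<le> Lh * norm (X - Y)"
  unfolding h_diff Lh_def using norm_matrix_mult by (metis norm_minus_cancel mult.commute)

text \<open>The linear bound comes from \<open>a 0 = 0\<close>; paired with the decay of the layer
  it yields order \<open>\<epsilon>\<close>.\<close>

lemma a_bounds:
  obtains Ra Da where "0 \<le> Ra" "0 \<le> Da"
    "\<And>s. s \<in> {0..T} \<Longrightarrow> norm (a s) \<le> Ra" "\<And>s. s \<in> {0..T} \<Longrightarrow> norm (a s) \<le> Da * s"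
    "\<And>s. s \<in> {0..T} \<Longrightarrow> norm (riccati_f G (a s) (h (a s)) 0 0) \<le> Da"
proof -
  have ac: "continuous_on {0..T} a"
    unfolding continuous_on_eq_continuous_within using a_deriv has_vector_derivative_continuous by blast
  obtain Ra where Ra: "\<And>s. s \<in> {0..T} \<Longrightarrow> norm (a s) \<le> Ra"
    using compact_imp_bounded[OF compact_continuous_image[OF ac compact_Icc]]
    by (metis bounded_iff image_eqI)
  have "continuous_on {0..T} (\<lambda>s. riccati_f G (a s) (h (a s)) 0 0)"
    unfolding riccati_f_def h_eq by (intro continuous_intros ac)
  then obtain Da where Da: "\<And>s. s \<in> {0..T} \<Longrightarrow> norm (riccati_f G (a s) (h (a s)) 0 0) \<le> Da"
    using compact_imp_bounded[OF compact_continuous_image[OF _ compact_Icc]]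
    by (metis (no_types, lifting) bounded_iff image_eqI)
  have Da0: "0 \<le> Da" using order_trans[OF norm_ge_zero Da[of 0]] T by simp
  have "norm (a s - a 0) \<le> Da * norm (s - 0)" if s: "s \<in> {0..T}" for s
  proof (rule differentiable_bound[where S = "{0..T}"])
    fix r assume r: "r \<in> {0..T}"
    show "(a has_derivative (\<lambda>x. x *\<^sub>R riccati_f G (a r) (h (a r)) 0 0)) (at r within {0..T})"
      using a_deriv[OF r] by (simp add: has_vector_derivative_def)
    show "onorm (\<lambda>x. x *\<^sub>R riccati_f G (a r) (h (a r)) 0 0) \<le> Da"
      using mult_left_mono[OF Da[OF r] abs_ge_zero] by (intro onorm_bound Da0) (simp add: mult.commute)
  qed (use s T in auto)
  then show thesis
    using Ra Da Da0 a_0 Ra[of 0] T by (intro that[of Ra Da]) auto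
qed

text \<open>Deviation from outer solution plus layer. For zero initial data it vanishes at
  \<open>0\<close>, since the layer starts at minus the outer solution.\<close>

definition err :: "real \<Rightarrow> (real \<Rightarrow> real^'a^'a) \<Rightarrow> (real \<Rightarrow> real^'b^'a) \<Rightarrow> (real \<Rightarrow> real^'b^'b) \<Rightarrow> real \<Rightarrow> (real^'a^'a) \<times> (real^'b^'a) \<times> (real^'b^'b)"
  where "err \<epsilon> X1 X2 X3 s = (X1 s - a s, X2 s - (h (a s) + y (s / \<epsilon>)), X3 s - (Pb22 + p (s / \<epsilon>)))"

text \<open>Formulated on an initial segment, because during the bootstrap the projected path is
  known to solve the true system only as far as the error has stayed small.\<close>

definition "solves \<epsilon> t X1 X2 X3 \<longleftrightarrow> X1 0 = 0 \<and> X2 0 = 0 \<and> X3 0 = 0 \<and> (\<forall>s\<in>{0..t}.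
    (X1 has_vector_derivative riccati_f G (X1 s) (X2 s) (X3 s) \<epsilon>) (at s within {0..t})
  \<and> (X2 has_vector_derivative (1/\<epsilon>) *\<^sub>R riccati_g1 G (X1 s) (X2 s) (X3 s) \<epsilon>) (at s within {0..t})
  \<and> (X3 has_vector_derivative (1/\<epsilon>) *\<^sub>R riccati_g2 G (X1 s) (X2 s) (X3 s) \<epsilon>) (at s within {0..t})
  \<and> (X3 s)\<^sup>T = X3 s)"

lemma layer_bound: "norm (p \<tau>) \<le> c" "norm (y \<tau>) \<le> c" if "0 \<le> \<tau>"
proof -
  have "c * exp (- k * \<tau>) \<le> c * 1" using c k that by (intro mult_left_mono) auto
  then show "norm (p \<tau>) \<le> c" "norm (y \<tau>) \<le> c" using p_decay[OF that] y_decay[OF that] by auto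
qed

lemma layer_decay:
  assumes "0 < \<epsilon>" "0 \<le> s"
  shows "norm (p (s/\<epsilon>)) \<le> c * exp (- k * s / \<epsilon>)" "norm (y (s/\<epsilon>)) \<le> c * exp (- k * s / \<epsilon>)"
  using p_decay[of "s/\<epsilon>"] y_decay[of "s/\<epsilon>"] assms by (auto simp: field_simps)

lemma layer_deriv:
  assumes "0 < \<epsilon>" "s \<in> {0..t}"
  shows "((\<lambda>s. y (s/\<epsilon>)) has_vector_derivative (1/\<epsilon>) *\<^sub>R riccati_g1 G 0 (y (s/\<epsilon>) + h 0) (p (s/\<epsilon>) + Pb22) 0) (at s within {0..t})"
    "((\<lambda>s. p (s/\<epsilon>)) has_vector_derivative (1/\<epsilon>) *\<^sub>R riccati_g2 G 0 (y (s/\<epsilon>) + h 0) (p (s/\<epsilon>) + Pb22) 0) (at s within {0..t})"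
proof -
  have d: "((\<lambda>s. s/\<epsilon>) has_vector_derivative (1/\<epsilon>)) (at s within {0..t})"
    by (auto intro!: derivative_eq_intros)
  have im: "(\<lambda>s. s/\<epsilon>) ` {0..t} \<subseteq> {0..}" using assms by auto
  have "(y has_vector_derivative riccati_g1 G 0 (y (s/\<epsilon>) + h 0) (p (s/\<epsilon>) + Pb22) 0) (at (s/\<epsilon>) within (\<lambda>s. s/\<epsilon>) ` {0..t})"
    "(p has_vector_derivative riccati_g2 G 0 (y (s/\<epsilon>) + h 0) (p (s/\<epsilon>) + Pb22) 0) (at (s/\<epsilon>) within (\<lambda>s. s/\<epsilon>) ` {0..t})"
    using layer assms unfolding boundary_layer_solution_def
    by (intro has_vector_derivative_within_subset[OF _ im]; simp)+
  from vector_diff_chain_within[OF d this(1)] vector_diff_chain_within[OF d this(2)]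
  show "((\<lambda>s. y (s/\<epsilon>)) has_vector_derivative (1/\<epsilon>) *\<^sub>R riccati_g1 G 0 (y (s/\<epsilon>) + h 0) (p (s/\<epsilon>) + Pb22) 0) (at s within {0..t})"
    "((\<lambda>s. p (s/\<epsilon>)) has_vector_derivative (1/\<epsilon>) *\<^sub>R riccati_g2 G 0 (y (s/\<epsilon>) + h 0) (p (s/\<epsilon>) + Pb22) 0) (at s within {0..t})"
    by (simp_all add: o_def)
qed

text \<open>The error of the fast diagonal block closes on its own: the off-diagonal block enters
  its equation only with a factor \<open>\<epsilon>\<close>, so the crude bound
  \<open>\<eta>\<close> on it suffices, and the slow block does not enter at all. The smallness of
  \<open>\<eta>\<close> keeps the quadratic term below the damping.\<close>

lemma fast22_estimate:
  assumes \<eta>: "0 < \<eta>" "norm (Delta2 G) * \<eta> \<le> \<gamma> / 4"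
  shows "\<exists>C\<ge>0. \<forall>\<epsilon> t X1 X2 X3. 0 < \<epsilon> \<and> \<epsilon> \<le> 1 \<and> t \<in> {0..T} \<and> solves \<epsilon> t X1 X2 X3
     \<and> (\<forall>s\<in>{0..t}. norm (err \<epsilon> X1 X2 X3 s) \<le> \<eta>)
     \<longrightarrow> (\<forall>s\<in>{0..t}. (norm (X3 s - (Pb22 + p (s / \<epsilon>))))\<^sup>2 \<le> C * \<epsilon>\<^sup>2)"
proof -
  obtain Ra Da where Ra: "0 \<le> Ra" "\<And>s. s \<in> {0..T} \<Longrightarrow> norm (a s) \<le> Ra"
    using a_bounds by metis
  \<comment> \<open>Bounds the arguments of \<open>r2\<close>, the triple
    \<open>(X2, X3, \<epsilon>)\<close> near the composite approximation; the final \<open>1\<close>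
    is the bound of \<open>\<epsilon>\<close>.\<close>
  define R where "R = (norm (h 0) + Lh * Ra + c + \<eta>) + (norm Pb22 + c + \<eta>) + 1"
  define r2 where "r2 = (\<lambda>(Y, W, \<epsilon>). (A12 G)\<^sup>T ** Y + Y\<^sup>T ** A12 G + \<epsilon> *\<^sub>R (Y\<^sup>T ** (Delta1 G ** Y))
        + Y\<^sup>T ** (Delta G ** W) + W ** ((Delta G)\<^sup>T ** Y))"
  have "lipschitz_on_balls r2"
    unfolding r2_def case_prod_beta by (intro lob_intros lob_bilinear[OF bounded_bilinear_scaleR])
  then obtain B where B: "0 \<le> B" "\<And>x. norm x \<le> R \<Longrightarrow> norm (r2 x) \<le> B" using lob_bounded[where f = r2 and R = R] by blast
  \<comment> \<open>There are two coupling terms with the layer, mutually transposed, and each is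
    doubled by differentiating a square.\<close>
  define d where "d = 4 * norm (Delta2 G) * c"
  define C where "C = exp (d / k) * ((2 * B\<^sup>2 / \<gamma>) / \<gamma>)"
  have "(norm (X3 s - (Pb22 + p (s / \<epsilon>))))\<^sup>2 \<le> C * \<epsilon>\<^sup>2"
    if \<epsilon>: "0 < \<epsilon>" "\<epsilon> \<le> 1" and t: "t \<in> {0..T}" and sol: "solves \<epsilon> t X1 X2 X3"
      and small: "\<And>s. s \<in> {0..t} \<Longrightarrow> norm (err \<epsilon> X1 X2 X3 s) \<le> \<eta>" and st: "s \<in> {0..t}" for \<epsilon> t X1 X2 X3 s
  proof -
    define E where "E s = X3 s - (Pb22 + p (s / \<epsilon>))" for s
    have "(norm (E s))\<^sup>2 \<le> exp (d / k) * ((norm (E 0))\<^sup>2 + (2 * B\<^sup>2 / \<gamma> * \<epsilon>\<^sup>2) / \<gamma>)"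
    proof (rule gronwall_fast_stable[OF _ _ _ _ _ _ _ _ st])
      fix s assume s: "s \<in> {0..t}"
      have sT: "s \<in> {0..T}" using s t by auto
      define q where "q = p (s/\<epsilon>)"
      have qs: "q\<^sup>T = q" "(E s)\<^sup>T = E s"
        using p_sym[of "s/\<epsilon>"] s \<epsilon> sol by (auto simp: q_def E_def solves_def)
      have X3: "X3 s = Pb22 + q + E s" by (simp add: E_def q_def)
      define r where "r = r2 (X2 s, Pb22 + q + E s, \<epsilon>)"
      have En: "norm (E s) \<le> \<eta>" and X2n: "norm (X2 s - (h (a s) + y (s / \<epsilon>))) \<le> \<eta>"
        using order_trans[OF norm_triple_ge(3) small[OF s, unfolded err_def]]
          order_trans[OF norm_triple_ge(2) small[OF s, unfolded err_def]] by (auto simp: E_def)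
      have "norm (X2 s) \<le> norm (h 0) + Lh * Ra + c + \<eta>"
      proof -
        have "norm (h (a s) - h 0) \<le> Lh * Ra"
          using h_lipschitz[of "a s" 0] mult_left_mono[OF Ra(2)[OF sT] Lh_nonneg] by simp
        moreover have "norm (y (s/\<epsilon>)) \<le> c" using layer_bound s \<epsilon> by simp
        moreover have "X2 s = (X2 s - (h (a s) + y (s / \<epsilon>))) + (h (a s) - h 0) + h 0 + y (s/\<epsilon>)" by simp
        ultimately have "norm (X2 s) \<le> norm (X2 s - (h (a s) + y (s / \<epsilon>))) + norm (h (a s) - h 0) + norm (h 0) + norm (y (s/\<epsilon>))"
          using norm_triangle_ineq[of "(X2 s - (h (a s) + y (s / \<epsilon>))) + (h (a s) - h 0) + h 0" "y (s/\<epsilon>)"]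
            norm_triangle_ineq[of "(X2 s - (h (a s) + y (s / \<epsilon>))) + (h (a s) - h 0)" "h 0"]
            norm_triangle_ineq[of "X2 s - (h (a s) + y (s / \<epsilon>))" "h (a s) - h 0"]
          by simp
        then show ?thesis using X2n \<open>norm (h (a s) - h 0) \<le> Lh * Ra\<close> \<open>norm (y (s/\<epsilon>)) \<le> c\<close> by linarith
      qed
      moreover have "norm (Pb22 + q + E s) \<le> norm Pb22 + c + \<eta>"
        using layer_bound(1)[of "s/\<epsilon>"] s \<epsilon> En norm_triangle_ineq[of "Pb22 + q" "E s"] norm_triangle_ineq[of "Pb22" q]
        by (simp add: q_def)
      ultimately have "norm (X2 s, Pb22 + q + E s, \<epsilon>) \<le> R"
        using norm_Pair_le[of "X2 s" "(Pb22 + q + E s, \<epsilon>)"] norm_Pair_le[of "Pb22 + q + E s" \<epsilon>] \<epsilon> by (simp add: R_def)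
      then have rB: "norm r \<le> B" unfolding r_def by (rule B)
      have exp: "riccati_g2 G (X1 s) (X2 s) (X3 s) \<epsilon> - riccati_g2 G 0 (y (s/\<epsilon>) + h 0) (q + Pb22) 0
         = S\<^sup>T ** E s + E s ** S + (E s ** (Delta2 G ** q)) + (E s ** (Delta2 G ** q))\<^sup>T + E s ** (Delta2 G ** E s) + \<epsilon> *\<^sub>R r"
        unfolding X3 riccati_g2_expand[OF qs, where Z = "y (s/\<epsilon>) + h 0"] r_def r2_def
        by (simp add: matrix_mult_algebra qs algebra_simps)
      show "((\<lambda>s. (norm (E s))\<^sup>2) has_real_derivative 2 * inner (E s) ((1/\<epsilon>) *\<^sub>R (riccati_g2 G (X1 s) (X2 s) (X3 s) \<epsilon> - riccati_g2 G 0 (y (s/\<epsilon>) + h 0) (q + Pb22) 0))) (at s within {0..t})"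
      proof (rule has_vector_derivative_norm_square)
        have "(E has_vector_derivative (1/\<epsilon>) *\<^sub>R riccati_g2 G (X1 s) (X2 s) (X3 s) \<epsilon> - (0 + (1/\<epsilon>) *\<^sub>R riccati_g2 G 0 (y (s/\<epsilon>) + h 0) (q + Pb22) 0)) (at s within {0..t})"
          unfolding E_def[abs_def] q_def using sol s \<epsilon>
          by (intro derivative_intros layer_deriv) (auto simp: solves_def)
        then show "(E has_vector_derivative (1/\<epsilon>) *\<^sub>R (riccati_g2 G (X1 s) (X2 s) (X3 s) \<epsilon> - riccati_g2 G 0 (y (s/\<epsilon>) + h 0) (q + Pb22) 0)) (at s within {0..t})"
          by (simp add: scaleR_diff_right)
      qed
      define n where "n = norm (E s)"
      define e where "e = exp (- k * s / \<epsilon>)"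
      have 1: "inner (E s) (S\<^sup>T ** E s) \<le> - \<gamma> * n\<^sup>2" "inner (E s) (E s ** S) \<le> - \<gamma> * n\<^sup>2"
        unfolding n_def by (rule stable_left stable_right)+
      have "inner (E s) (E s ** (Delta2 G ** q)) \<le> norm (Delta2 G ** q) * n\<^sup>2"
        unfolding n_def by (rule inner_mult_le)
      also have "norm (Delta2 G ** q) \<le> norm (Delta2 G) * (c * e)"
        using norm_matrix_mult[of "Delta2 G" q] mult_left_mono[OF layer_decay(1)[of \<epsilon> s], of "norm (Delta2 G)"] s \<epsilon>
        by (simp add: e_def q_def)
      finally have 2: "inner (E s) (E s ** (Delta2 G ** q)) \<le> d / 4 * e * n\<^sup>2"
        by (simp add: d_def mult_right_mono)
      have tr: "inner (E s) ((E s ** (Delta2 G ** q))\<^sup>T) = inner (E s) (E s ** (Delta2 G ** q))"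
        using inner_transpose[of "E s" "E s ** (Delta2 G ** q)"] qs by simp
      have "inner (E s) (E s ** (Delta2 G ** E s)) \<le> norm (Delta2 G ** E s) * n\<^sup>2"
        unfolding n_def by (rule inner_mult_le)
      also have "norm (Delta2 G ** E s) \<le> \<gamma> / 4"
        using norm_matrix_mult[of "Delta2 G" "E s"] mult_left_mono[OF En, of "norm (Delta2 G)"] \<eta> by simp
      finally have 3: "inner (E s) (E s ** (Delta2 G ** E s)) \<le> \<gamma> / 4 * n\<^sup>2"
        by (simp add: mult_right_mono)
      have "inner (E s) r \<le> n * B"
        unfolding n_def using norm_cauchy_schwarz[of "E s" r] mult_left_mono[OF rB, of "norm (E s)"] by simp
      then have "inner (E s) (\<epsilon> *\<^sub>R r) \<le> n * (B * \<epsilon>)"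
        using \<epsilon> mult_left_mono[of "inner (E s) r" "n * B" \<epsilon>] by (simp add: mult_ac)
      moreover have "2 * (n * (B * \<epsilon>)) \<le> (\<gamma>/2) * n\<^sup>2 + (B * \<epsilon>)\<^sup>2 / (\<gamma>/2)"
        using gamma by (intro young) simp
      ultimately have 4: "2 * inner (E s) (\<epsilon> *\<^sub>R r) \<le> (\<gamma>/2) * n\<^sup>2 + 2 * B\<^sup>2 / \<gamma> * \<epsilon>\<^sup>2"
        by (simp add: power_mult_distrib)
      have g0: "0 \<le> \<gamma> * n\<^sup>2" using gamma by simp
      have "2 * inner (E s) (riccati_g2 G (X1 s) (X2 s) (X3 s) \<epsilon> - riccati_g2 G 0 (y (s/\<epsilon>) + h 0) (q + Pb22) 0)
         \<le> (- \<gamma> + d * e) * n\<^sup>2 + 2 * B\<^sup>2 / \<gamma> * \<epsilon>\<^sup>2"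
        unfolding exp inner_add_right tr using 1 2 3 4 g0 by (simp add: algebra_simps)
      then have "(1/\<epsilon>) * (2 * inner (E s) (riccati_g2 G (X1 s) (X2 s) (X3 s) \<epsilon> - riccati_g2 G 0 (y (s/\<epsilon>) + h 0) (q + Pb22) 0))
        \<le> (1/\<epsilon>) * ((- \<gamma> + d * e) * n\<^sup>2 + 2 * B\<^sup>2 / \<gamma> * \<epsilon>\<^sup>2)"
        using \<epsilon> by (intro mult_left_mono) auto
      then show "2 * inner (E s) ((1/\<epsilon>) *\<^sub>R (riccati_g2 G (X1 s) (X2 s) (X3 s) \<epsilon> - riccati_g2 G 0 (y (s/\<epsilon>) + h 0) (q + Pb22) 0))
        \<le> (1/\<epsilon>) * ((- \<gamma> + d * exp (- k * s / \<epsilon>)) * (norm (E s))\<^sup>2 + 2 * B\<^sup>2 / \<gamma> * \<epsilon>\<^sup>2)"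
        by (simp add: e_def n_def)
    qed (use \<epsilon> gamma k c in \<open>auto simp: d_def\<close>)
    moreover have "E 0 = 0" using sol layer by (simp add: E_def solves_def boundary_layer_solution_def)
    ultimately show ?thesis by (simp add: C_def E_def)
  qed
  then show ?thesis using gamma by (intro exI[of _ C]) (auto simp: C_def)
qed

end

lemma sum3_square_le: "(u + v + w)\<^sup>2 \<le> 3 * (u\<^sup>2 + v\<^sup>2 + (w::real)\<^sup>2)"
proof -
  have "0 \<le> (u - v)\<^sup>2 + (u - w)\<^sup>2 + (v - w)\<^sup>2" by simp
  then show ?thesis by (simp add: power2_eq_square algebra_simps)
qed

context tikhonov_data
begin

lemma h_affine: "h X = h 0 - X ** ((A12 G + Delta G ** Pb22) ** matrix_inv S)"
  using h_diff[of X 0] by (simp add: algebra_simps)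

lemma ha_deriv:
  assumes "s \<in> {0..t}" "t \<in> {0..T}"
  shows "((\<lambda>s. h (a s)) has_vector_derivative
     - (riccati_f G (a s) (h (a s)) 0 0 ** ((A12 G + Delta G ** Pb22) ** matrix_inv S))) (at s within {0..t})"
proof -
  have "(a has_vector_derivative riccati_f G (a s) (h (a s)) 0 0) (at s within {0..t})"
    using a_deriv[of s] assms by (auto intro: has_vector_derivative_within_subset)
  then have "((\<lambda>s. h 0 - a s ** ((A12 G + Delta G ** Pb22) ** matrix_inv S)) has_vector_derivative
     0 - riccati_f G (a s) (h (a s)) 0 0 ** ((A12 G + Delta G ** Pb22) ** matrix_inv S)) (at s within {0..t})"
    by (intro derivative_intros bounded_linear.has_vector_derivative[OF bounded_bilinear.bounded_linear_left[OF bounded_bilinear_matrix_mult]])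
  then show ?thesis by (subst h_affine) simp
qed

lemma ha_bound:
  assumes "norm (a s) \<le> Ra" shows "norm (h (a s)) \<le> norm (h 0) + Lh * Ra"
  using h_lipschitz[of "a s" 0] mult_left_mono[OF assms Lh_nonneg] norm_triangle_ineq[of "h (a s) - h 0" "h 0"]
  by simp

text \<open>The improving step of the bootstrap: once \<open>\<epsilon>\<close> is small,
  \<open>C * \<epsilon>\<close> lies below \<open>\<eta>\<close>. The fast diagonal error is bounded
  first and becomes a source; the slow and off-diagonal errors are then treated together by
  \<open>two_scale_estimate\<close>.\<close>

theorem error_estimate:
  obtains \<eta> C where "0 < \<eta>" "0 \<le> C"
    "\<And>\<epsilon> t X1 X2 X3. 0 < \<epsilon> \<Longrightarrow> \<epsilon> \<le> 1 \<Longrightarrow> t \<in> {0..T} \<Longrightarrow> solves \<epsilon> t X1 X2 X3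
     \<Longrightarrow> (\<And>s. s \<in> {0..t} \<Longrightarrow> norm (err \<epsilon> X1 X2 X3 s) \<le> \<eta>)
     \<Longrightarrow> norm (err \<epsilon> X1 X2 X3 t) \<le> C * \<epsilon>"
proof -
  \<comment> \<open>The added one avoids a vanishing denominator; the quadratic terms then cost at
    most \<open>\<gamma> / 4\<close> each.\<close>
  define \<eta> where "\<eta> = \<gamma> / (4 * (norm (Delta2 G) + 1))"
  have \<eta>0: "0 < \<eta>" using gamma by (auto simp: \<eta>_def add_nonneg_pos)
  have \<eta>D: "norm (Delta2 G) * \<eta> \<le> \<gamma> / 4"
  proof -
    have "norm (Delta2 G) * \<eta> \<le> (norm (Delta2 G) + 1) * \<eta>" using \<eta>0 by simp
    also have "\<dots> = \<gamma> / 4"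
    proof -
      have "N * (\<gamma> / (4 * N)) = \<gamma> / 4" if "0 < N" for N :: real using that by simp
      from this[OF add_nonneg_pos[OF norm_ge_zero zero_less_one, of "Delta2 G"]] show ?thesis by (simp only: \<eta>_def)
    qed
    finally show ?thesis .
  qed
  obtain Ra Da where RD: "0 \<le> Ra" "0 \<le> Da"
    "\<And>s. s \<in> {0..T} \<Longrightarrow> norm (a s) \<le> Ra" "\<And>s. s \<in> {0..T} \<Longrightarrow> norm (a s) \<le> Da * s"
    "\<And>s. s \<in> {0..T} \<Longrightarrow> norm (riccati_f G (a s) (h (a s)) 0 0) \<le> Da"
    using a_bounds by blast
  obtain C22 where C22: "0 \<le> C22"
    "\<And>\<epsilon> t X1 X2 X3 s. 0 < \<epsilon> \<Longrightarrow> \<epsilon> \<le> 1 \<Longrightarrow> t \<in> {0..T} \<Longrightarrow> solves \<epsilon> t X1 X2 X3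
     \<Longrightarrow> (\<And>s. s \<in> {0..t} \<Longrightarrow> norm (err \<epsilon> X1 X2 X3 s) \<le> \<eta>)
     \<Longrightarrow> s \<in> {0..t} \<Longrightarrow> (norm (X3 s - (Pb22 + p (s / \<epsilon>))))\<^sup>2 \<le> C22 * \<epsilon>\<^sup>2"
    using fast22_estimate[OF \<eta>0 \<eta>D] by (metis (no_types, lifting))
  define H where "H = norm (h 0) + Lh * Ra"
  have H0: "0 \<le> H" using Lh_nonneg RD by (simp add: H_def)
  define R where "R = (Ra + \<eta>) + (H + c + \<eta>) + (norm Pb22 + c + \<eta>)"
  have R_ge: "Ra + H + c \<le> R" "Ra + H \<le> R" "(Ra + \<eta>) + (H + c + \<eta>) \<le> R" "norm Pb22 + c + \<eta> \<le> R"
    using RD H0 c \<eta>0 by (auto simp: R_def)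
  define q1 where "q1 W = A12 G + Delta G ** W" for W
  define q2 where "q2 = (\<lambda>(a, Y). (A21 G)\<^sup>T + a ** Delta G + Y ** Delta2 G)"
  define q3 where "q3 = (\<lambda>(X, Y). (A11 G)\<^sup>T ** Y + X ** (Delta1 G ** Y) + Y ** ((Delta G)\<^sup>T ** Y))"
  define f where "f = (\<lambda>(X, Y). riccati_f G X Y 0 0)"
  have "lipschitz_on_balls q1" "lipschitz_on_balls q2" "lipschitz_on_balls q3" and flob: "lipschitz_on_balls f"
    unfolding q1_def q2_def q3_def f_def case_prod_beta riccati_f_def by (intro lob_intros)+
  then obtain B1 B2 B3 where B: "0 \<le> B1" "\<And>x. norm x \<le> R \<Longrightarrow> norm (q1 x) \<le> B1"
      "0 \<le> B2" "\<And>x. norm x \<le> R \<Longrightarrow> norm (q2 x) \<le> B2" "0 \<le> B3" "\<And>x. norm x \<le> R \<Longrightarrow> norm (q3 x) \<le> B3"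
    using lob_bounded[where f = q1 and R = R] lob_bounded[where f = q2 and R = R] lob_bounded[where f = q3 and R = R] by metis
  obtain Lf where Lf: "0 \<le> Lf" "\<And>x y. norm x \<le> R \<Longrightarrow> norm y \<le> R \<Longrightarrow> norm (f x - f y) \<le> Lf * norm (x - y)"
    using lobE[OF flob, of R] by blast
  define Cr where "Cr = (norm (Delta G) + Lh * norm (Delta2 G)) * (Da * c / k) + B1 + B2 + B3 + Da * Lh"
  define C1 where "C1 = Lf * (3 + c)"
  define d where "d = 2 * norm (Delta2 G) * c"
  define D where "D = 6 * Cr\<^sup>2 * (C22 + 1) / \<gamma>"
  define K where "K = C1 / (\<gamma> * exp (- d / k))"
  define A where "A = exp ((C1 + K * D) * T + C1 / k) * (K * D * T + C1 / k)"
  define A2 where "A2 = exp (d / k) * (D * (A + 1) / \<gamma>)"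
  have nn: "0 \<le> Cr" "0 \<le> C1" "0 \<le> d" "0 \<le> D" "0 \<le> K"
    using B Lf c k RD Lh_nonneg C22(1) gamma by (auto simp: Cr_def C1_def d_def D_def K_def)
  then have A0: "0 \<le> A" "0 \<le> A2" using T k gamma by (auto simp: A_def A2_def)
  have main: "norm (err \<epsilon> X1 X2 X3 t) \<le> (sqrt A + sqrt A2 + sqrt C22) * \<epsilon>"
    if \<epsilon>: "0 < \<epsilon>" "\<epsilon> \<le> 1" and t: "t \<in> {0..T}" and sol: "solves \<epsilon> t X1 X2 X3"
      and small: "\<And>s. s \<in> {0..t} \<Longrightarrow> norm (err \<epsilon> X1 X2 X3 s) \<le> \<eta>" for \<epsilon> t X1 X2 X3
  proof -
    define E1 where "E1 s = X1 s - a s" for s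
    define E2 where "E2 s = X2 s - (h (a s) + y (s / \<epsilon>))" for s
    define E3 where "E3 s = X3 s - (Pb22 + p (s / \<epsilon>))" for s
    define e where "e s = exp (- k * s / \<epsilon>)" for s
    \<comment> \<open>What the equation of \<open>E2\<close> contains besides the damping and the
      couplings of \<open>E2\<close> to \<open>p\<close> and \<open>E3\<close>. The last term is
      \<open>- \<epsilon>\<close> times the derivative of \<open>h (a s)\<close>, the drift of the
      slow manifold.\<close>
    define rem where "rem s = (a s ** Delta G + (h (a s) - h 0) ** Delta2 G) ** p (s/\<epsilon>)
       + E1 s ** q1 (Pb22 + p (s/\<epsilon>) + E3 s)
       + q2 (a s, h (a s) + y (s/\<epsilon>)) ** E3 s
       + \<epsilon> *\<^sub>R q3 (a s + E1 s, h (a s) + y (s/\<epsilon>) + E2 s)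
       + \<epsilon> *\<^sub>R (riccati_f G (a s) (h (a s)) 0 0 ** ((A12 G + Delta G ** Pb22) ** matrix_inv S))" for s
    have Eb: "norm (E1 s) \<le> \<eta>" "norm (E2 s) \<le> \<eta>" "norm (E3 s) \<le> \<eta>" if "s \<in> {0..t}" for s
      using order_trans[OF norm_triple_ge(1) small[OF that, unfolded err_def]]
        order_trans[OF norm_triple_ge(2) small[OF that, unfolded err_def]]
        order_trans[OF norm_triple_ge(3) small[OF that, unfolded err_def]]
      by (auto simp: E1_def E2_def E3_def)
    have E3b: "(norm (E3 s))\<^sup>2 \<le> C22 * \<epsilon>\<^sup>2" if "s \<in> {0..t}" for s
      unfolding E3_def by (rule C22(2)[OF \<epsilon> t sol small that])
    have sizes: "norm (a s) \<le> Ra" "norm (h (a s)) \<le> H" "norm (y (s/\<epsilon>)) \<le> c" "norm (p (s/\<epsilon>)) \<le> c"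
      if "s \<in> {0..t}" for s
      using RD(3)[of s] ha_bound[of s Ra] layer_bound[of "s/\<epsilon>"] that t \<epsilon> by (auto simp: H_def)
    have remb: "norm (rem s) \<le> Cr * (norm (E1 s) + norm (E3 s) + \<epsilon>)" if s: "s \<in> {0..t}" for s
    proof -
      have sT: "s \<in> {0..T}" using s t by auto
      \<comment> \<open>Here \<open>a\<close> of order \<open>s\<close> meets a layer of order
        \<open>exp (- k s / \<epsilon>)\<close>; \<open>exp_layer_linear\<close> turns the product
        into order \<open>\<epsilon>\<close>.\<close>
      have 1: "norm ((a s ** Delta G + (h (a s) - h 0) ** Delta2 G) ** p (s/\<epsilon>)) \<le> (norm (Delta G) + Lh * norm (Delta2 G)) * (Da * c / k) * \<epsilon>"
      proof -
        have "norm (a s ** Delta G + (h (a s) - h 0) ** Delta2 G) \<le> norm (a s) * norm (Delta G) + (Lh * norm (a s)) * norm (Delta2 G)"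
          using norm_matrix_mult[of "a s" "Delta G"] norm_matrix_mult[of "h (a s) - h 0" "Delta2 G"]
            mult_right_mono[OF h_lipschitz[of "a s" 0] norm_ge_zero[of "Delta2 G"]]
            norm_triangle_ineq[of "a s ** Delta G" "(h (a s) - h 0) ** Delta2 G"] by simp
        also have "\<dots> = (norm (Delta G) + Lh * norm (Delta2 G)) * norm (a s)" by (simp add: algebra_simps)
        also have "\<dots> \<le> (norm (Delta G) + Lh * norm (Delta2 G)) * (Da * s)"
          using RD(4)[OF sT] Lh_nonneg by (intro mult_left_mono) auto
        finally have "norm ((a s ** Delta G + (h (a s) - h 0) ** Delta2 G) ** p (s/\<epsilon>))
          \<le> (norm (Delta G) + Lh * norm (Delta2 G)) * (Da * s) * (c * exp (- k * s / \<epsilon>))"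
          using layer_decay(1)[of \<epsilon> s] s \<epsilon> RD Lh_nonneg
          by (intro order_trans[OF norm_matrix_mult] mult_mono) auto
        also have "\<dots> = (norm (Delta G) + Lh * norm (Delta2 G)) * Da * c * (s * exp (- k * s / \<epsilon>))" by (simp add: mult_ac)
        also have "\<dots> \<le> (norm (Delta G) + Lh * norm (Delta2 G)) * Da * c * (\<epsilon> / k)"
          using exp_layer_linear[OF k \<epsilon>(1)] RD c Lh_nonneg by (intro mult_left_mono) auto
        finally show ?thesis by (simp add: mult_ac)
      qed
      have "norm (Pb22 + p (s/\<epsilon>) + E3 s) \<le> R"
        using sizes[OF s] Eb[OF s] R_ge norm_triangle_ineq[of "Pb22 + p (s/\<epsilon>)" "E3 s"] norm_triangle_ineq[of Pb22 "p (s/\<epsilon>)"] by linarith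
      then have 2: "norm (E1 s ** q1 (Pb22 + p (s/\<epsilon>) + E3 s)) \<le> B1 * norm (E1 s)"
        using order_trans[OF norm_matrix_mult mult_left_mono[OF B(2) norm_ge_zero]] by (metis mult.commute)
      have ny: "norm (h (a s) + y (s/\<epsilon>)) \<le> H + c"
        using sizes[OF s] norm_triangle_ineq[of "h (a s)" "y (s/\<epsilon>)"] by linarith
      have "norm (a s, h (a s) + y (s/\<epsilon>)) \<le> R"
        using norm_Pair_le[of "a s" "h (a s) + y (s/\<epsilon>)"] sizes[OF s] ny R_ge by linarith
      then have 3: "norm (q2 (a s, h (a s) + y (s/\<epsilon>)) ** E3 s) \<le> B2 * norm (E3 s)"
        by (intro order_trans[OF norm_matrix_mult mult_right_mono[OF B(4)]]) auto
      have "norm (a s + E1 s, h (a s) + y (s/\<epsilon>) + E2 s) \<le> R"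
        using norm_Pair_le[of "a s + E1 s" "h (a s) + y (s/\<epsilon>) + E2 s"] sizes[OF s] ny Eb[OF s] R_ge
          norm_triangle_ineq[of "a s" "E1 s"] norm_triangle_ineq[of "h (a s) + y (s/\<epsilon>)" "E2 s"] by linarith
      then have 4: "norm (\<epsilon> *\<^sub>R q3 (a s + E1 s, h (a s) + y (s/\<epsilon>) + E2 s)) \<le> B3 * \<epsilon>"
        using B(6) \<epsilon> by (simp add: mult.commute)
      have "norm (riccati_f G (a s) (h (a s)) 0 0 ** ((A12 G + Delta G ** Pb22) ** matrix_inv S)) \<le> Da * Lh"
        unfolding Lh_def by (intro order_trans[OF norm_matrix_mult mult_right_mono[OF RD(5)[OF sT]]]) auto
      then have 5: "norm (\<epsilon> *\<^sub>R (riccati_f G (a s) (h (a s)) 0 0 ** ((A12 G + Delta G ** Pb22) ** matrix_inv S))) \<le> Da * Lh * \<epsilon>"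
        using \<epsilon> by (simp add: mult.commute)
      have "norm (rem s) \<le> (norm (Delta G) + Lh * norm (Delta2 G)) * (Da * c / k) * \<epsilon> + B1 * norm (E1 s) + B2 * norm (E3 s) + B3 * \<epsilon> + Da * Lh * \<epsilon>"
        unfolding rem_def by (intro norm_triangle_le add_mono 1 2 3 4 5)
      also have "\<dots> \<le> Cr * \<epsilon> + Cr * norm (E1 s) + Cr * norm (E3 s)"
      proof -
        have p: "0 \<le> (norm (Delta G) + Lh * norm (Delta2 G)) * (Da * c / k)" "0 \<le> Da * Lh"
          using Lh_nonneg RD c k by auto
        have "B1 * norm (E1 s) \<le> Cr * norm (E1 s)" "B2 * norm (E3 s) \<le> Cr * norm (E3 s)"
          using p B by (auto intro!: mult_right_mono simp: Cr_def)
        moreover have "((norm (Delta G) + Lh * norm (Delta2 G)) * (Da * c / k) + B3 + Da * Lh) * \<epsilon> \<le> Cr * \<epsilon>"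
          using \<epsilon> B by (intro mult_right_mono) (auto simp: Cr_def)
        ultimately show ?thesis by (simp add: distrib_right)
      qed
      finally show ?thesis by (simp add: distrib_left)
    qed
    have E1': "(E1 has_vector_derivative (f (X1 s, X2 s) - f (a s, h (a s)))) (at s within {0..t})"
      if s: "s \<in> {0..t}" for s
    proof -
      have "riccati_f G (X1 s) (X2 s) (X3 s) \<epsilon> = f (X1 s, X2 s)" by (simp add: f_def riccati_f_def)
      moreover have "(X1 has_vector_derivative riccati_f G (X1 s) (X2 s) (X3 s) \<epsilon>) (at s within {0..t})"
        using sol s by (simp add: solves_def)
      moreover have "(a has_vector_derivative f (a s, h (a s))) (at s within {0..t})"
        using a_deriv[of s] s t by (auto simp: f_def intro: has_vector_derivative_within_subset)
      ultimately show ?thesis unfolding E1_def[abs_def] by (intro derivative_intros) auto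
    qed
    have E2': "(E2 has_vector_derivative (1/\<epsilon>) *\<^sub>R (E2 s ** S + E2 s ** (Delta2 G ** p (s/\<epsilon>)) + E2 s ** (Delta2 G ** E3 s) + rem s)) (at s within {0..t})"
      if s: "s \<in> {0..t}" for s
    proof -
      define F where "F = riccati_f G (a s) (h (a s)) 0 0 ** ((A12 G + Delta G ** Pb22) ** matrix_inv S)"
      have "(X2 has_vector_derivative (1/\<epsilon>) *\<^sub>R riccati_g1 G (X1 s) (X2 s) (X3 s) \<epsilon>) (at s within {0..t})"
        using sol s by (simp add: solves_def)
      then have 1: "(E2 has_vector_derivative (1/\<epsilon>) *\<^sub>R riccati_g1 G (X1 s) (X2 s) (X3 s) \<epsilon>
         - (- F + (1/\<epsilon>) *\<^sub>R riccati_g1 G 0 (y (s/\<epsilon>) + h 0) (p (s/\<epsilon>) + Pb22) 0)) (at s within {0..t})"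
        unfolding E2_def[abs_def] F_def by (intro derivative_intros ha_deriv layer_deriv s t \<epsilon>)
      have sT: "s \<in> {0..T}" using s t by auto
      have X: "X1 s = a s + E1 s" "X2 s = h (a s) + y (s/\<epsilon>) + E2 s" "X3 s = Pb22 + p (s/\<epsilon>) + E3 s"
        by (auto simp: E1_def E2_def E3_def)
      have 2: "riccati_g1 G (X1 s) (X2 s) (X3 s) \<epsilon> - riccati_g1 G 0 (y (s/\<epsilon>) + h 0) (p (s/\<epsilon>) + Pb22) 0
         = E2 s ** S + E2 s ** (Delta2 G ** p (s/\<epsilon>)) + E2 s ** (Delta2 G ** E3 s) + rem s - \<epsilon> *\<^sub>R F"
        unfolding X riccati_g1_expand[OF a_sym[OF sT]] rem_def q1_def q2_def q3_def F_def prod.case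
        by (simp add: bounded_bilinear.add_right[OF bounded_bilinear_matrix_mult])
      have "(1/\<epsilon>) *\<^sub>R riccati_g1 G (X1 s) (X2 s) (X3 s) \<epsilon>
         - (- F + (1/\<epsilon>) *\<^sub>R riccati_g1 G 0 (y (s/\<epsilon>) + h 0) (p (s/\<epsilon>) + Pb22) 0)
        = (1/\<epsilon>) *\<^sub>R (riccati_g1 G (X1 s) (X2 s) (X3 s) \<epsilon> - riccati_g1 G 0 (y (s/\<epsilon>) + h 0) (p (s/\<epsilon>) + Pb22) 0 + \<epsilon> *\<^sub>R F)"
        using \<epsilon> by (simp add: scaleR_add_right scaleR_diff_right)
      with 1 show ?thesis unfolding 2 by simp
    qed
    have ini: "E1 0 = 0" "E2 0 = 0"
      using sol layer a_0 by (auto simp: E1_def E2_def solves_def boundary_layer_solution_def)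
    have est: "(norm (E1 s))\<^sup>2 \<le> A * \<epsilon>\<^sup>2 \<and> (norm (E2 s))\<^sup>2 \<le> A2 * \<epsilon>\<^sup>2" if st: "s \<in> {0..t}" for s
      unfolding A2_def A_def K_def
    proof (rule two_scale_estimate[where v = "\<lambda>s. (norm (E1 s))\<^sup>2" and w = "\<lambda>s. (norm (E2 s))\<^sup>2" and T = t])
      fix s assume s: "s \<in> {0..t}"
      show "((\<lambda>s. (norm (E1 s))\<^sup>2) has_real_derivative 2 * inner (E1 s) (f (X1 s, X2 s) - f (a s, h (a s)))) (at s within {0..t})"
        by (rule has_vector_derivative_norm_square[OF E1'[OF s]])
      show "((\<lambda>s. (norm (E2 s))\<^sup>2) has_real_derivative 2 * inner (E2 s) ((1/\<epsilon>) *\<^sub>R (E2 s ** S + E2 s ** (Delta2 G ** p (s/\<epsilon>)) + E2 s ** (Delta2 G ** E3 s) + rem s))) (at s within {0..t})"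
        by (rule has_vector_derivative_norm_square[OF E2'[OF s]])
      define m n where "m = norm (E1 s)" and "n = norm (E2 s)"
      have mn: "0 \<le> m" "0 \<le> n" by (auto simp: m_def n_def)
      have e0: "0 < e s" by (simp add: e_def)
      have dec: "norm (p (s/\<epsilon>)) \<le> c * e s" "norm (y (s/\<epsilon>)) \<le> c * e s"
        using layer_decay[of \<epsilon> s] \<epsilon> s by (auto simp: e_def)
      have ny: "norm (h (a s) + y (s/\<epsilon>)) \<le> H + c"
        using sizes[OF s] norm_triangle_ineq[of "h (a s)" "y (s/\<epsilon>)"] by linarith
      have X: "X1 s = a s + E1 s" "X2 s = h (a s) + y (s/\<epsilon>) + E2 s"
        by (auto simp: E1_def E2_def)
      have "norm (X1 s, X2 s) \<le> R"
        unfolding X using norm_Pair_le[of "a s + E1 s" "h (a s) + y (s/\<epsilon>) + E2 s"] sizes[OF s] ny Eb[OF s] R_ge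
          norm_triangle_ineq[of "a s" "E1 s"] norm_triangle_ineq[of "h (a s) + y (s/\<epsilon>)" "E2 s"] by linarith
      moreover have "norm (a s, h (a s)) \<le> R"
        using norm_Pair_le[of "a s" "h (a s)"] sizes[OF s] R_ge by linarith
      ultimately have "norm (f (X1 s, X2 s) - f (a s, h (a s))) \<le> Lf * norm ((X1 s, X2 s) - (a s, h (a s)))"
        by (rule Lf(2))
      \<comment> \<open>The slow field is compared with its value on the slow manifold, so the layer
        \<open>y\<close> itself, initially of order one, appears next to the errors.\<close>
      also have "norm ((X1 s, X2 s) - (a s, h (a s))) \<le> m + (n + c * e s)"
        using norm_Pair_le[of "E1 s" "y (s/\<epsilon>) + E2 s"] norm_triangle_ineq[of "y (s/\<epsilon>)" "E2 s"] dec
        by (simp add: X m_def n_def)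
      finally have "norm (f (X1 s, X2 s) - f (a s, h (a s))) \<le> Lf * (m + (n + c * e s))"
        using Lf(1) by (simp add: mult_left_mono)
      then have "inner (E1 s) (f (X1 s, X2 s) - f (a s, h (a s))) \<le> m * (Lf * (m + (n + c * e s)))"
        unfolding m_def by (intro order_trans[OF norm_cauchy_schwarz mult_left_mono]) auto
      then have "2 * inner (E1 s) (f (X1 s, X2 s) - f (a s, h (a s))) \<le> Lf * (2 * m\<^sup>2 + 2 * (m * n) + c * e s * (2 * (m * 1)))"
        by (simp add: algebra_simps power2_eq_square)
      also have "\<dots> \<le> Lf * (2 * m\<^sup>2 + (m\<^sup>2 + n\<^sup>2) + c * e s * (m\<^sup>2 / \<epsilon> + \<epsilon>))"
      proof -
        have "2 * (m * n) \<le> m\<^sup>2 + n\<^sup>2" using young[of 1 m n] by simp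
        \<comment> \<open>Young's inequality with weight \<open>1 / \<epsilon>\<close> splits the
          linear term \<open>m\<close> into the two layer terms that
          \<open>two_scale_estimate\<close> admits.\<close>
        moreover have "c * e s * (2 * (m * 1)) \<le> c * e s * (m\<^sup>2 / \<epsilon> + \<epsilon>)"
          using young[of "1/\<epsilon>" m 1] \<epsilon> c e0 by (intro mult_left_mono) auto
        ultimately show ?thesis by (intro mult_left_mono[OF _ Lf(1)] add_mono order_refl)
      qed
      also have "\<dots> \<le> Lf * ((3 + c) * (m\<^sup>2 + n\<^sup>2 + e s * m\<^sup>2 / \<epsilon> + \<epsilon> * e s))"
      proof (intro mult_left_mono Lf(1))
        define u1 u2 where "u1 = e s * m\<^sup>2 / \<epsilon>" and "u2 = \<epsilon> * e s"
        have "0 \<le> c * m\<^sup>2" "0 \<le> c * n\<^sup>2" "0 \<le> u1" "0 \<le> u2" "0 \<le> n\<^sup>2"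
          using c e0 \<epsilon> by (auto simp: u1_def u2_def)
        moreover have "c * e s * (m\<^sup>2 / \<epsilon> + \<epsilon>) = c * u1 + c * u2"
          by (simp add: u1_def u2_def algebra_simps)
        ultimately show "2 * m\<^sup>2 + (m\<^sup>2 + n\<^sup>2) + c * e s * (m\<^sup>2 / \<epsilon> + \<epsilon>) \<le> (3 + c) * (m\<^sup>2 + n\<^sup>2 + e s * m\<^sup>2 / \<epsilon> + \<epsilon> * e s)"
          unfolding u1_def[symmetric] u2_def[symmetric] by (simp add: algebra_simps)
      qed
      finally show "2 * inner (E1 s) (f (X1 s, X2 s) - f (a s, h (a s)))
        \<le> C1 * ((norm (E1 s))\<^sup>2 + (norm (E2 s))\<^sup>2 + exp (- k * s / \<epsilon>) * (norm (E1 s))\<^sup>2 / \<epsilon> + \<epsilon> * exp (- k * s / \<epsilon>))"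
        by (simp add: C1_def m_def n_def e_def mult.assoc)
      have 1: "inner (E2 s) (E2 s ** S) \<le> - \<gamma> * n\<^sup>2" unfolding n_def by (rule stable_right)
      have "inner (E2 s) (E2 s ** (Delta2 G ** p (s/\<epsilon>))) \<le> norm (Delta2 G ** p (s/\<epsilon>)) * n\<^sup>2"
        unfolding n_def by (rule inner_mult_le)
      also have "norm (Delta2 G ** p (s/\<epsilon>)) \<le> norm (Delta2 G) * (c * e s)"
        by (intro order_trans[OF norm_matrix_mult mult_left_mono] dec) auto
      finally have 2: "2 * inner (E2 s) (E2 s ** (Delta2 G ** p (s/\<epsilon>))) \<le> d * e s * n\<^sup>2"
        by (simp add: d_def mult_right_mono)
      have "inner (E2 s) (E2 s ** (Delta2 G ** E3 s)) \<le> norm (Delta2 G ** E3 s) * n\<^sup>2"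
        unfolding n_def by (rule inner_mult_le)
      also have "norm (Delta2 G ** E3 s) \<le> \<gamma> / 4"
        by (intro order_trans[OF norm_matrix_mult order_trans[OF mult_left_mono \<eta>D]] Eb s) auto
      finally have 3: "inner (E2 s) (E2 s ** (Delta2 G ** E3 s)) \<le> \<gamma> / 4 * n\<^sup>2"
        by (simp add: mult_right_mono)
      define X where "X = m + norm (E3 s) + \<epsilon>"
      have "inner (E2 s) (rem s) \<le> n * (Cr * X)"
        unfolding n_def X_def m_def
        by (intro order_trans[OF norm_cauchy_schwarz mult_left_mono] remb s) auto
      moreover have "2 * (n * (Cr * X)) \<le> (\<gamma>/2) * n\<^sup>2 + (Cr * X)\<^sup>2 / (\<gamma>/2)"
        using gamma by (intro young) simp
      \<comment> \<open>The square of the already bounded \<open>E3\<close> counts as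
        \<open>C22 * \<epsilon>\<^sup>2\<close>, so the source involves only the slow error and
        \<open>\<epsilon>\<close>.\<close>
      moreover have "(Cr * X)\<^sup>2 / (\<gamma>/2) \<le> D * (m\<^sup>2 + \<epsilon>\<^sup>2)"
      proof -
        have "X\<^sup>2 \<le> 3 * (m\<^sup>2 + (norm (E3 s))\<^sup>2 + \<epsilon>\<^sup>2)"
          unfolding X_def by (rule sum3_square_le)
        also have "\<dots> \<le> 3 * ((C22 + 1) * (m\<^sup>2 + \<epsilon>\<^sup>2))"
          using E3b[OF s] mult_nonneg_nonneg[OF C22(1) zero_le_power2[of m]] by (simp add: algebra_simps)
        finally have "Cr\<^sup>2 * X\<^sup>2 * 2 / \<gamma> \<le> Cr\<^sup>2 * (3 * ((C22 + 1) * (m\<^sup>2 + \<epsilon>\<^sup>2))) * 2 / \<gamma>"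
          using gamma by (intro divide_right_mono mult_right_mono mult_left_mono) auto
        moreover have "Cr\<^sup>2 * (3 * ((C22 + 1) * Z)) * 2 / \<gamma> = D * Z" for Z by (simp add: D_def)
        ultimately have "Cr\<^sup>2 * X\<^sup>2 * 2 / \<gamma> \<le> D * (m\<^sup>2 + \<epsilon>\<^sup>2)" by metis
        then show ?thesis by (simp add: power_mult_distrib)
      qed
      moreover have "0 \<le> \<gamma> * n\<^sup>2" using gamma by simp
      ultimately have "2 * inner (E2 s) (E2 s ** S + E2 s ** (Delta2 G ** p (s/\<epsilon>)) + E2 s ** (Delta2 G ** E3 s) + rem s)
        \<le> (- \<gamma> + d * e s) * n\<^sup>2 + D * (m\<^sup>2 + \<epsilon>\<^sup>2)"
        unfolding inner_add_right using 1 2 3 by (simp add: algebra_simps)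
      then have "(1/\<epsilon>) * (2 * inner (E2 s) (E2 s ** S + E2 s ** (Delta2 G ** p (s/\<epsilon>)) + E2 s ** (Delta2 G ** E3 s) + rem s))
        \<le> (1/\<epsilon>) * ((- \<gamma> + d * e s) * n\<^sup>2 + D * (m\<^sup>2 + \<epsilon>\<^sup>2))"
        using \<epsilon> by (intro mult_left_mono) auto
      then show "2 * inner (E2 s) ((1/\<epsilon>) *\<^sub>R (E2 s ** S + E2 s ** (Delta2 G ** p (s/\<epsilon>)) + E2 s ** (Delta2 G ** E3 s) + rem s))
        \<le> (1/\<epsilon>) * ((- \<gamma> + d * exp (- k * s / \<epsilon>)) * (norm (E2 s))\<^sup>2 + D * ((norm (E1 s))\<^sup>2 + \<epsilon>\<^sup>2))"
        by (simp add: e_def n_def m_def)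
    qed (use st t \<epsilon> gamma k nn ini in auto)
    have tt: "t \<in> {0..t}" using t by auto
    have sq: "norm x \<le> sqrt B * \<epsilon>" if "(norm x)\<^sup>2 \<le> B * \<epsilon>\<^sup>2" for x :: "'z::real_normed_vector" and B
      using real_le_rsqrt[OF that] \<epsilon> by (simp add: real_sqrt_mult)
    have "norm (err \<epsilon> X1 X2 X3 t) \<le> norm (E1 t) + (norm (E2 t) + norm (E3 t))"
      unfolding err_def E1_def E2_def E3_def by (intro order_trans[OF norm_Pair_le add_left_mono] norm_Pair_le)
    also have "\<dots> \<le> sqrt A * \<epsilon> + (sqrt A2 * \<epsilon> + sqrt C22 * \<epsilon>)"
      using est[OF tt] E3b[OF tt] by (intro add_mono sq) auto
    finally show ?thesis by (simp add: distrib_right)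
  qed
  show thesis
    by (rule that[OF \<eta>0 _ main]) (use A0 C22(1) in auto)
qed

end

section \<open>Existence and uniqueness for the full Riccati system\<close>

definition riccati_field ::
  "('n1::finite,'n2::finite,'k1::finite,'k2::finite,'m1::finite,'m2::finite) lq_game \<Rightarrow> real
    \<Rightarrow> (real^'n1^'n1) \<times> (real^'n2^'n1) \<times> (real^'n2^'n2) \<Rightarrow> (real^'n1^'n1) \<times> (real^'n2^'n1) \<times> (real^'n2^'n2)" where
  "riccati_field G \<epsilon> x = (riccati_f G (fst x) (fst (snd x)) (snd (snd x)) \<epsilon>,
     (1/\<epsilon>) *\<^sub>R riccati_g1 G (fst x) (fst (snd x)) (snd (snd x)) \<epsilon>,
     (1/\<epsilon>) *\<^sub>R riccati_g2 G (fst x) (fst (snd x)) (snd (snd x)) \<epsilon>)"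

lemma lob_riccati_field: "lipschitz_on_balls (riccati_field G \<epsilon>)"
  unfolding riccati_field_def[abs_def] riccati_f_def riccati_g1_def riccati_g2_def by (intro lob_intros)

lemma full_solution_reversed:
  assumes "full_solution G T \<epsilon> P11 P12 P22" "\<epsilon> \<noteq> 0" "s \<in> {0..T}"
  shows "((\<lambda>s. (P11 (T - s), P12 (T - s), P22 (T - s))) has_vector_derivative
    riccati_field G \<epsilon> (P11 (T - s), P12 (T - s), P22 (T - s))) (at s within {0..T})"
proof -
  have Ts: "T - s \<in> {0..T}" using assms by auto
  then obtain D11 D12 D22 where D:
    "(P11 has_vector_derivative D11) (at (T - s) within {0..T})"
    "(P12 has_vector_derivative D12) (at (T - s) within {0..T})"
    "(P22 has_vector_derivative D22) (at (T - s) within {0..T})"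
    "D11 + riccati_f G (P11 (T - s)) (P12 (T - s)) (P22 (T - s)) \<epsilon> = 0"
    "\<epsilon> *\<^sub>R D12 + riccati_g1 G (P11 (T - s)) (P12 (T - s)) (P22 (T - s)) \<epsilon> = 0"
    "\<epsilon> *\<^sub>R D22 + riccati_g2 G (P11 (T - s)) (P12 (T - s)) (P22 (T - s)) \<epsilon> = 0"
    using assms(1) unfolding full_solution_def by blast
  have "riccati_field G \<epsilon> (P11 (T - s), P12 (T - s), P22 (T - s)) = (- D11, - D12, - D22)"
  proof -
    have "riccati_f G (P11 (T - s)) (P12 (T - s)) (P22 (T - s)) \<epsilon> = - D11"
      "riccati_g1 G (P11 (T - s)) (P12 (T - s)) (P22 (T - s)) \<epsilon> = - (\<epsilon> *\<^sub>R D12)"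
      "riccati_g2 G (P11 (T - s)) (P12 (T - s)) (P22 (T - s)) \<epsilon> = - (\<epsilon> *\<^sub>R D22)"
      using D(4-6) by (auto simp: eq_neg_iff_add_eq_0 add.commute)
    then show ?thesis using assms(2) by (simp add: riccati_field_def)
  qed
  then show ?thesis
    by (simp only:) (intro derivative_intros has_vector_derivative_reverse D)
qed

text \<open>Reversing time makes the terminal conditions initial ones, and for fixed
  \<open>\<epsilon>\<close> the field is polynomial, so \<open>ode_unique\<close> applies.\<close>

lemma full_solution_unique:
  assumes "full_solution G T \<epsilon> P11 P12 P22" "full_solution G T \<epsilon> R11 R12 R22" "\<epsilon> \<noteq> 0" "t \<in> {0..T}"
  shows "P11 t = R11 t \<and> P12 t = R12 t \<and> P22 t = R22 t"
proof -
  have "(P11 (T - (T - t)), P12 (T - (T - t)), P22 (T - (T - t))) = (R11 (T - (T - t)), R12 (T - (T - t)), R22 (T - (T - t)))"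
    by (rule ode_unique[OF lob_riccati_field full_solution_reversed[OF assms(1,3)] full_solution_reversed[OF assms(2,3)]])
      (use assms in \<open>auto simp: full_solution_def\<close>)
  then show ?thesis by simp
qed

lemma riccati_f_sym:
  assumes "X\<^sup>T = X" "(Q1 G)\<^sup>T = Q1 G" shows "(riccati_f G X Y Z \<epsilon>)\<^sup>T = riccati_f G X Y Z \<epsilon>"
  unfolding riccati_f_def using assms by (simp add: matrix_mult_algebra algebra_simps)

lemma riccati_g2_sym:
  assumes "Z\<^sup>T = Z" "(Q2 G)\<^sup>T = Q2 G" shows "(riccati_g2 G X Y Z \<epsilon>)\<^sup>T = riccati_g2 G X Y Z \<epsilon>"
  unfolding riccati_g2_def using assms by (simp add: matrix_mult_algebra algebra_simps)

context tikhonov_data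
begin

lemma err_continuous:
  assumes "0 < \<epsilon>" "continuous_on {0..T} X1" "continuous_on {0..T} X2" "continuous_on {0..T} X3"
  shows "continuous_on {0..T} (err \<epsilon> X1 X2 X3)"
proof -
  have T: "T \<in> {0..T}" using T by auto
  have "continuous_on {0..T} a" "continuous_on {0..T} (\<lambda>s. h (a s))"
    "continuous_on {0..T} (\<lambda>s. y (s/\<epsilon>))" "continuous_on {0..T} (\<lambda>s. p (s/\<epsilon>))"
    unfolding continuous_on_eq_continuous_within
    using a_deriv ha_deriv[OF _ T] layer_deriv[OF assms(1)] has_vector_derivative_continuous by blast+
  then show ?thesis unfolding err_def[abs_def] by (intro continuous_intros assms)
qed

theorem full_system_solution:
  obtains \<epsilon>s C where "0 < \<epsilon>s" "\<epsilon>s \<le> 1" "0 \<le> C"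
    "\<And>\<epsilon>. 0 < \<epsilon> \<Longrightarrow> \<epsilon> < \<epsilon>s \<Longrightarrow> \<exists>P11 P12 P22. full_solution G T \<epsilon> P11 P12 P22
       \<and> (\<forall>s\<in>{0..T}. norm (err \<epsilon> (\<lambda>s. P11 (T - s)) (\<lambda>s. P12 (T - s)) (\<lambda>s. P22 (T - s)) s) \<le> C * \<epsilon>)"
proof -
  obtain \<eta> C where \<eta>: "0 < \<eta>" and C: "0 \<le> C"
    and est: "\<And>\<epsilon> t X1 X2 X3. 0 < \<epsilon> \<Longrightarrow> \<epsilon> \<le> 1 \<Longrightarrow> t \<in> {0..T} \<Longrightarrow> solves \<epsilon> t X1 X2 X3
     \<Longrightarrow> (\<And>s. s \<in> {0..t} \<Longrightarrow> norm (err \<epsilon> X1 X2 X3 s) \<le> \<eta>)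
     \<Longrightarrow> norm (err \<epsilon> X1 X2 X3 t) \<le> C * \<epsilon>"
    using error_estimate by blast
  obtain Ra where Ra: "\<And>s. s \<in> {0..T} \<Longrightarrow> norm (a s) \<le> Ra" using a_bounds by metis
  \<comment> \<open>The ball must contain the \<open>\<eta>\<close>-neighbourhood of the composite
    approximation, so that the projection below is inactive while the error is at most
    \<open>\<eta>\<close>.\<close>
  define R where "R = (Ra + (norm (h 0) + Lh * Ra + c) + (norm Pb22 + c)) + \<eta>"
  have Ra0: "0 \<le> Ra" using Ra[of 0] T norm_ge_zero[of "a 0"] by (meson atLeastAtMost_iff less_imp_le order_refl order_trans)
  have R0: "0 \<le> R" unfolding R_def using Ra0 c \<eta> Lh_nonneg by simp
  \<comment> \<open>Makes \<open>C * \<epsilon> < \<eta>\<close>; one is added to cover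
    \<open>C = 0\<close>.\<close>
  define \<epsilon>s where "\<epsilon>s = min 1 (\<eta> / (C + 1))"
  have \<epsilon>s: "0 < \<epsilon>s" "\<epsilon>s \<le> 1" using \<eta> C by (auto simp: \<epsilon>s_def)
  have "\<exists>P11 P12 P22. full_solution G T \<epsilon> P11 P12 P22
       \<and> (\<forall>s\<in>{0..T}. norm (err \<epsilon> (\<lambda>s. P11 (T - s)) (\<lambda>s. P12 (T - s)) (\<lambda>s. P22 (T - s)) s) \<le> C * \<epsilon>)"
    if \<epsilon>: "0 < \<epsilon>" "\<epsilon> < \<epsilon>s" for \<epsilon>
  proof -
    have \<epsilon>1: "\<epsilon> \<le> 1" using \<epsilon> \<epsilon>s by simp
    have C\<epsilon>: "C * \<epsilon> < \<eta>"
    proof -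
      have "\<epsilon> < \<eta> / (C + 1)" using \<epsilon> by (simp add: \<epsilon>s_def)
      then have "\<epsilon> * (C + 1) < \<eta>" using C by (simp add: pos_less_divide_eq)
      then show ?thesis using \<epsilon> by (simp add: algebra_simps)
    qed
    \<comment> \<open>Only the diagonal blocks are constrained to be symmetric. The projection then
      delivers symmetric velocities for them, which keeps these blocks symmetric before the
      projection is known to be inactive.\<close>
    define K where "K = cball 0 R \<inter> ((symmetric_matrices :: (real^'a^'a) set) \<times> (UNIV :: (real^'b^'a) set) \<times> (symmetric_matrices :: (real^'b^'b) set))"
    have sub: "subspace ((symmetric_matrices :: (real^'a^'a) set) \<times> (UNIV :: (real^'b^'a) set) \<times> (symmetric_matrices :: (real^'b^'b) set))"
      by (intro subspace_Times symmetric_matrices_subspace subspace_UNIV)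
    have K: "convex K" "closed K" "K \<noteq> {}"
    proof -
      show "convex K" "closed K"
        unfolding K_def by (intro convex_Int convex_cball subspace_imp_convex closed_Int closed_cball sub closed_subspace)+
      have "0 \<in> K" using R0 subspace_0[OF sub] by (simp add: K_def)
      then show "K \<noteq> {}" by blast
    qed
    define \<rho> where "\<rho> = closest_point K"
    have \<rho>K: "\<rho> x \<in> K" for x unfolding \<rho>_def by (rule closest_point_in_set[OF K(2,3)])
    have \<rho>id: "x \<in> K \<Longrightarrow> \<rho> x = x" for x unfolding \<rho>_def by (rule closest_point_self)
    have Kn: "norm (\<rho> x) \<le> R" "(fst (\<rho> x))\<^sup>T = fst (\<rho> x)" "(snd (snd (\<rho> x)))\<^sup>T = snd (snd (\<rho> x))" for x
      using \<rho>K[of x] by (auto simp: K_def symmetric_matrices_def)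
    obtain L where L: "L \<ge> 0"
      "\<And>x y. norm x \<le> R \<Longrightarrow> norm y \<le> R \<Longrightarrow> norm (riccati_field G \<epsilon> x - riccati_field G \<epsilon> y) \<le> L * norm (x - y)"
      using lobE[OF lob_riccati_field, where R = R] by blast
    have lip: "norm (riccati_field G \<epsilon> (\<rho> x) - riccati_field G \<epsilon> (\<rho> y)) \<le> L * norm (x - y)" for x y
    proof -
      have "norm (riccati_field G \<epsilon> (\<rho> x) - riccati_field G \<epsilon> (\<rho> y)) \<le> L * norm (\<rho> x - \<rho> y)" by (intro L Kn)
      also have "norm (\<rho> x - \<rho> y) \<le> norm (x - y)"
        using closest_point_lipschitz[OF K, of x y] by (simp add: \<rho>_def dist_norm)
      finally show ?thesis using L(1) by (simp add: mult_left_mono)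
    qed
    obtain x where x0: "x 0 = 0"
      and x: "\<And>t. t \<ge> 0 \<Longrightarrow> (x has_vector_derivative riccati_field G \<epsilon> (\<rho> (x t))) (at t within {0..})"
      using picard_lindeloef_halfline[of "\<lambda>_ x. riccati_field G \<epsilon> (\<rho> x)" L "norm (riccati_field G \<epsilon> (\<rho> 0))" 0] lip by auto
    define X1 X2 X3 where "X1 s = fst (x s)" and "X2 s = fst (snd (x s))" and "X3 s = snd (snd (x s))" for s
    define F where "F s = riccati_field G \<epsilon> (\<rho> (x s))" for s
    have Xd: "(X1 has_vector_derivative fst (F s)) (at s within {0..})"
      "(X2 has_vector_derivative fst (snd (F s))) (at s within {0..})"
      "(X3 has_vector_derivative snd (snd (F s))) (at s within {0..})" if "0 \<le> s" for s
    proof -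
      note d2 = bounded_linear.has_vector_derivative[OF bounded_linear_snd x[OF that]]
      show "(X1 has_vector_derivative fst (F s)) (at s within {0..})"
        unfolding X1_def[abs_def] F_def by (rule bounded_linear.has_vector_derivative[OF bounded_linear_fst x[OF that]])
      show "(X2 has_vector_derivative fst (snd (F s))) (at s within {0..})"
        unfolding X2_def[abs_def] F_def by (rule bounded_linear.has_vector_derivative[OF bounded_linear_fst d2])
      show "(X3 has_vector_derivative snd (snd (F s))) (at s within {0..})"
        unfolding X3_def[abs_def] F_def by (rule bounded_linear.has_vector_derivative[OF bounded_linear_snd d2])
    qed
    have sym: "(X1 s)\<^sup>T = X1 s" "(X3 s)\<^sup>T = X3 s" if "0 \<le> s" for s
    proof -
      show "(X1 s)\<^sup>T = X1 s"
        by (rule has_vector_derivative_symmetric[OF Xd(1) _ _ that])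
          (auto simp: F_def riccati_field_def X1_def x0 riccati_f_sym Kn)
      show "(X3 s)\<^sup>T = X3 s"
        by (rule has_vector_derivative_symmetric[OF Xd(3) _ _ that])
          (auto simp: F_def riccati_field_def X3_def x0 riccati_g2_sym Kn)
    qed
    have inK: "x s \<in> K" if s: "s \<in> {0..T}" and small: "norm (err \<epsilon> X1 X2 X3 s) \<le> \<eta>" for s
    proof -
      define z where "z = (a s, h (a s) + y (s/\<epsilon>), Pb22 + p (s/\<epsilon>))"
      have "x s = z + err \<epsilon> X1 X2 X3 s" by (simp add: z_def err_def X1_def X2_def X3_def prod_eq_iff)
      then have "norm (x s) \<le> norm z + norm (err \<epsilon> X1 X2 X3 s)" by (metis norm_triangle_ineq)
      moreover have "norm z \<le> norm (a s) + (norm (h (a s) + y (s/\<epsilon>)) + norm (Pb22 + p (s/\<epsilon>)))"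
        unfolding z_def by (intro order_trans[OF norm_Pair_le add_left_mono] norm_Pair_le)
      moreover have "norm (a s) \<le> Ra" "norm (h (a s)) \<le> norm (h 0) + Lh * Ra" "norm (y (s/\<epsilon>)) \<le> c" "norm (p (s/\<epsilon>)) \<le> c"
        using Ra[OF s] ha_bound[OF Ra[OF s]] layer_bound[of "s/\<epsilon>"] s \<epsilon> by auto
      ultimately have "norm (x s) \<le> R"
        using small norm_triangle_ineq[of "h (a s)" "y (s/\<epsilon>)"] norm_triangle_ineq[of Pb22 "p (s/\<epsilon>)"] by (simp add: R_def)
      moreover have "x s = (X1 s, X2 s, X3 s)" by (simp add: X1_def X2_def X3_def)
      ultimately show ?thesis using sym[of s] s by (auto simp: K_def symmetric_matrices_def)
    qed
    have sol: "solves \<epsilon> t X1 X2 X3" if t: "t \<in> {0..T}" and small: "\<And>s. s \<in> {0..t} \<Longrightarrow> norm (err \<epsilon> X1 X2 X3 s) \<le> \<eta>" for t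
      unfolding solves_def
    proof (intro conjI ballI)
      fix s assume s: "s \<in> {0..t}"
      then have "F s = riccati_field G \<epsilon> (x s)"
        using \<rho>id[OF inK[of s]] small[OF s] t by (auto simp: F_def)
      then have F: "F s = (riccati_f G (X1 s) (X2 s) (X3 s) \<epsilon>, (1/\<epsilon>) *\<^sub>R riccati_g1 G (X1 s) (X2 s) (X3 s) \<epsilon>,
          (1/\<epsilon>) *\<^sub>R riccati_g2 G (X1 s) (X2 s) (X3 s) \<epsilon>)"
        by (simp add: riccati_field_def X1_def X2_def X3_def)
      have s0: "0 \<le> s" and sub: "{0..t} \<subseteq> {0..}" using s by auto
      show "(X1 has_vector_derivative riccati_f G (X1 s) (X2 s) (X3 s) \<epsilon>) (at s within {0..t})"
        "(X2 has_vector_derivative (1/\<epsilon>) *\<^sub>R riccati_g1 G (X1 s) (X2 s) (X3 s) \<epsilon>) (at s within {0..t})"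
        "(X3 has_vector_derivative (1/\<epsilon>) *\<^sub>R riccati_g2 G (X1 s) (X2 s) (X3 s) \<epsilon>) (at s within {0..t})"
        using Xd[OF s0, THEN has_vector_derivative_within_subset, OF sub] by (simp_all add: F)
      show "(X3 s)\<^sup>T = X3 s" using sym s0 by simp
    qed (auto simp: X1_def X2_def X3_def x0)
    have Xc: "continuous_on {0..T} X1" "continuous_on {0..T} X2" "continuous_on {0..T} X3"
    proof -
      have sub: "{0..T} \<subseteq> {0..}" by auto
      have "continuous_on {0..} X1" "continuous_on {0..} X2" "continuous_on {0..} X3"
        unfolding continuous_on_eq_continuous_within
        using Xd has_vector_derivative_continuous by (metis atLeast_iff)+
      then show "continuous_on {0..T} X1" "continuous_on {0..T} X2" "continuous_on {0..T} X3"
        using sub continuous_on_subset by blast+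
    qed
    \<comment> \<open>While the error is at most \<open>\<eta>\<close> the path solves the true
      system, and then \<open>est\<close> gives the strictly better
      \<open>C * \<epsilon>\<close>.\<close>
    have small: "norm (err \<epsilon> X1 X2 X3 t) < \<eta>" if t: "t \<in> {0..T}" for t
    proof (rule bootstrap_bound[where \<phi> = "\<lambda>s. norm (err \<epsilon> X1 X2 X3 s)", OF _ _ _ t])
      show "continuous_on {0..T} (\<lambda>s. norm (err \<epsilon> X1 X2 X3 s))"
        by (intro continuous_intros err_continuous \<epsilon> Xc)
      have "err \<epsilon> X1 X2 X3 0 = 0"
        using layer a_0 by (simp add: err_def X1_def X2_def X3_def x0 boundary_layer_solution_def zero_prod_def)
      then show "norm (err \<epsilon> X1 X2 X3 0) < \<eta>" using \<eta> by simp
      fix s assume s: "s \<in> {0..T}" "\<And>r. r \<in> {0..s} \<Longrightarrow> norm (err \<epsilon> X1 X2 X3 r) \<le> \<eta>"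
      have "norm (err \<epsilon> X1 X2 X3 s) \<le> C * \<epsilon>"
        by (rule est[OF \<epsilon>(1) \<epsilon>1 s(1) sol[OF s] s(2)])
      then show "norm (err \<epsilon> X1 X2 X3 s) < \<eta>" using C\<epsilon> by simp
    qed
    have errC: "norm (err \<epsilon> X1 X2 X3 t) \<le> C * \<epsilon>" if t: "t \<in> {0..T}" for t
    proof (rule est[OF \<epsilon>(1) \<epsilon>1 t])
      show "solves \<epsilon> t X1 X2 X3" using t small by (intro sol) (auto intro: less_imp_le)
      show "norm (err \<epsilon> X1 X2 X3 s) \<le> \<eta>" if "s \<in> {0..t}" for s
        using small[of s] that t by auto
    qed
    have solT: "solves \<epsilon> T X1 X2 X3" using T small by (intro sol) (auto intro: less_imp_le)
    have "full_solution G T \<epsilon> (\<lambda>t. X1 (T - t)) (\<lambda>t. X2 (T - t)) (\<lambda>t. X3 (T - t))"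
      unfolding full_solution_def
    proof (intro conjI ballI)
      fix t assume t: "t \<in> {0..T}"
      then have Tt: "T - t \<in> {0..T}" by auto
      show "X1 (T - t) \<in> symmetric_matrices" "X3 (T - t) \<in> symmetric_matrices"
        using sym[of "T - t"] Tt by (auto simp: symmetric_matrices_def)
      let ?f = "riccati_f G (X1 (T - t)) (X2 (T - t)) (X3 (T - t)) \<epsilon>"
      let ?g1 = "riccati_g1 G (X1 (T - t)) (X2 (T - t)) (X3 (T - t)) \<epsilon>"
      let ?g2 = "riccati_g2 G (X1 (T - t)) (X2 (T - t)) (X3 (T - t)) \<epsilon>"
      have "(X1 has_vector_derivative ?f) (at (T - t) within {0..T})"
        "(X2 has_vector_derivative (1/\<epsilon>) *\<^sub>R ?g1) (at (T - t) within {0..T})"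
        "(X3 has_vector_derivative (1/\<epsilon>) *\<^sub>R ?g2) (at (T - t) within {0..T})"
        using solT Tt unfolding solves_def by auto
      note d = this[THEN has_vector_derivative_reverse]
      show "\<exists>D11 D12 D22. ((\<lambda>t. X1 (T - t)) has_vector_derivative D11) (at t within {0..T})
         \<and> ((\<lambda>t. X2 (T - t)) has_vector_derivative D12) (at t within {0..T})
         \<and> ((\<lambda>t. X3 (T - t)) has_vector_derivative D22) (at t within {0..T})
         \<and> D11 + ?f = 0 \<and> \<epsilon> *\<^sub>R D12 + ?g1 = 0 \<and> \<epsilon> *\<^sub>R D22 + ?g2 = 0"
        using d \<epsilon> by (intro exI[of _ "- ?f"] exI[of _ "- ((1/\<epsilon>) *\<^sub>R ?g1)"] exI[of _ "- ((1/\<epsilon>) *\<^sub>R ?g2)"]) simp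
    qed (auto simp: X1_def X2_def X3_def x0)
    moreover have "err \<epsilon> (\<lambda>s. X1 (T - (T - s))) (\<lambda>s. X2 (T - (T - s))) (\<lambda>s. X3 (T - (T - s))) = err \<epsilon> X1 X2 X3"
      by simp
    ultimately show ?thesis using errC
      by (intro exI[of _ "\<lambda>t. X1 (T - t)"] exI[of _ "\<lambda>t. X2 (T - t)"] exI[of _ "\<lambda>t. X3 (T - t)"]) auto
  qed
  then show thesis using \<epsilon>s C that by blast
qed

text \<open>Uniqueness transfers the estimate from the constructed solution to every solution. The
  bounds are stated again with \<open>y\<close> and \<open>p\<close>, because
  \<open>tikhonov_threshold\<close> hides the layer behind an existential quantifier while the cost
  estimate relies on its decay.\<close>

theorem tikhonov:
  obtains \<epsilon>s C where "tikhonov_threshold G T Pb22 Pb11 \<epsilon>s" "0 \<le> C"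
    "\<And>\<epsilon> P11 P12 P22 t. 0 < \<epsilon> \<Longrightarrow> \<epsilon> < \<epsilon>s \<Longrightarrow> full_solution G T \<epsilon> P11 P12 P22 \<Longrightarrow> t \<in> {0..T} \<Longrightarrow>
        norm (P11 t - Pb11 t) \<le> C * \<epsilon>
      \<and> norm (P12 t - h (Pb11 t) - y ((T - t) / \<epsilon>)) \<le> C * \<epsilon>
      \<and> norm (P22 t - Pb22 - p ((T - t) / \<epsilon>)) \<le> C * \<epsilon>"
proof -
  obtain \<epsilon>s C where \<epsilon>s: "0 < \<epsilon>s" "\<epsilon>s \<le> 1" "0 \<le> C"
    and ex: "\<And>\<epsilon>. 0 < \<epsilon> \<Longrightarrow> \<epsilon> < \<epsilon>s \<Longrightarrow> \<exists>P11 P12 P22. full_solution G T \<epsilon> P11 P12 P22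
       \<and> (\<forall>s\<in>{0..T}. norm (err \<epsilon> (\<lambda>s. P11 (T - s)) (\<lambda>s. P12 (T - s)) (\<lambda>s. P22 (T - s)) s) \<le> C * \<epsilon>)"
    using full_system_solution by blast
  have est: "norm (P11 t - Pb11 t) \<le> C * \<epsilon>
      \<and> norm (P12 t - h (Pb11 t) - y ((T - t) / \<epsilon>)) \<le> C * \<epsilon>
      \<and> norm (P22 t - Pb22 - p ((T - t) / \<epsilon>)) \<le> C * \<epsilon>"
    if "0 < \<epsilon>" "\<epsilon> < \<epsilon>s" and sol: "full_solution G T \<epsilon> P11 P12 P22" and t: "t \<in> {0..T}" for \<epsilon> P11 P12 P22 t
  proof -
    obtain R11 R12 R22 where R: "full_solution G T \<epsilon> R11 R12 R22"
      "\<forall>s\<in>{0..T}. norm (err \<epsilon> (\<lambda>s. R11 (T - s)) (\<lambda>s. R12 (T - s)) (\<lambda>s. R22 (T - s)) s) \<le> C * \<epsilon>"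
      using ex[OF \<open>0 < \<epsilon>\<close> \<open>\<epsilon> < \<epsilon>s\<close>] by blast
    have eq: "P11 t = R11 t" "P12 t = R12 t" "P22 t = R22 t"
      using full_solution_unique[OF sol R(1) _ t] \<open>0 < \<epsilon>\<close> by auto
    have "norm (err \<epsilon> (\<lambda>s. R11 (T - s)) (\<lambda>s. R12 (T - s)) (\<lambda>s. R22 (T - s)) (T - t)) \<le> C * \<epsilon>"
      using R(2) t by auto
    then have "norm (P11 t - Pb11 t, P12 t - (h (Pb11 t) + y ((T - t) / \<epsilon>)), P22 t - (Pb22 + p ((T - t) / \<epsilon>))) \<le> C * \<epsilon>"
      by (simp add: err_def a_def eq)
    from order_trans[OF norm_triple_ge(1) this] order_trans[OF norm_triple_ge(2) this] order_trans[OF norm_triple_ge(3) this]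
    show ?thesis by (simp add: algebra_simps)
  qed
  have "tikhonov_threshold G T Pb22 Pb11 \<epsilon>s"
    unfolding tikhonov_threshold_def
  proof (intro conjI allI impI \<epsilon>s)
    show "\<exists>P11 P12 P22. full_unique_solution G T \<epsilon> P11 P12 P22" if e: "0 < \<epsilon> \<and> \<epsilon> < \<epsilon>s" for \<epsilon>
    proof -
      obtain P11 P12 P22 where P: "full_solution G T \<epsilon> P11 P12 P22" using ex[of \<epsilon>] e by blast
      have "full_unique_solution G T \<epsilon> P11 P12 P22"
        unfolding full_unique_solution_def using full_solution_unique[OF _ P] e P by blast
      then show ?thesis by blast
    qed
    show "\<exists>Ph12 Ph22. boundary_layer_solution G Pb22 Ph12 Ph22
         \<and> (\<exists>C. \<forall>\<epsilon> P11 P12 P22. 0 < \<epsilon> \<and> \<epsilon> < \<epsilon>s \<and> full_solution G T \<epsilon> P11 P12 P22 \<longrightarrow>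
              (\<forall>t\<in>{0..T}.
                 norm (P11 t - Pb11 t) \<le> C * \<epsilon>
               \<and> norm (P12 t - h (Pb11 t) - Ph12 ((T - t) / \<epsilon>)) \<le> C * \<epsilon>
               \<and> norm (P22 t - Pb22 - Ph22 ((T - t) / \<epsilon>)) \<le> C * \<epsilon>))"
      using layer est by (intro exI[of _ y] exI[of _ p] exI[of _ C] conjI) auto
  qed
  then show thesis using est \<epsilon>s(3) that by blast
qed

end

section \<open>Linear equations with additive noise\<close>

text \<open>A limit of processes that are constant in time between grid points; this joint
  measurability is what Fubini's theorem asks for later.\<close>

lemma borel_measurable_continuous_paths:
  fixes V :: "real \<Rightarrow> 'o \<Rightarrow> 'a::euclidean_space"
  assumes T: "0 \<le> T" and meas: "\<And>t. t \<in> {0..T} \<Longrightarrow> V t \<in> borel_measurable N"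
    and cont: "\<And>\<omega>. \<omega> \<in> space N \<Longrightarrow> continuous_on {0..T} (\<lambda>t. V t \<omega>)"
  shows "(\<lambda>(t, \<omega>). indicator {0..T} t *\<^sub>R V t \<omega>) \<in> borel_measurable (borel \<Otimes>\<^sub>M N)"
proof -
  \<comment> \<open>Clamping keeps the grid points inside \<open>{0..T}\<close>, where the paths are
    known to be continuous.\<close>
  define cl where "cl t = max 0 (min T t)" for t
  have cl: "cl t \<in> {0..T}" for t using T by (auto simp: cl_def)
  have clc: "continuous_on UNIV cl" unfolding cl_def by (intro continuous_intros)
  have [measurable]: "V (cl t) \<in> borel_measurable N" for t using meas cl by blast
  define W where "W n = (\<lambda>(t, \<omega>). V (cl (real_of_int \<lfloor>t * real (Suc n)\<rfloor> / real (Suc n))) \<omega>)" for n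
  have "W n \<in> borel_measurable (borel \<Otimes>\<^sub>M N)" for n
  proof -
    have "(\<lambda>x. (\<lambda>i x. V (cl (real_of_int i / real (Suc n))) (snd x)) (\<lfloor>fst x * real (Suc n)\<rfloor>) x) \<in> borel_measurable (borel \<Otimes>\<^sub>M N)"
      by (rule measurable_compose_countable) measurable
    then show ?thesis unfolding W_def by (simp add: case_prod_beta')
  qed
  moreover have "(\<lambda>n. W n x) \<longlonglongrightarrow> (case x of (t, \<omega>) \<Rightarrow> V (cl t) \<omega>)" if x: "x \<in> space (borel \<Otimes>\<^sub>M N)" for x
  proof -
    obtain t \<omega> where [simp]: "x = (t, \<omega>)" by (cases x)
    have \<omega>: "\<omega> \<in> space N" using x by (simp add: space_pair_measure)
    have "(\<lambda>n. real_of_int \<lfloor>t * real (Suc n)\<rfloor> / real (Suc n)) \<longlonglongrightarrow> t"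
    proof (rule tendsto_sandwich[where f = "\<lambda>n. t - 1 / real (Suc n)" and h = "\<lambda>_. t"])
      show "\<forall>\<^sub>F n in sequentially. t - 1 / real (Suc n) \<le> real_of_int \<lfloor>t * real (Suc n)\<rfloor> / real (Suc n)"
      proof (intro always_eventually allI)
        fix n
        have "t * real (Suc n) - 1 \<le> real_of_int \<lfloor>t * real (Suc n)\<rfloor>" by linarith
        then have "(t * real (Suc n) - 1) / real (Suc n) \<le> real_of_int \<lfloor>t * real (Suc n)\<rfloor> / real (Suc n)"
          by (intro divide_right_mono) auto
        then show "t - 1 / real (Suc n) \<le> real_of_int \<lfloor>t * real (Suc n)\<rfloor> / real (Suc n)"
          by (simp add: diff_divide_distrib)
      qed
      show "\<forall>\<^sub>F n in sequentially. real_of_int \<lfloor>t * real (Suc n)\<rfloor> / real (Suc n) \<le> t"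
        by (intro always_eventually allI) (simp add: divide_le_eq)
      have "(\<lambda>n. t - inverse (real (Suc n))) \<longlonglongrightarrow> t - 0"
        by (intro tendsto_intros LIMSEQ_inverse_real_of_nat)
      then show "(\<lambda>n. t - 1 / real (Suc n)) \<longlonglongrightarrow> t" by (simp add: inverse_eq_divide)
    qed auto
    moreover have "continuous_on UNIV (\<lambda>t. V (cl t) \<omega>)"
      by (rule continuous_on_compose2[OF cont[OF \<omega>] clc]) (use cl in auto)
    ultimately have "(\<lambda>n. V (cl (real_of_int \<lfloor>t * real (Suc n)\<rfloor> / real (Suc n))) \<omega>) \<longlonglongrightarrow> V (cl t) \<omega>"
      by (intro continuous_on_tendsto_compose[where f = "\<lambda>t. V (cl t) \<omega>"]) auto
    then show ?thesis by (simp add: W_def)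
  qed
  ultimately have [measurable]: "(\<lambda>(t, \<omega>). V (cl t) \<omega>) \<in> borel_measurable (borel \<Otimes>\<^sub>M N)"
    by (rule borel_measurable_LIMSEQ_metric)
  have "(\<lambda>(t, \<omega>). indicator {0..T} t *\<^sub>R V t \<omega>) = (\<lambda>x. indicator {0..T} (fst x) *\<^sub>R (case x of (t, \<omega>) \<Rightarrow> V (cl t) \<omega>))"
    by (auto simp: fun_eq_iff indicator_def cl_def)
  then show ?thesis by simp
qed

lemma borel_measurable_time_integral:
  fixes V :: "real \<Rightarrow> 'o \<Rightarrow> 'a::euclidean_space"
  assumes T: "0 \<le> T" and meas: "\<And>t. t \<in> {0..T} \<Longrightarrow> V t \<in> borel_measurable N"
    and cont: "\<And>\<omega>. \<omega> \<in> space N \<Longrightarrow> continuous_on {0..T} (\<lambda>t. V t \<omega>)"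
  shows "(\<lambda>\<omega>. LINT s:{0..T}|lborel. V s \<omega>) \<in> borel_measurable N"
proof -
  have "(\<lambda>(t, \<omega>). indicator {0..T} t *\<^sub>R V t \<omega>) \<in> borel_measurable (lborel \<Otimes>\<^sub>M N)"
    using borel_measurable_continuous_paths[OF assms] by simp
  from measurable_pair_swap[OF this]
  have "(\<lambda>(\<omega>, t). indicator {0..T} t *\<^sub>R V t \<omega>) \<in> borel_measurable (N \<Otimes>\<^sub>M lborel)"
    by (simp add: case_prod_beta')
  then show ?thesis
    unfolding set_lebesgue_integral_def
    by (intro lborel.borel_measurable_lebesgue_integral) (simp add: case_prod_beta')
qed

lemma LINT_eq_integral:
  fixes f :: "real \<Rightarrow> 'a::euclidean_space"
  assumes "continuous_on {a..b} f"
  shows "(LINT s:{a..b}|lborel. f s) = integral {a..b} f"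
  by (rule set_borel_integral_eq_integral(2)[OF borel_integrable_atLeastAtMost'[OF assms]])

lemma LINT_has_vector_derivative:
  fixes f :: "real \<Rightarrow> 'a::euclidean_space"
  assumes f: "continuous_on {0..T} f" and t: "t \<in> {0..T}"
  shows "((\<lambda>t. LINT s:{0..t}|lborel. f s) has_vector_derivative f t) (at t within {0..T})"
proof (rule has_vector_derivative_transform[OF t])
  show "((\<lambda>t. integral {0..t} f) has_vector_derivative f t) (at t within {0..T})"
    by (rule integral_has_vector_derivative[OF f t])
  show "\<And>r. r \<in> {0..T} \<Longrightarrow> (LINT s:{0..r}|lborel. f s) = integral {0..r} f"
    by (intro LINT_eq_integral continuous_on_subset[OF f]) auto
qed

lemma LINT_FTC:
  fixes f :: "real \<Rightarrow> 'a::euclidean_space"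
  assumes "0 \<le> t" "\<And>s. s \<in> {0..t} \<Longrightarrow> (F has_vector_derivative f s) (at s within {0..t})"
    "continuous_on {0..t} f"
  shows "(LINT s:{0..t}|lborel. f s) = F t - F 0"
  unfolding LINT_eq_integral[OF assms(3)]
  by (rule integral_unique[OF fundamental_theorem_of_calculus[OF assms(1,2)]])

text \<open>Cauchy-Schwarz in time, obtained from the nonnegative integral of
  \<open>(norm (f s) - I / t)\<^sup>2\<close> with \<open>I\<close> the integral of
  \<open>norm (f s)\<close>.\<close>

lemma LINT_norm_square_le:
  fixes f :: "real \<Rightarrow> 'a::euclidean_space"
  assumes t: "0 \<le> t" and f: "continuous_on {0..t} f"
  shows "(norm (LINT s:{0..t}|lborel. f s))\<^sup>2 \<le> t * (LINT s:{0..t}|lborel. (norm (f s))\<^sup>2)"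
proof (cases "t = 0")
  case True
  have "(LINT s:{0..t}|lborel. f s) = integral {0} f" using LINT_eq_integral[OF f] True by simp
  also have "\<dots> = 0" by (rule integral_unique[OF has_integral_refl(2)])
  finally show ?thesis using True by simp
next
  case False
  with t have t: "0 < t" by simp
  have c: "continuous_on {0..t} (\<lambda>s. norm (f s))" "continuous_on {0..t} (\<lambda>s. (norm (f s))\<^sup>2)"
    by (intro continuous_intros f)+
  note i = integrable_continuous_interval[OF c(1)] integrable_continuous_interval[OF c(2)]
  define I where "I = integral {0..t} (\<lambda>s. norm (f s))"
  define J where "J = integral {0..t} (\<lambda>s. (norm (f s))\<^sup>2)"
  have le: "norm (integral {0..t} f) \<le> I"
    unfolding I_def using integrable_continuous_interval[OF f] i(1) by (intro integral_norm_bound_integral) auto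
  have "((\<lambda>s. (norm (f s))\<^sup>2 - 2 * (I/t) * norm (f s) + (I/t)\<^sup>2) has_integral (J - 2 * (I/t) * I + (I/t)\<^sup>2 * t)) {0..t}"
    unfolding I_def J_def using t has_integral_const_real[of "(I/t)\<^sup>2" 0 t]
    by (intro has_integral_add has_integral_diff has_integral_mult_right integrable_integral i)
      (simp add: mult.commute I_def)
  then have "0 \<le> J - 2 * (I/t) * I + (I/t)\<^sup>2 * t"
  proof (rule has_integral_nonneg)
    fix s show "0 \<le> (norm (f s))\<^sup>2 - 2 * (I/t) * norm (f s) + (I/t)\<^sup>2"
      using zero_le_power2[of "norm (f s) - I/t"] by (simp add: power2_diff mult_ac)
  qed
  also have "J - 2 * (I/t) * I + (I/t)\<^sup>2 * t = J - I\<^sup>2 / t"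
    using t by (simp add: power2_eq_square field_simps)
  finally have "I\<^sup>2 \<le> t * J" using t by (simp add: field_simps)
  moreover have "(norm (integral {0..t} f))\<^sup>2 \<le> I\<^sup>2" using le by (intro power_mono) auto
  ultimately show ?thesis by (simp add: LINT_eq_integral f c J_def)
qed

lemma continuous_on_blinfun_bound:
  fixes H :: "real \<Rightarrow> 'a::real_normed_vector \<Rightarrow>\<^sub>L 'b::real_normed_vector"
  assumes "continuous_on {0..T} H"
  obtains K where "0 \<le> K" "\<And>t. t \<in> {0..T} \<Longrightarrow> norm (H t) \<le> K"
proof -
  obtain K where K: "\<And>t. t \<in> {0..T} \<Longrightarrow> norm (H t) \<le> K"
    using compact_imp_bounded[OF compact_continuous_image[OF assms compact_Icc]]
    by (metis bounded_iff image_eqI)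
  show thesis by (rule that[of "max K 0"]) (use K in \<open>auto simp: le_max_iff_disj\<close>)
qed

context prob_space
begin

interpretation LM: pair_sigma_finite lborel M ..

text \<open>A uniform bound on the first absolute moments makes the integrand integrable on the
  product space, after which Fubini applies.\<close>

lemma expectation_LINT:
  fixes f :: "real \<Rightarrow> 'a \<Rightarrow> real"
  assumes T: "0 \<le> T" and meas: "\<And>t. t \<in> {0..T} \<Longrightarrow> f t \<in> borel_measurable M"
    and cont: "\<And>\<omega>. \<omega> \<in> space M \<Longrightarrow> continuous_on {0..T} (\<lambda>t. f t \<omega>)"
    and int: "\<And>t. t \<in> {0..T} \<Longrightarrow> integrable M (f t)"
    and bd: "\<And>t. t \<in> {0..T} \<Longrightarrow> expectation (\<lambda>\<omega>. \<bar>f t \<omega>\<bar>) \<le> C"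
  shows "integrable (lborel \<Otimes>\<^sub>M M) (\<lambda>(t, \<omega>). indicator {0..T} t *\<^sub>R f t \<omega>)"
    "integrable M (\<lambda>\<omega>. LINT s:{0..T}|lborel. f s \<omega>)"
    "set_integrable lborel {0..T} (\<lambda>s. expectation (f s))"
    "expectation (\<lambda>\<omega>. LINT s:{0..T}|lborel. f s \<omega>) = (LINT s:{0..T}|lborel. expectation (f s))"
proof -
  define g where "g t \<omega> = indicator {0..T} t *\<^sub>R f t \<omega>" for t \<omega>
  have gm: "case_prod g \<in> borel_measurable (lborel \<Otimes>\<^sub>M M)"
    using borel_measurable_continuous_paths[OF T meas cont] by (simp add: g_def[abs_def])
  have gm': "case_prod (\<lambda>t \<omega>. norm (g t \<omega>)) \<in> borel_measurable (lborel \<Otimes>\<^sub>M M)"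
    using gm by (simp add: case_prod_beta')
  have n0: "0 \<le> C" using bd[of 0] T by (meson Bochner_Integration.integral_nonneg abs_ge_zero atLeastAtMost_iff order_refl order_trans)
  have gi: "integrable (lborel \<Otimes>\<^sub>M M) (case_prod g)"
  proof (rule LM.Fubini_integrable[OF gm])
    have "(\<lambda>t. expectation (\<lambda>\<omega>. norm (g t \<omega>))) \<in> borel_measurable lborel"
      by (rule borel_measurable_lebesgue_integral[OF gm'])
    then show "integrable lborel (\<lambda>t. \<integral>\<omega>. norm (case_prod g (t, \<omega>)) \<partial>M)"
    proof (intro integrableI_bounded_set[where A = "{0..T}" and B = C])
      show "AE t in lborel. t \<in> {0..T} \<longrightarrow> norm (\<integral>\<omega>. norm (case_prod g (t, \<omega>)) \<partial>M) \<le> C"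
        using bd by (auto simp: g_def)
      show "AE t in lborel. t \<notin> {0..T} \<longrightarrow> (\<integral>\<omega>. norm (case_prod g (t, \<omega>)) \<partial>M) = 0"
        by (auto simp: g_def)
    qed (auto simp: emeasure_lborel_Icc_eq)
    show "AE t in lborel. integrable M (\<lambda>\<omega>. case_prod g (t, \<omega>))"
      using int by (intro AE_I2) (auto simp: g_def indicator_def)
  qed
  then show "integrable (lborel \<Otimes>\<^sub>M M) (\<lambda>(t, \<omega>). indicator {0..T} t *\<^sub>R f t \<omega>)" by (simp add: g_def[abs_def])
  show "integrable M (\<lambda>\<omega>. LINT s:{0..T}|lborel. f s \<omega>)"
    using LM.integrable_snd[OF gi] by (simp add: g_def set_lebesgue_integral_def)
  have Eg: "expectation (g t) = indicator {0..T} t *\<^sub>R expectation (f t)" for t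
    by (simp add: g_def[abs_def])
  show "set_integrable lborel {0..T} (\<lambda>s. expectation (f s))"
    using LM.integrable_fst[OF gi] unfolding set_integrable_def Eg .
  show "expectation (\<lambda>\<omega>. LINT s:{0..T}|lborel. f s \<omega>) = (LINT s:{0..T}|lborel. expectation (f s))"
    using LM.Fubini_integral[OF gi] unfolding set_lebesgue_integral_def Eg by (simp add: g_def)
qed

end

section \<open>Second moments of processes driven by white noise\<close>

lemma norm_add_square_le: "(norm (x + y))\<^sup>2 \<le> 2 * (norm x)\<^sup>2 + 2 * (norm (y :: 'a::real_inner))\<^sup>2"
proof -
  have "0 \<le> (norm (x - y))\<^sup>2" by simp
  then show ?thesis by (simp add: power2_norm_eq_inner inner_add inner_diff inner_commute)
qed

lemma (in prob_space) integrable_inner_of_square: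
  fixes V W :: "'a \<Rightarrow> 'b::euclidean_space"
  assumes [measurable]: "V \<in> borel_measurable M" "W \<in> borel_measurable M"
    and i: "integrable M (\<lambda>\<omega>. (norm (V \<omega>))\<^sup>2)" "integrable M (\<lambda>\<omega>. (norm (W \<omega>))\<^sup>2)"
  shows "integrable M (\<lambda>\<omega>. V \<omega> \<bullet> W \<omega>)"
    "expectation (\<lambda>\<omega>. \<bar>V \<omega> \<bullet> W \<omega>\<bar>) \<le> expectation (\<lambda>\<omega>. (norm (V \<omega>))\<^sup>2) + expectation (\<lambda>\<omega>. (norm (W \<omega>))\<^sup>2)"
proof -
  have b: "\<bar>v \<bullet> w\<bar> \<le> (norm v)\<^sup>2 + (norm w)\<^sup>2" for v w :: 'b
  proof -
    have "\<bar>v \<bullet> w\<bar> \<le> norm v * norm w" by (rule Cauchy_Schwarz_ineq2)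
    moreover have "0 \<le> norm v * norm w" by simp
    moreover have "2 * (norm v * norm w) \<le> (norm v)\<^sup>2 + (norm w)\<^sup>2"
      using sum_squares_bound[of "norm v" "norm w"] by simp
    ultimately show ?thesis by linarith
  qed
  have s: "integrable M (\<lambda>\<omega>. (norm (V \<omega>))\<^sup>2 + (norm (W \<omega>))\<^sup>2)" using i by simp
  show 1: "integrable M (\<lambda>\<omega>. V \<omega> \<bullet> W \<omega>)"
    by (rule Bochner_Integration.integrable_bound[OF s]) (use b in \<open>auto intro!: AE_I2\<close>)
  have "expectation (\<lambda>\<omega>. \<bar>V \<omega> \<bullet> W \<omega>\<bar>) \<le> expectation (\<lambda>\<omega>. (norm (V \<omega>))\<^sup>2 + (norm (W \<omega>))\<^sup>2)"
    using 1 s b by (intro integral_mono) auto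
  also have "\<dots> = expectation (\<lambda>\<omega>. (norm (V \<omega>))\<^sup>2) + expectation (\<lambda>\<omega>. (norm (W \<omega>))\<^sup>2)"
    using i by (rule Bochner_Integration.integral_add)
  finally show "expectation (\<lambda>\<omega>. \<bar>V \<omega> \<bullet> W \<omega>\<bar>) \<le> expectation (\<lambda>\<omega>. (norm (V \<omega>))\<^sup>2) + expectation (\<lambda>\<omega>. (norm (W \<omega>))\<^sup>2)" .
qed

text \<open>Brownian noise enters through its first two moments: \<open>N_cov\<close> expresses
  uncorrelated increments whose covariance per unit time is \<open>cov\<close>. Continuity is
  demanded for every \<open>\<omega>\<close>, which is why irregular paths are later replaced by
  zero.\<close>

locale white_noise = prob_space M for M :: "'o measure" +
  fixes T :: real and N :: "real \<Rightarrow> 'o \<Rightarrow> 'a::euclidean_space" and cov :: "'a \<Rightarrow> 'a \<Rightarrow> real"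
  assumes T: "0 \<le> T"
    and N_meas: "\<And>t. t \<in> {0..T} \<Longrightarrow> N t \<in> borel_measurable M"
    and N_cont: "\<And>\<omega>. \<omega> \<in> space M \<Longrightarrow> continuous_on {0..T} (\<lambda>t. N t \<omega>)"
    and N_sq: "\<And>t. t \<in> {0..T} \<Longrightarrow> integrable M (\<lambda>\<omega>. (norm (N t \<omega>))\<^sup>2)"
    and N_mean: "\<And>t a. t \<in> {0..T} \<Longrightarrow> expectation (\<lambda>\<omega>. N t \<omega> \<bullet> a) = 0"
    and N_cov: "\<And>s t a b. s \<in> {0..T} \<Longrightarrow> t \<in> {0..T} \<Longrightarrow> expectation (\<lambda>\<omega>. (N s \<omega> \<bullet> a) * (N t \<omega> \<bullet> b)) = min s t * cov a b"
begin

text \<open>Square integrable continuous processes that are orthogonal to the future increments of the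
  noise; in the absence of stochastic integrals this is all that adaptedness is needed for.\<close>

definition nonant :: "(real \<Rightarrow> 'o \<Rightarrow> 'a) \<Rightarrow> bool" where
  "nonant V \<longleftrightarrow> (\<forall>t\<in>{0..T}. V t \<in> borel_measurable M)
     \<and> (\<forall>\<omega>\<in>space M. continuous_on {0..T} (\<lambda>t. V t \<omega>))
     \<and> (\<exists>C. \<forall>t\<in>{0..T}. integrable M (\<lambda>\<omega>. (norm (V t \<omega>))\<^sup>2) \<and> expectation (\<lambda>\<omega>. (norm (V t \<omega>))\<^sup>2) \<le> C)
     \<and> (\<forall>s r a b. 0 \<le> s \<and> s \<le> r \<and> r \<le> T \<longrightarrow> expectation (\<lambda>\<omega>. ((N r \<omega> - N s \<omega>) \<bullet> a) * (V s \<omega> \<bullet> b)) = 0)"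

lemma nonantI:
  assumes "\<And>t. t \<in> {0..T} \<Longrightarrow> V t \<in> borel_measurable M"
    "\<And>\<omega>. \<omega> \<in> space M \<Longrightarrow> continuous_on {0..T} (\<lambda>t. V t \<omega>)"
    "\<And>t. t \<in> {0..T} \<Longrightarrow> integrable M (\<lambda>\<omega>. (norm (V t \<omega>))\<^sup>2)"
    "\<And>t. t \<in> {0..T} \<Longrightarrow> expectation (\<lambda>\<omega>. (norm (V t \<omega>))\<^sup>2) \<le> C"
    "\<And>s r a b. 0 \<le> s \<Longrightarrow> s \<le> r \<Longrightarrow> r \<le> T \<Longrightarrow> expectation (\<lambda>\<omega>. ((N r \<omega> - N s \<omega>) \<bullet> a) * (V s \<omega> \<bullet> b)) = 0"
  shows "nonant V"
  unfolding nonant_def using assms by blast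

lemma nonant_orth: "nonant V \<Longrightarrow> 0 \<le> s \<Longrightarrow> s \<le> r \<Longrightarrow> r \<le> T \<Longrightarrow> expectation (\<lambda>\<omega>. ((N r \<omega> - N s \<omega>) \<bullet> a) * (V s \<omega> \<bullet> b)) = 0"
  unfolding nonant_def by blast

lemma nonantD:
  assumes "nonant V" "t \<in> {0..T}"
  shows "V t \<in> borel_measurable M" "integrable M (\<lambda>\<omega>. (norm (V t \<omega>))\<^sup>2)"
  using assms by (auto simp: nonant_def)

lemma nonant_cont: "nonant V \<Longrightarrow> \<omega> \<in> space M \<Longrightarrow> continuous_on {0..T} (\<lambda>t. V t \<omega>)"
  by (auto simp: nonant_def)

lemma nonant_bound:
  assumes "nonant V" obtains C where "0 \<le> C" "\<And>t. t \<in> {0..T} \<Longrightarrow> expectation (\<lambda>\<omega>. (norm (V t \<omega>))\<^sup>2) \<le> C"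
proof -
  obtain C where C: "\<And>t. t \<in> {0..T} \<Longrightarrow> expectation (\<lambda>\<omega>. (norm (V t \<omega>))\<^sup>2) \<le> C"
    using assms unfolding nonant_def by blast
  show thesis by (rule that[of "max C 0"]) (use C in \<open>auto simp: le_max_iff_disj\<close>)
qed

lemma integrable_mult_inner:
  assumes "U \<in> borel_measurable M" "V \<in> borel_measurable M"
    "integrable M (\<lambda>\<omega>. (norm (U \<omega>))\<^sup>2)" "integrable M (\<lambda>\<omega>. (norm (V \<omega> :: 'a))\<^sup>2)"
  shows "integrable M (\<lambda>\<omega>. ((U \<omega> :: 'a) \<bullet> a) * (V \<omega> \<bullet> b))"
proof -
  have "integrable M (\<lambda>\<omega>. (norm (U \<omega> \<bullet> a))\<^sup>2)" if "U \<in> borel_measurable M" "integrable M (\<lambda>\<omega>. (norm (U \<omega>))\<^sup>2)" for U :: "'o \<Rightarrow> 'a" and a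
  proof (rule Bochner_Integration.integrable_bound)
    show "integrable M (\<lambda>\<omega>. (norm (U \<omega>))\<^sup>2 * (norm a)\<^sup>2)" using that by simp
    show "(\<lambda>\<omega>. (norm (U \<omega> \<bullet> a))\<^sup>2) \<in> borel_measurable M" using that(1) by measurable
    have "\<bar>U \<omega> \<bullet> a\<bar>\<^sup>2 \<le> (norm (U \<omega>) * norm a)\<^sup>2" for \<omega>
      by (intro power_mono Cauchy_Schwarz_ineq2) auto
    then show "AE \<omega> in M. norm ((norm (U \<omega> \<bullet> a))\<^sup>2) \<le> norm ((norm (U \<omega>))\<^sup>2 * (norm a)\<^sup>2)"
      by (intro AE_I2) (simp add: power_mult_distrib)
  qed
  from integrable_inner_of_square(1)[OF _ _ this[OF assms(1,3), of a] this[OF assms(2,4), of b]]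
  show ?thesis using assms by simp
qed

lemma N_diff_sq:
  assumes "s \<in> {0..T}" "r \<in> {0..T}"
  shows "(\<lambda>\<omega>. N r \<omega> - N s \<omega>) \<in> borel_measurable M" "integrable M (\<lambda>\<omega>. (norm (N r \<omega> - N s \<omega>))\<^sup>2)"
proof -
  show m: "(\<lambda>\<omega>. N r \<omega> - N s \<omega>) \<in> borel_measurable M" using N_meas assms by simp
  have "integrable M (\<lambda>\<omega>. 2 * (norm (N r \<omega>))\<^sup>2 + 2 * (norm (N s \<omega>))\<^sup>2)" using N_sq assms by simp
  then show "integrable M (\<lambda>\<omega>. (norm (N r \<omega> - N s \<omega>))\<^sup>2)"
  proof (rule Bochner_Integration.integrable_bound)
    show "AE \<omega> in M. norm ((norm (N r \<omega> - N s \<omega>))\<^sup>2) \<le> norm (2 * (norm (N r \<omega>))\<^sup>2 + 2 * (norm (N s \<omega>))\<^sup>2)"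
      using norm_add_square_le[of "N r _" "- N s _"] by (intro AE_I2) simp
  qed (use m in measurable)
qed

text \<open>The increment from \<open>t\<close> to \<open>r\<close> is the difference of two
  increments that start at \<open>s\<close>. Integrals of past values inherit their orthogonality
  from this.\<close>

lemma nonant_future:
  assumes V: "nonant V" and srt: "0 \<le> s" "s \<le> t" "t \<le> r" "r \<le> T"
  shows "expectation (\<lambda>\<omega>. ((N r \<omega> - N t \<omega>) \<bullet> a) * (V s \<omega> \<bullet> b)) = 0"
proof -
  have s: "s \<in> {0..T}" "t \<in> {0..T}" "r \<in> {0..T}" using srt by auto
  have i: "integrable M (\<lambda>\<omega>. ((N q \<omega> - N s \<omega>) \<bullet> a) * (V s \<omega> \<bullet> b))" if "q \<in> {0..T}" for q
    by (intro integrable_mult_inner N_diff_sq nonantD[OF V] s that)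
  have "expectation (\<lambda>\<omega>. ((N r \<omega> - N t \<omega>) \<bullet> a) * (V s \<omega> \<bullet> b))
    = expectation (\<lambda>\<omega>. ((N r \<omega> - N s \<omega>) \<bullet> a) * (V s \<omega> \<bullet> b) - ((N t \<omega> - N s \<omega>) \<bullet> a) * (V s \<omega> \<bullet> b))"
    by (simp add: inner_diff_left algebra_simps)
  also have "\<dots> = 0 - 0"
    using nonant_orth[OF V] srt by (subst Bochner_Integration.integral_diff[OF i i]) (simp_all add: s)
  finally show ?thesis by simp
qed

lemma nonant_const:
  assumes "continuous_on {0..T} v" shows "nonant (\<lambda>t \<omega>. v t)"
proof -
  obtain B where B: "\<And>t. t \<in> {0..T} \<Longrightarrow> norm (v t) \<le> B"
    using compact_imp_bounded[OF compact_continuous_image[OF assms compact_Icc]]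
    by (metis bounded_iff image_eqI)
  have mean: "expectation (\<lambda>\<omega>. ((N r \<omega> - N s \<omega>) \<bullet> a) * (v s \<bullet> b)) = 0"
    if "0 \<le> s" "s \<le> r" "r \<le> T" for s r a b
  proof -
    have i: "integrable M (\<lambda>\<omega>. N q \<omega> \<bullet> a)" if "q \<in> {0..T}" for q
      using integrable_inner_of_square(1)[of "N q" "\<lambda>_. a"] N_meas N_sq that by simp
    have "expectation (\<lambda>\<omega>. (N r \<omega> - N s \<omega>) \<bullet> a) = 0"
      unfolding inner_diff_left using that by (subst Bochner_Integration.integral_diff) (auto intro!: i simp: N_mean)
    then show ?thesis by simp
  qed
  show ?thesis
    unfolding nonant_def using B assms mean
    by (auto intro!: exI[of _ "B\<^sup>2"] power_mono simp: prob_space)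
qed

lemma nonant_N: "nonant N"
proof -
  define C where "C = (\<Sum>b\<in>Basis. T * cov b b)"
  have cov0: "0 \<le> T * cov b b" for b
    using N_cov[of T T b b] T Bochner_Integration.integral_nonneg[of M "\<lambda>\<omega>. (N T \<omega> \<bullet> b) * (N T \<omega> \<bullet> b)"] by simp
  have "expectation (\<lambda>\<omega>. (norm (N t \<omega>))\<^sup>2) \<le> C" if t: "t \<in> {0..T}" for t
  proof -
    have "expectation (\<lambda>\<omega>. (norm (N t \<omega>))\<^sup>2) = expectation (\<lambda>\<omega>. \<Sum>b\<in>Basis. (N t \<omega> \<bullet> b) * (N t \<omega> \<bullet> b))"
      by (simp add: power2_norm_eq_inner euclidean_inner[of "N t _" "N t _"])
    also have "\<dots> = (\<Sum>b\<in>Basis. t * cov b b)"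
      using t by (subst Bochner_Integration.integral_sum) (auto simp: N_cov intro!: integrable_mult_inner N_meas N_sq)
    also have "\<dots> \<le> C"
      unfolding C_def
    proof (rule sum_mono)
      fix b :: 'a
      show "t * cov b b \<le> T * cov b b"
      \<comment> \<open>For \<open>T = 0\<close> the fact \<open>cov0\<close> carries no information
        about the sign of \<open>cov b b\<close>, but then \<open>t = 0\<close> as well.\<close>
      proof (cases "T = 0")
        case False
        then have "0 \<le> cov b b" using cov0[of b] T by (simp add: zero_le_mult_iff)
        then show ?thesis using t by (simp add: mult_right_mono)
      qed (use t in simp)
    qed
    finally show ?thesis .
  qed
  moreover have "expectation (\<lambda>\<omega>. ((N r \<omega> - N s \<omega>) \<bullet> a) * (N s \<omega> \<bullet> b)) = 0" if "0 \<le> s" "s \<le> r" "r \<le> T" for s r a b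
  proof -
    have sr: "s \<in> {0..T}" "r \<in> {0..T}" using that by auto
    have "expectation (\<lambda>\<omega>. ((N r \<omega> - N s \<omega>) \<bullet> a) * (N s \<omega> \<bullet> b)) = expectation (\<lambda>\<omega>. (N r \<omega> \<bullet> a) * (N s \<omega> \<bullet> b) - (N s \<omega> \<bullet> a) * (N s \<omega> \<bullet> b))"
      by (simp add: inner_diff_left algebra_simps)
    also have "\<dots> = min r s * cov a b - min s s * cov a b"
      unfolding N_cov[OF sr(2) sr(1), symmetric] N_cov[OF sr(1) sr(1), symmetric]
      by (rule Bochner_Integration.integral_diff) (intro integrable_mult_inner N_meas N_sq sr)+
    finally show ?thesis using that by (simp add: min_def)
  qed
  ultimately show ?thesis by (intro nonantI N_meas N_cont N_sq)
qed

lemma nonant_add: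
  assumes U: "nonant U" and V: "nonant V" shows "nonant (\<lambda>t \<omega>. U t \<omega> + V t \<omega>)"
proof -
  obtain C D where CD: "\<And>t. t \<in> {0..T} \<Longrightarrow> expectation (\<lambda>\<omega>. (norm (U t \<omega>))\<^sup>2) \<le> C"
     "\<And>t. t \<in> {0..T} \<Longrightarrow> expectation (\<lambda>\<omega>. (norm (V t \<omega>))\<^sup>2) \<le> D" using nonant_bound[OF U] nonant_bound[OF V] by metis
  have m: "(\<lambda>\<omega>. U t \<omega> + V t \<omega>) \<in> borel_measurable M" if "t \<in> {0..T}" for t
    using nonantD(1)[OF U that] nonantD(1)[OF V that] by simp
  have isum: "integrable M (\<lambda>\<omega>. 2 * (norm (U t \<omega>))\<^sup>2 + 2 * (norm (V t \<omega>))\<^sup>2)" if "t \<in> {0..T}" for t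
    using nonantD(2)[OF U that] nonantD(2)[OF V that] by simp
  have i: "integrable M (\<lambda>\<omega>. (norm (U t \<omega> + V t \<omega>))\<^sup>2)" if t: "t \<in> {0..T}" for t
  proof (rule Bochner_Integration.integrable_bound[OF isum[OF t]])
    show "AE \<omega> in M. norm ((norm (U t \<omega> + V t \<omega>))\<^sup>2) \<le> norm (2 * (norm (U t \<omega>))\<^sup>2 + 2 * (norm (V t \<omega>))\<^sup>2)"
      using norm_add_square_le by (intro AE_I2) simp
  qed (use m[OF t] in measurable)
  have "expectation (\<lambda>\<omega>. (norm (U t \<omega> + V t \<omega>))\<^sup>2) \<le> 2 * C + 2 * D" if t: "t \<in> {0..T}" for t
  proof -
    have "expectation (\<lambda>\<omega>. (norm (U t \<omega> + V t \<omega>))\<^sup>2) \<le> expectation (\<lambda>\<omega>. 2 * (norm (U t \<omega>))\<^sup>2 + 2 * (norm (V t \<omega>))\<^sup>2)"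
      by (intro integral_mono i isum t norm_add_square_le)
    also have "\<dots> \<le> 2 * C + 2 * D"
      using CD[OF t] nonantD(2)[OF U t] nonantD(2)[OF V t] by simp
    finally show ?thesis .
  qed
  moreover have "expectation (\<lambda>\<omega>. ((N r \<omega> - N s \<omega>) \<bullet> a) * ((U s \<omega> + V s \<omega>) \<bullet> b)) = 0" if "0 \<le> s" "s \<le> r" "r \<le> T" for s r a b
  proof -
    have sr: "s \<in> {0..T}" "r \<in> {0..T}" using that by auto
    show ?thesis
      unfolding inner_add_left distrib_left
      by (subst Bochner_Integration.integral_add)
        (intro integrable_mult_inner N_diff_sq nonantD[OF U] nonantD[OF V] sr,
         intro integrable_mult_inner N_diff_sq nonantD[OF U] nonantD[OF V] sr,
         simp add: nonant_orth[OF U that] nonant_orth[OF V that])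
  qed
  moreover have "continuous_on {0..T} (\<lambda>t. U t \<omega> + V t \<omega>)" if "\<omega> \<in> space M" for \<omega>
    using nonant_cont[OF U that] nonant_cont[OF V that] by (rule continuous_on_add)
  ultimately show ?thesis using m i by (intro nonantI)
qed

lemma nonant_blinfun:
  assumes H: "continuous_on {0..T} H" and V: "nonant V"
  shows "nonant (\<lambda>t \<omega>. blinfun_apply (H t) (V t \<omega>))"
proof -
  obtain K where K: "0 \<le> K" "\<And>t. t \<in> {0..T} \<Longrightarrow> norm (H t) \<le> K" using continuous_on_blinfun_bound[OF H] by blast
  obtain C where C: "0 \<le> C" "\<And>t. t \<in> {0..T} \<Longrightarrow> expectation (\<lambda>\<omega>. (norm (V t \<omega>))\<^sup>2) \<le> C" using nonant_bound[OF V] by blast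
  have m: "(\<lambda>\<omega>. H t (V t \<omega>)) \<in> borel_measurable M" if "t \<in> {0..T}" for t
    by (rule measurable_compose[OF nonantD(1)[OF V that]])
      (intro borel_measurable_continuous_onI linear_continuous_on blinfun.bounded_linear_right)
  have le: "(norm (H t x))\<^sup>2 \<le> K\<^sup>2 * (norm x)\<^sup>2" if "t \<in> {0..T}" for t x
  proof -
    have "norm (H t x) \<le> K * norm x"
      using norm_blinfun[of "H t" x] mult_right_mono[OF K(2)[OF that] norm_ge_zero[of x]] by linarith
    then have "(norm (H t x))\<^sup>2 \<le> (K * norm x)\<^sup>2" by (intro power_mono) auto
    then show ?thesis by (simp add: power_mult_distrib)
  qed
  have i: "integrable M (\<lambda>\<omega>. (norm (H t (V t \<omega>)))\<^sup>2)" if t: "t \<in> {0..T}" for t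
  proof (rule Bochner_Integration.integrable_bound)
    show "integrable M (\<lambda>\<omega>. K\<^sup>2 * (norm (V t \<omega>))\<^sup>2)" using nonantD(2)[OF V t] by simp
    show "AE \<omega> in M. norm ((norm (H t (V t \<omega>)))\<^sup>2) \<le> norm (K\<^sup>2 * (norm (V t \<omega>))\<^sup>2)"
      using le[OF t] by (intro AE_I2) simp
  qed (use m[OF t] in measurable)
  have "expectation (\<lambda>\<omega>. (norm (H t (V t \<omega>)))\<^sup>2) \<le> K\<^sup>2 * C" if t: "t \<in> {0..T}" for t
  proof -
    have "expectation (\<lambda>\<omega>. (norm (H t (V t \<omega>)))\<^sup>2) \<le> expectation (\<lambda>\<omega>. K\<^sup>2 * (norm (V t \<omega>))\<^sup>2)"
      using nonantD(2)[OF V t] by (intro integral_mono i t le) auto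
    also have "\<dots> \<le> K\<^sup>2 * C" using C(2)[OF t] by (simp add: mult_left_mono)
    finally show ?thesis .
  qed
  moreover have "expectation (\<lambda>\<omega>. ((N r \<omega> - N s \<omega>) \<bullet> a) * (H s (V s \<omega>) \<bullet> b)) = 0" if "0 \<le> s" "s \<le> r" "r \<le> T" for s r a b
  proof -
    have sr: "s \<in> {0..T}" "r \<in> {0..T}" using that by auto
    \<comment> \<open>The adjoint moves the deterministic operator onto the test vector.\<close>
    have lin: "linear (blinfun_apply (H s))"
      using blinfun.bounded_linear_right bounded_linear.linear by blast
    have "H s (V s \<omega>) \<bullet> b = V s \<omega> \<bullet> adjoint (blinfun_apply (H s)) b" for \<omega>
      using adjoint_works[OF lin, of "V s \<omega>" b] by simp
    then show ?thesis using nonant_orth[OF V that] by simp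
  qed
  moreover have "continuous_on {0..T} (\<lambda>t. H t (V t \<omega>))" if "\<omega> \<in> space M" for \<omega>
    using nonant_cont[OF V that] H by (intro continuous_intros)
  ultimately show ?thesis using m i by (intro nonantI)
qed

lemma nonant_LINT_square:
  assumes V: "nonant V" and t: "t \<in> {0..T}"
  shows "integrable M (\<lambda>\<omega>. LINT s:{0..t}|lborel. (norm (V s \<omega>))\<^sup>2)"
   "expectation (\<lambda>\<omega>. LINT s:{0..t}|lborel. (norm (V s \<omega>))\<^sup>2) = (LINT s:{0..t}|lborel. expectation (\<lambda>\<omega>. (norm (V s \<omega>))\<^sup>2))"
   "set_integrable lborel {0..t} (\<lambda>s. expectation (\<lambda>\<omega>. (norm (V s \<omega>))\<^sup>2))"
proof -
  obtain C where C: "0 \<le> C" "\<And>t. t \<in> {0..T} \<Longrightarrow> expectation (\<lambda>\<omega>. (norm (V t \<omega>))\<^sup>2) \<le> C" using nonant_bound[OF V] by blast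
  have "0 \<le> t" and sub: "{0..t} \<subseteq> {0..T}" using t by auto
  have m: "(\<lambda>\<omega>. (norm (V s \<omega>))\<^sup>2) \<in> borel_measurable M" if "s \<in> {0..t}" for s
  proof -
    have [measurable]: "V s \<in> borel_measurable M" using nonantD(1)[OF V, of s] that t by auto
    show ?thesis by measurable
  qed
  have c: "continuous_on {0..t} (\<lambda>s. (norm (V s \<omega>))\<^sup>2)" if "\<omega> \<in> space M" for \<omega>
    by (intro continuous_intros continuous_on_subset[OF nonant_cont[OF V that] sub])
  have i: "integrable M (\<lambda>\<omega>. (norm (V s \<omega>))\<^sup>2)" if "s \<in> {0..t}" for s using nonantD(2)[OF V, of s] that t by auto
  have b: "expectation (\<lambda>\<omega>. \<bar>(norm (V s \<omega>))\<^sup>2\<bar>) \<le> C" if "s \<in> {0..t}" for s using C(2)[of s] that t by auto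
  from expectation_LINT(2-4)[OF \<open>0 \<le> t\<close> m c i b]
  show "integrable M (\<lambda>\<omega>. LINT s:{0..t}|lborel. (norm (V s \<omega>))\<^sup>2)"
   "expectation (\<lambda>\<omega>. LINT s:{0..t}|lborel. (norm (V s \<omega>))\<^sup>2) = (LINT s:{0..t}|lborel. expectation (\<lambda>\<omega>. (norm (V s \<omega>))\<^sup>2))"
   "set_integrable lborel {0..t} (\<lambda>s. expectation (\<lambda>\<omega>. (norm (V s \<omega>))\<^sup>2))" by blast+
qed

lemma nonant_inner:
  assumes U: "nonant U" and V: "nonant V" and t: "t \<in> {0..T}"
  shows "integrable M (\<lambda>\<omega>. U t \<omega> \<bullet> V t \<omega>)"
   "integrable M (\<lambda>\<omega>. LINT s:{0..t}|lborel. U s \<omega> \<bullet> V s \<omega>)"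
   "expectation (\<lambda>\<omega>. LINT s:{0..t}|lborel. U s \<omega> \<bullet> V s \<omega>) = (LINT s:{0..t}|lborel. expectation (\<lambda>\<omega>. U s \<omega> \<bullet> V s \<omega>))"
   "set_integrable lborel {0..t} (\<lambda>s. expectation (\<lambda>\<omega>. U s \<omega> \<bullet> V s \<omega>))"
proof -
  obtain C where C: "0 \<le> C" "\<And>t. t \<in> {0..T} \<Longrightarrow> expectation (\<lambda>\<omega>. (norm (U t \<omega>))\<^sup>2) \<le> C" using nonant_bound[OF U] by blast
  obtain D where D: "0 \<le> D" "\<And>t. t \<in> {0..T} \<Longrightarrow> expectation (\<lambda>\<omega>. (norm (V t \<omega>))\<^sup>2) \<le> D" using nonant_bound[OF V] by blast
  have "0 \<le> t" and sub: "{0..t} \<subseteq> {0..T}" using t by auto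
  have i: "integrable M (\<lambda>\<omega>. U s \<omega> \<bullet> V s \<omega>)" if "s \<in> {0..T}" for s
    by (intro integrable_inner_of_square nonantD[OF U] nonantD[OF V] that)
  show "integrable M (\<lambda>\<omega>. U t \<omega> \<bullet> V t \<omega>)" using i t by blast
  have i': "integrable M (\<lambda>\<omega>. U s \<omega> \<bullet> V s \<omega>)" if "s \<in> {0..t}" for s using i that sub by blast
  have m: "(\<lambda>\<omega>. U s \<omega> \<bullet> V s \<omega>) \<in> borel_measurable M" if "s \<in> {0..t}" for s
    using i'[OF that] by (rule borel_measurable_integrable)
  have c: "continuous_on {0..t} (\<lambda>s. U s \<omega> \<bullet> V s \<omega>)" if "\<omega> \<in> space M" for \<omega>
    by (intro continuous_intros continuous_on_subset[OF nonant_cont[OF V that] sub] continuous_on_subset[OF nonant_cont[OF U that] sub])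
  have b: "expectation (\<lambda>\<omega>. \<bar>U s \<omega> \<bullet> V s \<omega>\<bar>) \<le> C + D" if "s \<in> {0..t}" for s
  proof -
    have s: "s \<in> {0..T}" using that sub by blast
    show ?thesis
      using integrable_inner_of_square(2)[OF nonantD(1)[OF U s] nonantD(1)[OF V s] nonantD(2)[OF U s] nonantD(2)[OF V s]]
        C(2)[OF s] D(2)[OF s] by linarith
  qed
  from expectation_LINT(2-4)[OF \<open>0 \<le> t\<close> m c i' b]
  show "integrable M (\<lambda>\<omega>. LINT s:{0..t}|lborel. U s \<omega> \<bullet> V s \<omega>)"
   "expectation (\<lambda>\<omega>. LINT s:{0..t}|lborel. U s \<omega> \<bullet> V s \<omega>) = (LINT s:{0..t}|lborel. expectation (\<lambda>\<omega>. U s \<omega> \<bullet> V s \<omega>))"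
   "set_integrable lborel {0..t} (\<lambda>s. expectation (\<lambda>\<omega>. U s \<omega> \<bullet> V s \<omega>))" by blast+
qed

lemma inner_LINT_right:
  fixes f :: "real \<Rightarrow> 'a"
  assumes "continuous_on {0..t} f"
  shows "(LINT s:{0..t}|lborel. f s) \<bullet> (b::'a) = (LINT s:{0..t}|lborel. f s \<bullet> b)"
  using borel_integrable_atLeastAtMost'[OF assms]
  unfolding set_lebesgue_integral_def set_integrable_def
  by (subst integral_inner_left[symmetric]) auto

lemma nonant_inner_LINT:
  assumes V: "nonant V" and t: "t \<in> {0..T}"
    and U: "U \<in> borel_measurable M" "integrable M (\<lambda>\<omega>. (norm (U \<omega>))\<^sup>2)"
  shows "integrable M (\<lambda>\<omega>. (LINT s:{0..t}|lborel. V s \<omega>) \<bullet> U \<omega>)"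
    "expectation (\<lambda>\<omega>. (LINT s:{0..t}|lborel. V s \<omega>) \<bullet> U \<omega>) = (LINT s:{0..t}|lborel. expectation (\<lambda>\<omega>. V s \<omega> \<bullet> U \<omega>))"
proof -
  obtain C where C: "0 \<le> C" "\<And>t. t \<in> {0..T} \<Longrightarrow> expectation (\<lambda>\<omega>. (norm (V t \<omega>))\<^sup>2) \<le> C" using nonant_bound[OF V] by blast
  have "0 \<le> t" and sub: "{0..t} \<subseteq> {0..T}" using t by auto
  have Vc: "continuous_on {0..t} (\<lambda>s. V s \<omega>)" if "\<omega> \<in> space M" for \<omega>
    by (rule continuous_on_subset[OF nonant_cont[OF V that] sub])
  have i: "integrable M (\<lambda>\<omega>. V s \<omega> \<bullet> U \<omega>)" if "s \<in> {0..t}" for s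
    using that sub by (intro integrable_inner_of_square nonantD[OF V] U) auto
  have m: "(\<lambda>\<omega>. V s \<omega> \<bullet> U \<omega>) \<in> borel_measurable M" if "s \<in> {0..t}" for s
    using i[OF that] by (rule borel_measurable_integrable)
  have c: "continuous_on {0..t} (\<lambda>s. V s \<omega> \<bullet> U \<omega>)" if "\<omega> \<in> space M" for \<omega>
    by (intro continuous_intros Vc that)
  have b: "expectation (\<lambda>\<omega>. \<bar>V s \<omega> \<bullet> U \<omega>\<bar>) \<le> C + expectation (\<lambda>\<omega>. (norm (U \<omega>))\<^sup>2)" if "s \<in> {0..t}" for s
  proof -
    have s: "s \<in> {0..T}" using that sub by blast
    show ?thesis
      using integrable_inner_of_square(2)[OF nonantD(1)[OF V s] U(1) nonantD(2)[OF V s] U(2)] C(2)[OF s] by linarith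
  qed
  note F = expectation_LINT(2-4)[OF \<open>0 \<le> t\<close> m c i b]
  have eq: "(LINT s:{0..t}|lborel. V s \<omega>) \<bullet> U \<omega> = (LINT s:{0..t}|lborel. V s \<omega> \<bullet> U \<omega>)" if "\<omega> \<in> space M" for \<omega>
    by (rule inner_LINT_right[OF Vc[OF that]])
  show "integrable M (\<lambda>\<omega>. (LINT s:{0..t}|lborel. V s \<omega>) \<bullet> U \<omega>)"
    using F(1) by (subst Bochner_Integration.integrable_cong[OF refl eq])
  show "expectation (\<lambda>\<omega>. (LINT s:{0..t}|lborel. V s \<omega>) \<bullet> U \<omega>) = (LINT s:{0..t}|lborel. expectation (\<lambda>\<omega>. V s \<omega> \<bullet> U \<omega>))"
    using F(3) by (subst Bochner_Integration.integral_cong[OF refl eq])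
qed

text \<open>Orthogonality survives time integration by Fubini, since every \<open>V q\<close> with
  \<open>q \<le> s\<close> is orthogonal to the increment from \<open>s\<close> on. The second
  moment is bounded by Cauchy-Schwarz in time.\<close>

lemma nonant_LINT:
  assumes V: "nonant V" shows "nonant (\<lambda>t \<omega>. LINT s:{0..t}|lborel. V s \<omega>)"
proof -
  obtain C where C: "0 \<le> C" "\<And>t. t \<in> {0..T} \<Longrightarrow> expectation (\<lambda>\<omega>. (norm (V t \<omega>))\<^sup>2) \<le> C" using nonant_bound[OF V] by blast
  have Vc: "continuous_on {0..t} (\<lambda>s. V s \<omega>)" if "\<omega> \<in> space M" "t \<in> {0..T}" for \<omega> t
    by (rule continuous_on_subset[OF nonant_cont[OF V that(1)]]) (use that in auto)
  have m: "(\<lambda>\<omega>. LINT s:{0..t}|lborel. V s \<omega>) \<in> borel_measurable M" if t: "t \<in> {0..T}" for t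
    by (rule borel_measurable_time_integral) (use t nonantD(1)[OF V] Vc in auto)
  have le: "(norm (LINT s:{0..t}|lborel. V s \<omega>))\<^sup>2 \<le> t * (LINT s:{0..t}|lborel. (norm (V s \<omega>))\<^sup>2)"
    if "\<omega> \<in> space M" "t \<in> {0..T}" for \<omega> t
    using that by (intro LINT_norm_square_le Vc) auto
  have ii: "integrable M (\<lambda>\<omega>. t * (LINT s:{0..t}|lborel. (norm (V s \<omega>))\<^sup>2))" if "t \<in> {0..T}" for t
    using nonant_LINT_square(1)[OF V that] by simp
  have i: "integrable M (\<lambda>\<omega>. (norm (LINT s:{0..t}|lborel. V s \<omega>))\<^sup>2)" if t: "t \<in> {0..T}" for t
  proof (rule Bochner_Integration.integrable_bound[OF ii[OF t]])
    have [measurable]: "(\<lambda>\<omega>. LINT s:{0..t}|lborel. V s \<omega>) \<in> borel_measurable M" by (rule m[OF t])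
    show "(\<lambda>\<omega>. (norm (LINT s:{0..t}|lborel. V s \<omega>))\<^sup>2) \<in> borel_measurable M" by measurable
    show "AE \<omega> in M. norm ((norm (LINT s:{0..t}|lborel. V s \<omega>))\<^sup>2) \<le> norm (t * (LINT s:{0..t}|lborel. (norm (V s \<omega>))\<^sup>2))"
      using le[OF _ t] by (intro AE_I2) (simp add: abs_le_iff order_trans[OF _ abs_ge_self])
  qed
  have b: "expectation (\<lambda>\<omega>. (norm (LINT s:{0..t}|lborel. V s \<omega>))\<^sup>2) \<le> T * (T * C)" if t: "t \<in> {0..T}" for t
  proof -
    have "expectation (\<lambda>\<omega>. (norm (LINT s:{0..t}|lborel. V s \<omega>))\<^sup>2) \<le> expectation (\<lambda>\<omega>. t * (LINT s:{0..t}|lborel. (norm (V s \<omega>))\<^sup>2))"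
      by (intro integral_mono i t ii le)
    also have "\<dots> = t * (LINT s:{0..t}|lborel. expectation (\<lambda>\<omega>. (norm (V s \<omega>))\<^sup>2))"
      using nonant_LINT_square(2)[OF V t] by simp
    also have "(LINT s:{0..t}|lborel. expectation (\<lambda>\<omega>. (norm (V s \<omega>))\<^sup>2)) \<le> (LINT s:{0..t}|lborel. C)"
      using C t by (intro set_integral_mono nonant_LINT_square(3)[OF V t] borel_integrable_atLeastAtMost' continuous_on_const) auto
    also have "(LINT s:{0..t}|lborel. C) = t * C"
      using t by (simp add: set_lebesgue_integral_def)
    also have "t * (t * C) \<le> T * (T * C)"
      using t C(1) by (intro mult_mono) auto
    finally show ?thesis using t by (simp add: mult_left_mono)
  qed
  have o: "expectation (\<lambda>\<omega>. ((N r \<omega> - N s \<omega>) \<bullet> a) * ((LINT q:{0..s}|lborel. V q \<omega>) \<bullet> b)) = 0"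
    if sr: "0 \<le> s" "s \<le> r" "r \<le> T" for s r a b
  proof -
    have s: "s \<in> {0..T}" "r \<in> {0..T}" using sr by auto
    \<comment> \<open>Packs the scalar increment into a vector, so that
      \<open>nonant_inner_LINT\<close> applies to it.\<close>
    define U where "U \<omega> = ((N r \<omega> - N s \<omega>) \<bullet> a) *\<^sub>R b" for \<omega>
    have [measurable]: "(\<lambda>\<omega>. N r \<omega> - N s \<omega>) \<in> borel_measurable M" by (rule N_diff_sq(1)[OF s])
    have Um: "U \<in> borel_measurable M" unfolding U_def by measurable
    have Ui: "integrable M (\<lambda>\<omega>. (norm (U \<omega>))\<^sup>2)"
    proof -
      have "integrable M (\<lambda>\<omega>. ((N r \<omega> - N s \<omega>) \<bullet> a) * ((N r \<omega> - N s \<omega>) \<bullet> a) * (norm b)\<^sup>2)"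
        by (intro integrable_mult_left integrable_mult_inner N_diff_sq s)
      then show ?thesis by (simp add: U_def power_mult_distrib power2_eq_square mult_ac)
    qed
    have "expectation (\<lambda>\<omega>. ((N r \<omega> - N s \<omega>) \<bullet> a) * ((LINT q:{0..s}|lborel. V q \<omega>) \<bullet> b))
       = expectation (\<lambda>\<omega>. (LINT q:{0..s}|lborel. V q \<omega>) \<bullet> U \<omega>)" by (simp add: U_def)
    also have "\<dots> = (LINT q:{0..s}|lborel. expectation (\<lambda>\<omega>. V q \<omega> \<bullet> U \<omega>))"
      by (rule nonant_inner_LINT(2)[OF V s(1) Um Ui])
    also have "\<dots> = (LINT q:{0..s}|lborel. 0)"
      using nonant_future[OF V _ _ sr(2,3)]
      by (intro set_lebesgue_integral_cong) (auto simp: U_def)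
    finally show ?thesis by simp
  qed
  have c: "continuous_on {0..T} (\<lambda>t. LINT s:{0..t}|lborel. V s \<omega>)" if "\<omega> \<in> space M" for \<omega>
    unfolding continuous_on_eq_continuous_within
    using LINT_has_vector_derivative[OF nonant_cont[OF V that]] has_vector_derivative_continuous by blast
  show ?thesis by (rule nonantI[OF m c i b o])
qed

text \<open>The second-order term of Ito's formula: if \<open>cov\<close> is given by a matrix
  \<open>\<Sigma> \<Sigma>\<^sup>T\<close>, this is the trace of that matrix times
  \<open>H\<close>.\<close>

definition trc :: "('a \<Rightarrow>\<^sub>L 'a) \<Rightarrow> real" where
  "trc H = (\<Sum>i\<in>Basis. \<Sum>j\<in>Basis. cov i j * (i \<bullet> blinfun_apply H j))"

lemma bounded_linear_trc: "bounded_linear trc"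
  unfolding trc_def[abs_def]
  by (intro bounded_linear_sum bounded_linear_const_mult bounded_linear_inner_right_comp blinfun.bounded_linear_left)

lemma expectation_quadratic_N:
  assumes t: "t \<in> {0..T}" shows "expectation (\<lambda>\<omega>. N t \<omega> \<bullet> blinfun_apply H (N t \<omega>)) = t * trc H"
proof -
  have "N t \<omega> \<bullet> blinfun_apply H (N t \<omega>) = (\<Sum>i\<in>Basis. \<Sum>j\<in>Basis. (N t \<omega> \<bullet> i) * (N t \<omega> \<bullet> j) * (i \<bullet> blinfun_apply H j))" for \<omega>
  proof -
    have "blinfun_apply H (N t \<omega>) = (\<Sum>j\<in>Basis. (N t \<omega> \<bullet> j) *\<^sub>R blinfun_apply H j)"
      by (subst (1) euclidean_representation[of "N t \<omega>", symmetric]) (simp add: blinfun.sum_right blinfun.scaleR_right)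
    then show ?thesis
      by (subst euclidean_inner) (simp add: inner_sum_left inner_sum_right sum_distrib_left mult_ac inner_commute)
  qed
  then have "expectation (\<lambda>\<omega>. N t \<omega> \<bullet> blinfun_apply H (N t \<omega>))
     = expectation (\<lambda>\<omega>. \<Sum>i\<in>Basis. \<Sum>j\<in>Basis. (N t \<omega> \<bullet> i) * (N t \<omega> \<bullet> j) * (i \<bullet> blinfun_apply H j))" by simp
  also have "\<dots> = (\<Sum>i\<in>Basis. \<Sum>j\<in>Basis. expectation (\<lambda>\<omega>. (N t \<omega> \<bullet> i) * (N t \<omega> \<bullet> j) * (i \<bullet> blinfun_apply H j)))"
    by (subst Bochner_Integration.integral_sum) (intro Bochner_Integration.integrable_sum integrable_mult_left integrable_mult_inner N_meas N_sq t,
       intro sum.cong refl Bochner_Integration.integral_sum integrable_mult_left integrable_mult_inner N_meas N_sq t)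
  also have "\<dots> = t * trc H"
    using t by (simp add: N_cov trc_def sum_distrib_left mult_ac)
  finally show ?thesis .
qed

text \<open>Orthogonality to the increment from \<open>s\<close> to \<open>t\<close>, summed over a
  basis. In the moment identity it lets the noise at the final time be replaced by the noise at the
  time of integration.\<close>

lemma nonant_N_forward:
  assumes V: "nonant V" and st: "s \<in> {0..t}" "t \<in> {0..T}"
  shows "expectation (\<lambda>\<omega>. V s \<omega> \<bullet> N t \<omega>) = expectation (\<lambda>\<omega>. V s \<omega> \<bullet> N s \<omega>)"
proof -
  have s: "s \<in> {0..T}" using st by auto
  have i: "integrable M (\<lambda>\<omega>. V s \<omega> \<bullet> N q \<omega>)" if "q \<in> {0..T}" for q
    by (intro integrable_inner_of_square nonantD[OF V] N_meas N_sq s that)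
  have "expectation (\<lambda>\<omega>. V s \<omega> \<bullet> N t \<omega>) - expectation (\<lambda>\<omega>. V s \<omega> \<bullet> N s \<omega>) = expectation (\<lambda>\<omega>. V s \<omega> \<bullet> N t \<omega> - V s \<omega> \<bullet> N s \<omega>)"
    using i[OF st(2)] i[OF s] by (rule Bochner_Integration.integral_diff[symmetric])
  also have "\<dots> = expectation (\<lambda>\<omega>. \<Sum>b\<in>Basis. ((N t \<omega> - N s \<omega>) \<bullet> b) * (V s \<omega> \<bullet> b))"
    unfolding inner_diff_right[symmetric] by (subst euclidean_inner) (simp add: mult.commute)
  also have "\<dots> = (\<Sum>b\<in>Basis. expectation (\<lambda>\<omega>. ((N t \<omega> - N s \<omega>) \<bullet> b) * (V s \<omega> \<bullet> b)))"
    by (rule Bochner_Integration.integral_sum) (intro integrable_mult_inner N_diff_sq nonantD[OF V] s st)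
  also have "\<dots> = 0" using nonant_orth[OF V, of s t] st by simp
  finally show ?thesis by simp
qed

text \<open>Ito's formula in expectation. Write \<open>X = N + Y\<close>, where \<open>Y\<close> is
  differentiable in time along each path, and expand the quadratic form: the part in
  \<open>Y\<close> alone obeys the ordinary product rule, the mixed part uses
  \<open>nonant_N_forward\<close>, and the part in \<open>N\<close> alone is explicit from the
  covariance.\<close>

theorem moment_identity:
  assumes X: "nonant X" and A: "continuous_on {0..T} A"
    and eq: "\<And>t \<omega>. t \<in> {0..T} \<Longrightarrow> \<omega> \<in> space M \<Longrightarrow>
       X t \<omega> = N t \<omega> + (x + (LINT s:{0..t}|lborel. blinfun_apply (A s) (X s \<omega>)))"
    and H: "\<And>t. t \<in> {0..T} \<Longrightarrow> (H has_vector_derivative H' t) (at t within {0..T})"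
    and H'c: "continuous_on {0..T} H'"
    and sym: "\<And>t u v. t \<in> {0..T} \<Longrightarrow> blinfun_apply (H t) u \<bullet> v = u \<bullet> blinfun_apply (H t) v"
       "\<And>t u v. t \<in> {0..T} \<Longrightarrow> blinfun_apply (H' t) u \<bullet> v = u \<bullet> blinfun_apply (H' t) v"
    and t: "t \<in> {0..T}"
  shows "set_integrable lborel {0..t} (\<lambda>s. expectation (\<lambda>\<omega>. X s \<omega> \<bullet> H' s (X s \<omega>) + 2 * (A s (X s \<omega>) \<bullet> H s (X s \<omega>))) + trc (H s))" (is ?int)
    and "expectation (\<lambda>\<omega>. X t \<omega> \<bullet> H t (X t \<omega>)) = x \<bullet> H 0 x
      + (LINT s:{0..t}|lborel. expectation (\<lambda>\<omega>. X s \<omega> \<bullet> H' s (X s \<omega>) + 2 * (A s (X s \<omega>) \<bullet> H s (X s \<omega>))) + trc (H s))" (is ?eq)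
proof -
  have t0: "0 \<le> t" and sub: "{0..t} \<subseteq> {0..T}" using t by auto
  have Hc: "continuous_on {0..T} H"
    unfolding continuous_on_eq_continuous_within using H has_vector_derivative_continuous by blast
  define V where "V s \<omega> = A s (X s \<omega>)" for s \<omega>
  define Y where "Y s \<omega> = x + (LINT r:{0..s}|lborel. V r \<omega>)" for s \<omega>
  \<comment> \<open>The time derivative of \<open>H s (Y s \<omega>)\<close>, as \<open>HY'\<close>
    confirms.\<close>
  define G where "G s \<omega> = H s (V s \<omega>) + H' s (Y s \<omega>)" for s \<omega>
  have V: "nonant V" unfolding V_def[abs_def] by (rule nonant_blinfun[OF A X])
  have Y: "nonant Y" unfolding Y_def[abs_def] by (intro nonant_add nonant_const nonant_LINT V continuous_intros)
  have HY: "nonant (\<lambda>s \<omega>. H s (Y s \<omega>))" "nonant (\<lambda>s \<omega>. H' s (Y s \<omega>))" "nonant (\<lambda>s \<omega>. H s (V s \<omega>))"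
    "nonant (\<lambda>s \<omega>. H s (N s \<omega>))" "nonant (\<lambda>s \<omega>. H' s (N s \<omega>))"
    by (intro nonant_blinfun Hc H'c Y V nonant_N)+
  have G: "nonant G" unfolding G_def[abs_def] by (intro nonant_add HY)
  have XNY: "X s \<omega> = N s \<omega> + Y s \<omega>" if "s \<in> {0..T}" "\<omega> \<in> space M" for s \<omega>
    using eq[OF that] by (simp add: Y_def V_def)
  have Y': "((\<lambda>s. Y s \<omega>) has_vector_derivative V s \<omega>) (at s within {0..T})" if "s \<in> {0..T}" "\<omega> \<in> space M" for s \<omega>
    unfolding Y_def using LINT_has_vector_derivative[OF nonant_cont[OF V that(2)] that(1)]
    by (auto intro!: derivative_eq_intros)
  have HY': "((\<lambda>s. H s (Y s \<omega>)) has_vector_derivative G s \<omega>) (at s within {0..T})" if "s \<in> {0..T}" "\<omega> \<in> space M" for s \<omega>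
    unfolding G_def by (rule bounded_bilinear.has_vector_derivative[OF bounded_bilinear_blinfun_apply H[OF that(1)] Y'[OF that]])
  have Y0: "Y 0 \<omega> = x" for \<omega>
  proof -
    have "(LINT r:{0..0}|lborel. V r \<omega>) = integral {0} (\<lambda>r. V r \<omega>)" using LINT_eq_integral[of 0 0 "\<lambda>r. V r \<omega>"] by simp
    also have "\<dots> = 0" by (rule integral_unique[OF has_integral_refl(2)])
    finally show ?thesis by (simp add: Y_def)
  qed
  have path1: "Y t \<omega> \<bullet> H t (Y t \<omega>) = x \<bullet> H 0 x + ((LINT s:{0..t}|lborel. Y s \<omega> \<bullet> H' s (Y s \<omega>)) + 2 * (LINT s:{0..t}|lborel. V s \<omega> \<bullet> H s (Y s \<omega>)))"
    if \<omega>: "\<omega> \<in> space M" for \<omega>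
  proof -
    have c: "continuous_on {0..t} (\<lambda>s. Y s \<omega> \<bullet> H' s (Y s \<omega>))" "continuous_on {0..t} (\<lambda>s. V s \<omega> \<bullet> H s (Y s \<omega>))"
      by (intro continuous_on_inner continuous_on_subset[OF nonant_cont[OF _ \<omega>] sub] HY Y V)+
    have d: "((\<lambda>s. Y s \<omega> \<bullet> H s (Y s \<omega>)) has_vector_derivative (Y s \<omega> \<bullet> H' s (Y s \<omega>) + 2 * (V s \<omega> \<bullet> H s (Y s \<omega>)))) (at s within {0..t})"
      if s: "s \<in> {0..t}" for s
    proof -
      have sT: "s \<in> {0..T}" using s sub by blast
      have "((\<lambda>s. Y s \<omega> \<bullet> H s (Y s \<omega>)) has_vector_derivative (Y s \<omega> \<bullet> G s \<omega> + V s \<omega> \<bullet> H s (Y s \<omega>))) (at s within {0..t})"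
        by (rule bounded_bilinear.has_vector_derivative[OF bounded_bilinear_inner
              has_vector_derivative_within_subset[OF Y'[OF sT \<omega>] sub] has_vector_derivative_within_subset[OF HY'[OF sT \<omega>] sub]])
      moreover have "Y s \<omega> \<bullet> H s (V s \<omega>) = V s \<omega> \<bullet> H s (Y s \<omega>)" using sym(1)[OF sT] by (simp add: inner_commute)
      ultimately show ?thesis by (simp add: G_def inner_add_right add_ac)
    qed
    have "(LINT s:{0..t}|lborel. Y s \<omega> \<bullet> H' s (Y s \<omega>) + 2 * (V s \<omega> \<bullet> H s (Y s \<omega>))) = Y t \<omega> \<bullet> H t (Y t \<omega>) - Y 0 \<omega> \<bullet> H 0 (Y 0 \<omega>)"
      by (rule LINT_FTC[OF t0 d]) (auto intro!: continuous_intros c)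
    moreover have "(LINT s:{0..t}|lborel. Y s \<omega> \<bullet> H' s (Y s \<omega>) + 2 * (V s \<omega> \<bullet> H s (Y s \<omega>)))
      = (LINT s:{0..t}|lborel. Y s \<omega> \<bullet> H' s (Y s \<omega>)) + 2 * (LINT s:{0..t}|lborel. V s \<omega> \<bullet> H s (Y s \<omega>))"
      using borel_integrable_atLeastAtMost'[OF c(1)] borel_integrable_atLeastAtMost'[OF c(2)]
      by (simp add: set_integral_add)
    ultimately show ?thesis by (simp add: Y0)
  qed
  note iYY = nonant_inner[OF Y HY(2) t] and iVY = nonant_inner[OF V HY(1) t] and iGN = nonant_inner[OF G nonant_N t]
  have E1: "expectation (\<lambda>\<omega>. Y t \<omega> \<bullet> H t (Y t \<omega>)) = x \<bullet> H 0 x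
     + ((LINT s:{0..t}|lborel. expectation (\<lambda>\<omega>. Y s \<omega> \<bullet> H' s (Y s \<omega>))) + 2 * (LINT s:{0..t}|lborel. expectation (\<lambda>\<omega>. V s \<omega> \<bullet> H s (Y s \<omega>))))"
  proof -
    have "expectation (\<lambda>\<omega>. Y t \<omega> \<bullet> H t (Y t \<omega>)) = expectation (\<lambda>\<omega>. x \<bullet> H 0 x + ((LINT s:{0..t}|lborel. Y s \<omega> \<bullet> H' s (Y s \<omega>)) + 2 * (LINT s:{0..t}|lborel. V s \<omega> \<bullet> H s (Y s \<omega>))))"
      by (rule Bochner_Integration.integral_cong[OF refl path1])
    also have "\<dots> = x \<bullet> H 0 x + (expectation (\<lambda>\<omega>. LINT s:{0..t}|lborel. Y s \<omega> \<bullet> H' s (Y s \<omega>)) + 2 * expectation (\<lambda>\<omega>. LINT s:{0..t}|lborel. V s \<omega> \<bullet> H s (Y s \<omega>)))"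
      using iYY(2) iVY(2) by (simp add: prob_space)
    finally show ?thesis by (simp add: iYY(3) iVY(3))
  qed
  have E2: "expectation (\<lambda>\<omega>. N t \<omega> \<bullet> H t (Y t \<omega>)) = (LINT s:{0..t}|lborel. expectation (\<lambda>\<omega>. G s \<omega> \<bullet> N s \<omega>))"
  proof -
    \<comment> \<open>\<open>H t (Y t \<omega>)\<close> is written as the integral of
      \<open>G\<close>, so that \<open>N t\<close> can be replaced by \<open>N s\<close> under the
      integral once expectations are taken.\<close>
    have path2: "N t \<omega> \<bullet> H t (Y t \<omega>) = N t \<omega> \<bullet> H 0 x + (LINT s:{0..t}|lborel. G s \<omega>) \<bullet> N t \<omega>" if \<omega>: "\<omega> \<in> space M" for \<omega>
    proof -
      have "(LINT s:{0..t}|lborel. G s \<omega>) = H t (Y t \<omega>) - H 0 (Y 0 \<omega>)"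
      proof (rule LINT_FTC[OF t0])
        show "((\<lambda>s. H s (Y s \<omega>)) has_vector_derivative G s \<omega>) (at s within {0..t})" if "s \<in> {0..t}" for s
          using HY'[OF subsetD[OF sub that] \<omega>] by (rule has_vector_derivative_within_subset[OF _ sub])
        show "continuous_on {0..t} (\<lambda>s. G s \<omega>)" by (rule continuous_on_subset[OF nonant_cont[OF G \<omega>] sub])
      qed
      then show ?thesis by (simp add: Y0 inner_diff_left inner_diff_right inner_commute)
    qed
    note F = nonant_inner_LINT[OF G t N_meas[OF t] N_sq[OF t]]
    have i0: "integrable M (\<lambda>\<omega>. N t \<omega> \<bullet> H 0 x)"
      using integrable_inner_of_square(1)[OF N_meas[OF t] _ N_sq[OF t], of "\<lambda>_. H 0 x"] by simp
    have "expectation (\<lambda>\<omega>. N t \<omega> \<bullet> H t (Y t \<omega>)) = expectation (\<lambda>\<omega>. N t \<omega> \<bullet> H 0 x + (LINT s:{0..t}|lborel. G s \<omega>) \<bullet> N t \<omega>)"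
      by (rule Bochner_Integration.integral_cong[OF refl path2])
    also have "\<dots> = 0 + (LINT s:{0..t}|lborel. expectation (\<lambda>\<omega>. G s \<omega> \<bullet> N t \<omega>))"
      using i0 F N_mean[OF t] by simp
    also have "(LINT s:{0..t}|lborel. expectation (\<lambda>\<omega>. G s \<omega> \<bullet> N t \<omega>)) = (LINT s:{0..t}|lborel. expectation (\<lambda>\<omega>. G s \<omega> \<bullet> N s \<omega>))"
      using nonant_N_forward[OF G _ t] by (intro set_lebesgue_integral_cong) auto
    finally show ?thesis by simp
  qed
  have trc_c: "continuous_on {0..t} (\<lambda>s. trc (H s))" "continuous_on {0..t} (\<lambda>s. s * trc (H' s))"
    by (intro continuous_intros bounded_linear.continuous_on[OF bounded_linear_trc] continuous_on_subset[OF Hc sub] continuous_on_subset[OF H'c sub])+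
  have E3: "expectation (\<lambda>\<omega>. N t \<omega> \<bullet> H t (N t \<omega>)) = (LINT s:{0..t}|lborel. trc (H s) + expectation (\<lambda>\<omega>. N s \<omega> \<bullet> H' s (N s \<omega>)))"
  proof -
    \<comment> \<open>Product rule for \<open>s * trc (H s)\<close>; the term
      \<open>s * trc (H' s)\<close> is the expected quadratic form of the noise under
      \<open>H' s\<close>.\<close>
    have "(LINT s:{0..t}|lborel. trc (H s) + s * trc (H' s)) = t * trc (H t) - 0 * trc (H 0)"
    proof (rule LINT_FTC[OF t0])
      show "((\<lambda>s. s * trc (H s)) has_vector_derivative (trc (H s) + s * trc (H' s))) (at s within {0..t})" if "s \<in> {0..t}" for s
      proof -
        have "((\<lambda>s. trc (H s)) has_vector_derivative trc (H' s)) (at s within {0..t})"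
          by (rule bounded_linear.has_vector_derivative[OF bounded_linear_trc has_vector_derivative_within_subset[OF H[OF subsetD[OF sub that]] sub]])
        from bounded_bilinear.has_vector_derivative[OF bounded_bilinear_mult has_vector_derivative_id this]
        show ?thesis by (simp add: add.commute)
      qed
      show "continuous_on {0..t} (\<lambda>s. trc (H s) + s * trc (H' s))" by (intro continuous_intros trc_c)
    qed
    also have "(LINT s:{0..t}|lborel. trc (H s) + s * trc (H' s)) = (LINT s:{0..t}|lborel. trc (H s) + expectation (\<lambda>\<omega>. N s \<omega> \<bullet> H' s (N s \<omega>)))"
      using expectation_quadratic_N sub by (intro set_lebesgue_integral_cong) auto
    finally show ?thesis using expectation_quadratic_N[OF t] by simp
  qed
  have split: "expectation (\<lambda>\<omega>. X s \<omega> \<bullet> K s (X s \<omega>)) = expectation (\<lambda>\<omega>. Y s \<omega> \<bullet> K s (Y s \<omega>))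
     + 2 * expectation (\<lambda>\<omega>. N s \<omega> \<bullet> K s (Y s \<omega>)) + expectation (\<lambda>\<omega>. N s \<omega> \<bullet> K s (N s \<omega>))"
    and Xint: "integrable M (\<lambda>\<omega>. X s \<omega> \<bullet> K s (X s \<omega>))"
    if s: "s \<in> {0..T}" and K: "continuous_on {0..T} K"
      and ks: "\<And>u v. blinfun_apply (K s) u \<bullet> v = u \<bullet> blinfun_apply (K s) v" for s K
  proof -
    note i = nonant_inner(1)[OF Y nonant_blinfun[OF K Y] s] nonant_inner(1)[OF nonant_N nonant_blinfun[OF K Y] s]
      nonant_inner(1)[OF nonant_N nonant_blinfun[OF K nonant_N] s]
    have "expectation (\<lambda>\<omega>. X s \<omega> \<bullet> K s (X s \<omega>)) = expectation (\<lambda>\<omega>. Y s \<omega> \<bullet> K s (Y s \<omega>) + 2 * (N s \<omega> \<bullet> K s (Y s \<omega>)) + N s \<omega> \<bullet> K s (N s \<omega>))"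
    proof (rule Bochner_Integration.integral_cong[OF refl])
      fix \<omega> assume "\<omega> \<in> space M"
      moreover have "Y s \<omega> \<bullet> K s (N s \<omega>) = N s \<omega> \<bullet> K s (Y s \<omega>)" using ks by (simp add: inner_commute)
      ultimately show "X s \<omega> \<bullet> K s (X s \<omega>) = Y s \<omega> \<bullet> K s (Y s \<omega>) + 2 * (N s \<omega> \<bullet> K s (Y s \<omega>)) + N s \<omega> \<bullet> K s (N s \<omega>)"
        using XNY[OF s] by (simp add: blinfun.add_right inner_add_left inner_add_right)
    qed
    then show "expectation (\<lambda>\<omega>. X s \<omega> \<bullet> K s (X s \<omega>)) = expectation (\<lambda>\<omega>. Y s \<omega> \<bullet> K s (Y s \<omega>))
     + 2 * expectation (\<lambda>\<omega>. N s \<omega> \<bullet> K s (Y s \<omega>)) + expectation (\<lambda>\<omega>. N s \<omega> \<bullet> K s (N s \<omega>))"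
      using i by simp
    show "integrable M (\<lambda>\<omega>. X s \<omega> \<bullet> K s (X s \<omega>))"
      by (rule nonant_inner(1)[OF X nonant_blinfun[OF K X] s])
  qed
  \<comment> \<open>Sum of the integrands of the three parts; \<open>geq\<close> regroups them into
    the integrand in \<open>X\<close>, using the symmetry of \<open>H\<close> and
    \<open>H'\<close>.\<close>
  define g where "g s = expectation (\<lambda>\<omega>. Y s \<omega> \<bullet> H' s (Y s \<omega>)) + 2 * expectation (\<lambda>\<omega>. V s \<omega> \<bullet> H s (Y s \<omega>))
      + 2 * expectation (\<lambda>\<omega>. G s \<omega> \<bullet> N s \<omega>) + (trc (H s) + expectation (\<lambda>\<omega>. N s \<omega> \<bullet> H' s (N s \<omega>)))" for s
  have iNN: "set_integrable lborel {0..t} (\<lambda>s. trc (H s) + expectation (\<lambda>\<omega>. N s \<omega> \<bullet> H' s (N s \<omega>)))"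
    by (intro set_integral_add(1) borel_integrable_atLeastAtMost' trc_c nonant_inner(4)[OF nonant_N HY(5) t])
  have gi: "set_integrable lborel {0..t} g"
    unfolding g_def[abs_def] by (intro set_integral_add(1) set_integrable_mult_right iYY(4) iVY(4) iGN(4) iNN)
  have geq: "g s = expectation (\<lambda>\<omega>. X s \<omega> \<bullet> H' s (X s \<omega>) + 2 * (A s (X s \<omega>) \<bullet> H s (X s \<omega>))) + trc (H s)" if "s \<in> {0..t}" for s
  proof -
    have s: "s \<in> {0..T}" using that sub by blast
    have a: "expectation (\<lambda>\<omega>. G s \<omega> \<bullet> N s \<omega>) = expectation (\<lambda>\<omega>. V s \<omega> \<bullet> H s (N s \<omega>)) + expectation (\<lambda>\<omega>. N s \<omega> \<bullet> H' s (Y s \<omega>))"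
    proof -
      have "G s \<omega> \<bullet> N s \<omega> = V s \<omega> \<bullet> H s (N s \<omega>) + N s \<omega> \<bullet> H' s (Y s \<omega>)" for \<omega>
        using inner_commute[of "H' s (Y s \<omega>)" "N s \<omega>"] by (simp add: G_def inner_add_left sym(1)[OF s])
      then show ?thesis
        using nonant_inner(1)[OF V HY(4) s] nonant_inner(1)[OF nonant_N HY(2) s] by simp
    qed
    have b: "expectation (\<lambda>\<omega>. A s (X s \<omega>) \<bullet> H s (X s \<omega>)) = expectation (\<lambda>\<omega>. V s \<omega> \<bullet> H s (Y s \<omega>)) + expectation (\<lambda>\<omega>. V s \<omega> \<bullet> H s (N s \<omega>))"
    proof -
      have "expectation (\<lambda>\<omega>. A s (X s \<omega>) \<bullet> H s (X s \<omega>)) = expectation (\<lambda>\<omega>. V s \<omega> \<bullet> H s (Y s \<omega>) + V s \<omega> \<bullet> H s (N s \<omega>))"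
        by (rule Bochner_Integration.integral_cong[OF refl])
          (use XNY[OF s] in \<open>simp add: V_def blinfun.add_right inner_add_right\<close>)
      then show ?thesis
        using nonant_inner(1)[OF V HY(4) s] nonant_inner(1)[OF V HY(1) s] by simp
    qed
    have c: "expectation (\<lambda>\<omega>. X s \<omega> \<bullet> H' s (X s \<omega>) + 2 * (A s (X s \<omega>) \<bullet> H s (X s \<omega>)))
       = expectation (\<lambda>\<omega>. X s \<omega> \<bullet> H' s (X s \<omega>)) + 2 * expectation (\<lambda>\<omega>. A s (X s \<omega>) \<bullet> H s (X s \<omega>))"
      using Xint[OF s H'c sym(2)[OF s]] nonant_inner(1)[OF V nonant_blinfun[OF Hc X] s] by (simp add: V_def)
    show ?thesis unfolding c b split[OF s H'c sym(2)[OF s]] g_def a by simp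
  qed
  show ?int
    using gi geq by (subst set_integrable_cong[OF refl refl, of _ _ g]) auto
  have "(LINT s:{0..t}|lborel. g s) = (LINT s:{0..t}|lborel. expectation (\<lambda>\<omega>. Y s \<omega> \<bullet> H' s (Y s \<omega>))) + 2 * (LINT s:{0..t}|lborel. expectation (\<lambda>\<omega>. V s \<omega> \<bullet> H s (Y s \<omega>)))
      + 2 * (LINT s:{0..t}|lborel. expectation (\<lambda>\<omega>. G s \<omega> \<bullet> N s \<omega>)) + (LINT s:{0..t}|lborel. trc (H s) + expectation (\<lambda>\<omega>. N s \<omega> \<bullet> H' s (N s \<omega>)))"
    unfolding g_def
    by (simp add: set_integral_add iYY(4) iVY(4) iGN(4) iNN set_integrable_mult_right)
  then have "expectation (\<lambda>\<omega>. X t \<omega> \<bullet> H t (X t \<omega>)) = x \<bullet> H 0 x + (LINT s:{0..t}|lborel. g s)"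
    unfolding split[OF t Hc sym(1)[OF t]] E1 E2 E3 by simp
  also have "(LINT s:{0..t}|lborel. g s) = (LINT s:{0..t}|lborel. expectation (\<lambda>\<omega>. X s \<omega> \<bullet> H' s (X s \<omega>) + 2 * (A s (X s \<omega>) \<bullet> H s (X s \<omega>))) + trc (H s))"
    using geq by (intro set_lebesgue_integral_cong) auto
  finally show ?eq .
qed

end

section \<open>Linear equations: fundamental solutions, uniqueness and additive noise\<close>

lemma linear_ode_fundamental:
  fixes A :: "real \<Rightarrow> 'a::euclidean_space \<Rightarrow>\<^sub>L 'a"
  assumes T: "0 \<le> T" and A: "continuous_on {0..T} A"
  obtains \<Phi> \<Psi> :: "real \<Rightarrow> 'a \<Rightarrow>\<^sub>L 'a" where
    "\<And>t. t \<in> {0..T} \<Longrightarrow> (\<Phi> has_vector_derivative A t o\<^sub>L \<Phi> t) (at t within {0..T})"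
    "continuous_on {0..T} \<Phi>" "continuous_on {0..T} \<Psi>" "\<Phi> 0 = id_blinfun"
    "\<And>t z. t \<in> {0..T} \<Longrightarrow> blinfun_apply (\<Phi> t) (\<Psi> t z) = z"
proof -
  obtain K where K: "0 \<le> K" "\<And>t. t \<in> {0..T} \<Longrightarrow> norm (A t) \<le> K" using continuous_on_blinfun_bound[OF A] by blast
  \<comment> \<open>Freezing the coefficient after \<open>T\<close> gives a bounded coefficient on
    the half-line, as \<open>picard_lindeloef_halfline\<close> requires.\<close>
  define B where "B t = A (min t T)" for t
  have Bc: "continuous_on {0..} B"
    unfolding B_def by (rule continuous_on_compose2[OF A]) (use T in \<open>auto intro!: continuous_intros\<close>)
  have BK: "norm (B t) \<le> K" if "0 \<le> t" for t using K(2)[of "min t T"] T that by (simp add: B_def)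
  obtain \<Phi> where \<Phi>: "\<Phi> 0 = id_blinfun" "\<And>t. 0 \<le> t \<Longrightarrow> (\<Phi> has_vector_derivative B t o\<^sub>L \<Phi> t) (at t within {0..})"
  proof -
    have "\<exists>x. x 0 = id_blinfun \<and> (\<forall>t\<ge>0. (x has_vector_derivative B t o\<^sub>L x t) (at t within {0..}))"
    proof (rule picard_lindeloef_halfline[where L = K and c = 0])
      fix t :: real and x y :: "'a \<Rightarrow>\<^sub>L 'a" assume t: "0 \<le> t"
      have "norm ((B t o\<^sub>L x) - (B t o\<^sub>L y)) \<le> norm (B t) * norm (x - y)"
        using norm_blinfun_compose[of "B t" "x - y"]
        by (simp add: bounded_bilinear.diff_right[OF bounded_bilinear_blinfun_compose])
      then show "norm ((B t o\<^sub>L x) - (B t o\<^sub>L y)) \<le> K * norm (x - y)"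
        using mult_right_mono[OF BK[OF t] norm_ge_zero[of "x - y"]] by linarith
    qed (auto intro!: continuous_intros Bc bounded_bilinear.continuous_on[OF bounded_bilinear_blinfun_compose])
    then show thesis using that by blast
  qed
  \<comment> \<open>The inverse flow solves the equation with the coefficient on the other side and
    the opposite sign. The composition of \<open>\<Psi>\<close> after \<open>\<Phi>\<close> is then
    constant, and in finite dimension a left inverse is also a right inverse.\<close>
  obtain \<Psi> where \<Psi>: "\<Psi> 0 = id_blinfun" "\<And>t. 0 \<le> t \<Longrightarrow> (\<Psi> has_vector_derivative - (\<Psi> t o\<^sub>L B t)) (at t within {0..})"
  proof -
    have "\<exists>x. x 0 = id_blinfun \<and> (\<forall>t\<ge>0. (x has_vector_derivative - (x t o\<^sub>L B t)) (at t within {0..}))"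
    proof (rule picard_lindeloef_halfline[where L = K and c = 0])
      fix t :: real and x y :: "'a \<Rightarrow>\<^sub>L 'a" assume t: "0 \<le> t"
      have "- (x o\<^sub>L B t) - - (y o\<^sub>L B t) = (y - x) o\<^sub>L B t"
        by (simp add: bounded_bilinear.diff_left[OF bounded_bilinear_blinfun_compose])
      then have "norm (- (x o\<^sub>L B t) - - (y o\<^sub>L B t)) \<le> norm (y - x) * norm (B t)"
        using norm_blinfun_compose[of "y - x" "B t"] by simp
      then show "norm (- (x o\<^sub>L B t) - - (y o\<^sub>L B t)) \<le> K * norm (x - y)"
        using mult_left_mono[OF BK[OF t] norm_ge_zero[of "y - x"]] by (simp add: mult.commute norm_minus_commute)
    qed (auto intro!: continuous_intros Bc bounded_bilinear.continuous_on[OF bounded_bilinear_blinfun_compose])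
    then show thesis using that by blast
  qed
  have "((\<lambda>t. \<Psi> t o\<^sub>L \<Phi> t) has_vector_derivative 0) (at t within {0..})" if "t \<in> {0..}" for t
  proof -
    have "0 \<le> t" using that by simp
    have "((\<lambda>t. \<Psi> t o\<^sub>L \<Phi> t) has_vector_derivative (\<Psi> t o\<^sub>L (B t o\<^sub>L \<Phi> t)) + ((- (\<Psi> t o\<^sub>L B t)) o\<^sub>L \<Phi> t)) (at t within {0..})"
      by (rule bounded_bilinear.has_vector_derivative[OF bounded_bilinear_blinfun_compose \<Psi>(2)[OF \<open>0 \<le> t\<close>] \<Phi>(2)[OF \<open>0 \<le> t\<close>]])
    moreover have "(\<Psi> t o\<^sub>L (B t o\<^sub>L \<Phi> t)) + ((- (\<Psi> t o\<^sub>L B t)) o\<^sub>L \<Phi> t) = 0"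
      by (rule blinfun_eqI) (simp add: blinfun.add_left blinfun.minus_left)
    ultimately show ?thesis by simp
  qed
  then obtain Z where Z: "\<And>t. t \<in> {0..} \<Longrightarrow> \<Psi> t o\<^sub>L \<Phi> t = Z"
    using has_vector_derivative_zero_constant[of "{0..}" "\<lambda>t. \<Psi> t o\<^sub>L \<Phi> t"] by blast
  have left: "\<Psi> t o\<^sub>L \<Phi> t = id_blinfun" if "0 \<le> t" for t
  proof -
    have "id_blinfun o\<^sub>L id_blinfun = (id_blinfun :: 'a \<Rightarrow>\<^sub>L 'a)" by (rule blinfun_eqI) simp
    then show ?thesis using Z[of t] Z[of 0] \<Phi>(1) \<Psi>(1) that by simp
  qed
  have right: "blinfun_apply (\<Phi> t) (\<Psi> t z) = z" if "0 \<le> t" for t z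
  proof -
    have lin: "linear (blinfun_apply (\<Phi> t))" "linear (blinfun_apply (\<Psi> t))"
      using blinfun.bounded_linear_right bounded_linear.linear by blast+
    have "blinfun_apply (\<Psi> t) (\<Phi> t z) = z" for z
      using arg_cong[OF left[OF that], of "\<lambda>F. blinfun_apply F z"] by simp
    then have "blinfun_apply (\<Psi> t) \<circ> blinfun_apply (\<Phi> t) = id" by (auto simp: fun_eq_iff)
    then have "blinfun_apply (\<Phi> t) \<circ> blinfun_apply (\<Psi> t) = id"
      using linear_inverse_left[OF lin] by simp
    then show ?thesis by (metis comp_apply id_apply)
  qed
  have sub: "{0..T} \<subseteq> {0..}" by auto
  have c: "continuous_on {0..} \<Phi>" "continuous_on {0..} \<Psi>"
    unfolding continuous_on_eq_continuous_within
    using \<Phi>(2) \<Psi>(2) has_vector_derivative_continuous by (metis atLeast_iff)+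
  show thesis
  proof (rule that[of \<Phi> \<Psi>])
    show "(\<Phi> has_vector_derivative A t o\<^sub>L \<Phi> t) (at t within {0..T})" if t: "t \<in> {0..T}" for t
      using has_vector_derivative_within_subset[OF \<Phi>(2) sub, of t] t by (simp add: B_def)
  qed (use c \<Phi>(1) right in \<open>auto intro: continuous_on_subset\<close>)
qed

text \<open>The term \<open>n\<close> cancels in the difference, which therefore solves a linear
  differential equation with zero initial value in the classical sense.\<close>

lemma integral_equation_unique:
  fixes A :: "real \<Rightarrow> 'a::euclidean_space \<Rightarrow>\<^sub>L 'a"
  assumes A: "continuous_on {0..T} A" and c: "continuous_on {0..T} u" "continuous_on {0..T} v" "continuous_on {0..T} g"
    and u: "\<And>t. t \<in> {0..T} \<Longrightarrow> u t = n t + (x + (LINT s:{0..t}|lborel. blinfun_apply (A s) (u s) + g s))"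
    and v: "\<And>t. t \<in> {0..T} \<Longrightarrow> v t = n t + (x + (LINT s:{0..t}|lborel. blinfun_apply (A s) (v s) + g s))"
    and t: "t \<in> {0..T}"
  shows "u t = v t"
proof -
  obtain K where K: "0 \<le> K" "\<And>t. t \<in> {0..T} \<Longrightarrow> norm (A t) \<le> K" using continuous_on_blinfun_bound[OF A] by blast
  define d where "d t = (LINT s:{0..t}|lborel. blinfun_apply (A s) (u s) + g s) - (LINT s:{0..t}|lborel. blinfun_apply (A s) (v s) + g s)" for t
  have du: "d t = u t - v t" if "t \<in> {0..T}" for t using u[OF that] v[OF that] by (simp add: d_def)
  have d': "(d has_vector_derivative A t (d t)) (at t within {0..T})" if t: "t \<in> {0..T}" for t
  proof -
    have "(d has_vector_derivative (A t (u t) + g t) - (A t (v t) + g t)) (at t within {0..T})"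
      unfolding d_def by (intro derivative_intros LINT_has_vector_derivative bounded_bilinear.continuous_on[OF bounded_bilinear_blinfun_apply] A c t continuous_intros)
    then show ?thesis using du[OF t] by (simp add: blinfun.diff_right)
  qed
  have "(norm (d t))\<^sup>2 \<le> exp (2 * K * t) * ((norm (d 0))\<^sup>2 * exp (- (2 * K * 0)) + 0 - 0)"
  proof (rule gronwall_differential[where v = "\<lambda>t. (norm (d t))\<^sup>2" and b = "\<lambda>_. 0" and \<beta> = "\<lambda>_. 0" and a = "\<lambda>_. 2 * K", OF _ _ _ _ _ t])
    fix s assume s: "s \<in> {0..T}"
    show "((\<lambda>t. (norm (d t))\<^sup>2) has_real_derivative 2 * inner (d s) (A s (d s))) (at s within {0..T})"
      by (rule has_vector_derivative_norm_square[OF d'[OF s]])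
    have "inner (d s) (A s (d s)) \<le> norm (d s) * (norm (A s) * norm (d s))"
      by (intro order_trans[OF norm_cauchy_schwarz mult_left_mono] norm_blinfun) auto
    also have "\<dots> \<le> norm (d s) * (K * norm (d s))"
      by (intro mult_left_mono mult_right_mono K s) auto
    finally show "2 * inner (d s) (A s (d s)) \<le> 2 * K * (norm (d s))\<^sup>2 + 0"
      by (simp add: power2_eq_square algebra_simps)
  qed (auto intro!: derivative_eq_intros)
  moreover have "d 0 = 0"
    unfolding d_def using LINT_eq_integral[of 0 0 "\<lambda>s. A s (u s) + g s"] LINT_eq_integral[of 0 0 "\<lambda>s. A s (v s) + g s"]
    by (simp add: integral_unique[OF has_integral_refl(2)])
  ultimately show ?thesis using du[OF t] by simp
qed

context white_noise
begin

text \<open>Variation of constants for \<open>X - N\<close>, which along each path solves a linear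
  equation with source \<open>A N\<close>. The explicit formula also yields measurability with
  respect to any \<open>F\<close> that knows the noise up to \<open>t\<close>.\<close>

lemma linear_sde_solution:
  assumes A: "continuous_on {0..T} A"
  obtains X where "nonant X"
    "\<And>t \<omega>. t \<in> {0..T} \<Longrightarrow> \<omega> \<in> space M \<Longrightarrow>
       X t \<omega> = N t \<omega> + (x + (LINT s:{0..t}|lborel. blinfun_apply (A s) (X s \<omega>)))"
    "\<And>t F. t \<in> {0..T} \<Longrightarrow> space F = space M \<Longrightarrow> (\<forall>s\<in>{0..t}. N s \<in> borel_measurable F) \<Longrightarrow> X t \<in> borel_measurable F"
proof -
  obtain \<Phi> \<Psi> where \<Phi>: "\<And>t. t \<in> {0..T} \<Longrightarrow> (\<Phi> has_vector_derivative A t o\<^sub>L \<Phi> t) (at t within {0..T})"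
    and c: "continuous_on {0..T} \<Phi>" "continuous_on {0..T} \<Psi>" and \<Phi>0: "\<Phi> 0 = id_blinfun"
    and inv: "\<And>t z. t \<in> {0..T} \<Longrightarrow> blinfun_apply (\<Phi> t) (blinfun_apply (\<Psi> t) z) = z"
    by (rule linear_ode_fundamental[OF T A]) (rule that)
  define I where "I t \<omega> = x + (LINT s:{0..t}|lborel. blinfun_apply (\<Psi> s) (A s (N s \<omega>)))" for t \<omega>
  define X where "X t \<omega> = N t \<omega> + \<Phi> t (I t \<omega>)" for t \<omega>
  have VN: "nonant (\<lambda>s \<omega>. blinfun_apply (\<Psi> s) (A s (N s \<omega>)))"
    by (intro nonant_blinfun c A nonant_N)
  have X: "nonant X"
    unfolding X_def[abs_def] I_def[abs_def]
    by (intro nonant_add nonant_N nonant_blinfun[OF c(1)] nonant_const continuous_intros nonant_LINT VN)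
  moreover have "X t \<omega> = N t \<omega> + (x + (LINT s:{0..t}|lborel. A s (X s \<omega>)))" if t: "t \<in> {0..T}" and \<omega>: "\<omega> \<in> space M" for t \<omega>
  proof -
    have sub: "{0..t} \<subseteq> {0..T}" and t0: "0 \<le> t" using t by auto
    have I': "((\<lambda>s. I s \<omega>) has_vector_derivative \<Psi> s (A s (N s \<omega>))) (at s within {0..T})" if "s \<in> {0..T}" for s
      unfolding I_def using LINT_has_vector_derivative[OF nonant_cont[OF VN \<omega>] that]
      by (auto intro!: derivative_eq_intros)
    have "(LINT s:{0..t}|lborel. A s (X s \<omega>)) = \<Phi> t (I t \<omega>) - \<Phi> 0 (I 0 \<omega>)"
    proof (rule LINT_FTC[OF t0])
      fix s assume s: "s \<in> {0..t}"
      then have sT: "s \<in> {0..T}" using sub by blast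
      have "((\<lambda>s. \<Phi> s (I s \<omega>)) has_vector_derivative \<Phi> s (\<Psi> s (A s (N s \<omega>))) + (A s o\<^sub>L \<Phi> s) (I s \<omega>)) (at s within {0..T})"
        by (rule bounded_bilinear.has_vector_derivative[OF bounded_bilinear_blinfun_apply \<Phi>[OF sT] I'[OF sT]])
      moreover have "\<Phi> s (\<Psi> s (A s (N s \<omega>))) + (A s o\<^sub>L \<Phi> s) (I s \<omega>) = A s (X s \<omega>)"
        using inv[OF sT] by (simp add: X_def blinfun.add_right)
      ultimately show "((\<lambda>s. \<Phi> s (I s \<omega>)) has_vector_derivative A s (X s \<omega>)) (at s within {0..t})"
        using sub by (auto intro: has_vector_derivative_within_subset)
    next
      show "continuous_on {0..t} (\<lambda>s. A s (X s \<omega>))"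
        by (intro bounded_bilinear.continuous_on[OF bounded_bilinear_blinfun_apply] continuous_on_subset[OF A sub] continuous_on_subset[OF nonant_cont[OF X \<omega>] sub] continuous_intros)
    qed
    moreover have "I 0 \<omega> = x"
      using LINT_eq_integral[of 0 0 "\<lambda>s. \<Psi> s (A s (N s \<omega>))"] by (simp add: I_def integral_unique[OF has_integral_refl(2)])
    ultimately show ?thesis by (simp add: X_def \<Phi>0)
  qed
  moreover have "X t \<in> borel_measurable F" if t: "t \<in> {0..T}" and F: "space F = space M"
    and "\<forall>s\<in>{0..t}. N s \<in> borel_measurable F" for t F
  proof -
    have NF: "N s \<in> borel_measurable F" if "s \<in> {0..t}" for s
      using that \<open>\<forall>s\<in>{0..t}. N s \<in> borel_measurable F\<close> by blast
    have bl: "(\<lambda>\<omega>. blinfun_apply K (V \<omega>)) \<in> borel_measurable F" if "V \<in> borel_measurable F" for K :: "'a \<Rightarrow>\<^sub>L 'a" and V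
      by (rule measurable_compose[OF that])
        (intro borel_measurable_continuous_onI linear_continuous_on blinfun.bounded_linear_right)
    have "(\<lambda>\<omega>. LINT s:{0..t}|lborel. blinfun_apply (\<Psi> s) (A s (N s \<omega>))) \<in> borel_measurable F"
    proof (rule borel_measurable_time_integral)
      show "0 \<le> t" using t by simp
      show "(\<lambda>\<omega>. blinfun_apply (\<Psi> s) (A s (N s \<omega>))) \<in> borel_measurable F" if "s \<in> {0..t}" for s
        by (intro bl NF that)
      show "continuous_on {0..t} (\<lambda>s. blinfun_apply (\<Psi> s) (A s (N s \<omega>)))" if "\<omega> \<in> space F" for \<omega>
        by (rule continuous_on_subset[OF nonant_cont[OF VN]]) (use that F t in auto)
    qed
    then have "(\<lambda>\<omega>. I t \<omega>) \<in> borel_measurable F" unfolding I_def by simp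
    then have "(\<lambda>\<omega>. \<Phi> t (I t \<omega>)) \<in> borel_measurable F" by (rule bl)
    moreover have "N t \<in> borel_measurable F" using NF t by simp
    ultimately show ?thesis unfolding X_def[abs_def] by simp
  qed
  ultimately show thesis by (rule that)
qed

end

section \<open>Moments of Brownian motion up to order two\<close>

context prob_space
begin

lemma indep_var_of_indep_set:
  assumes ind: "indep_set \<A> \<B>"
    and X: "X \<in> borel_measurable M" "{X -` S \<inter> space M | S. S \<in> sets borel} \<subseteq> \<A>"
    and Y: "Y \<in> borel_measurable M" "{Y -` S \<inter> space M | S. S \<in> sets borel} \<subseteq> \<B>"
  shows "indep_var borel X borel (Y :: 'a \<Rightarrow> real)"
proof -
  have sig: "sigma_sets (space M) {Z -` S \<inter> space M | S. S \<in> sets borel} = {Z -` S \<inter> space M | S. S \<in> sets borel}" for Z :: "'a \<Rightarrow> 'b::topological_space"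
    using sets_vimage_algebra[of "space M" Z borel] sets_vimage_algebra2[of Z "space M" borel] by simp
  have "indep_set {X -` S \<inter> space M | S. S \<in> sets borel} {Y -` S \<inter> space M | S. S \<in> sets borel}"
    using ind unfolding indep_set_def
    by (rule indep_sets_mono_sets) (use X(2) Y(2) in \<open>auto split: bool.split\<close>)
  then show ?thesis unfolding indep_var_eq sig using X(1) Y(1) by simp
qed

lemma path_events_component:
  fixes W :: "real \<Rightarrow> 'a \<Rightarrow> real^'m"
  assumes "0 \<le> s" "s \<le> t"
  shows "{(\<lambda>\<omega>. W s \<omega> $ i) -` S \<inter> space M | S. S \<in> sets borel} \<subseteq> sigma_sets (space M) (path_events M W t)"
proof clarify
  fix S :: "real set" assume S: "S \<in> sets borel"
  have "(\<lambda>v::real^'m. v $ i) \<in> borel_measurable borel"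
    by (intro borel_measurable_continuous_onI continuous_intros)
  from measurable_sets[OF this S] have "(\<lambda>v::real^'m. v $ i) -` S \<in> sets borel" by simp
  moreover have "(\<lambda>\<omega>. W s \<omega> $ i) -` S \<inter> space M = W s -` ((\<lambda>v. v $ i) -` S) \<inter> space M" by auto
  ultimately have "(\<lambda>\<omega>. W s \<omega> $ i) -` S \<inter> space M \<in> path_events M W t"
    unfolding path_events_def using assms by blast
  then show "(\<lambda>\<omega>. W s \<omega> $ i) -` S \<inter> space M \<in> sigma_sets (space M) (path_events M W t)" by blast
qed

lemma brownian_increment:
  assumes W: "brownian_motion M T W" and st: "0 \<le> s" "s < t" "t \<le> T"
  shows "integrable M (\<lambda>\<omega>. (W t \<omega> - W s \<omega>) $ i)" "expectation (\<lambda>\<omega>. (W t \<omega> - W s \<omega>) $ i) = 0"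
    "integrable M (\<lambda>\<omega>. ((W t \<omega> - W s \<omega>) $ i)\<^sup>2)" "expectation (\<lambda>\<omega>. ((W t \<omega> - W s \<omega>) $ i)\<^sup>2) = t - s"
proof -
  have D: "distributed M lborel (\<lambda>\<omega>. (W t \<omega> - W s \<omega>) $ i) (normal_density 0 (sqrt (t - s)))"
    using W st unfolding brownian_motion_def by blast
  have pos: "0 < sqrt (t - s)" using st by simp
  note di = distributed_integrable[OF D] distributed_integral[OF D]
  show "integrable M (\<lambda>\<omega>. (W t \<omega> - W s \<omega>) $ i)"
    using di(1)[of "\<lambda>x. x"] integrable_normal_moment_nz_1[OF pos, of 0] by simp
  show "expectation (\<lambda>\<omega>. (W t \<omega> - W s \<omega>) $ i) = 0"
    using di(2)[of "\<lambda>x. x"] integral_normal_moment_nz_1[OF pos, of 0] by simp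
  show "integrable M (\<lambda>\<omega>. ((W t \<omega> - W s \<omega>) $ i)\<^sup>2)"
    using di(1)[of "\<lambda>x. x\<^sup>2"] integrable_normal_moment[OF pos, of 0 2] by simp
  show "expectation (\<lambda>\<omega>. ((W t \<omega> - W s \<omega>) $ i)\<^sup>2) = t - s"
    using di(2)[of "\<lambda>x. x\<^sup>2"] integral_normal_moment_even[OF pos, of 0 1] st by simp
qed

lemma brownian_W0:
  assumes "brownian_motion M T W" shows "AE \<omega> in M. W 0 \<omega> $ i = 0"
  using assms unfolding brownian_motion_def by auto

lemma brownian_meas:
  assumes "brownian_motion M T W" "t \<in> {0..T}"
  shows "W t \<in> borel_measurable M" "(\<lambda>\<omega>. W t \<omega> $ i) \<in> borel_measurable M"
proof -
  show [measurable]: "W t \<in> borel_measurable M" using assms unfolding brownian_motion_def by blast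
  show "(\<lambda>\<omega>. W t \<omega> $ i) \<in> borel_measurable M"
    by (rule measurable_compose[of "W t" M borel "\<lambda>v. v $ i"]) (auto intro!: borel_measurable_continuous_onI continuous_intros)
qed

lemma brownian_component:
  assumes W: "brownian_motion M T W" and t: "t \<in> {0..T}"
  shows "integrable M (\<lambda>\<omega>. W t \<omega> $ i)" "expectation (\<lambda>\<omega>. W t \<omega> $ i) = 0"
    "integrable M (\<lambda>\<omega>. (W t \<omega> $ i)\<^sup>2)" "expectation (\<lambda>\<omega>. (W t \<omega> $ i)\<^sup>2) = t"
proof -
  have [measurable]: "(\<lambda>\<omega>. W t \<omega> $ i) \<in> borel_measurable M" "(\<lambda>\<omega>. W 0 \<omega> $ i) \<in> borel_measurable M"
    using brownian_meas(2)[OF W] t by auto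
  show "integrable M (\<lambda>\<omega>. W t \<omega> $ i)" "expectation (\<lambda>\<omega>. W t \<omega> $ i) = 0"
    "integrable M (\<lambda>\<omega>. (W t \<omega> $ i)\<^sup>2)" "expectation (\<lambda>\<omega>. (W t \<omega> $ i)\<^sup>2) = t"
  proof -
    have *: "integrable M (\<lambda>\<omega>. W t \<omega> $ i) \<and> expectation (\<lambda>\<omega>. W t \<omega> $ i) = 0
      \<and> integrable M (\<lambda>\<omega>. (W t \<omega> $ i)\<^sup>2) \<and> expectation (\<lambda>\<omega>. (W t \<omega> $ i)\<^sup>2) = t"
    \<comment> \<open>\<open>brownian_increment\<close> speaks about distinct times, and at
      \<open>t = 0\<close> the value is zero only almost everywhere.\<close>
    proof (cases "t = 0")
      case True
      have ae: "AE \<omega> in M. W t \<omega> $ i = 0" "AE \<omega> in M. (W t \<omega> $ i)\<^sup>2 = 0"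
        using brownian_W0[OF W, of i] True by auto
      have "integrable M (\<lambda>\<omega>. W t \<omega> $ i) = integrable M (\<lambda>\<omega>. 0::real)"
        "integrable M (\<lambda>\<omega>. (W t \<omega> $ i)\<^sup>2) = integrable M (\<lambda>\<omega>. 0::real)"
        using ae by (intro integrable_cong_AE; measurable)+
      moreover have "expectation (\<lambda>\<omega>. W t \<omega> $ i) = expectation (\<lambda>\<omega>. 0)" "expectation (\<lambda>\<omega>. (W t \<omega> $ i)\<^sup>2) = expectation (\<lambda>\<omega>. 0)"
        using ae by (intro integral_cong_AE; measurable)+
      ultimately show ?thesis using True by simp
    next
      case False
      then have t': "0 \<le> (0::real)" "0 < t" "t \<le> T" using t by auto
      note b = brownian_increment[OF W t', of i]
      have [measurable]: "(\<lambda>\<omega>. (W t \<omega> - W 0 \<omega>) $ i) \<in> borel_measurable M" using b(1) by (rule borel_measurable_integrable)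
      have ae: "AE \<omega> in M. W t \<omega> $ i = (W t \<omega> - W 0 \<omega>) $ i" "AE \<omega> in M. (W t \<omega> $ i)\<^sup>2 = ((W t \<omega> - W 0 \<omega>) $ i)\<^sup>2"
        using brownian_W0[OF W, of i] by auto
      have "integrable M (\<lambda>\<omega>. W t \<omega> $ i) = integrable M (\<lambda>\<omega>. (W t \<omega> - W 0 \<omega>) $ i)"
        "integrable M (\<lambda>\<omega>. (W t \<omega> $ i)\<^sup>2) = integrable M (\<lambda>\<omega>. ((W t \<omega> - W 0 \<omega>) $ i)\<^sup>2)"
        using ae by (intro integrable_cong_AE; measurable)+
      moreover have "expectation (\<lambda>\<omega>. W t \<omega> $ i) = expectation (\<lambda>\<omega>. (W t \<omega> - W 0 \<omega>) $ i)"
        "expectation (\<lambda>\<omega>. (W t \<omega> $ i)\<^sup>2) = expectation (\<lambda>\<omega>. ((W t \<omega> - W 0 \<omega>) $ i)\<^sup>2)"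
        using ae by (intro integral_cong_AE; measurable)+
      ultimately show ?thesis using b by simp
    qed
    then show "integrable M (\<lambda>\<omega>. W t \<omega> $ i)" "expectation (\<lambda>\<omega>. W t \<omega> $ i) = 0"
      "integrable M (\<lambda>\<omega>. (W t \<omega> $ i)\<^sup>2)" "expectation (\<lambda>\<omega>. (W t \<omega> $ i)\<^sup>2) = t" by auto
  qed
qed

lemma brownian_product_integrable:
  assumes "brownian_motion M T W" "brownian_motion M T V" "s \<in> {0..T}" "t \<in> {0..T}"
  shows "integrable M (\<lambda>\<omega>. (W s \<omega> $ i) * (V t \<omega> $ j))"
  using integrable_inner_of_square(1)[of "\<lambda>\<omega>. W s \<omega> $ i" "\<lambda>\<omega>. V t \<omega> $ j"]
    brownian_meas(2)[OF assms(1,3)] brownian_meas(2)[OF assms(2,4)] brownian_component(3)[OF assms(1,3)] brownian_component(3)[OF assms(2,4)]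
  by simp

text \<open>The product with the increment after \<open>s\<close> factorises by independence into
  means that vanish.\<close>

lemma brownian_past_future:
  assumes W: "brownian_motion M T W" and st: "0 \<le> s" "s \<le> t" "t \<le> T"
  shows "expectation (\<lambda>\<omega>. (W s \<omega> $ i) * (W t \<omega> $ j)) = expectation (\<lambda>\<omega>. (W s \<omega> $ i) * (W s \<omega> $ j))"
proof (cases "s = t")
  case False
  with st have lt: "s < t" by simp
  have s: "s \<in> {0..T}" "t \<in> {0..T}" using st by auto
  have ind: "indep_set (sigma_sets (space M) (path_events M W s)) {(\<lambda>\<omega>. W t \<omega> - W s \<omega>) -` A \<inter> space M | A. A \<in> sets borel}"
    using W st lt unfolding brownian_motion_def by blast
  have "indep_var borel (\<lambda>\<omega>. W s \<omega> $ i) borel (\<lambda>\<omega>. (W t \<omega> - W s \<omega>) $ j)"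
  proof (rule indep_var_of_indep_set[OF ind])
    show "{(\<lambda>\<omega>. (W t \<omega> - W s \<omega>) $ j) -` S \<inter> space M |S. S \<in> sets borel} \<subseteq> {(\<lambda>\<omega>. W t \<omega> - W s \<omega>) -` A \<inter> space M |A. A \<in> sets borel}"
    proof clarify
      fix S :: "real set" assume S: "S \<in> sets borel"
      have "(\<lambda>v::real^'b. v $ j) \<in> borel_measurable borel"
        by (intro borel_measurable_continuous_onI continuous_intros)
      from measurable_sets[OF this S] have "(\<lambda>v::real^'b. v $ j) -` S \<in> sets borel" by simp
      moreover have "(\<lambda>\<omega>. (W t \<omega> - W s \<omega>) $ j) -` S \<inter> space M = (\<lambda>\<omega>. W t \<omega> - W s \<omega>) -` ((\<lambda>v. v $ j) -` S) \<inter> space M" by auto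
      ultimately show "\<exists>A. (\<lambda>\<omega>. (W t \<omega> - W s \<omega>) $ j) -` S \<inter> space M = (\<lambda>\<omega>. W t \<omega> - W s \<omega>) -` A \<inter> space M \<and> A \<in> sets borel" by blast
    qed
  qed (use path_events_component[of s s W i] st brownian_meas(2)[OF W] s brownian_increment(1)[OF W st(1) lt st(3)] in auto)
  from indep_var_lebesgue_integral[OF this brownian_component(1)[OF W s(1)] brownian_increment(1)[OF W st(1) lt st(3)]]
  have "expectation (\<lambda>\<omega>. (W s \<omega> $ i) * ((W t \<omega> - W s \<omega>) $ j)) = 0"
    using brownian_component(2)[OF W s(1)] by simp
  then have "expectation (\<lambda>\<omega>. (W s \<omega> $ i) * (W t \<omega> $ j) - (W s \<omega> $ i) * (W s \<omega> $ j)) = 0"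
    by (simp add: right_diff_distrib)
  then show ?thesis
    using brownian_product_integrable[OF W W s] brownian_product_integrable[OF W W s(1) s(1)] by simp
qed simp

lemma brownian_same_time:
  assumes W: "brownian_motion M T W" and t: "t \<in> {0..T}"
  shows "expectation (\<lambda>\<omega>. (W t \<omega> $ i) * (W t \<omega> $ j)) = (if i = j then t else 0)"
proof (cases "i = j")
  case True
  then show ?thesis using brownian_component(4)[OF W t, of i] by (simp add: power2_eq_square)
next
  case False
  have [measurable]: "(\<lambda>\<omega>. W t \<omega> $ i) \<in> borel_measurable M" "(\<lambda>\<omega>. W 0 \<omega> $ i) \<in> borel_measurable M"
    "(\<lambda>\<omega>. W t \<omega> $ j) \<in> borel_measurable M" "(\<lambda>\<omega>. W 0 \<omega> $ j) \<in> borel_measurable M"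
    using brownian_meas(2)[OF W] t by auto
  show ?thesis
  proof (cases "t = 0")
    case True
    have "expectation (\<lambda>\<omega>. (W t \<omega> $ i) * (W t \<omega> $ j)) = expectation (\<lambda>\<omega>. 0)"
      using brownian_W0[OF W, of i] True by (intro integral_cong_AE) auto
    then show ?thesis using False by simp
  next
    case nz: False
    then have t': "0 \<le> (0::real)" "0 < t" "t \<le> T" using t by auto
    have "indep_vars (\<lambda>_. borel) (\<lambda>i \<omega>. (W t \<omega> - W 0 \<omega>) $ i) UNIV"
      using W t' unfolding brownian_motion_def by blast
    \<comment> \<open>Independence of two coordinates is read off from the rule for sums with the
      one-element set \<open>{j}\<close>.\<close>
    then have "indep_var borel (\<lambda>\<omega>. (W t \<omega> - W 0 \<omega>) $ i) borel (\<lambda>\<omega>. (W t \<omega> - W 0 \<omega>) $ j)"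
      using indep_vars_sum[OF _ _ indep_vars_subset, of "{j}" i "\<lambda>i \<omega>. (W t \<omega> - W 0 \<omega>) $ i" UNIV] False by simp
    from indep_var_lebesgue_integral[OF this brownian_increment(1)[OF W t'] brownian_increment(1)[OF W t']]
    have "expectation (\<lambda>\<omega>. ((W t \<omega> - W 0 \<omega>) $ i) * ((W t \<omega> - W 0 \<omega>) $ j)) = 0"
      using brownian_increment(2)[OF W t'] by simp
    moreover have "expectation (\<lambda>\<omega>. (W t \<omega> $ i) * (W t \<omega> $ j)) = expectation (\<lambda>\<omega>. ((W t \<omega> - W 0 \<omega>) $ i) * ((W t \<omega> - W 0 \<omega>) $ j))"
      using brownian_W0[OF W, of i] brownian_W0[OF W, of j] by (intro integral_cong_AE) auto
    ultimately show ?thesis using False by simp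
  qed
qed

lemma brownian_covariance:
  assumes W: "brownian_motion M T W" and s: "s \<in> {0..T}" "t \<in> {0..T}"
  shows "expectation (\<lambda>\<omega>. (W s \<omega> $ i) * (W t \<omega> $ j)) = (if i = j then min s t else 0)"
proof (cases "s \<le> t")
  case True
  then show ?thesis
    using brownian_past_future[OF W, of s t i j] brownian_same_time[OF W s(1), of i j] s by (simp add: min_def)
next
  case False
  then have "expectation (\<lambda>\<omega>. (W t \<omega> $ j) * (W s \<omega> $ i)) = (if j = i then t else 0)"
    using brownian_past_future[OF W, of t s j i] brownian_same_time[OF W s(2), of j i] s by simp
  then show ?thesis using False by (simp add: mult.commute min_def)
qed

lemma brownian_cross:
  assumes W: "brownian_motion M T W" "brownian_motion M T V" and s: "s \<in> {0..T}" "t \<in> {0..T}"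
    and ind: "indep_set (sigma_sets (space M) (path_events M W T)) (sigma_sets (space M) (path_events M V T))"
  shows "expectation (\<lambda>\<omega>. (W s \<omega> $ i) * (V t \<omega> $ j)) = 0"
proof -
  have "indep_var borel (\<lambda>\<omega>. W s \<omega> $ i) borel (\<lambda>\<omega>. V t \<omega> $ j)"
    by (rule indep_var_of_indep_set[OF ind])
      (use path_events_component[of s T W i] path_events_component[of t T V j] brownian_meas(2)[OF W(1)] brownian_meas(2)[OF W(2)] s in auto)
  from indep_var_lebesgue_integral[OF this brownian_component(1)[OF W(1) s(1)] brownian_component(1)[OF W(2) s(2)]]
  show ?thesis using brownian_component(2)[OF W(1) s(1)] by simp
qed

lemma brownian_inner:
  assumes W: "brownian_motion M T W" and s: "s \<in> {0..T}" "t \<in> {0..T}"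
  shows "integrable M (\<lambda>\<omega>. (W s \<omega> \<bullet> u) * (W t \<omega> \<bullet> v))"
    "expectation (\<lambda>\<omega>. (W s \<omega> \<bullet> u) * (W t \<omega> \<bullet> v)) = min s t * (u \<bullet> v)"
    "integrable M (\<lambda>\<omega>. W t \<omega> \<bullet> v)" "expectation (\<lambda>\<omega>. W t \<omega> \<bullet> v) = 0"
    "integrable M (\<lambda>\<omega>. (norm (W t \<omega>))\<^sup>2)"
proof -
  have e: "(\<lambda>\<omega>. (W s \<omega> \<bullet> u) * (W t \<omega> \<bullet> v)) = (\<lambda>\<omega>. \<Sum>i\<in>UNIV. \<Sum>j\<in>UNIV. (W s \<omega> $ i) * (W t \<omega> $ j) * (u $ i * v $ j))"
    by (simp add: inner_vec_def sum_product mult_ac)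
  show "integrable M (\<lambda>\<omega>. (W s \<omega> \<bullet> u) * (W t \<omega> \<bullet> v))"
    unfolding e by (intro Bochner_Integration.integrable_sum integrable_mult_left brownian_product_integrable[OF W W s])
  have "expectation (\<lambda>\<omega>. (W s \<omega> \<bullet> u) * (W t \<omega> \<bullet> v)) = (\<Sum>i\<in>UNIV. \<Sum>j\<in>UNIV. (if i = j then min s t else 0) * (u $ i * v $ j))"
    unfolding e using brownian_product_integrable[OF W W s]
    by (simp add: brownian_covariance[OF W s])
  also have "\<dots> = min s t * (u \<bullet> v)"
    by (simp add: inner_vec_def sum_distrib_left if_distrib[where f = "\<lambda>x. x * _"] sum.delta cong: if_cong)
  finally show "expectation (\<lambda>\<omega>. (W s \<omega> \<bullet> u) * (W t \<omega> \<bullet> v)) = min s t * (u \<bullet> v)" .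
  show "integrable M (\<lambda>\<omega>. W t \<omega> \<bullet> v)" "expectation (\<lambda>\<omega>. W t \<omega> \<bullet> v) = 0"
    using brownian_component(1,2)[OF W s(2)] by (simp_all add: inner_vec_def)
  show "integrable M (\<lambda>\<omega>. (norm (W t \<omega>))\<^sup>2)"
    unfolding power2_norm_eq_inner inner_vec_def
    using brownian_component(3)[OF W s(2)] by (simp add: power2_eq_square)
qed

lemma brownian_cross_inner:
  assumes W: "brownian_motion M T W" "brownian_motion M T V" and s: "s \<in> {0..T}" "t \<in> {0..T}"
    and ind: "indep_set (sigma_sets (space M) (path_events M W T)) (sigma_sets (space M) (path_events M V T))"
  shows "integrable M (\<lambda>\<omega>. (W s \<omega> \<bullet> u) * (V t \<omega> \<bullet> v))" "expectation (\<lambda>\<omega>. (W s \<omega> \<bullet> u) * (V t \<omega> \<bullet> v)) = 0"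
proof -
  have e: "(\<lambda>\<omega>. (W s \<omega> \<bullet> u) * (V t \<omega> \<bullet> v)) = (\<lambda>\<omega>. \<Sum>i\<in>UNIV. \<Sum>j\<in>UNIV. (W s \<omega> $ i) * (V t \<omega> $ j) * (u $ i * v $ j))"
    by (simp add: inner_vec_def sum_product mult_ac)
  show "integrable M (\<lambda>\<omega>. (W s \<omega> \<bullet> u) * (V t \<omega> \<bullet> v))"
    unfolding e by (intro Bochner_Integration.integrable_sum integrable_mult_left brownian_product_integrable[OF W s])
  show "expectation (\<lambda>\<omega>. (W s \<omega> \<bullet> u) * (V t \<omega> \<bullet> v)) = 0"
    unfolding e using brownian_product_integrable[OF W s] by (simp add: brownian_cross[OF W s ind])
qed

end

section \<open>Brownian noise and closed loops\<close>

lemma measurable_of_AE_eq: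
  assumes M: "complete_measure M" and f: "f \<in> borel_measurable M" and eq: "AE x in M. f x = (g x :: real)"
  shows "g \<in> borel_measurable M"
proof (rule measurableI)
  fix A :: "real set" assume A: "A \<in> sets borel"
  have "f -` A \<inter> space M \<in> sets M" using f A by (rule measurable_sets)
  moreover have "AE x in M. x \<in> f -` A \<inter> space M \<longleftrightarrow> x \<in> g -` A \<inter> space M" using eq by eventually_elim auto
  ultimately show "g -` A \<inter> space M \<in> sets M"
    using complete_measure.in_sets_AE[OF M, of "f -` A \<inter> space M" "g -` A \<inter> space M"] by auto
qed auto

text \<open>On a complete space \<open>f\<close> and \<open>g\<close> are measurable together, and
  otherwise both integrals have the default value zero. This serves the costs of state processes
  whose pathwise integrals have not been shown measurable.\<close>

lemma integral_cong_AE_complete: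
  assumes M: "complete_measure M" and eq: "AE x in M. f x = (g x :: real)"
  shows "(\<integral>x. f x \<partial>M) = (\<integral>x. g x \<partial>M)"
proof (cases "f \<in> borel_measurable M")
  case True
  then show ?thesis using measurable_of_AE_eq[OF M True eq] eq by (intro integral_cong_AE)
next
  case False
  have "g \<notin> borel_measurable M"
    using measurable_of_AE_eq[OF M, of g f] eq False by (metis (mono_tags, lifting) AE_mp AE_I2)
  then show ?thesis
    using False by (metis borel_measurable_integrable not_integrable_integral_eq)
qed

text \<open>Left-endpoint step approximations: between consecutive grid points the process is
  replaced by its value at the left one, which belongs to the past, so preimages are countable
  unions of generators of the predictable sigma-algebra. Continuity of the paths gives the
  limit.\<close>

lemma borel_measurable_predictable:
  fixes V :: "real \<Rightarrow> 'o \<Rightarrow> 'a::metric_space"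
  assumes T: "0 \<le> T" and sp: "\<And>t. t \<in> {0..T} \<Longrightarrow> space (F t) = space M"
    and Fsub: "\<And>t. t \<in> {0..T} \<Longrightarrow> sets (F t) \<subseteq> Pow (space M)"
    and meas: "\<And>t. t \<in> {0..T} \<Longrightarrow> V t \<in> borel_measurable (F t)"
    and cont: "\<And>\<omega>. \<omega> \<in> space M \<Longrightarrow> continuous_on {0..T} (\<lambda>t. V t \<omega>)"
  shows "(\<lambda>(t, \<omega>). V t \<omega>) \<in> borel_measurable (predictable_sigma M F T)"
proof -
  define gen where "gen = {{0} \<times> A | A. A \<in> sets (F 0)} \<union> {{s<..t} \<times> A | s t A. 0 \<le> s \<and> s \<le> t \<and> t \<le> T \<and> A \<in> sets (F s)}"
  have genP: "gen \<subseteq> Pow ({0..T} \<times> space M)"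
  proof
    fix E assume "E \<in> gen"
    then consider A where "E = {0} \<times> A" "A \<in> sets (F 0)"
      | s t A where "E = {s<..t} \<times> A" "0 \<le> s" "s \<le> t" "t \<le> T" "A \<in> sets (F s)" unfolding gen_def by blast
    then show "E \<in> Pow ({0..T} \<times> space M)"
    proof cases
      case 1
      then show ?thesis using Fsub[of 0] T by auto
    next
      case 2
      then have "A \<subseteq> space M" using Fsub[of s] by auto
      then show ?thesis using 2 by auto
    qed
  qed
  have P: "predictable_sigma M F T = sigma ({0..T} \<times> space M) gen" by (simp add: predictable_sigma_def gen_def)
  have spP: "space (predictable_sigma M F T) = {0..T} \<times> space M" by (simp add: P space_measure_of_conv)
  have setsP: "sets (predictable_sigma M F T) = sigma_sets ({0..T} \<times> space M) gen"
    unfolding P by (rule sets_measure_of[OF genP])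
  \<comment> \<open>The ceiling minus one is the largest grid index strictly before
    \<open>t\<close>; at \<open>t = 0\<close> there is none, and the index zero is used.\<close>
  define W where "W n = (\<lambda>(t, \<omega>). V ((real_of_int \<lceil>t * real (Suc n)\<rceil> - (if t = 0 then 0 else 1)) / real (Suc n)) \<omega>)" for n
  have W: "W n \<in> borel_measurable (predictable_sigma M F T)" for n
  proof (rule measurableI)
    fix B :: "'a set" assume B: "B \<in> sets borel"
    \<comment> \<open>The last interval is cut at \<open>T\<close>, since generators must lie in
      \<open>{0..T}\<close>.\<close>
    define E where "E k = {real k / real (Suc n)<..min (real (Suc k) / real (Suc n)) T} \<times> (V (real k / real (Suc n)) -` B \<inter> space M)" for k
    define E0 where "E0 = {0::real} \<times> (V 0 -` B \<inter> space M)"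
    have "W n -` B \<inter> ({0..T} \<times> space M) = E0 \<union> (\<Union>k\<in>{k. real k / real (Suc n) \<le> T}. E k)"
    proof (intro set_eqI iffI)
      fix x assume x: "x \<in> W n -` B \<inter> ({0..T} \<times> space M)"
      obtain t \<omega> where [simp]: "x = (t, \<omega>)" by (cases x)
      have t: "t \<in> {0..T}" "\<omega> \<in> space M" using x by auto
      show "x \<in> E0 \<union> (\<Union>k\<in>{k. real k / real (Suc n) \<le> T}. E k)"
      proof (cases "t = 0")
        case True
        then show ?thesis using x by (auto simp: W_def E0_def)
      next
        case False
        with t have tp: "0 < t * real (Suc n)" by simp
        define k where "k = nat (\<lceil>t * real (Suc n)\<rceil> - 1)"
        have "0 < \<lceil>t * real (Suc n)\<rceil>" using tp by simp
        then have k: "real k = real_of_int \<lceil>t * real (Suc n)\<rceil> - 1" by (simp add: k_def)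
        have lt: "real k < t * real (Suc n)" "t * real (Suc n) \<le> real (Suc k)" using k by linarith+
        then have "real k / real (Suc n) < t" "t \<le> real (Suc k) / real (Suc n)"
          by (simp_all add: pos_divide_less_eq pos_le_divide_eq del: of_nat_Suc)
        moreover have "V (real k / real (Suc n)) \<omega> \<in> B" using x False by (simp add: W_def k del: of_nat_Suc)
        ultimately have "x \<in> E k" "real k / real (Suc n) \<le> T" using t by (auto simp: E_def)
        then show ?thesis by blast
      qed
    next
      fix x assume "x \<in> E0 \<union> (\<Union>k\<in>{k. real k / real (Suc n) \<le> T}. E k)"
      then consider "x \<in> E0" | k where "x \<in> E k" by blast
      then show "x \<in> W n -` B \<inter> ({0..T} \<times> space M)"
      proof cases
        case 1
        then show ?thesis using T by (auto simp: E0_def W_def)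
      next
        case 2
        then obtain t \<omega> where [simp]: "x = (t, \<omega>)" and
          t: "real k / real (Suc n) < t" "t \<le> real (Suc k) / real (Suc n)" "t \<le> T" "V (real k / real (Suc n)) \<omega> \<in> B" "\<omega> \<in> space M"
          by (auto simp: E_def)
        have "real k < t * real (Suc n)" "t * real (Suc n) \<le> real (Suc k)"
          using t by (simp_all add: pos_divide_less_eq pos_le_divide_eq del: of_nat_Suc)
        then have "\<lceil>t * real (Suc n)\<rceil> = int k + 1" by (intro ceiling_unique) auto
        moreover have "0 \<le> real k / real (Suc n)" by simp
        then have "0 < t" using t(1) by linarith
        ultimately show ?thesis using t by (simp add: W_def del: of_nat_Suc)
      qed
    qed
    moreover have "E0 \<in> sigma_sets ({0..T} \<times> space M) gen"
      using measurable_sets[OF meas B, of 0] T sp[of 0] unfolding E0_def gen_def by (intro sigma_sets.Basic) auto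
    moreover have "E k \<in> sigma_sets ({0..T} \<times> space M) gen" if k: "real k / real (Suc n) \<le> T" for k
    proof -
      have s: "real k / real (Suc n) \<in> {0..T}" using k by simp
      have "real k / real (Suc n) \<le> min (real (Suc k) / real (Suc n)) T" using k by (simp add: divide_right_mono)
      moreover have "V (real k / real (Suc n)) -` B \<inter> space M \<in> sets (F (real k / real (Suc n)))"
        using measurable_sets[OF meas[OF s] B] sp[OF s] by simp
      ultimately have "E k \<in> gen" unfolding E_def gen_def using s
        by (intro UnI2 CollectI exI[of _ "real k / real (Suc n)"] exI[of _ "min (real (Suc k) / real (Suc n)) T"]
            exI[of _ "V (real k / real (Suc n)) -` B \<inter> space M"]) auto
      then show ?thesis by (rule sigma_sets.Basic)
    qed
    ultimately show "W n -` B \<inter> space (predictable_sigma M F T) \<in> sets (predictable_sigma M F T)"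
      unfolding spP setsP[symmetric] by (auto intro!: sets.countable_UN'')
  qed simp
  show ?thesis
  proof (rule borel_measurable_LIMSEQ_metric[OF W])
    fix x assume "x \<in> space (predictable_sigma M F T)"
    then obtain t \<omega> where [simp]: "x = (t, \<omega>)" and t: "t \<in> {0..T}" and \<omega>: "\<omega> \<in> space M" by (auto simp: spP)
    show "(\<lambda>n. W n x) \<longlonglongrightarrow> (case x of (t, \<omega>) \<Rightarrow> V t \<omega>)"
    proof (cases "t = 0")
      case True then show ?thesis by (simp add: W_def)
    next
      case False
      with t have t0: "0 < t" by simp
      let ?d = "\<lambda>n. (real_of_int \<lceil>t * real (Suc n)\<rceil> - 1) / real (Suc n)"
      have d: "t - 1 / real (Suc n) \<le> ?d n" "?d n \<le> t" "0 \<le> ?d n" for n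
      proof -
        have "t * real (Suc n) - 1 \<le> real_of_int \<lceil>t * real (Suc n)\<rceil> - 1" "real_of_int \<lceil>t * real (Suc n)\<rceil> - 1 \<le> t * real (Suc n)"
          by linarith+
        then have "(t * real (Suc n) - 1) / real (Suc n) \<le> ?d n" "?d n \<le> t * real (Suc n) / real (Suc n)"
          by (intro divide_right_mono; simp)+
        then show "t - 1 / real (Suc n) \<le> ?d n" "?d n \<le> t" by (simp_all add: diff_divide_distrib del: of_nat_Suc)
        have "0 < \<lceil>t * real (Suc n)\<rceil>" using t0 by simp
        then have "1 \<le> real_of_int \<lceil>t * real (Suc n)\<rceil>" by linarith
        then show "0 \<le> ?d n" by simp
      qed
      have "?d \<longlonglongrightarrow> t"
      proof (rule tendsto_sandwich[where f = "\<lambda>n. t - 1 / real (Suc n)" and h = "\<lambda>_. t"])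
        have "(\<lambda>n. t - inverse (real (Suc n))) \<longlonglongrightarrow> t - 0"
          by (intro tendsto_intros LIMSEQ_inverse_real_of_nat)
        then show "(\<lambda>n. t - 1 / real (Suc n)) \<longlonglongrightarrow> t" by (simp add: inverse_eq_divide)
      qed (use d in \<open>auto intro!: always_eventually\<close>)
      moreover have "?d n \<in> {0..T}" for n using d[of n] t by auto
      ultimately have "(\<lambda>n. V (?d n) \<omega>) \<longlonglongrightarrow> V t \<omega>"
        by (intro continuous_on_tendsto_compose[OF cont[OF \<omega>] _ t]) auto
      then show ?thesis using False by (simp add: W_def)
    qed
  qed
qed

locale brownian_pair = prob_space \<Omega> for \<Omega> :: "'o measure" +
  fixes T :: real and W1 :: "real \<Rightarrow> 'o \<Rightarrow> real^'m1" and W2 :: "real \<Rightarrow> 'o \<Rightarrow> real^'m2"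
  assumes T0: "0 < T" and compl: "complete_measure \<Omega>"
    and BM1: "brownian_motion \<Omega> T W1" and BM2: "brownian_motion \<Omega> T W2"
    and indep: "indep_set (sigma_sets (space \<Omega>) (path_events \<Omega> W1 T)) (sigma_sets (space \<Omega>) (path_events \<Omega> W2 T))"
begin

abbreviation "\<F> \<equiv> augmented_filtration \<Omega> W1 W2"

lemma gen_Pow: "path_events \<Omega> W1 t \<union> path_events \<Omega> W2 t \<union> null_sets \<Omega> \<subseteq> Pow (space \<Omega>)"
proof -
  have "null_sets \<Omega> \<subseteq> Pow (space \<Omega>)" using sets.sets_into_space by blast
  then show ?thesis by (auto simp: path_events_def)
qed

lemma space_F [simp]: "space (\<F> t) = space \<Omega>"
  by (simp add: augmented_filtration_def space_measure_of_conv)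

lemma sets_F: "sets (\<F> t) = sigma_sets (space \<Omega>) (path_events \<Omega> W1 t \<union> path_events \<Omega> W2 t \<union> null_sets \<Omega>)"
  unfolding augmented_filtration_def by (rule sets_measure_of[OF gen_Pow])

lemma sets_F_subset: "t \<in> {0..T} \<Longrightarrow> sets (\<F> t) \<subseteq> sets \<Omega>"
proof -
  assume t: "t \<in> {0..T}"
  have "path_events \<Omega> W1 t \<subseteq> sets \<Omega>" "path_events \<Omega> W2 t \<subseteq> sets \<Omega>"
    using measurable_sets[OF brownian_meas(1)[OF BM1]] measurable_sets[OF brownian_meas(1)[OF BM2]] t
    by (auto simp: path_events_def)
  then show ?thesis unfolding sets_F by (intro sets.sigma_sets_subset) auto
qed

lemma measurable_F_Omega: "f \<in> borel_measurable (\<F> t) \<Longrightarrow> t \<in> {0..T} \<Longrightarrow> f \<in> borel_measurable \<Omega>"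
  using sets_F_subset[of t] by (auto simp: measurable_def)

lemma W_F: "0 \<le> s \<Longrightarrow> s \<le> t \<Longrightarrow> W1 s \<in> borel_measurable (\<F> t)" "0 \<le> s \<Longrightarrow> s \<le> t \<Longrightarrow> W2 s \<in> borel_measurable (\<F> t)"
proof -
  have *: "W1 s -` A \<inter> space \<Omega> \<in> sets (\<F> t)" "W2 s -` B \<inter> space \<Omega> \<in> sets (\<F> t)"
    if "0 \<le> s" "s \<le> t" "A \<in> sets borel" "B \<in> sets borel" for A B
    unfolding sets_F using that by (intro sigma_sets.Basic; auto simp: path_events_def)+
  show "0 \<le> s \<Longrightarrow> s \<le> t \<Longrightarrow> W1 s \<in> borel_measurable (\<F> t)" "0 \<le> s \<Longrightarrow> s \<le> t \<Longrightarrow> W2 s \<in> borel_measurable (\<F> t)"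
    using *[of _ "{}"] *[of "{}"] by (auto intro!: measurableI)
qed

lemma null_F: "Z \<in> null_sets \<Omega> \<Longrightarrow> Z \<in> sets (\<F> t)"
  unfolding sets_F by (intro sigma_sets.Basic) auto

end

section \<open>Block operators on the product of slow and fast space\<close>

definition blk :: "real^'n1^'n1 \<Rightarrow> real^'n2^'n1 \<Rightarrow> real^'n1^'n2 \<Rightarrow> real^'n2^'n2
    \<Rightarrow> ((real^'n1) \<times> (real^'n2)) \<Rightarrow>\<^sub>L ((real^'n1) \<times> (real^'n2))" where
  "blk A B C D = Blinfun (\<lambda>z. (A *v fst z + B *v snd z, C *v fst z + D *v snd z))"

lemma blk_apply [simp]: "blinfun_apply (blk A B C D) z = (A *v fst z + B *v snd z, C *v fst z + D *v snd z)"
proof -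
  have "bounded_linear (\<lambda>z. (A *v fst z + B *v snd z, C *v fst z + D *v snd z))"
    by (intro bounded_linear_Pair bounded_linear_add bounded_linear_compose[OF matrix_vector_mul_bounded_linear] bounded_linear_fst bounded_linear_snd)
  then show ?thesis by (simp add: blk_def bounded_linear_Blinfun_apply)
qed

lemma bounded_linear_blk:
  "bounded_linear (\<lambda>m. blk (fst m) (fst (snd m)) (fst (snd (snd m))) (snd (snd (snd m))))"
  unfolding linear_conv_bounded_linear[symmetric]
  by (rule linearI) (rule blinfun_eqI,
      simp add: blinfun.add_left blinfun.scaleR_left matrix_vector_mult_add_rdistrib scaleR_matrix_vector_assoc[symmetric] scaleR_add_right)+

lemma continuous_on_blk [continuous_intros]:
  assumes "continuous_on S a" "continuous_on S b" "continuous_on S c" "continuous_on S d"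
  shows "continuous_on S (\<lambda>t. blk (a t) (b t) (c t) (d t))"
  using bounded_linear.continuous_on[OF bounded_linear_blk, of S "\<lambda>t. (a t, b t, c t, d t)"] assms
  by (simp add: continuous_on_Pair)

lemma has_vector_derivative_blk:
  assumes "(a has_vector_derivative a') (at x within S)" "(b has_vector_derivative b') (at x within S)"
    "(c has_vector_derivative c') (at x within S)" "(d has_vector_derivative d') (at x within S)"
  shows "((\<lambda>t. blk (a t) (b t) (c t) (d t)) has_vector_derivative blk a' b' c' d') (at x within S)"
  using bounded_linear.has_vector_derivative[OF bounded_linear_blk has_vector_derivative_Pair[OF assms(1) has_vector_derivative_Pair[OF assms(2) has_vector_derivative_Pair[OF assms(3,4)]]]]
  by simp

lemma matrix_vector_bounded_bilinear: "bounded_bilinear (\<lambda>(A::real^'n^'m) (x::real^'n). A *v x)"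
proof -
  have "bilinear (\<lambda>(A::real^'n^'m) (x::real^'n). A *v x)"
    unfolding bilinear_def
    by (auto intro!: linearI simp: matrix_vector_mult_add_rdistrib matrix_vector_right_distrib scaleR_matrix_vector_assoc[symmetric] matrix_vector_mult_scaleR)
  then show ?thesis by (simp add: bilinear_conv_bounded_bilinear)
qed

lemmas continuous_on_matrix_vector [continuous_intros] =
  bounded_bilinear.continuous_on[OF matrix_vector_bounded_bilinear]

lemma borel_measurable_matrix_vector [measurable (raw)]:
  "f \<in> borel_measurable M \<Longrightarrow> (\<lambda>\<omega>. (A::real^'n^'m) *v f \<omega>) \<in> borel_measurable M"
  by (rule measurable_compose[of f M borel]) (auto intro!: borel_measurable_continuous_onI continuous_intros)

lemma LINT_Pair:
  fixes f :: "real \<Rightarrow> 'a::euclidean_space" and g :: "real \<Rightarrow> 'b::euclidean_space"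
  assumes f: "continuous_on {0..t} f" and g: "continuous_on {0..t} g"
  shows "(LINT s:{0..t}|lborel. (f s, g s)) = (LINT s:{0..t}|lborel. f s, LINT s:{0..t}|lborel. g s)"
proof -
  have c: "continuous_on {0..t} (\<lambda>s. (f s, g s))" using f g by (rule continuous_on_Pair)
  have "((\<lambda>s. (f s, g s)) has_integral (integral {0..t} f, integral {0..t} g)) {0..t}"
  proof -
    have i: "(\<lambda>s. (f s, g s)) integrable_on {0..t}" by (rule integrable_continuous_interval[OF c])
    have "fst (integral {0..t} (\<lambda>s. (f s, g s))) = integral {0..t} f" "snd (integral {0..t} (\<lambda>s. (f s, g s))) = integral {0..t} g"
      using integral_linear[OF i bounded_linear_fst] integral_linear[OF i bounded_linear_snd] by (simp_all add: o_def)
    then show ?thesis using integrable_integral[OF i] by (metis prod.collapse)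
  qed
  then show ?thesis by (simp add: LINT_eq_integral f g c integral_unique)
qed

lemma norm_Pair_square: "(norm (x, y))\<^sup>2 = (norm x)\<^sup>2 + (norm y)\<^sup>2"
  by (simp add: norm_Pair)

lemma inner_vector_matrix: "x \<bullet> (y v* M) = (M *v x) \<bullet> y" for M :: "real^'p^'q"
  by (metis dot_lmul_matrix inner_commute)

context brownian_pair
begin

text \<open>One null set carrying all bad paths of both motions, fixed by choice so that it can
  appear in definitions. The augmentation puts it into every \<open>\<F> t\<close>.\<close>

definition irregular_paths where "irregular_paths = (SOME Z. Z \<in> null_sets \<Omega> \<and> (\<forall>\<omega>\<in>space \<Omega> - Z. continuous_on {0..T} (\<lambda>t. W1 t \<omega>) \<and> continuous_on {0..T} (\<lambda>t. W2 t \<omega>) \<and> W1 0 \<omega> = 0 \<and> W2 0 \<omega> = 0))"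

lemma irregular_paths: "irregular_paths \<in> null_sets \<Omega>"
  "\<And>\<omega>. \<omega> \<in> space \<Omega> \<Longrightarrow> \<omega> \<notin> irregular_paths \<Longrightarrow> continuous_on {0..T} (\<lambda>t. W1 t \<omega>) \<and> continuous_on {0..T} (\<lambda>t. W2 t \<omega>) \<and> W1 0 \<omega> = 0 \<and> W2 0 \<omega> = 0"
proof -
  have "AE \<omega> in \<Omega>. continuous_on {0..T} (\<lambda>t. W1 t \<omega>) \<and> continuous_on {0..T} (\<lambda>t. W2 t \<omega>) \<and> W1 0 \<omega> = 0 \<and> W2 0 \<omega> = 0"
    using BM1 BM2 unfolding brownian_motion_def by (auto intro: AE_conjI)
  then obtain Z where "{\<omega> \<in> space \<Omega>. \<not> (continuous_on {0..T} (\<lambda>t. W1 t \<omega>) \<and> continuous_on {0..T} (\<lambda>t. W2 t \<omega>) \<and> W1 0 \<omega> = 0 \<and> W2 0 \<omega> = 0)} \<subseteq> Z"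
      "emeasure \<Omega> Z = 0" "Z \<in> sets \<Omega>"
    by (rule AE_E)
  then have "\<exists>Z. Z \<in> null_sets \<Omega> \<and> (\<forall>\<omega>\<in>space \<Omega> - Z. continuous_on {0..T} (\<lambda>t. W1 t \<omega>) \<and> continuous_on {0..T} (\<lambda>t. W2 t \<omega>) \<and> W1 0 \<omega> = 0 \<and> W2 0 \<omega> = 0)"
    by (intro exI[of _ Z]) auto
  from someI_ex[OF this] show "irregular_paths \<in> null_sets \<Omega>"
    "\<And>\<omega>. \<omega> \<in> space \<Omega> \<Longrightarrow> \<omega> \<notin> irregular_paths \<Longrightarrow> continuous_on {0..T} (\<lambda>t. W1 t \<omega>) \<and> continuous_on {0..T} (\<lambda>t. W2 t \<omega>) \<and> W1 0 \<omega> = 0 \<and> W2 0 \<omega> = 0"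
    unfolding irregular_paths_def[symmetric] by auto
qed

lemma AE_irregular_paths: "AE \<omega> in \<Omega>. \<omega> \<notin> irregular_paths" by (rule AE_not_in[OF irregular_paths(1)])

text \<open>Setting the noise to zero on the irregular paths makes every path continuous without
  losing adaptedness. \<open>c\<close> will be \<open>1 / sqrt \<epsilon>\<close>.\<close>

definition noise :: "real^'m1^'n1 \<Rightarrow> real^'m2^'n2 \<Rightarrow> real \<Rightarrow> real \<Rightarrow> 'o \<Rightarrow> (real^'n1) \<times> (real^'n2)" where
  "noise \<sigma>1 \<sigma>2 c t \<omega> = (if \<omega> \<in> irregular_paths then 0 else (\<sigma>1 *v W1 t \<omega>, c *\<^sub>R (\<sigma>2 *v W2 t \<omega>)))"

definition noise_cov :: "real^'m1^'n1 \<Rightarrow> real^'m2^'n2 \<Rightarrow> real \<Rightarrow> (real^'n1) \<times> (real^'n2) \<Rightarrow> (real^'n1) \<times> (real^'n2) \<Rightarrow> real" where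
  "noise_cov \<sigma>1 \<sigma>2 c a b = (\<sigma>1\<^sup>T *v fst a) \<bullet> (\<sigma>1\<^sup>T *v fst b) + c\<^sup>2 * ((\<sigma>2\<^sup>T *v snd a) \<bullet> (\<sigma>2\<^sup>T *v snd b))"

lemma noise_F: "0 \<le> s \<Longrightarrow> s \<le> t \<Longrightarrow> noise \<sigma>1 \<sigma>2 c s \<in> borel_measurable (\<F> t)"
proof -
  assume s: "0 \<le> s" "s \<le> t"
  have [measurable]: "W1 s \<in> borel_measurable (\<F> t)" "W2 s \<in> borel_measurable (\<F> t)" using W_F s by auto
  have [measurable]: "irregular_paths \<in> sets (\<F> t)" by (rule null_F[OF irregular_paths(1)])
  have "(\<lambda>\<omega>. if \<omega> \<in> irregular_paths then 0 else (\<sigma>1 *v W1 s \<omega>, c *\<^sub>R (\<sigma>2 *v W2 s \<omega>))) \<in> borel_measurable (\<F> t)"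
    by measurable
  then show ?thesis by (simp add: noise_def[abs_def])
qed

lemma noise_cont: "\<omega> \<in> space \<Omega> \<Longrightarrow> continuous_on {0..T} (\<lambda>t. noise \<sigma>1 \<sigma>2 c t \<omega>)"
  using irregular_paths(2)[of \<omega>] by (cases "\<omega> \<in> irregular_paths") (auto simp: noise_def intro!: continuous_intros)

lemma white_noise_noise:
  fixes \<sigma>1 :: "real^'m1^'n1" and \<sigma>2 :: "real^'m2^'n2"
  shows "white_noise \<Omega> T (noise \<sigma>1 \<sigma>2 c) (noise_cov \<sigma>1 \<sigma>2 c)"
proof
  show "0 \<le> T" using T0 by simp
  have m: "noise \<sigma>1 \<sigma>2 c t \<in> borel_measurable \<Omega>" if "t \<in> {0..T}" for t
    using noise_F[of t t] measurable_F_Omega[OF _ that] that by auto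
  then show "\<And>t. t \<in> {0..T} \<Longrightarrow> noise \<sigma>1 \<sigma>2 c t \<in> borel_measurable \<Omega>" .
  show "\<And>\<omega>. \<omega> \<in> space \<Omega> \<Longrightarrow> continuous_on {0..T} (\<lambda>t. noise \<sigma>1 \<sigma>2 c t \<omega>)" by (rule noise_cont)
  \<comment> \<open>The noise tested against \<open>a\<close>, without the correction on the null
    set; its moments come directly from \<open>W1\<close> and \<open>W2\<close>.\<close>
  define R where "R t \<omega> a = W1 t \<omega> \<bullet> (\<sigma>1\<^sup>T *v fst a) + c * (W2 t \<omega> \<bullet> (\<sigma>2\<^sup>T *v snd a))" for t \<omega> and a :: "(real^'n1) \<times> (real^'n2)"
  have Rn: "AE \<omega> in \<Omega>. noise \<sigma>1 \<sigma>2 c t \<omega> \<bullet> a = R t \<omega> a" for t a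
    using AE_irregular_paths
  proof eventually_elim
    case (elim \<omega>)
    show ?case using elim by (simp add: noise_def R_def inner_prod_def inner_vector_matrix)
  qed
  have W [measurable]: "W1 t \<in> borel_measurable \<Omega>" "W2 t \<in> borel_measurable \<Omega>" if "t \<in> {0..T}" for t
    using brownian_meas(1)[OF BM1 that] brownian_meas(1)[OF BM2 that] by auto
  have Rm: "(\<lambda>\<omega>. R t \<omega> a) \<in> borel_measurable \<Omega>" if "t \<in> {0..T}" for t a
  proof -
    note [measurable] = W[OF that]
    show ?thesis unfolding R_def by measurable
  qed
  have nm: "(\<lambda>\<omega>. noise \<sigma>1 \<sigma>2 c t \<omega> \<bullet> a) \<in> borel_measurable \<Omega>" if "t \<in> {0..T}" for t a
    using m[OF that] by measurable
  show "expectation (\<lambda>\<omega>. noise \<sigma>1 \<sigma>2 c t \<omega> \<bullet> a) = 0" if t: "t \<in> {0..T}" for t a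
  proof -
    have "expectation (\<lambda>\<omega>. noise \<sigma>1 \<sigma>2 c t \<omega> \<bullet> a) = expectation (\<lambda>\<omega>. R t \<omega> a)"
      by (rule integral_cong_AE[OF nm[OF t] Rm[OF t] Rn])
    also have "\<dots> = 0"
      unfolding R_def using brownian_inner(3,4)[OF BM1 t t] brownian_inner(3,4)[OF BM2 t t] by simp
    finally show ?thesis .
  qed
  have RR: "integrable \<Omega> (\<lambda>\<omega>. R s \<omega> a * R t \<omega> b)" "expectation (\<lambda>\<omega>. R s \<omega> a * R t \<omega> b) = min s t * noise_cov \<sigma>1 \<sigma>2 c a b"
    if s: "s \<in> {0..T}" and t: "t \<in> {0..T}" for s t a b
  proof -
    have e: "R s \<omega> a * R t \<omega> b = (W1 s \<omega> \<bullet> (\<sigma>1\<^sup>T *v fst a)) * (W1 t \<omega> \<bullet> (\<sigma>1\<^sup>T *v fst b))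
      + c * ((W1 s \<omega> \<bullet> (\<sigma>1\<^sup>T *v fst a)) * (W2 t \<omega> \<bullet> (\<sigma>2\<^sup>T *v snd b)))
      + c * ((W1 t \<omega> \<bullet> (\<sigma>1\<^sup>T *v fst b)) * (W2 s \<omega> \<bullet> (\<sigma>2\<^sup>T *v snd a)))
      + c\<^sup>2 * ((W2 s \<omega> \<bullet> (\<sigma>2\<^sup>T *v snd a)) * (W2 t \<omega> \<bullet> (\<sigma>2\<^sup>T *v snd b)))" for \<omega>
      by (simp add: R_def algebra_simps power2_eq_square)
    note i = brownian_inner(1,2)[OF BM1 s t] brownian_inner(1,2)[OF BM2 s t]
      brownian_cross_inner[OF BM1 BM2 s t indep] brownian_cross_inner[OF BM1 BM2 t s indep]
    show "integrable \<Omega> (\<lambda>\<omega>. R s \<omega> a * R t \<omega> b)" unfolding e using i by simp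
    show "expectation (\<lambda>\<omega>. R s \<omega> a * R t \<omega> b) = min s t * noise_cov \<sigma>1 \<sigma>2 c a b"
      unfolding e using i by (simp add: noise_cov_def distrib_left)
  qed
  show "expectation (\<lambda>\<omega>. (noise \<sigma>1 \<sigma>2 c s \<omega> \<bullet> a) * (noise \<sigma>1 \<sigma>2 c t \<omega> \<bullet> b)) = min s t * noise_cov \<sigma>1 \<sigma>2 c a b"
    if s: "s \<in> {0..T}" and t: "t \<in> {0..T}" for s t a b
  proof -
    have "expectation (\<lambda>\<omega>. (noise \<sigma>1 \<sigma>2 c s \<omega> \<bullet> a) * (noise \<sigma>1 \<sigma>2 c t \<omega> \<bullet> b)) = expectation (\<lambda>\<omega>. R s \<omega> a * R t \<omega> b)"
    proof (rule integral_cong_AE)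
      show "AE \<omega> in \<Omega>. (noise \<sigma>1 \<sigma>2 c s \<omega> \<bullet> a) * (noise \<sigma>1 \<sigma>2 c t \<omega> \<bullet> b) = R s \<omega> a * R t \<omega> b"
        using Rn[of s a] Rn[of t b] by eventually_elim simp
    qed (intro borel_measurable_times nm Rm s t)+
    then show ?thesis using RR(2)[OF s t] by simp
  qed
  show "integrable \<Omega> (\<lambda>\<omega>. (norm (noise \<sigma>1 \<sigma>2 c t \<omega>))\<^sup>2)" if t: "t \<in> {0..T}" for t
  proof -
    have e: "(norm (noise \<sigma>1 \<sigma>2 c t \<omega>))\<^sup>2 = (\<Sum>b\<in>Basis. (noise \<sigma>1 \<sigma>2 c t \<omega> \<bullet> b) * (noise \<sigma>1 \<sigma>2 c t \<omega> \<bullet> b))" for \<omega>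
      unfolding power2_norm_eq_inner by (rule euclidean_inner)
    have i: "integrable \<Omega> (\<lambda>\<omega>. (noise \<sigma>1 \<sigma>2 c t \<omega> \<bullet> b) * (noise \<sigma>1 \<sigma>2 c t \<omega> \<bullet> b))" for b
    proof (rule integrable_cong_AE_imp[OF RR(1)[OF t t, of b b]])
      show "AE \<omega> in \<Omega>. R t \<omega> b * R t \<omega> b = (noise \<sigma>1 \<sigma>2 c t \<omega> \<bullet> b) * (noise \<sigma>1 \<sigma>2 c t \<omega> \<bullet> b)"
        using Rn[of t b] by eventually_elim simp
    qed (intro borel_measurable_times nm t)
    show ?thesis unfolding e by (rule Bochner_Integration.integrable_sum) (rule i)
  qed
qed

lemma admissibleI:
  fixes u :: "real \<Rightarrow> 'o \<Rightarrow> real^'k"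
  assumes meas: "\<And>t. t \<in> {0..T} \<Longrightarrow> u t \<in> borel_measurable (\<F> t)"
    and cont: "\<And>\<omega>. \<omega> \<in> space \<Omega> \<Longrightarrow> continuous_on {0..T} (\<lambda>t. u t \<omega>)"
    and int: "\<And>t. t \<in> {0..T} \<Longrightarrow> integrable \<Omega> (\<lambda>\<omega>. (norm (u t \<omega>))\<^sup>2)"
    and bd: "\<And>t. t \<in> {0..T} \<Longrightarrow> expectation (\<lambda>\<omega>. (norm (u t \<omega>))\<^sup>2) \<le> C"
  shows "admissible \<Omega> \<F> T u"
  unfolding admissible_def
proof
  have T: "0 \<le> T" using T0 by simp
  let ?P = "predictable_sigma \<Omega> \<F> T" and ?L = "restrict_space lborel {0..T}"
  show P: "(\<lambda>(t, \<omega>). u t \<omega>) \<in> borel_measurable ?P"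
    by (rule borel_measurable_predictable[OF T space_F _ meas cont]) (use sets.space_closed[of "\<F> _"] in simp)+
  have FS: "A \<subseteq> space \<Omega>" if "A \<in> sets (\<F> t)" for A t using sets.sets_into_space[OF that] by simp
  \<comment> \<open>The predictable sigma-algebra is coarser than the product one, so predictability
    yields the joint measurability that Fubini asks for.\<close>
  have "(\<lambda>x. x) \<in> measurable (?L \<Otimes>\<^sub>M \<Omega>) ?P"
    unfolding predictable_sigma_def
  proof (rule measurable_measure_of)
    show "{{0} \<times> A |A. A \<in> sets (\<F> 0)} \<union> {{s<..t} \<times> A |s t A. 0 \<le> s \<and> s \<le> t \<and> t \<le> T \<and> A \<in> sets (\<F> s)} \<subseteq> Pow ({0..T} \<times> space \<Omega>)"
      using FS T by fastforce
    show "(\<lambda>x. x) \<in> space (?L \<Otimes>\<^sub>M \<Omega>) \<rightarrow> {0..T} \<times> space \<Omega>" by (auto simp: space_pair_measure)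
    fix E assume "E \<in> {{0} \<times> A |A. A \<in> sets (\<F> 0)} \<union> {{s<..t} \<times> A |s t A. 0 \<le> s \<and> s \<le> t \<and> t \<le> T \<and> A \<in> sets (\<F> s)}"
    then consider A where "E = {0} \<times> A" "A \<in> sets (\<F> 0)"
      | s t A where "E = {s<..t} \<times> A" "0 \<le> s" "s \<le> t" "t \<le> T" "A \<in> sets (\<F> s)" by blast
    then have "\<exists>B A. E = B \<times> A \<and> B \<in> sets borel \<and> B \<subseteq> {0..T} \<and> A \<in> sets \<Omega>"
    proof cases
      case (1 A)
      then show ?thesis using sets_F_subset[of 0] T by (intro exI[of _ "{0}"] exI[of _ A]) auto
    next
      case (2 s t A)
      then show ?thesis using sets_F_subset[of s] by (intro exI[of _ "{s<..t}"] exI[of _ A]) auto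
    qed
    then obtain B A where E: "E = B \<times> A" "B \<in> sets borel" "B \<subseteq> {0..T}" "A \<in> sets \<Omega>" by blast
    then have "B \<in> sets ?L" by (auto simp: sets_restrict_space)
    then have "E \<in> sets (?L \<Otimes>\<^sub>M \<Omega>)" using E by simp
    moreover have "(\<lambda>x. x) -` E \<inter> space (?L \<Otimes>\<^sub>M \<Omega>) = E" using sets.sets_into_space[OF calculation] by auto
    ultimately show "(\<lambda>x. x) -` E \<inter> space (?L \<Otimes>\<^sub>M \<Omega>) \<in> sets (?L \<Otimes>\<^sub>M \<Omega>)" by simp
  qed
  from measurable_compose[OF this P] have um: "(\<lambda>(t, \<omega>). u t \<omega>) \<in> borel_measurable (?L \<Otimes>\<^sub>M \<Omega>)" .
  interpret L: sigma_finite_measure ?L by (rule sigma_finite_measure_restrict_space) (auto intro: lborel.sigma_finite_measure_axioms)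
  interpret LO: pair_sigma_finite ?L \<Omega> ..
  have fm: "(\<lambda>(t, \<omega>). (norm (u t \<omega>))\<^sup>2) \<in> borel_measurable (?L \<Otimes>\<^sub>M \<Omega>)"
    using um by (simp add: case_prod_beta')
  have set_i: "set_integrable lborel {0..T} (\<lambda>t. expectation (\<lambda>\<omega>. (norm (u t \<omega>))\<^sup>2))"
  proof (rule expectation_LINT(3)[OF T _ _ int])
    show "(\<lambda>\<omega>. (norm (u t \<omega>))\<^sup>2) \<in> borel_measurable \<Omega>" if "t \<in> {0..T}" for t
      using int[OF that] by (rule borel_measurable_integrable)
    show "continuous_on {0..T} (\<lambda>t. (norm (u t \<omega>))\<^sup>2)" if "\<omega> \<in> space \<Omega>" for \<omega> by (intro continuous_intros cont that)
    show "expectation (\<lambda>\<omega>. \<bar>(norm (u t \<omega>))\<^sup>2\<bar>) \<le> C" if "t \<in> {0..T}" for t using bd[OF that] by simp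
  qed
  show "integrable (?L \<Otimes>\<^sub>M \<Omega>) (\<lambda>(t, \<omega>). (norm (u t \<omega>))\<^sup>2)"
  proof (rule LO.Fubini_integrable[OF fm])
    show "integrable ?L (\<lambda>t. \<integral>\<omega>. norm (case (t, \<omega>) of (t, \<omega>) \<Rightarrow> (norm (u t \<omega>))\<^sup>2) \<partial>\<Omega>)"
      using set_i by (subst integrable_restrict_space) (auto simp: set_integrable_def)
    show "AE t in ?L. integrable \<Omega> (\<lambda>\<omega>. case (t, \<omega>) of (t, \<omega>) \<Rightarrow> (norm (u t \<omega>))\<^sup>2)"
      using int by (intro AE_I2) auto
  qed
qed

end

section \<open>Linear feedbacks and their closed loops\<close>

definition closed_loop_op ::
  "('n1::finite,'n2::finite,'k1::finite,'k2::finite,'m1::finite,'m2::finite) lq_game \<Rightarrow> real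
    \<Rightarrow> (real \<Rightarrow> real^'n1^'k1) \<Rightarrow> (real \<Rightarrow> real^'n2^'k1) \<Rightarrow> (real \<Rightarrow> real^'n1^'k2) \<Rightarrow> (real \<Rightarrow> real^'n2^'k2)
    \<Rightarrow> real \<Rightarrow> ((real^'n1) \<times> (real^'n2)) \<Rightarrow>\<^sub>L ((real^'n1) \<times> (real^'n2))" where
  "closed_loop_op G \<epsilon> K11 K12 K21 K22 t =
     blk (A11 G + B11 G ** K11 t + B12 G ** K21 t) (A12 G + B11 G ** K12 t + B12 G ** K22 t)
       ((1/\<epsilon>) *\<^sub>R (A21 G + B21 G ** K11 t + B22 G ** K21 t)) ((1/\<epsilon>) *\<^sub>R (A22 G + B21 G ** K12 t + B22 G ** K22 t))"

definition linear_feedback ::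
  "(real \<Rightarrow> real^'n1^'k) \<Rightarrow> (real \<Rightarrow> real^'n2^'k) \<Rightarrow> (real \<Rightarrow> 'o \<Rightarrow> real^'n1) \<Rightarrow> (real \<Rightarrow> 'o \<Rightarrow> real^'n2)
    \<Rightarrow> real \<Rightarrow> 'o \<Rightarrow> real^'k" where
  "linear_feedback K1 K2 X1 X2 t \<omega> = K1 t *v X1 t \<omega> + K2 t *v X2 t \<omega>"

definition running_integrand ::
  "('n1::finite,'n2::finite,'k1::finite,'k2::finite,'m1::finite,'m2::finite) lq_game
    \<Rightarrow> (real \<Rightarrow> real^'n1^'k1) \<Rightarrow> (real \<Rightarrow> real^'n2^'k1) \<Rightarrow> (real \<Rightarrow> real^'n1^'k2) \<Rightarrow> (real \<Rightarrow> real^'n2^'k2)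
    \<Rightarrow> real \<Rightarrow> (real^'n1) \<times> (real^'n2) \<Rightarrow> real" where
  "running_integrand G K11 K12 K21 K22 t z = (Q1 G *v fst z) \<bullet> fst z + (Q2 G *v snd z) \<bullet> snd z
     - (norm (K11 t *v fst z + K12 t *v snd z))\<^sup>2 + (norm (K21 t *v fst z + K22 t *v snd z))\<^sup>2"

lemma continuous_on_closed_loop_op:
  assumes "continuous_on S K11" "continuous_on S K12" "continuous_on S K21" "continuous_on S K22"
  shows "continuous_on S (closed_loop_op G \<epsilon> K11 K12 K21 K22)"
  unfolding closed_loop_op_def[abs_def] by (intro continuous_intros assms)

lemma linear_feedback_bound:
  fixes K1 :: "real \<Rightarrow> real^'n1^'k" and K2 :: "real \<Rightarrow> real^'n2^'k"
  assumes "continuous_on {0..T} K1" "continuous_on {0..T} K2"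
  obtains C where "0 \<le> C" "\<And>t z. t \<in> {0..T} \<Longrightarrow> (norm (K1 t *v fst z + K2 t *v snd z))\<^sup>2 \<le> C * (norm z)\<^sup>2"
proof -
  obtain a where a: "0 < a" "\<And>(A::real^'n1^'k) x. norm (A *v x) \<le> norm A * norm x * a"
    using bounded_bilinear.pos_bounded[OF matrix_vector_bounded_bilinear[where 'n='n1 and 'm='k]] by blast
  obtain b where b: "0 < b" "\<And>(A::real^'n2^'k) x. norm (A *v x) \<le> norm A * norm x * b"
    using bounded_bilinear.pos_bounded[OF matrix_vector_bounded_bilinear[where 'n='n2 and 'm='k]] by blast
  obtain c where c: "\<And>t. t \<in> {0..T} \<Longrightarrow> norm (K1 t) \<le> c"
    using compact_imp_bounded[OF compact_continuous_image[OF assms(1) compact_Icc]] by (metis bounded_iff image_eqI)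
  obtain d where d: "\<And>t. t \<in> {0..T} \<Longrightarrow> norm (K2 t) \<le> d"
    using compact_imp_bounded[OF compact_continuous_image[OF assms(2) compact_Icc]] by (metis bounded_iff image_eqI)
  show thesis
  proof (rule that[of "(\<bar>c\<bar> * a + \<bar>d\<bar> * b)\<^sup>2"])
    fix t and z :: "(real^'n1) \<times> (real^'n2)" assume t: "t \<in> {0..T}"
    have n: "norm (fst z) \<le> norm z" "norm (snd z) \<le> norm z"
      using norm_fst_le[of "fst z" "snd z"] norm_snd_le[of "snd z" "fst z"] by auto
    have "norm (K1 t *v fst z) \<le> \<bar>c\<bar> * norm z * a"
      using c[OF t] n a(1) by (intro order_trans[OF a(2)] mult_right_mono mult_mono) auto
    moreover have "norm (K2 t *v snd z) \<le> \<bar>d\<bar> * norm z * b"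
      using d[OF t] n b(1) by (intro order_trans[OF b(2)] mult_right_mono mult_mono) auto
    ultimately have "norm (K1 t *v fst z + K2 t *v snd z) \<le> (\<bar>c\<bar> * a + \<bar>d\<bar> * b) * norm z"
      using norm_triangle_ineq[of "K1 t *v fst z" "K2 t *v snd z"] by (simp add: algebra_simps)
    then have "(norm (K1 t *v fst z + K2 t *v snd z))\<^sup>2 \<le> ((\<bar>c\<bar> * a + \<bar>d\<bar> * b) * norm z)\<^sup>2"
      by (intro power_mono) auto
    then show "(norm (K1 t *v fst z + K2 t *v snd z))\<^sup>2 \<le> (\<bar>c\<bar> * a + \<bar>d\<bar> * b)\<^sup>2 * (norm z)\<^sup>2"
      by (simp add: power_mult_distrib)
  qed simp
qed

context brownian_pair
begin

text \<open>Joins the two state equations into one on the product space. The controls stay general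
  processes, so the lemma serves both the closed loop and the equation with the controls
  frozen.\<close>

lemma state_equation_pair:
  fixes X1 :: "real \<Rightarrow> 'o \<Rightarrow> real^'n1::finite" and X2 :: "real \<Rightarrow> 'o \<Rightarrow> real^'n2::finite"
    and G :: "('n1,'n2,'k1::finite,'k2::finite,'m1,'m2) lq_game"
  assumes \<omega>: "\<omega> \<in> space \<Omega>" "\<omega> \<notin> irregular_paths"
    and c: "continuous_on {0..T} (\<lambda>t. X1 t \<omega>)" "continuous_on {0..T} (\<lambda>t. X2 t \<omega>)"
      "continuous_on {0..T} (\<lambda>t. u1 t \<omega>)" "continuous_on {0..T} (\<lambda>t. u2 t \<omega>)"
    and t: "t \<in> {0..T}"
  shows "(X1 t \<omega> = x1
                + (LINT s:{0..t}|lborel. A11 G *v X1 s \<omega> + A12 G *v X2 s \<omega>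
                                       + B11 G *v u1 s \<omega> + B12 G *v u2 s \<omega>)
                + sigma1 G *v (W1 t \<omega> - W1 0 \<omega>)
            \<and> X2 t \<omega> = x2
                + (1 / \<epsilon>) *\<^sub>R (LINT s:{0..t}|lborel. A21 G *v X1 s \<omega> + A22 G *v X2 s \<omega>
                                       + B21 G *v u1 s \<omega> + B22 G *v u2 s \<omega>)
                + (1 / sqrt \<epsilon>) *\<^sub>R (sigma2 G *v (W2 t \<omega> - W2 0 \<omega>)))
    \<longleftrightarrow> (X1 t \<omega>, X2 t \<omega>) = noise (sigma1 G) (sigma2 G) (1 / sqrt \<epsilon>) t \<omega> + ((x1, x2)
        + (LINT s:{0..t}|lborel. blk (A11 G) (A12 G) ((1/\<epsilon>) *\<^sub>R A21 G) ((1/\<epsilon>) *\<^sub>R A22 G) (X1 s \<omega>, X2 s \<omega>)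
            + (B11 G *v u1 s \<omega> + B12 G *v u2 s \<omega>, (1/\<epsilon>) *\<^sub>R (B21 G *v u1 s \<omega> + B22 G *v u2 s \<omega>))))"
proof -
  have sub: "{0..t} \<subseteq> {0..T}" using t by auto
  note c' = c[THEN continuous_on_subset, OF sub]
  define f where "f s = A11 G *v X1 s \<omega> + A12 G *v X2 s \<omega> + B11 G *v u1 s \<omega> + B12 G *v u2 s \<omega>" for s
  define g where "g s = A21 G *v X1 s \<omega> + A22 G *v X2 s \<omega> + B21 G *v u1 s \<omega> + B22 G *v u2 s \<omega>" for s
  have fg: "continuous_on {0..t} f" "continuous_on {0..t} g"
    unfolding f_def[abs_def] g_def[abs_def] by (intro continuous_intros c')+
  have "(LINT s:{0..t}|lborel. blk (A11 G) (A12 G) ((1/\<epsilon>) *\<^sub>R A21 G) ((1/\<epsilon>) *\<^sub>R A22 G) (X1 s \<omega>, X2 s \<omega>)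
            + (B11 G *v u1 s \<omega> + B12 G *v u2 s \<omega>, (1/\<epsilon>) *\<^sub>R (B21 G *v u1 s \<omega> + B22 G *v u2 s \<omega>)))
      = (LINT s:{0..t}|lborel. (f s, (1/\<epsilon>) *\<^sub>R g s))"
    by (simp add: f_def g_def scaleR_matrix_vector_assoc[symmetric] scaleR_add_right add.assoc)
  also have "\<dots> = (LINT s:{0..t}|lborel. f s, (1/\<epsilon>) *\<^sub>R (LINT s:{0..t}|lborel. g s))"
    by (subst LINT_Pair) (auto intro!: fg continuous_intros)
  finally show ?thesis
    unfolding f_def[symmetric] g_def[symmetric]
    using irregular_paths(2)[OF \<omega>] \<omega>(2) by (auto simp: noise_def prod_eq_iff algebra_simps)
qed

lemma closed_loop_integrand:
  "blk (A11 G) (A12 G) ((1/\<epsilon>) *\<^sub>R A21 G) ((1/\<epsilon>) *\<^sub>R A22 G) (X1 s \<omega>, X2 s \<omega>)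
     + (B11 G *v linear_feedback K11 K12 X1 X2 s \<omega> + B12 G *v linear_feedback K21 K22 X1 X2 s \<omega>,
        (1/\<epsilon>) *\<^sub>R (B21 G *v linear_feedback K11 K12 X1 X2 s \<omega> + B22 G *v linear_feedback K21 K22 X1 X2 s \<omega>))
   = closed_loop_op G \<epsilon> K11 K12 K21 K22 s (X1 s \<omega>, X2 s \<omega>)"
  by (simp add: linear_feedback_def closed_loop_op_def scaleR_matrix_vector_assoc[symmetric] scaleR_add_right
      matrix_vector_mult_add_rdistrib matrix_vector_right_distrib matrix_vector_mul_assoc add_ac)

lemma linear_feedback_admissible:
  fixes K1 :: "real \<Rightarrow> real^'n1::finite^'k::finite" and K2 :: "real \<Rightarrow> real^'n2::finite^'k"
    and X :: "real \<Rightarrow> 'o \<Rightarrow> (real^'n1) \<times> (real^'n2)"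
  assumes K: "continuous_on {0..T} K1" "continuous_on {0..T} K2"
    and Xm: "\<And>t. t \<in> {0..T} \<Longrightarrow> X t \<in> borel_measurable (\<F> t)"
    and Xc: "\<And>\<omega>. \<omega> \<in> space \<Omega> \<Longrightarrow> continuous_on {0..T} (\<lambda>t. X t \<omega>)"
    and Xi: "\<And>t. t \<in> {0..T} \<Longrightarrow> integrable \<Omega> (\<lambda>\<omega>. (norm (X t \<omega>))\<^sup>2)"
    and D: "\<And>t. t \<in> {0..T} \<Longrightarrow> expectation (\<lambda>\<omega>. (norm (X t \<omega>))\<^sup>2) \<le> D"
  shows "admissible \<Omega> \<F> T (linear_feedback K1 K2 (\<lambda>t \<omega>. fst (X t \<omega>)) (\<lambda>t \<omega>. snd (X t \<omega>)))" (is "admissible _ _ _ ?u")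
proof -
  obtain C where C: "0 \<le> C" "\<And>t z. t \<in> {0..T} \<Longrightarrow> (norm (K1 t *v fst z + K2 t *v snd z))\<^sup>2 \<le> C * (norm z)\<^sup>2"
    using linear_feedback_bound[OF K] by blast
  have m: "?u t \<in> borel_measurable (\<F> t)" if "t \<in> {0..T}" for t
  proof -
    have "(\<lambda>z. K1 t *v fst z + K2 t *v snd z) \<in> borel_measurable (borel :: ((real^'n1) \<times> (real^'n2)) measure)"
      by (intro borel_measurable_continuous_onI continuous_intros)
    from measurable_compose[OF Xm[OF that] this] show ?thesis by (simp add: linear_feedback_def[abs_def])
  qed
  have le: "(norm (?u t \<omega>))\<^sup>2 \<le> C * (norm (X t \<omega>))\<^sup>2" if "t \<in> {0..T}" for t \<omega>
    using C(2)[OF that, of "X t \<omega>"] by (simp add: linear_feedback_def)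
  have i0: "integrable \<Omega> (\<lambda>\<omega>. C * (norm (X t \<omega>))\<^sup>2)" if "t \<in> {0..T}" for t using Xi[OF that] by simp
  have i: "integrable \<Omega> (\<lambda>\<omega>. (norm (?u t \<omega>))\<^sup>2)" if t: "t \<in> {0..T}" for t
  proof (rule Bochner_Integration.integrable_bound[OF i0[OF t]])
    show "(\<lambda>\<omega>. (norm (?u t \<omega>))\<^sup>2) \<in> borel_measurable \<Omega>" using measurable_F_Omega[OF m[OF t] t] by measurable
    show "AE \<omega> in \<Omega>. norm ((norm (?u t \<omega>))\<^sup>2) \<le> norm (C * (norm (X t \<omega>))\<^sup>2)"
      using le[OF t] C(1) by (intro AE_I2) simp
  qed
  have b: "expectation (\<lambda>\<omega>. (norm (?u t \<omega>))\<^sup>2) \<le> C * D" if t: "t \<in> {0..T}" for t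
  proof -
    have "expectation (\<lambda>\<omega>. (norm (?u t \<omega>))\<^sup>2) \<le> expectation (\<lambda>\<omega>. C * (norm (X t \<omega>))\<^sup>2)"
      by (intro integral_mono i i0 t le)
    also have "\<dots> \<le> C * D" using D[OF t] C(1) by (simp add: mult_left_mono)
    finally show ?thesis .
  qed
  have c: "continuous_on {0..T} (\<lambda>t. ?u t \<omega>)" if "\<omega> \<in> space \<Omega>" for \<omega>
    unfolding linear_feedback_def by (intro continuous_intros K Xc that)
  show ?thesis by (rule admissibleI[OF m c i b])
qed

text \<open>Two uniqueness arguments meet here. Feedback controls are defined along some state,
  which must be the explicit \<open>X\<close>; and \<open>cost_J\<close> ranges over all states that
  belong to the given controls, which must agree with it as well.\<close>

theorem closed_loop:
  fixes G :: "('n1::finite,'n2::finite,'k1::finite,'k2::finite,'m1,'m2) lq_game"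
    and K11 :: "real \<Rightarrow> real^'n1^'k1" and K12 :: "real \<Rightarrow> real^'n2^'k1" and K21 :: "real \<Rightarrow> real^'n1^'k2" and K22 :: "real \<Rightarrow> real^'n2^'k2"
    and x1 :: "real^'n1" and x2 :: "real^'n2"
  assumes K: "continuous_on {0..T} K11" "continuous_on {0..T} K12" "continuous_on {0..T} K21" "continuous_on {0..T} K22"
  obtains X where "white_noise.nonant \<Omega> T (noise (sigma1 G) (sigma2 G) (1 / sqrt \<epsilon>)) X"
    "\<And>t \<omega>. t \<in> {0..T} \<Longrightarrow> \<omega> \<in> space \<Omega> \<Longrightarrow> X t \<omega> = noise (sigma1 G) (sigma2 G) (1 / sqrt \<epsilon>) t \<omega>
        + ((x1, x2) + (LINT s:{0..t}|lborel. blinfun_apply (closed_loop_op G \<epsilon> K11 K12 K21 K22 s) (X s \<omega>)))"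
    "\<exists>u1 u2. feedback_controls G T \<Omega> W1 W2 \<epsilon> x1 x2 (linear_feedback K11 K12) (linear_feedback K21 K22) u1 u2"
    "\<And>u1 u2. feedback_controls G T \<Omega> W1 W2 \<epsilon> x1 x2 (linear_feedback K11 K12) (linear_feedback K21 K22) u1 u2 \<Longrightarrow>
       cost_J G T \<Omega> W1 W2 \<epsilon> x1 x2 u1 u2
         = (1/2) * expectation (\<lambda>\<omega>. LINT t:{0..T}|lborel. running_integrand G K11 K12 K21 K22 t (X t \<omega>))"
proof -
  define N :: "real \<Rightarrow> 'o \<Rightarrow> (real^'n1) \<times> (real^'n2)" where "N = noise (sigma1 G) (sigma2 G) (1 / sqrt \<epsilon>)"
  interpret N: white_noise \<Omega> T N "noise_cov (sigma1 G) (sigma2 G) (1 / sqrt \<epsilon>)"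
    unfolding N_def by (rule white_noise_noise)
  let ?A = "closed_loop_op G \<epsilon> K11 K12 K21 K22"
  have Ac: "continuous_on {0..T} ?A" by (rule continuous_on_closed_loop_op[OF K])
  obtain X where X: "N.nonant X"
    and Xeq: "\<And>t \<omega>. t \<in> {0..T} \<Longrightarrow> \<omega> \<in> space \<Omega> \<Longrightarrow>
       X t \<omega> = N t \<omega> + ((x1, x2) + (LINT s:{0..t}|lborel. blinfun_apply (?A s) (X s \<omega>)))"
    and XF: "\<And>t F. t \<in> {0..T} \<Longrightarrow> space F = space \<Omega> \<Longrightarrow> (\<forall>s\<in>{0..t}. N s \<in> borel_measurable F) \<Longrightarrow> X t \<in> borel_measurable F"
    by (rule N.linear_sde_solution[OF Ac, of "(x1, x2)"]) (rule that)
  define Y1 Y2 where "Y1 t \<omega> = fst (X t \<omega>)" and "Y2 t \<omega> = snd (X t \<omega>)" for t \<omega>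
  have YX: "(Y1 t \<omega>, Y2 t \<omega>) = X t \<omega>" for t \<omega> by (simp add: Y1_def Y2_def)
  have Xm: "X t \<in> borel_measurable (\<F> t)" if "t \<in> {0..T}" for t
    by (rule XF[OF that space_F]) (use that noise_F in \<open>auto simp: N_def\<close>)
  have Ym: "Y1 t \<in> borel_measurable (\<F> t)" "Y2 t \<in> borel_measurable (\<F> t)" if "t \<in> {0..T}" for t
  proof -
    have "fst \<in> borel_measurable (borel :: ((real^'n1) \<times> (real^'n2)) measure)" "snd \<in> borel_measurable (borel :: ((real^'n1) \<times> (real^'n2)) measure)"
      by (intro borel_measurable_continuous_onI continuous_intros)+
    from measurable_compose[OF Xm[OF that] this(1)] measurable_compose[OF Xm[OF that] this(2)]
    show "Y1 t \<in> borel_measurable (\<F> t)" "Y2 t \<in> borel_measurable (\<F> t)"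
      by (simp_all add: Y1_def[abs_def] Y2_def[abs_def])
  qed
  have Yc: "continuous_on {0..T} (\<lambda>t. Y1 t \<omega>)" "continuous_on {0..T} (\<lambda>t. Y2 t \<omega>)" if "\<omega> \<in> space \<Omega>" for \<omega>
    unfolding Y1_def Y2_def by (intro continuous_intros N.nonant_cont[OF X that])+
  have fbc1: "continuous_on {0..T} (\<lambda>t. linear_feedback K11 K12 Za Zb t \<omega>)" "continuous_on {0..T} (\<lambda>t. linear_feedback K21 K22 Za Zb t \<omega>)"
    if "continuous_on {0..T} (\<lambda>t. Za t \<omega>)" "continuous_on {0..T} (\<lambda>t. Zb t \<omega>)" for Za Zb :: "real \<Rightarrow> 'o \<Rightarrow> _" and \<omega>
    unfolding linear_feedback_def by (intro continuous_intros that K)+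
  obtain D where D: "0 \<le> D" "\<And>t. t \<in> {0..T} \<Longrightarrow> expectation (\<lambda>\<omega>. (norm (X t \<omega>))\<^sup>2) \<le> D"
    using N.nonant_bound[OF X] by blast
  note adm = linear_feedback_admissible[OF _ _ Xm N.nonant_cont[OF X] N.nonantD(2)[OF X] D(2), folded Y1_def[abs_def] Y2_def[abs_def]]
  have Ysol: "state_process G T \<Omega> W1 W2 \<epsilon> x1 x2 (linear_feedback K11 K12 Y1 Y2) (linear_feedback K21 K22 Y1 Y2) Y1 Y2"
    unfolding state_process_def
  proof (intro conjI ballI)
    show "AE \<omega> in \<Omega>. continuous_on {0..T} (\<lambda>t. Y1 t \<omega>) \<and> continuous_on {0..T} (\<lambda>t. Y2 t \<omega>)
         \<and> (\<forall>t\<in>{0..T}.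
              Y1 t \<omega> = x1
                + (LINT s:{0..t}|lborel. A11 G *v Y1 s \<omega> + A12 G *v Y2 s \<omega>
                                       + B11 G *v linear_feedback K11 K12 Y1 Y2 s \<omega> + B12 G *v linear_feedback K21 K22 Y1 Y2 s \<omega>)
                + sigma1 G *v (W1 t \<omega> - W1 0 \<omega>)
            \<and> Y2 t \<omega> = x2
                + (1 / \<epsilon>) *\<^sub>R (LINT s:{0..t}|lborel. A21 G *v Y1 s \<omega> + A22 G *v Y2 s \<omega>
                                       + B21 G *v linear_feedback K11 K12 Y1 Y2 s \<omega> + B22 G *v linear_feedback K21 K22 Y1 Y2 s \<omega>)
                + (1 / sqrt \<epsilon>) *\<^sub>R (sigma2 G *v (W2 t \<omega> - W2 0 \<omega>)))"
      using AE_irregular_paths AE_space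
    proof eventually_elim
      case (elim \<omega>)
      note e = state_equation_pair[where ?X1.0 = Y1 and ?X2.0 = Y2 and ?u1.0 = "linear_feedback K11 K12 Y1 Y2"
          and ?u2.0 = "linear_feedback K21 K22 Y1 Y2" and ?x1.0 = x1 and ?x2.0 = x2 and G = G and \<epsilon> = \<epsilon>, OF elim(2,1) Yc[OF elim(2)] fbc1[of Y1 \<omega> Y2, OF Yc[OF elim(2)]], unfolded closed_loop_integrand, unfolded YX]
      show ?case
      proof (intro conjI Yc elim ballI)
        fix t assume t: "t \<in> {0..T}"
        show "Y1 t \<omega> = x1
                + (LINT s:{0..t}|lborel. A11 G *v Y1 s \<omega> + A12 G *v Y2 s \<omega>
                                       + B11 G *v linear_feedback K11 K12 Y1 Y2 s \<omega> + B12 G *v linear_feedback K21 K22 Y1 Y2 s \<omega>)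
                + sigma1 G *v (W1 t \<omega> - W1 0 \<omega>)"
          "Y2 t \<omega> = x2
                + (1 / \<epsilon>) *\<^sub>R (LINT s:{0..t}|lborel. A21 G *v Y1 s \<omega> + A22 G *v Y2 s \<omega>
                                       + B21 G *v linear_feedback K11 K12 Y1 Y2 s \<omega> + B22 G *v linear_feedback K21 K22 Y1 Y2 s \<omega>)
                + (1 / sqrt \<epsilon>) *\<^sub>R (sigma2 G *v (W2 t \<omega> - W2 0 \<omega>))"
          using e[OF t] Xeq[OF t elim(2), unfolded N_def] by blast+
      qed
    qed
  qed (use Ym in auto)
  have ex: "\<exists>u1 u2. feedback_controls G T \<Omega> W1 W2 \<epsilon> x1 x2 (linear_feedback K11 K12) (linear_feedback K21 K22) u1 u2"
    unfolding feedback_controls_def using adm[OF K(1,2)] adm[OF K(3,4)] Ysol by blast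
  have cost: "cost_J G T \<Omega> W1 W2 \<epsilon> x1 x2 u1 u2
         = (1/2) * expectation (\<lambda>\<omega>. LINT t:{0..T}|lborel. running_integrand G K11 K12 K21 K22 t (X t \<omega>))"
    if fb: "feedback_controls G T \<Omega> W1 W2 \<epsilon> x1 x2 (linear_feedback K11 K12) (linear_feedback K21 K22) u1 u2" for u1 u2
  proof -
    obtain Z1 Z2 where Z: "state_process G T \<Omega> W1 W2 \<epsilon> x1 x2 u1 u2 Z1 Z2"
      and u: "u1 = linear_feedback K11 K12 Z1 Z2" "u2 = linear_feedback K21 K22 Z1 Z2"
      using fb unfolding feedback_controls_def by blast
    \<comment> \<open>Along a state that generates the controls, the equation is the closed loop
      itself and has \<open>X\<close> as its only solution.\<close>
    have ZX: "AE \<omega> in \<Omega>. \<forall>t\<in>{0..T}. (Z1 t \<omega>, Z2 t \<omega>) = X t \<omega>"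
      using Z[unfolded state_process_def, THEN conjunct2] AE_irregular_paths AE_space
    proof eventually_elim
      case (elim \<omega>)
      then have c: "continuous_on {0..T} (\<lambda>t. Z1 t \<omega>)" "continuous_on {0..T} (\<lambda>t. Z2 t \<omega>)" by auto
      note e = state_equation_pair[where ?X1.0 = Z1 and ?X2.0 = Z2 and ?u1.0 = u1
          and ?u2.0 = u2 and ?x1.0 = x1 and ?x2.0 = x2 and G = G and \<epsilon> = \<epsilon>, OF elim(3,2) c, unfolded u, OF fbc1[of Z1 \<omega> Z2, OF c], unfolded closed_loop_integrand]
      show ?case
      proof
        fix t assume t: "t \<in> {0..T}"
        show "(Z1 t \<omega>, Z2 t \<omega>) = X t \<omega>"
        proof (rule integral_equation_unique[where u = "\<lambda>t. (Z1 t \<omega>, Z2 t \<omega>)" and v = "\<lambda>t. X t \<omega>" and g = "\<lambda>_. 0", OF Ac _ _ _ _ _ t])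
          show "continuous_on {0..T} (\<lambda>t. (Z1 t \<omega>, Z2 t \<omega>))" using c by (rule continuous_on_Pair)
          show "continuous_on {0..T} (\<lambda>t. X t \<omega>)" by (rule N.nonant_cont[OF X elim(3)])
          fix s assume s: "s \<in> {0..T}"
          show "(Z1 s \<omega>, Z2 s \<omega>) = N s \<omega> + ((x1, x2) + (LINT r:{0..s}|lborel. blinfun_apply (?A r) (Z1 r \<omega>, Z2 r \<omega>) + 0))"
            using e[OF s] elim(1) s unfolding u N_def by simp
          show "X s \<omega> = N s \<omega> + ((x1, x2) + (LINT r:{0..s}|lborel. blinfun_apply (?A r) (X r \<omega>) + 0))"
            using Xeq[OF s elim(3)] by simp
        qed simp
      qed
    qed
    have rc: "running_cost G T \<Omega> u1 u2 V1 V2 = (1/2) * expectation (\<lambda>\<omega>. LINT t:{0..T}|lborel. running_integrand G K11 K12 K21 K22 t (X t \<omega>))"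
      if V: "state_process G T \<Omega> W1 W2 \<epsilon> x1 x2 u1 u2 V1 V2" for V1 V2
    proof -
      \<comment> \<open>For another state \<open>V\<close> the controls are frozen processes, so
        uniqueness is applied to the uncontrolled drift with the controls as source.\<close>
      have VZ: "AE \<omega> in \<Omega>. \<forall>t\<in>{0..T}. (V1 t \<omega>, V2 t \<omega>) = (Z1 t \<omega>, Z2 t \<omega>)"
        using Z[unfolded state_process_def, THEN conjunct2] V[unfolded state_process_def, THEN conjunct2] AE_irregular_paths AE_space
      proof eventually_elim
        case (elim \<omega>)
        have c: "continuous_on {0..T} (\<lambda>t. Z1 t \<omega>)" "continuous_on {0..T} (\<lambda>t. Z2 t \<omega>)"
          and cV: "continuous_on {0..T} (\<lambda>t. V1 t \<omega>)" "continuous_on {0..T} (\<lambda>t. V2 t \<omega>)" using elim(1,2) by auto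
        have cu: "continuous_on {0..T} (\<lambda>t. u1 t \<omega>)" "continuous_on {0..T} (\<lambda>t. u2 t \<omega>)" unfolding u by (rule fbc1[of Z1 \<omega> Z2, OF c])+
        note e = state_equation_pair[where ?X1.0 = Z1 and ?X2.0 = Z2 and ?u1.0 = u1
            and ?u2.0 = u2 and ?x1.0 = x1 and ?x2.0 = x2 and G = G and \<epsilon> = \<epsilon>, OF elim(4,3) c cu]
        note eV = state_equation_pair[where ?X1.0 = V1 and ?X2.0 = V2 and ?u1.0 = u1
            and ?u2.0 = u2 and ?x1.0 = x1 and ?x2.0 = x2 and G = G and \<epsilon> = \<epsilon>, OF elim(4,3) cV cu]
        show ?case
        proof
          fix t assume t: "t \<in> {0..T}"
          show "(V1 t \<omega>, V2 t \<omega>) = (Z1 t \<omega>, Z2 t \<omega>)"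
          proof (rule integral_equation_unique[where u = "\<lambda>t. (V1 t \<omega>, V2 t \<omega>)" and v = "\<lambda>t. (Z1 t \<omega>, Z2 t \<omega>)"
                and A = "\<lambda>_. blk (A11 G) (A12 G) ((1/\<epsilon>) *\<^sub>R A21 G) ((1/\<epsilon>) *\<^sub>R A22 G)"
                and g = "\<lambda>s. (B11 G *v u1 s \<omega> + B12 G *v u2 s \<omega>, (1/\<epsilon>) *\<^sub>R (B21 G *v u1 s \<omega> + B22 G *v u2 s \<omega>))", OF _ _ _ _ _ _ t])
            show "continuous_on {0..T} (\<lambda>s. (B11 G *v u1 s \<omega> + B12 G *v u2 s \<omega>, (1/\<epsilon>) *\<^sub>R (B21 G *v u1 s \<omega> + B22 G *v u2 s \<omega>)))"
              by (intro continuous_intros cu)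
            fix s assume s: "s \<in> {0..T}"
            show "(V1 s \<omega>, V2 s \<omega>) = N s \<omega> + ((x1, x2) + (LINT r:{0..s}|lborel. blk (A11 G) (A12 G) ((1/\<epsilon>) *\<^sub>R A21 G) ((1/\<epsilon>) *\<^sub>R A22 G) (V1 r \<omega>, V2 r \<omega>)
                + (B11 G *v u1 r \<omega> + B12 G *v u2 r \<omega>, (1/\<epsilon>) *\<^sub>R (B21 G *v u1 r \<omega> + B22 G *v u2 r \<omega>))))"
              using eV[OF s, THEN iffD1] elim(2) s unfolding N_def by blast
            show "(Z1 s \<omega>, Z2 s \<omega>) = N s \<omega> + ((x1, x2) + (LINT r:{0..s}|lborel. blk (A11 G) (A12 G) ((1/\<epsilon>) *\<^sub>R A21 G) ((1/\<epsilon>) *\<^sub>R A22 G) (Z1 r \<omega>, Z2 r \<omega>)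
                + (B11 G *v u1 r \<omega> + B12 G *v u2 r \<omega>, (1/\<epsilon>) *\<^sub>R (B21 G *v u1 r \<omega> + B22 G *v u2 r \<omega>))))"
              using e[OF s, THEN iffD1] elim(1) s unfolding N_def by blast
          qed (intro continuous_on_Pair c cV continuous_on_const)+
        qed
      qed
      have "AE \<omega> in \<Omega>. (LINT t:{0..T}|lborel. (Q1 G *v V1 t \<omega>) \<bullet> V1 t \<omega> + (Q2 G *v V2 t \<omega>) \<bullet> V2 t \<omega> - (norm (u1 t \<omega>))\<^sup>2 + (norm (u2 t \<omega>))\<^sup>2)
         = (LINT t:{0..T}|lborel. running_integrand G K11 K12 K21 K22 t (X t \<omega>))"
        using VZ ZX
      proof eventually_elim
        case (elim \<omega>)
        show ?case
        proof (rule set_lebesgue_integral_cong)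
          show "\<forall>t. t \<in> {0..T} \<longrightarrow> (Q1 G *v V1 t \<omega>) \<bullet> V1 t \<omega> + (Q2 G *v V2 t \<omega>) \<bullet> V2 t \<omega> - (norm (u1 t \<omega>))\<^sup>2 + (norm (u2 t \<omega>))\<^sup>2
             = running_integrand G K11 K12 K21 K22 t (X t \<omega>)"
          proof (intro allI impI)
            fix t assume t: "t \<in> {0..T}"
            have "(V1 t \<omega>, V2 t \<omega>) = (Z1 t \<omega>, Z2 t \<omega>)" "X t \<omega> = (Z1 t \<omega>, Z2 t \<omega>)"
              using bspec[OF elim(1) t] bspec[OF elim(2) t] by metis+
            then have "X t \<omega> = (Z1 t \<omega>, Z2 t \<omega>)" "V1 t \<omega> = Z1 t \<omega>" "V2 t \<omega> = Z2 t \<omega>" by simp_all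
            then show "(Q1 G *v V1 t \<omega>) \<bullet> V1 t \<omega> + (Q2 G *v V2 t \<omega>) \<bullet> V2 t \<omega> - (norm (u1 t \<omega>))\<^sup>2 + (norm (u2 t \<omega>))\<^sup>2
             = running_integrand G K11 K12 K21 K22 t (X t \<omega>)"
              by (simp add: running_integrand_def u linear_feedback_def)
          qed
        qed simp
      qed
      \<comment> \<open>The pathwise costs agree almost everywhere; completeness replaces a
        measurability check for \<open>V1\<close> and \<open>V2\<close>.\<close>
      then show ?thesis unfolding running_cost_def by (intro arg_cong[where f = "(*) (1/2)"] integral_cong_AE_complete[OF compl])
    qed
    show ?thesis unfolding cost_J_def
    proof (rule the_equality)
      show "\<exists>X1 X2. state_process G T \<Omega> W1 W2 \<epsilon> x1 x2 u1 u2 X1 X2 \<and> (1/2) * expectation (\<lambda>\<omega>. LINT t:{0..T}|lborel. running_integrand G K11 K12 K21 K22 t (X t \<omega>)) = running_cost G T \<Omega> u1 u2 X1 X2"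
        by (intro exI[of _ Z1] exI[of _ Z2] conjI Z rc[OF Z, symmetric])
      fix r assume "\<exists>X1 X2. state_process G T \<Omega> W1 W2 \<epsilon> x1 x2 u1 u2 X1 X2 \<and> r = running_cost G T \<Omega> u1 u2 X1 X2"
      then obtain V1 V2 where "state_process G T \<Omega> W1 W2 \<epsilon> x1 x2 u1 u2 V1 V2" "r = running_cost G T \<Omega> u1 u2 V1 V2" by blast
      then show "r = (1/2) * expectation (\<lambda>\<omega>. LINT t:{0..T}|lborel. running_integrand G K11 K12 K21 K22 t (X t \<omega>))"
        using rc by simp
    qed
  qed
  show thesis
    by (rule that[OF X[unfolded N_def] Xeq[unfolded N_def] ex cost])
qed

end

section \<open>Costs of linear feedbacks\<close>

lemma norm_matrix_vector_le: "norm (A *v x) \<le> norm A * norm x" for A :: "real^'n^'m"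
proof -
  have "norm (A *v x) = L2_set (\<lambda>i. norm ((A *v x) $ i)) UNIV" by (simp add: norm_vec_def)
  also have "\<dots> \<le> L2_set (\<lambda>i. norm (A $ i) * norm x) UNIV"
  proof (rule L2_set_mono)
    fix i show "norm ((A *v x) $ i) \<le> norm (A $ i) * norm x"
      using Cauchy_Schwarz_ineq2[of "A $ i" x] by (simp add: matrix_vector_mult_def inner_vec_def)
  qed simp
  also have "\<dots> = norm A * norm x" by (simp add: norm_vec_def[of A] L2_set_left_distrib)
  finally show ?thesis .
qed

lemma inner_transpose_left: "x \<bullet> (M\<^sup>T *v y) = (M *v x) \<bullet> y" for M :: "real^'p^'q"
  by (simp add: inner_vector_matrix)

lemma minus_matrix_vector: "(- A) *v x = - (A *v x)" for A :: "real^'n^'m"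
  by (simp add: vec_eq_iff matrix_vector_mult_def sum_negf)

lemma sym_inner: "P\<^sup>T = P \<Longrightarrow> x \<bullet> (P *v y) = (P *v x) \<bullet> y" for P :: "real^'n^'n"
  using inner_transpose_left[of x P y] by simp

text \<open>With \<open>p\<^sub>1 = P\<^sub>1\<^sub>1 z\<^sub>1 + \<epsilon> P\<^sub>1\<^sub>2 z\<^sub>2\<close> and \<open>p\<^sub>2 = P\<^sub>1\<^sub>2\<^sup>T z\<^sub>1 + P\<^sub>2\<^sub>2 z\<^sub>2\<close> the three Riccati equations combine
  to the Hamiltonian evaluated at \<open>(p\<^sub>1, p\<^sub>2)\<close>.\<close>

lemma riccati_quadratic_form:
  fixes G :: "('n1::finite,'n2::finite,'k1::finite,'k2::finite,'m1::finite,'m2::finite) lq_game"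
  assumes sym: "P11\<^sup>T = P11" "P22\<^sup>T = P22"
    and p1: "p1 = P11 *v z1 + \<epsilon> *\<^sub>R (P12 *v z2)" and p2: "p2 = P12\<^sup>T *v z1 + P22 *v z2"
  shows "z1 \<bullet> (riccati_f G P11 P12 P22 \<epsilon> *v z1) + 2 * (z1 \<bullet> (riccati_g1 G P11 P12 P22 \<epsilon> *v z2)) + z2 \<bullet> (riccati_g2 G P11 P12 P22 \<epsilon> *v z2)
   = z1 \<bullet> (Q1 G *v z1) + z2 \<bullet> (Q2 G *v z2) + 2 * (p1 \<bullet> (A11 G *v z1 + A12 G *v z2)) + 2 * (p2 \<bullet> (A21 G *v z1 + A22 G *v z2))
     + p1 \<bullet> (Delta1 G *v p1) + 2 * (p1 \<bullet> (Delta G *v p2)) + p2 \<bullet> (Delta2 G *v p2)"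
proof -
  define a b c d where "a = P11 *v z1" and "b = P12 *v z2" and "c = P12\<^sup>T *v z1" and "d = P22 *v z2"
  have P: "z1 \<bullet> (P11 *v y) = a \<bullet> y" "z1 \<bullet> (P12 *v y') = c \<bullet> y'" "z2 \<bullet> (P22 *v y') = d \<bullet> y'" "z2 \<bullet> (P12\<^sup>T *v y) = b \<bullet> y" for y y'
    using sym_inner[OF sym(1), of z1 y] sym_inner[OF sym(2), of z2 y'] inner_transpose_left[of z2 P12 y] inner_transpose_left[of z1 "P12\<^sup>T" y']
    by (simp_all add: a_def b_def c_def d_def del: transpose_matrix_vector)
  note mv = matrix_vector_mult_add_rdistrib matrix_vector_mul_assoc[symmetric] scaleR_matrix_vector_assoc[symmetric]
    inner_add_right inner_scaleR_right
  have f: "z1 \<bullet> (riccati_f G P11 P12 P22 \<epsilon> *v z1) = (A11 G *v z1) \<bullet> a + (A21 G *v z1) \<bullet> c + a \<bullet> (A11 G *v z1) + c \<bullet> (A21 G *v z1)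
     + a \<bullet> (Delta1 G *v a) + (Delta G *v c) \<bullet> a + a \<bullet> (Delta G *v c) + c \<bullet> (Delta2 G *v c) + z1 \<bullet> (Q1 G *v z1)"
    unfolding riccati_f_def
    by (simp add: mv P inner_transpose_left a_def[symmetric] b_def[symmetric] c_def[symmetric] d_def[symmetric] del: transpose_matrix_vector)
  have g1: "z1 \<bullet> (riccati_g1 G P11 P12 P22 \<epsilon> *v z2) = \<epsilon> * ((A11 G *v z1) \<bullet> b) + (A21 G *v z1) \<bullet> d + a \<bullet> (A12 G *v z2) + c \<bullet> (A22 G *v z2)
     + \<epsilon> * (a \<bullet> (Delta1 G *v b)) + \<epsilon> * ((Delta G *v c) \<bullet> b) + a \<bullet> (Delta G *v d) + c \<bullet> (Delta2 G *v d)"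
    unfolding riccati_g1_def
    by (simp add: mv P inner_transpose_left a_def[symmetric] b_def[symmetric] c_def[symmetric] d_def[symmetric] del: transpose_matrix_vector)
  have g2: "z2 \<bullet> (riccati_g2 G P11 P12 P22 \<epsilon> *v z2) = \<epsilon> * ((A12 G *v z2) \<bullet> b) + (A22 G *v z2) \<bullet> d + \<epsilon> * (b \<bullet> (A12 G *v z2)) + d \<bullet> (A22 G *v z2)
     + \<epsilon>\<^sup>2 * (b \<bullet> (Delta1 G *v b)) + \<epsilon> * (b \<bullet> (Delta G *v d)) + \<epsilon> * ((Delta G *v d) \<bullet> b) + d \<bullet> (Delta2 G *v d) + z2 \<bullet> (Q2 G *v z2)"
    unfolding riccati_g2_def
    by (simp add: mv P inner_transpose_left a_def[symmetric] b_def[symmetric] c_def[symmetric] d_def[symmetric] del: transpose_matrix_vector)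
  have s: "b \<bullet> (Delta1 G *v a) = a \<bullet> (Delta1 G *v b)" "d \<bullet> (Delta2 G *v c) = c \<bullet> (Delta2 G *v d)"
    using sym_inner[OF Delta1_sym[of G], of b a] sym_inner[OF Delta2_sym[of G], of d c] by (simp_all add: inner_commute)
  have p: "p1 = a + \<epsilon> *\<^sub>R b" "p2 = c + d" using p1 p2 by (simp_all add: a_def b_def c_def d_def)
  note cm = inner_commute[of "A11 G *v z1" a] inner_commute[of "A11 G *v z1" b] inner_commute[of "A21 G *v z1" c] inner_commute[of "A21 G *v z1" d]
    inner_commute[of "A12 G *v z2" b] inner_commute[of "A22 G *v z2" d] inner_commute[of "Delta G *v c" a]
    inner_commute[of "Delta G *v c" b] inner_commute[of "Delta G *v d" b]
  show ?thesis
    unfolding f g1 g2 p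
    by (simp add: matrix_vector_right_distrib matrix_vector_mult_scaleR inner_add_left inner_add_right cm s algebra_simps power2_eq_square)
qed

text \<open>\<open>H\<close> carries a factor \<open>\<epsilon>\<close> in the fast rows, which
  cancels the \<open>1 / \<epsilon>\<close> of the fast drift, and \<open>H'\<close> is its time
  derivative by the Riccati system. What the Riccati equations leave over are the squared distances
  to the saddle controls, negative for the maximiser and positive for the minimiser.\<close>

lemma completing_square:
  fixes G :: "('n1::finite,'n2::finite,'k1::finite,'k2::finite,'m1::finite,'m2::finite) lq_game"
    and P11 :: "real^'n1^'n1" and P12 :: "real^'n2^'n1" and P22 :: "real^'n2^'n2"
  assumes sym: "P11\<^sup>T = P11" "P22\<^sup>T = P22" and \<epsilon>: "0 < \<epsilon>"
  defines "H \<equiv> blk P11 (\<epsilon> *\<^sub>R P12) (\<epsilon> *\<^sub>R P12\<^sup>T) (\<epsilon> *\<^sub>R P22)"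
    and "H' \<equiv> blk (- riccati_f G P11 P12 P22 \<epsilon>) (- riccati_g1 G P11 P12 P22 \<epsilon>) (- (riccati_g1 G P11 P12 P22 \<epsilon>)\<^sup>T) (- riccati_g2 G P11 P12 P22 \<epsilon>)"
  shows "running_integrand G K11 K12 K21 K22 t z + (z \<bullet> H' z + 2 * (closed_loop_op G \<epsilon> K11 K12 K21 K22 t z \<bullet> H z))
    = - (norm ((K11 t - ((B11 G)\<^sup>T ** P11 + (B21 G)\<^sup>T ** P12\<^sup>T)) *v fst z + (K12 t - (\<epsilon> *\<^sub>R ((B11 G)\<^sup>T ** P12) + (B21 G)\<^sup>T ** P22)) *v snd z))\<^sup>2
      + (norm ((K21 t + ((B12 G)\<^sup>T ** P11 + (B22 G)\<^sup>T ** P12\<^sup>T)) *v fst z + (K22 t + (\<epsilon> *\<^sub>R ((B12 G)\<^sup>T ** P12) + (B22 G)\<^sup>T ** P22)) *v snd z))\<^sup>2"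
proof -
  obtain z1 z2 where z: "z = (z1, z2)" by (cases z)
  \<comment> \<open>The costates: \<open>H z = (p1, \<epsilon> *\<^sub>R p2)\<close>.\<close>
  define p1 p2 where "p1 = P11 *v z1 + \<epsilon> *\<^sub>R (P12 *v z2)" and "p2 = P12\<^sup>T *v z1 + P22 *v z2"
  define u1 u2 where "u1 = K11 t *v z1 + K12 t *v z2" and "u2 = K21 t *v z1 + K22 t *v z2"
  \<comment> \<open>\<open>s1\<close> and \<open>- s2\<close> are the saddle controls at
    \<open>z\<close>.\<close>
  define s1 s2 where "s1 = (B11 G)\<^sup>T *v p1 + (B21 G)\<^sup>T *v p2" and "s2 = (B12 G)\<^sup>T *v p1 + (B22 G)\<^sup>T *v p2"
  note mv = matrix_vector_mult_add_rdistrib matrix_vector_mult_diff_rdistrib matrix_vector_mul_assoc[symmetric] scaleR_matrix_vector_assoc[symmetric]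
    matrix_vector_right_distrib matrix_vector_mult_scaleR
  have d1: "(K11 t - ((B11 G)\<^sup>T ** P11 + (B21 G)\<^sup>T ** P12\<^sup>T)) *v z1 + (K12 t - (\<epsilon> *\<^sub>R ((B11 G)\<^sup>T ** P12) + (B21 G)\<^sup>T ** P22)) *v z2 = u1 - s1"
    unfolding u1_def s1_def p1_def p2_def by (simp add: mv algebra_simps del: transpose_matrix_vector)
  have d2: "(K21 t + ((B12 G)\<^sup>T ** P11 + (B22 G)\<^sup>T ** P12\<^sup>T)) *v z1 + (K22 t + (\<epsilon> *\<^sub>R ((B12 G)\<^sup>T ** P12) + (B22 G)\<^sup>T ** P22)) *v z2 = u2 + s2"
    unfolding u2_def s2_def p1_def p2_def by (simp add: mv algebra_simps del: transpose_matrix_vector)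
  have H: "H z = (p1, \<epsilon> *\<^sub>R p2)"
    by (simp add: H_def z p1_def p2_def scaleR_matrix_vector_assoc[symmetric] scaleR_add_right del: transpose_matrix_vector)
  have H': "z \<bullet> H' z = - (z1 \<bullet> (riccati_f G P11 P12 P22 \<epsilon> *v z1) + 2 * (z1 \<bullet> (riccati_g1 G P11 P12 P22 \<epsilon> *v z2)) + z2 \<bullet> (riccati_g2 G P11 P12 P22 \<epsilon> *v z2))"
    unfolding H'_def z blk_apply
    using inner_transpose_left[of z2 "riccati_g1 G P11 P12 P22 \<epsilon>" z1] inner_commute[of "riccati_g1 G P11 P12 P22 \<epsilon> *v z2" z1]
    by (simp add: minus_matrix_vector inner_add_right inner_diff_right del: transpose_matrix_vector)
  have A: "closed_loop_op G \<epsilon> K11 K12 K21 K22 t z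
     = (A11 G *v z1 + A12 G *v z2 + B11 G *v u1 + B12 G *v u2, (1/\<epsilon>) *\<^sub>R (A21 G *v z1 + A22 G *v z2 + B21 G *v u1 + B22 G *v u2))"
    by (simp add: closed_loop_op_def z u1_def u2_def mv scaleR_add_right add_ac)
  have AH: "closed_loop_op G \<epsilon> K11 K12 K21 K22 t z \<bullet> H z = p1 \<bullet> (A11 G *v z1 + A12 G *v z2) + p2 \<bullet> (A21 G *v z1 + A22 G *v z2) + s1 \<bullet> u1 + s2 \<bullet> u2"
  proof -
    have "p1 \<bullet> (B11 G *v u1) + p2 \<bullet> (B21 G *v u1) = s1 \<bullet> u1" "p1 \<bullet> (B12 G *v u2) + p2 \<bullet> (B22 G *v u2) = s2 \<bullet> u2"
      using inner_transpose_left[of p1 "(B11 G)\<^sup>T" u1] inner_transpose_left[of p2 "(B21 G)\<^sup>T" u1]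
        inner_transpose_left[of p1 "(B12 G)\<^sup>T" u2] inner_transpose_left[of p2 "(B22 G)\<^sup>T" u2]
      by (simp_all add: s1_def s2_def inner_add_left del: transpose_matrix_vector)
    then show ?thesis using \<epsilon>
      unfolding A H by (simp add: inner_commute[of _ p1] inner_commute[of _ p2] inner_add_right)
  qed
  \<comment> \<open>The indefinite \<open>Delta1 G\<close>, \<open>Delta G\<close> and
    \<open>Delta2 G\<close> are the difference of the two players' squares.\<close>
  have ss: "(norm s1)\<^sup>2 - (norm s2)\<^sup>2 = p1 \<bullet> (Delta1 G *v p1) + 2 * (p1 \<bullet> (Delta G *v p2)) + p2 \<bullet> (Delta2 G *v p2)"
  proof -
    have q1: "(norm s1)\<^sup>2 = p1 \<bullet> ((B11 G ** (B11 G)\<^sup>T) *v p1) + 2 * (p1 \<bullet> ((B11 G ** (B21 G)\<^sup>T) *v p2)) + p2 \<bullet> ((B21 G ** (B21 G)\<^sup>T) *v p2)"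
      unfolding s1_def power2_norm_eq_inner
      using inner_transpose_left[of p1 "(B11 G)\<^sup>T"] inner_transpose_left[of p2 "(B21 G)\<^sup>T"] inner_commute[of "(B21 G)\<^sup>T *v p2" "(B11 G)\<^sup>T *v p1"]
      by (simp add: inner_add_left inner_add_right matrix_vector_mul_assoc[symmetric] del: transpose_matrix_vector)
    have q2: "(norm s2)\<^sup>2 = p1 \<bullet> ((B12 G ** (B12 G)\<^sup>T) *v p1) + 2 * (p1 \<bullet> ((B12 G ** (B22 G)\<^sup>T) *v p2)) + p2 \<bullet> ((B22 G ** (B22 G)\<^sup>T) *v p2)"
      unfolding s2_def power2_norm_eq_inner
      using inner_transpose_left[of p1 "(B12 G)\<^sup>T"] inner_transpose_left[of p2 "(B22 G)\<^sup>T"] inner_commute[of "(B22 G)\<^sup>T *v p2" "(B12 G)\<^sup>T *v p1"]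
      by (simp add: inner_add_left inner_add_right matrix_vector_mul_assoc[symmetric] del: transpose_matrix_vector)
    show ?thesis unfolding q1 q2
      by (simp add: Delta1_def Delta_def Delta2_def matrix_vector_mult_diff_rdistrib inner_diff_right)
  qed
  have ri: "running_integrand G K11 K12 K21 K22 t z = z1 \<bullet> (Q1 G *v z1) + z2 \<bullet> (Q2 G *v z2) - (norm u1)\<^sup>2 + (norm u2)\<^sup>2"
    by (simp add: running_integrand_def z u1_def u2_def inner_commute)
  have sq: "(norm (u1 - s1))\<^sup>2 = (norm u1)\<^sup>2 - 2 * (s1 \<bullet> u1) + (norm s1)\<^sup>2" "(norm (u2 + s2))\<^sup>2 = (norm u2)\<^sup>2 + 2 * (s2 \<bullet> u2) + (norm s2)\<^sup>2"
    by (simp_all add: power2_norm_eq_inner inner_diff_left inner_diff_right inner_add_left inner_add_right inner_commute)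
  show ?thesis
    unfolding z fst_conv snd_conv d1 d2
    unfolding z[symmetric] ri H' AH sq riccati_quadratic_form[OF sym p1_def p2_def]
    using ss by simp
qed

context white_noise
begin

text \<open>The pointwise identity \<open>q\<close> is integrated in time, and the terminal term of
  the moment identity vanishes by \<open>H T = 0\<close>. Quadratic growth of the running cost
  provides integrability from the second moments of \<open>X\<close>.\<close>

lemma cost_identity:
  assumes X: "nonant X" and A: "continuous_on {0..T} A"
    and eq: "\<And>t \<omega>. t \<in> {0..T} \<Longrightarrow> \<omega> \<in> space M \<Longrightarrow>
       X t \<omega> = N t \<omega> + (x + (LINT s:{0..t}|lborel. blinfun_apply (A s) (X s \<omega>)))"
    and H: "\<And>t. t \<in> {0..T} \<Longrightarrow> (H has_vector_derivative H' t) (at t within {0..T})"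
    and H'c: "continuous_on {0..T} H'"
    and sym: "\<And>t u v. t \<in> {0..T} \<Longrightarrow> blinfun_apply (H t) u \<bullet> v = u \<bullet> blinfun_apply (H t) v"
       "\<And>t u v. t \<in> {0..T} \<Longrightarrow> blinfun_apply (H' t) u \<bullet> v = u \<bullet> blinfun_apply (H' t) v"
    and HT: "H T = 0"
    and q: "\<And>t z. t \<in> {0..T} \<Longrightarrow> q t z + (z \<bullet> H' t z + 2 * (A t z \<bullet> H t z)) = d t z"
    and qm: "\<And>t. t \<in> {0..T} \<Longrightarrow> q t \<in> borel_measurable borel"
    and qc: "\<And>\<omega>. \<omega> \<in> space M \<Longrightarrow> continuous_on {0..T} (\<lambda>t. q t (X t \<omega>))"
    and qb: "\<And>t z. t \<in> {0..T} \<Longrightarrow> \<bar>q t z\<bar> \<le> C * (norm z)\<^sup>2" and C: "0 \<le> C"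
  shows "set_integrable lborel {0..T} (\<lambda>s. expectation (\<lambda>\<omega>. d s (X s \<omega>)))"
    and "expectation (\<lambda>\<omega>. LINT s:{0..T}|lborel. q s (X s \<omega>))
      = x \<bullet> H 0 x + (LINT s:{0..T}|lborel. trc (H s)) + (LINT s:{0..T}|lborel. expectation (\<lambda>\<omega>. d s (X s \<omega>)))"
proof -
  have TT: "T \<in> {0..T}" using T by simp
  obtain D where D: "0 \<le> D" "\<And>t. t \<in> {0..T} \<Longrightarrow> expectation (\<lambda>\<omega>. (norm (X t \<omega>))\<^sup>2) \<le> D" using nonant_bound[OF X] by blast
  have Hc: "continuous_on {0..T} H"
    unfolding continuous_on_eq_continuous_within using H has_vector_derivative_continuous by blast
  have HX: "nonant (\<lambda>s \<omega>. H s (X s \<omega>))" "nonant (\<lambda>s \<omega>. H' s (X s \<omega>))" "nonant (\<lambda>s \<omega>. A s (X s \<omega>))"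
    by (intro nonant_blinfun Hc H'c A X)+
  define w where "w s \<omega> = X s \<omega> \<bullet> H' s (X s \<omega>) + 2 * (A s (X s \<omega>) \<bullet> H s (X s \<omega>))" for s \<omega>
  have wi: "integrable M (w s)" if "s \<in> {0..T}" for s
    unfolding w_def[abs_def] using nonant_inner(1)[OF X HX(2) that] nonant_inner(1)[OF HX(3,1) that] by simp
  have ti: "set_integrable lborel {0..T} (\<lambda>s. trc (H s))"
    by (intro borel_integrable_atLeastAtMost' bounded_linear.continuous_on[OF bounded_linear_trc] Hc)
  note m = moment_identity[OF X A eq H H'c sym TT, folded w_def]
  have ei: "set_integrable lborel {0..T} (\<lambda>s. expectation (w s))"
    using set_integral_diff(1)[OF m(1) ti] by simp
  have qXm: "(\<lambda>\<omega>. q t (X t \<omega>)) \<in> borel_measurable M" if "t \<in> {0..T}" for t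
    by (rule measurable_compose[OF nonantD(1)[OF X that] qm[OF that]])
  have i0: "integrable M (\<lambda>\<omega>. C * (norm (X t \<omega>))\<^sup>2)" if "t \<in> {0..T}" for t using nonantD(2)[OF X that] by simp
  have qi: "integrable M (\<lambda>\<omega>. q t (X t \<omega>))" if t: "t \<in> {0..T}" for t
    by (rule Bochner_Integration.integrable_bound[OF i0[OF t] qXm[OF t]])
      (use qb[OF t] C in \<open>auto intro!: AE_I2\<close>)
  have qB: "expectation (\<lambda>\<omega>. \<bar>q t (X t \<omega>)\<bar>) \<le> C * D" if t: "t \<in> {0..T}" for t
  proof -
    have "expectation (\<lambda>\<omega>. \<bar>q t (X t \<omega>)\<bar>) \<le> expectation (\<lambda>\<omega>. C * (norm (X t \<omega>))\<^sup>2)"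
      by (intro integral_mono integrable_abs qi i0 t qb)
    also have "\<dots> \<le> C * D" using D(2)[OF t] C by (simp add: mult_left_mono)
    finally show ?thesis .
  qed
  note qE = expectation_LINT[where f = "\<lambda>t \<omega>. q t (X t \<omega>)", OF T qXm qc qi qB]
  have dE: "expectation (\<lambda>\<omega>. d s (X s \<omega>)) = expectation (\<lambda>\<omega>. q s (X s \<omega>)) + expectation (w s)" if s: "s \<in> {0..T}" for s
    unfolding q[OF s, symmetric] w_def[symmetric] by (rule Bochner_Integration.integral_add[OF qi[OF s] wi[OF s]])
  have c: "indicator {0..T} s *\<^sub>R expectation (\<lambda>\<omega>. d s (X s \<omega>))
     = indicator {0..T} s *\<^sub>R (expectation (\<lambda>\<omega>. q s (X s \<omega>)) + expectation (w s))" for s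
    using dE[of s] by (cases "s \<in> {0..T}") auto
  show "set_integrable lborel {0..T} (\<lambda>s. expectation (\<lambda>\<omega>. d s (X s \<omega>)))"
    using set_integral_add(1)[OF qE(3) ei] unfolding set_integrable_def c .
  have "(LINT s:{0..T}|lborel. expectation (\<lambda>\<omega>. d s (X s \<omega>)))
     = (LINT s:{0..T}|lborel. expectation (\<lambda>\<omega>. q s (X s \<omega>))) + (LINT s:{0..T}|lborel. expectation (w s))"
    using set_integral_add(2)[OF qE(3) ei] unfolding set_lebesgue_integral_def c .
  moreover have "0 = x \<bullet> H 0 x + ((LINT s:{0..T}|lborel. expectation (w s)) + (LINT s:{0..T}|lborel. trc (H s)))"
    using m(2) unfolding set_integral_add(2)[OF ei ti] by (simp add: HT)
  ultimately show "expectation (\<lambda>\<omega>. LINT s:{0..T}|lborel. q s (X s \<omega>))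
      = x \<bullet> H 0 x + (LINT s:{0..T}|lborel. trc (H s)) + (LINT s:{0..T}|lborel. expectation (\<lambda>\<omega>. d s (X s \<omega>)))"
    using qE(4) by simp
qed

text \<open>One-sided version of the moment identity. \<open>d\<close> bounds the drift of the
  quadratic form pointwise, while \<open>g\<close> may bound its expectation by moments that have
  been estimated before.\<close>

lemma moment_bound:
  assumes X: "nonant X" and A: "continuous_on {0..T} A"
    and eq: "\<And>t \<omega>. t \<in> {0..T} \<Longrightarrow> \<omega> \<in> space M \<Longrightarrow>
       X t \<omega> = N t \<omega> + (x + (LINT s:{0..t}|lborel. blinfun_apply (A s) (X s \<omega>)))"
    and H: "\<And>t. t \<in> {0..T} \<Longrightarrow> (H has_vector_derivative H' t) (at t within {0..T})"
    and H'c: "continuous_on {0..T} H'"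
    and sym: "\<And>t u v. t \<in> {0..T} \<Longrightarrow> blinfun_apply (H t) u \<bullet> v = u \<bullet> blinfun_apply (H t) v"
       "\<And>t u v. t \<in> {0..T} \<Longrightarrow> blinfun_apply (H' t) u \<bullet> v = u \<bullet> blinfun_apply (H' t) v"
    and d: "\<And>t z. t \<in> {0..T} \<Longrightarrow> z \<bullet> H' t z + 2 * (A t z \<bullet> H t z) \<le> d t z"
    and di: "\<And>t. t \<in> {0..T} \<Longrightarrow> integrable M (\<lambda>\<omega>. d t (X t \<omega>))"
    and g: "continuous_on {0..T} g" "\<And>t. t \<in> {0..T} \<Longrightarrow> expectation (\<lambda>\<omega>. d t (X t \<omega>)) + trc (H t) \<le> g t"
    and t: "t \<in> {0..T}"
  shows "expectation (\<lambda>\<omega>. X t \<omega> \<bullet> H t (X t \<omega>)) \<le> x \<bullet> H 0 x + (LINT s:{0..t}|lborel. g s)"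
proof -
  have sub: "{0..t} \<subseteq> {0..T}" using t by auto
  have Hc: "continuous_on {0..T} H"
    unfolding continuous_on_eq_continuous_within using H has_vector_derivative_continuous by blast
  have HX: "nonant (\<lambda>s \<omega>. H s (X s \<omega>))" "nonant (\<lambda>s \<omega>. H' s (X s \<omega>))" "nonant (\<lambda>s \<omega>. A s (X s \<omega>))"
    by (intro nonant_blinfun Hc H'c A X)+
  define w where "w s \<omega> = X s \<omega> \<bullet> H' s (X s \<omega>) + 2 * (A s (X s \<omega>) \<bullet> H s (X s \<omega>))" for s \<omega>
  have wi: "integrable M (w s)" if "s \<in> {0..T}" for s
    unfolding w_def[abs_def] using nonant_inner(1)[OF X HX(2) that] nonant_inner(1)[OF HX(3,1) that] by simp
  note m = moment_identity[OF X A eq H H'c sym t, folded w_def]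
  have "(LINT s:{0..t}|lborel. expectation (w s) + trc (H s)) \<le> (LINT s:{0..t}|lborel. g s)"
  proof (rule set_integral_mono[OF m(1)])
    show "set_integrable lborel {0..t} g"
      by (intro borel_integrable_atLeastAtMost' continuous_on_subset[OF g(1) sub])
    fix s assume "s \<in> {0..t}" then have s: "s \<in> {0..T}" using sub by blast
    have "expectation (w s) \<le> expectation (\<lambda>\<omega>. d s (X s \<omega>))"
      by (rule integral_mono[OF wi[OF s] di[OF s]]) (use d[OF s] in \<open>simp add: w_def\<close>)
    then show "expectation (w s) + trc (H s) \<le> g s" using g(2)[OF s] by simp
  qed
  then show ?thesis using m(2) by simp
qed

end

section \<open>Block quadratic forms and moment bounds uniform in the perturbation parameter\<close>

lemma blk_symmetric:
  assumes "A\<^sup>T = A" "B = C\<^sup>T" "D\<^sup>T = D"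
  shows "blinfun_apply (blk A B C D) u \<bullet> v = u \<bullet> blinfun_apply (blk A B C D) v"
proof -
  have "fst u \<bullet> (B *v snd v) = (C *v fst u) \<bullet> snd v" "(B *v snd u) \<bullet> fst v = snd u \<bullet> (C *v fst v)"
    using inner_transpose_left[of "fst u" C "snd v"] inner_transpose_left[of "fst v" C "snd u"]
    by (simp_all add: assms(2) inner_commute del: transpose_matrix_vector)
  then show ?thesis
    using sym_inner[OF assms(1), of "fst u" "fst v"] sym_inner[OF assms(3), of "snd u" "snd v"]
    by (simp add: inner_prod_def inner_add_left inner_add_right)
qed

lemma blk_0: "blk 0 0 0 0 = 0"
  by (rule blinfun_eqI) (simp add: zero_prod_def)

lemma inner_matrix_vector_bound:
  fixes F :: "real^'n^'m"
  assumes "norm F \<le> b" shows "\<bar>(F *v x) \<bullet> y\<bar> \<le> b * (norm x * norm y)"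
proof -
  have "\<bar>(F *v x) \<bullet> y\<bar> \<le> norm (F *v x) * norm y" by (rule Cauchy_Schwarz_ineq2)
  also have "\<dots> \<le> (norm F * norm x) * norm y" by (intro mult_right_mono norm_matrix_vector_le) simp
  also have "\<dots> \<le> (b * norm x) * norm y" using assms by (intro mult_right_mono) auto
  finally show ?thesis by (simp only: mult.assoc)
qed

lemma quadratic_form_bound:
  fixes F :: "real^'n^'n"
  assumes "norm x \<le> r" shows "\<bar>(F *v x) \<bullet> x\<bar> \<le> norm F * r\<^sup>2"
proof -
  have "norm F * (norm x * norm x) \<le> norm F * (r * r)"
    using assms order_trans[OF norm_ge_zero assms] by (intro mult_left_mono mult_mono) auto
  then show ?thesis using inner_matrix_vector_bound[of F "norm F" x x] by (simp add: power2_eq_square)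
qed

lemma mat_vector: "mat \<alpha> *v x = \<alpha> *\<^sub>R x" for x :: "real^'n"
  by (simp add: vec_eq_iff matrix_vector_mult_def mat_def if_distrib[of "\<lambda>a. a * _"] cong: if_cong)

lemma sum_Basis_pair:
  fixes f :: "'a::euclidean_space \<times> 'b::euclidean_space \<Rightarrow> 'c::comm_monoid_add"
  shows "sum f Basis = (\<Sum>i\<in>Basis. f (i, 0)) + (\<Sum>i\<in>Basis. f (0, i))"
  unfolding Basis_prod_def by (subst sum.union_disjoint) (auto simp: sum.reindex inj_on_def)

lemma running_integrand_bound:
  fixes G :: "('n1::finite,'n2::finite,'k1::finite,'k2::finite,'m1::finite,'m2::finite) lq_game"
  assumes "continuous_on {0..T} K11" "continuous_on {0..T} K12" "continuous_on {0..T} K21" "continuous_on {0..T} K22"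
  obtains C where "0 \<le> C" "\<And>t z. t \<in> {0..T} \<Longrightarrow> \<bar>running_integrand G K11 K12 K21 K22 t z\<bar> \<le> C * (norm z)\<^sup>2"
proof -
  obtain a where a: "0 \<le> a" "\<And>t z. t \<in> {0..T} \<Longrightarrow> (norm (K11 t *v fst z + K12 t *v snd z))\<^sup>2 \<le> a * (norm z)\<^sup>2"
    using linear_feedback_bound[OF assms(1,2)] by blast
  obtain b where b: "0 \<le> b" "\<And>t z. t \<in> {0..T} \<Longrightarrow> (norm (K21 t *v fst z + K22 t *v snd z))\<^sup>2 \<le> b * (norm z)\<^sup>2"
    using linear_feedback_bound[OF assms(3,4)] by blast
  have q1: "\<bar>(Q1 G *v fst z) \<bullet> fst z\<bar> \<le> norm (Q1 G) * (norm z)\<^sup>2" for z :: "(real^'n1) \<times> (real^'n2)"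
    using norm_fst_le[of "fst z" "snd z"] by (intro quadratic_form_bound) simp
  have q2: "\<bar>(Q2 G *v snd z) \<bullet> snd z\<bar> \<le> norm (Q2 G) * (norm z)\<^sup>2" for z :: "(real^'n1) \<times> (real^'n2)"
    using norm_snd_le[of "snd z" "fst z"] by (intro quadratic_form_bound) simp
  show thesis
  proof (rule that[of "norm (Q1 G) + norm (Q2 G) + a + b"])
    fix t and z :: "(real^'n1) \<times> (real^'n2)" assume t: "t \<in> {0..T}"
    show "\<bar>running_integrand G K11 K12 K21 K22 t z\<bar> \<le> (norm (Q1 G) + norm (Q2 G) + a + b) * (norm z)\<^sup>2"
      using q1[of z] q2[of z] a(2)[OF t, of z] b(2)[OF t, of z]
        zero_le_power2[of "norm (K11 t *v fst z + K12 t *v snd z)"] zero_le_power2[of "norm (K21 t *v fst z + K22 t *v snd z)"]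
      unfolding running_integrand_def distrib_right by linarith
  qed (use a b in auto)
qed

context brownian_pair
begin

lemma white_noise_trc:
  fixes \<sigma>1 :: "real^'m1^'n1" and \<sigma>2 :: "real^'m2^'n2"
  shows "white_noise.trc (noise_cov \<sigma>1 \<sigma>2 c) (blk (mat \<alpha>) 0 0 (mat \<beta>))
    = \<alpha> * (\<Sum>i\<in>Basis. (norm (\<sigma>1\<^sup>T *v i))\<^sup>2) + \<beta> * (c\<^sup>2 * (\<Sum>j\<in>Basis. (norm (\<sigma>2\<^sup>T *v j))\<^sup>2))"
proof -
  interpret N: white_noise \<Omega> T "noise \<sigma>1 \<sigma>2 c" "noise_cov \<sigma>1 \<sigma>2 c" by (rule white_noise_noise)
  show ?thesis
    unfolding N.trc_def sum_Basis_pair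
    by (simp add: mat_vector noise_cov_def inner_Basis if_distrib[of "\<lambda>a. a * _"] if_distrib[of "(*) _"] sum_distrib_left
        power2_norm_eq_inner mult_ac cong: if_cong del: transpose_matrix_vector)
qed

text \<open>The slow component is estimated first, with the damping of the fast one absorbing the
  coupling; the fast component is then driven by a bounded slow one. The noise intensity
  \<open>1 / \<epsilon>\<close> is compensated in both steps, by the factor
  \<open>\<epsilon>\<close> in the first weight and by the damping
  \<open>\<gamma> / \<epsilon>\<close> in the second.\<close>

lemma fast_slow_moment_bound:
  fixes \<sigma>1 :: "real^'m1^'n1::finite" and \<sigma>2 :: "real^'m2^'n2::finite" and x1 :: "real^'n1" and x2 :: "real^'n2"
    and F11 :: "real \<Rightarrow> real^'n1^'n1" and F12 :: "real \<Rightarrow> real^'n2^'n1" and F21 :: "real \<Rightarrow> real^'n1^'n2" and S :: "real^'n2^'n2"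
  assumes \<epsilon>: "0 < \<epsilon>" "\<epsilon> \<le> 1" and \<gamma>: "0 < \<gamma>" and S: "\<And>z. (S *v z) \<bullet> z \<le> - \<gamma> * (norm z)\<^sup>2"
    and F: "continuous_on {0..T} F11" "continuous_on {0..T} F12" "continuous_on {0..T} F21"
    and b: "\<And>t. t \<in> {0..T} \<Longrightarrow> norm (F11 t) \<le> b" "\<And>t. t \<in> {0..T} \<Longrightarrow> norm (F12 t) \<le> b" "\<And>t. t \<in> {0..T} \<Longrightarrow> norm (F21 t) \<le> b"
    and X: "white_noise.nonant \<Omega> T (noise \<sigma>1 \<sigma>2 (1 / sqrt \<epsilon>)) X"
    and eq: "\<And>t \<omega>. t \<in> {0..T} \<Longrightarrow> \<omega> \<in> space \<Omega> \<Longrightarrow> X t \<omega> = noise \<sigma>1 \<sigma>2 (1 / sqrt \<epsilon>) t \<omega>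
        + ((x1, x2) + (LINT s:{0..t}|lborel. blinfun_apply (blk (F11 s) (F12 s) ((1/\<epsilon>) *\<^sub>R F21 s) ((1/\<epsilon>) *\<^sub>R S)) (X s \<omega>)))"
    and t: "t \<in> {0..T}"
    and C1: "C1 = (\<Sum>i\<in>Basis. (norm (\<sigma>1\<^sup>T *v i))\<^sup>2)" and C2: "C2 = (\<Sum>i\<in>Basis. (norm (\<sigma>2\<^sup>T *v i))\<^sup>2)"
    and V: "V = exp ((2 * b + 4 * b\<^sup>2 / \<gamma>) * T) * ((norm x1)\<^sup>2 + (norm x2)\<^sup>2 + T * (C1 + C2))"
  shows "expectation (\<lambda>\<omega>. (norm (X t \<omega>))\<^sup>2) \<le> V + ((norm x2)\<^sup>2 + (b\<^sup>2 * V / \<gamma> + C2) / \<gamma>)"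
proof -
  define c where "c = 1 / sqrt \<epsilon>"
  interpret N: white_noise \<Omega> T "noise \<sigma>1 \<sigma>2 c" "noise_cov \<sigma>1 \<sigma>2 c" by (rule white_noise_noise)
  define A where "A s = blk (F11 s) (F12 s) ((1/\<epsilon>) *\<^sub>R F21 s) ((1/\<epsilon>) *\<^sub>R S)" for s
  note X = X[folded c_def] and eq = eq[folded c_def A_def]
  have T: "0 \<le> T" using T0 by simp
  have b0: "0 \<le> b" using b(1)[OF t] norm_ge_zero order_trans by blast
  have CC: "0 \<le> C1" "0 \<le> C2" unfolding C1 C2 by (auto intro: sum_nonneg)
  have V0: "0 \<le> V" unfolding V using CC T by (intro mult_nonneg_nonneg add_nonneg_nonneg) auto
  have Ac: "continuous_on {0..T} A" unfolding A_def[abs_def] by (intro continuous_intros F)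
  have c2: "c\<^sup>2 = 1 / \<epsilon>" using \<epsilon> by (simp add: c_def power_divide)
  have tr: "N.trc (blk (mat \<alpha>) 0 0 (mat \<beta>)) = \<alpha> * C1 + \<beta> * (1/\<epsilon> * C2)" for \<alpha> \<beta>
    unfolding white_noise_trc C1 C2 c2 ..
  have fi: "integrable \<Omega> (\<lambda>\<omega>. (norm (fst (X s \<omega>)))\<^sup>2)" "integrable \<Omega> (\<lambda>\<omega>. (norm (snd (X s \<omega>)))\<^sup>2)" if s: "s \<in> {0..T}" for s
  proof -
    have m0: "fst \<in> borel_measurable (borel :: ((real^'n1) \<times> (real^'n2)) measure)" "snd \<in> borel_measurable (borel :: ((real^'n1) \<times> (real^'n2)) measure)"
      by (intro borel_measurable_continuous_onI continuous_intros)+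
    note m = measurable_compose[OF N.nonantD(1)[OF X s] m0(1)] measurable_compose[OF N.nonantD(1)[OF X s] m0(2)]
    have le: "(norm (fst (X s \<omega>)))\<^sup>2 \<le> (norm (X s \<omega>))\<^sup>2" "(norm (snd (X s \<omega>)))\<^sup>2 \<le> (norm (X s \<omega>))\<^sup>2" for \<omega>
      using norm_Pair_square[of "fst (X s \<omega>)" "snd (X s \<omega>)"] by simp_all
    have "(\<lambda>\<omega>. (norm (fst (X s \<omega>)))\<^sup>2) \<in> borel_measurable \<Omega>" "(\<lambda>\<omega>. (norm (snd (X s \<omega>)))\<^sup>2) \<in> borel_measurable \<Omega>"
      using m by (auto intro!: borel_measurable_power borel_measurable_norm)
    then show "integrable \<Omega> (\<lambda>\<omega>. (norm (fst (X s \<omega>)))\<^sup>2)" "integrable \<Omega> (\<lambda>\<omega>. (norm (snd (X s \<omega>)))\<^sup>2)"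
      by (auto intro!: Bochner_Integration.integrable_bound[OF N.nonantD(2)[OF X s]] AE_I2 simp: le)
  qed
  have Fb: "(F11 s *v z1) \<bullet> z1 \<le> b * (norm z1 * norm z1)" "(F12 s *v z2) \<bullet> z1 \<le> b * (norm z2 * norm z1)"
     "(F21 s *v z1) \<bullet> z2 \<le> b * (norm z1 * norm z2)" if s: "s \<in> {0..T}" for s z1 z2
    using inner_matrix_vector_bound[OF b(1)[OF s], of z1 z1] inner_matrix_vector_bound[OF b(2)[OF s], of z2 z1]
      inner_matrix_vector_bound[OF b(3)[OF s], of z1 z2] by linarith+
  \<comment> \<open>\<open>2 * b\<close> covers \<open>F11\<close>; the rest comes from Young's
    inequality for the two couplings against the damping \<open>\<gamma>\<close>.\<close>
  define \<kappa> where "\<kappa> = 2 * b + 4 * b\<^sup>2 / \<gamma>"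
  have l0: "0 \<le> \<kappa>" using b0 \<gamma> by (simp add: \<kappa>_def)
  have E1: "expectation (\<lambda>\<omega>. (norm (fst (X s \<omega>)))\<^sup>2) \<le> V" if s: "s \<in> {0..T}" for s
  proof -
    define H where "H r = exp (- \<kappa> * r) *\<^sub>R blk (mat 1 :: real^'n1^'n1) 0 0 (mat \<epsilon> :: real^'n2^'n2)" for r
    define H' where "H' r = (- \<kappa> * exp (- \<kappa> * r)) *\<^sub>R blk (mat 1 :: real^'n1^'n1) 0 0 (mat \<epsilon> :: real^'n2^'n2)" for r
    have "expectation (\<lambda>\<omega>. X s \<omega> \<bullet> H s (X s \<omega>)) \<le> (x1, x2) \<bullet> H 0 (x1, x2) + (LINT r:{0..s}|lborel. C1 + C2)"
    proof (rule N.moment_bound[OF X Ac eq _ _ _ _ _ _ _ _ s])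
      show "(H has_vector_derivative H' r) (at r within {0..T})" for r
        unfolding H_def[abs_def] H'_def by (auto intro!: derivative_eq_intros)
      show "continuous_on {0..T} H'" unfolding H'_def[abs_def] by (intro continuous_intros)
      show "blinfun_apply (H r) u \<bullet> v = u \<bullet> blinfun_apply (H r) v" "blinfun_apply (H' r) u \<bullet> v = u \<bullet> blinfun_apply (H' r) v" for r u v
        by (simp_all add: H_def H'_def blinfun.scaleR_left blinfun.minus_left blk_symmetric del: blk_apply)
      show "continuous_on {0..T} (\<lambda>r. C1 + C2)" by simp
      show "integrable \<Omega> (\<lambda>\<omega>. 0 :: real)" by simp
      fix r assume r: "r \<in> {0..T}"
      \<comment> \<open>The fast noise contributes
        \<open>\<epsilon> * (1 / \<epsilon>) * C2\<close>, which does not grow as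
        \<open>\<epsilon>\<close> tends to zero.\<close>
      have "N.trc (H r) = exp (- \<kappa> * r) * (C1 + C2)"
        unfolding H_def linear_simps(5)[OF N.bounded_linear_trc] tr using \<epsilon> by simp
      also have "\<dots> \<le> 1 * (C1 + C2)" using CC l0 r by (intro mult_right_mono) auto
      finally show "expectation (\<lambda>\<omega>. 0) + N.trc (H r) \<le> C1 + C2" by simp
      fix z :: "(real^'n1) \<times> (real^'n2)"
      obtain z1 z2 where z: "z = (z1, z2)" by (cases z)
      have "z \<bullet> H' r z + 2 * (A r z \<bullet> H r z) = exp (- \<kappa> * r) *
        (- \<kappa> * ((norm z1)\<^sup>2 + \<epsilon> * (norm z2)\<^sup>2) + 2 * ((F11 r *v z1) \<bullet> z1 + (F12 r *v z2) \<bullet> z1 + (F21 r *v z1) \<bullet> z2 + (S *v z2) \<bullet> z2))"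
        using \<epsilon> by (simp add: H_def H'_def A_def z blinfun.scaleR_left blinfun.minus_left mat_vector inner_add_left power2_norm_eq_inner
            scaleR_matrix_vector_assoc[symmetric] algebra_simps)
      also have "\<dots> \<le> exp (- \<kappa> * r) * 0"
      proof (intro mult_left_mono)
        have "2 * (norm z2 * (2 * b * norm z1)) \<le> \<gamma> * (norm z2)\<^sup>2 + (2 * b * norm z1)\<^sup>2 / \<gamma>" by (rule young[OF \<gamma>])
        moreover have "0 \<le> \<kappa> * (\<epsilon> * (norm z2)\<^sup>2)" "0 \<le> \<gamma> * (norm z2)\<^sup>2" using l0 \<epsilon> \<gamma> by simp_all
        moreover have "(2 * b * norm z1)\<^sup>2 / \<gamma> = 4 * b\<^sup>2 / \<gamma> * (norm z1)\<^sup>2" by (simp add: power_mult_distrib)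
        moreover have "\<kappa> * (norm z1)\<^sup>2 = 2 * (b * (norm z1 * norm z1)) + 4 * b\<^sup>2 / \<gamma> * (norm z1)\<^sup>2"
          by (simp add: \<kappa>_def power2_eq_square algebra_simps)
        moreover have "norm z2 * (2 * b * norm z1) = b * (norm z2 * norm z1) + b * (norm z1 * norm z2)" by simp
        ultimately show "- \<kappa> * ((norm z1)\<^sup>2 + \<epsilon> * (norm z2)\<^sup>2) + 2 * ((F11 r *v z1) \<bullet> z1 + (F12 r *v z2) \<bullet> z1 + (F21 r *v z1) \<bullet> z2 + (S *v z2) \<bullet> z2) \<le> 0"
          using Fb(1)[OF r, of z1] Fb(2)[OF r, of z2 z1] Fb(3)[OF r, of z1 z2] S[of z2] by (simp add: distrib_left mult.commute[of "norm z2" "norm z1"])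
      qed simp
      finally show "z \<bullet> H' r z + 2 * (A r z \<bullet> H r z) \<le> 0" by simp
    qed
    also have "\<dots> = (norm x1)\<^sup>2 + \<epsilon> * (norm x2)\<^sup>2 + s * (C1 + C2)"
      using s by (simp add: H_def mat_vector power2_norm_eq_inner blinfun.scaleR_left set_integral_const)
    also have "\<dots> \<le> (norm x1)\<^sup>2 + 1 * (norm x2)\<^sup>2 + T * (C1 + C2)"
      using \<epsilon> s CC by (intro add_mono mult_right_mono) auto
    finally have *: "expectation (\<lambda>\<omega>. X s \<omega> \<bullet> H s (X s \<omega>)) \<le> (norm x1)\<^sup>2 + (norm x2)\<^sup>2 + T * (C1 + C2)" by simp
    have "exp (- \<kappa> * s) * expectation (\<lambda>\<omega>. (norm (fst (X s \<omega>)))\<^sup>2) = expectation (\<lambda>\<omega>. exp (- \<kappa> * s) * (norm (fst (X s \<omega>)))\<^sup>2)" by simp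
    also have "\<dots> \<le> expectation (\<lambda>\<omega>. X s \<omega> \<bullet> H s (X s \<omega>))"
    proof (rule integral_mono)
      have e: "X s \<omega> \<bullet> H s (X s \<omega>) = exp (- \<kappa> * s) * ((norm (fst (X s \<omega>)))\<^sup>2 + \<epsilon> * (norm (snd (X s \<omega>)))\<^sup>2)" for \<omega>
        by (simp add: H_def mat_vector power2_norm_eq_inner inner_prod_def blinfun.scaleR_left algebra_simps)
      show "integrable \<Omega> (\<lambda>\<omega>. X s \<omega> \<bullet> H s (X s \<omega>))" unfolding e using fi[OF s] by simp
      show "integrable \<Omega> (\<lambda>\<omega>. exp (- \<kappa> * s) * (norm (fst (X s \<omega>)))\<^sup>2)" using fi[OF s] by simp
      show "exp (- \<kappa> * s) * (norm (fst (X s \<omega>)))\<^sup>2 \<le> X s \<omega> \<bullet> H s (X s \<omega>)" for \<omega>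
        unfolding e using \<epsilon> by (intro mult_left_mono) auto
    qed
    finally have "exp (- \<kappa> * s) * expectation (\<lambda>\<omega>. (norm (fst (X s \<omega>)))\<^sup>2) \<le> (norm x1)\<^sup>2 + (norm x2)\<^sup>2 + T * (C1 + C2)" using * by simp
    then have "exp (\<kappa> * s) * (exp (- \<kappa> * s) * expectation (\<lambda>\<omega>. (norm (fst (X s \<omega>)))\<^sup>2)) \<le> exp (\<kappa> * s) * ((norm x1)\<^sup>2 + (norm x2)\<^sup>2 + T * (C1 + C2))"
      by (rule mult_left_mono) simp
    also have "\<dots> \<le> V" unfolding V \<kappa>_def[symmetric] using CC T l0 s
      by (intro mult_right_mono add_nonneg_nonneg mult_nonneg_nonneg) (auto intro: mult_left_mono)
    finally show ?thesis by (simp add: mult.assoc[symmetric] exp_add[symmetric])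
  qed
  have E2: "expectation (\<lambda>\<omega>. (norm (snd (X s \<omega>)))\<^sup>2) \<le> (norm x2)\<^sup>2 + (b\<^sup>2 * V / \<gamma> + C2) / \<gamma>" if s: "s \<in> {0..T}" for s
  proof -
    \<comment> \<open>Half of the damping \<open>2 \<gamma> / \<epsilon>\<close> pays for this
      weight, the other half absorbs the coupling \<open>F21\<close>. The source of order
      \<open>1 / \<epsilon>\<close>, integrated and measured against the weight, is of order
      one.\<close>
    define \<mu> where "\<mu> = \<gamma> / \<epsilon>"
    define D where "D = b\<^sup>2 * V / \<gamma> + C2"
    have \<mu>: "0 < \<mu>" using \<gamma> \<epsilon> by (simp add: \<mu>_def)
    have D: "0 \<le> D" using V0 CC \<gamma> by (simp add: D_def)
    define H where "H r = exp (\<mu> * r) *\<^sub>R blk (mat 0 :: real^'n1^'n1) 0 0 (mat 1 :: real^'n2^'n2)" for r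
    define H' where "H' r = (\<mu> * exp (\<mu> * r)) *\<^sub>R blk (mat 0 :: real^'n1^'n1) 0 0 (mat 1 :: real^'n2^'n2)" for r
    have "expectation (\<lambda>\<omega>. X s \<omega> \<bullet> H s (X s \<omega>)) \<le> (x1, x2) \<bullet> H 0 (x1, x2) + (LINT r:{0..s}|lborel. exp (\<mu> * r) * (D / \<epsilon>))"
    proof (rule N.moment_bound[OF X Ac eq, where d = "\<lambda>r z. exp (\<mu> * r) / \<epsilon> * (b\<^sup>2 / \<gamma> * (norm (fst z))\<^sup>2)", OF _ _ _ _ _ _ _ _ _ _ s])
      show "(H has_vector_derivative H' r) (at r within {0..T})" for r
        unfolding H_def[abs_def] H'_def by (auto intro!: derivative_eq_intros)
      show "continuous_on {0..T} H'" unfolding H'_def[abs_def] by (intro continuous_intros)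
      show "blinfun_apply (H r) u \<bullet> v = u \<bullet> blinfun_apply (H r) v" "blinfun_apply (H' r) u \<bullet> v = u \<bullet> blinfun_apply (H' r) v" for r u v
        by (simp_all add: H_def H'_def blinfun.scaleR_left blinfun.minus_left blk_symmetric del: blk_apply)
      show "continuous_on {0..T} (\<lambda>r. exp (\<mu> * r) * (D / \<epsilon>))" by (intro continuous_intros)
      fix r assume r: "r \<in> {0..T}"
      show "integrable \<Omega> (\<lambda>\<omega>. exp (\<mu> * r) / \<epsilon> * (b\<^sup>2 / \<gamma> * (norm (fst (X r \<omega>)))\<^sup>2))" using fi(1)[OF r] by simp
      have "expectation (\<lambda>\<omega>. exp (\<mu> * r) / \<epsilon> * (b\<^sup>2 / \<gamma> * (norm (fst (X r \<omega>)))\<^sup>2)) = exp (\<mu> * r) / \<epsilon> * (b\<^sup>2 / \<gamma> * expectation (\<lambda>\<omega>. (norm (fst (X r \<omega>)))\<^sup>2))"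
        by simp
      also have "\<dots> \<le> exp (\<mu> * r) / \<epsilon> * (b\<^sup>2 / \<gamma> * V)" using E1[OF r] \<epsilon> \<gamma> by (intro mult_left_mono) auto
      finally have "expectation (\<lambda>\<omega>. exp (\<mu> * r) / \<epsilon> * (b\<^sup>2 / \<gamma> * (norm (fst (X r \<omega>)))\<^sup>2)) \<le> exp (\<mu> * r) / \<epsilon> * (b\<^sup>2 / \<gamma> * V)" .
      moreover have "N.trc (H r) = exp (\<mu> * r) / \<epsilon> * C2"
        unfolding H_def linear_simps(5)[OF N.bounded_linear_trc] tr by simp
      ultimately show "expectation (\<lambda>\<omega>. exp (\<mu> * r) / \<epsilon> * (b\<^sup>2 / \<gamma> * (norm (fst (X r \<omega>)))\<^sup>2)) + N.trc (H r) \<le> exp (\<mu> * r) * (D / \<epsilon>)"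
        by (simp add: D_def add_divide_distrib distrib_left mult.commute[of \<epsilon> \<gamma>])
      fix z :: "(real^'n1) \<times> (real^'n2)"
      obtain z1 z2 where z: "z = (z1, z2)" by (cases z)
      have "z \<bullet> H' r z + 2 * (A r z \<bullet> H r z) = exp (\<mu> * r) / \<epsilon> * (\<gamma> * (norm z2)\<^sup>2 + 2 * ((F21 r *v z1) \<bullet> z2 + (S *v z2) \<bullet> z2))"
        using \<epsilon> by (simp add: H_def H'_def A_def z blinfun.scaleR_left blinfun.minus_left mat_vector inner_add_left power2_norm_eq_inner
            scaleR_matrix_vector_assoc[symmetric] \<mu>_def field_simps)
      also have "\<dots> \<le> exp (\<mu> * r) / \<epsilon> * (b\<^sup>2 / \<gamma> * (norm z1)\<^sup>2)"
      proof (intro mult_left_mono)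
        have "2 * (norm z2 * (b * norm z1)) \<le> \<gamma> * (norm z2)\<^sup>2 + (b * norm z1)\<^sup>2 / \<gamma>" by (rule young[OF \<gamma>])
        moreover have "(b * norm z1)\<^sup>2 / \<gamma> = b\<^sup>2 / \<gamma> * (norm z1)\<^sup>2" by (simp add: power_mult_distrib)
        moreover have "norm z2 * (b * norm z1) = b * (norm z1 * norm z2)" by simp
        ultimately show "\<gamma> * (norm z2)\<^sup>2 + 2 * ((F21 r *v z1) \<bullet> z2 + (S *v z2) \<bullet> z2) \<le> b\<^sup>2 / \<gamma> * (norm z1)\<^sup>2"
          using Fb(3)[OF r, of z1 z2] S[of z2] by simp
      qed (use \<epsilon> in simp)
      finally show "z \<bullet> H' r z + 2 * (A r z \<bullet> H r z) \<le> exp (\<mu> * r) / \<epsilon> * (b\<^sup>2 / \<gamma> * (norm (fst z))\<^sup>2)" by (simp add: z)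
    qed
    also have "(LINT r:{0..s}|lborel. exp (\<mu> * r) * (D / \<epsilon>)) = exp (\<mu> * s) * (D / \<gamma>) - exp (\<mu> * 0) * (D / \<gamma>)"
      using s \<gamma> \<epsilon> by (intro LINT_FTC) (auto intro!: derivative_eq_intros continuous_intros simp: has_real_derivative_iff_has_vector_derivative[symmetric] \<mu>_def)
    also have "(x1, x2) \<bullet> H 0 (x1, x2) = (norm x2)\<^sup>2" by (simp add: H_def mat_vector power2_norm_eq_inner blinfun.scaleR_left)
    also have "expectation (\<lambda>\<omega>. X s \<omega> \<bullet> H s (X s \<omega>)) = exp (\<mu> * s) * expectation (\<lambda>\<omega>. (norm (snd (X s \<omega>)))\<^sup>2)"
    proof -
      have e: "X s \<omega> \<bullet> H s (X s \<omega>) = exp (\<mu> * s) * (norm (snd (X s \<omega>)))\<^sup>2" for \<omega>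
        by (simp add: H_def mat_vector power2_norm_eq_inner inner_prod_def blinfun.scaleR_left)
      show ?thesis unfolding e by simp
    qed
    finally have "exp (\<mu> * s) * expectation (\<lambda>\<omega>. (norm (snd (X s \<omega>)))\<^sup>2) \<le> (norm x2)\<^sup>2 + exp (\<mu> * s) * (D / \<gamma>)"
      using divide_nonneg_pos[OF D \<gamma>] by (simp only: mult_zero_right exp_zero mult_1)
    also have "\<dots> \<le> exp (\<mu> * s) * (norm x2)\<^sup>2 + exp (\<mu> * s) * (D / \<gamma>)"
      using \<mu> s mult_right_mono[of 1 "exp (\<mu> * s)" "(norm x2)\<^sup>2"] by simp
    finally have "exp (\<mu> * s) * expectation (\<lambda>\<omega>. (norm (snd (X s \<omega>)))\<^sup>2) \<le> exp (\<mu> * s) * ((norm x2)\<^sup>2 + D / \<gamma>)"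
      by (simp add: distrib_left)
    then show ?thesis by (simp add: D_def)
  qed
  have "(norm (X t \<omega>))\<^sup>2 = (norm (fst (X t \<omega>)))\<^sup>2 + (norm (snd (X t \<omega>)))\<^sup>2" for \<omega>
    using norm_Pair_square[of "fst (X t \<omega>)" "snd (X t \<omega>)"] by simp
  then have "expectation (\<lambda>\<omega>. (norm (X t \<omega>))\<^sup>2) = expectation (\<lambda>\<omega>. (norm (fst (X t \<omega>)))\<^sup>2) + expectation (\<lambda>\<omega>. (norm (snd (X t \<omega>)))\<^sup>2)"
    using fi[OF t] by simp
  then show ?thesis using E1[OF t] E2[OF t] by simp
qed

end

section \<open>The cost gap between the saddle point and its approximation\<close>

definition gain_defect ::
  "('n1::finite,'n2::finite,'k1::finite,'k2::finite,'m1::finite,'m2::finite) lq_game \<Rightarrow> real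
    \<Rightarrow> real^'n1^'n1 \<Rightarrow> real^'n2^'n1 \<Rightarrow> real^'n2^'n2
    \<Rightarrow> real^'n1^'k1 \<Rightarrow> real^'n2^'k1 \<Rightarrow> real^'n1^'k2 \<Rightarrow> real^'n2^'k2 \<Rightarrow> (real^'n1) \<times> (real^'n2) \<Rightarrow> real" where
  "gain_defect G \<epsilon> P11 P12 P22 K11 K12 K21 K22 z =
    - (norm ((K11 - ((B11 G)\<^sup>T ** P11 + (B21 G)\<^sup>T ** P12\<^sup>T)) *v fst z + (K12 - (\<epsilon> *\<^sub>R ((B11 G)\<^sup>T ** P12) + (B21 G)\<^sup>T ** P22)) *v snd z))\<^sup>2
      + (norm ((K21 + ((B12 G)\<^sup>T ** P11 + (B22 G)\<^sup>T ** P12\<^sup>T)) *v fst z + (K22 + (\<epsilon> *\<^sub>R ((B12 G)\<^sup>T ** P12) + (B22 G)\<^sup>T ** P22)) *v snd z))\<^sup>2"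

lemma gain_defect_bound:
  fixes G :: "('n1::finite,'n2::finite,'k1::finite,'k2::finite,'m1::finite,'m2::finite) lq_game"
  assumes "norm (K11 - ((B11 G)\<^sup>T ** P11 + (B21 G)\<^sup>T ** P12\<^sup>T)) \<le> \<zeta>" "norm (K12 - (\<epsilon> *\<^sub>R ((B11 G)\<^sup>T ** P12) + (B21 G)\<^sup>T ** P22)) \<le> \<zeta>"
    "norm (K21 + ((B12 G)\<^sup>T ** P11 + (B22 G)\<^sup>T ** P12\<^sup>T)) \<le> \<zeta>" "norm (K22 + (\<epsilon> *\<^sub>R ((B12 G)\<^sup>T ** P12) + (B22 G)\<^sup>T ** P22)) \<le> \<zeta>"
  shows "\<bar>gain_defect G \<epsilon> P11 P12 P22 K11 K12 K21 K22 z\<bar> \<le> 4 * \<zeta>\<^sup>2 * (norm z)\<^sup>2"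
proof -
  have z: "norm (fst z) \<le> norm z" "norm (snd z) \<le> norm z"
    using norm_fst_le[of "fst z" "snd z"] norm_snd_le[of "snd z" "fst z"] by auto
  have \<zeta>: "0 \<le> \<zeta>" using order_trans[OF norm_ge_zero assms(1)] .
  have s: "(norm (u + v))\<^sup>2 \<le> 4 * \<zeta>\<^sup>2 * (norm z)\<^sup>2" if "norm u \<le> \<zeta> * norm z" "norm v \<le> \<zeta> * norm z" for u v :: "real^'k"
  proof -
    have "norm (u + v) \<le> 2 * \<zeta> * norm z" using norm_triangle_ineq[of u v] that by simp
    then have "(norm (u + v))\<^sup>2 \<le> (2 * \<zeta> * norm z)\<^sup>2" by (rule power_mono) simp
    then show ?thesis by (simp add: power_mult_distrib)
  qed
  have m: "norm (A *v fst z) \<le> \<zeta> * norm z" if "norm A \<le> \<zeta>" for A :: "real^'n1^'k"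
    using that z \<zeta> by (intro order_trans[OF norm_matrix_vector_le] mult_mono) auto
  have m': "norm (A *v snd z) \<le> \<zeta> * norm z" if "norm A \<le> \<zeta>" for A :: "real^'n2^'k"
    using that z \<zeta> by (intro order_trans[OF norm_matrix_vector_le] mult_mono) auto
  \<comment> \<open>Both squares are nonnegative, so their difference is bounded by the larger one
    and the factor \<open>4\<close> suffices.\<close>
  show ?thesis
    unfolding gain_defect_def
    using s[OF m[OF assms(1)] m'[OF assms(2)]] s[OF m[OF assms(3)] m'[OF assms(4)]]
    by (smt (verit) zero_le_power2)
qed

text \<open>Compares approximate with exact gains, which are linear in the Riccati blocks. The term
  \<open>\<epsilon> *\<^sub>R (B\<^sup>T ** Y')\<close> is missing from the approximate fast gain
  and counts in full as a defect.\<close>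

lemma gain_difference:
  fixes B :: "real^'k^'n1" and C :: "real^'k^'n2"
  shows "norm ((B\<^sup>T ** X + C\<^sup>T ** Y\<^sup>T) - (B\<^sup>T ** X' + C\<^sup>T ** Y'\<^sup>T)) \<le> norm B * norm (X - X') + norm C * norm (Y - Y')"
    "norm (C\<^sup>T ** Z - (\<epsilon> *\<^sub>R (B\<^sup>T ** Y') + C\<^sup>T ** Z')) \<le> norm C * norm (Z - Z') + \<bar>\<epsilon>\<bar> * (norm B * norm Y')"
proof -
  have "(B\<^sup>T ** X + C\<^sup>T ** Y\<^sup>T) - (B\<^sup>T ** X' + C\<^sup>T ** Y'\<^sup>T) = B\<^sup>T ** (X - X') + C\<^sup>T ** (Y - Y')\<^sup>T"
    by (simp add: matrix_mult_algebra)
  also have "norm \<dots> \<le> norm (B\<^sup>T ** (X - X')) + norm (C\<^sup>T ** (Y - Y')\<^sup>T)" by (rule norm_triangle_ineq)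
  also have "\<dots> \<le> norm B * norm (X - X') + norm C * norm (Y - Y')"
    using norm_matrix_mult[of "B\<^sup>T" "X - X'"] norm_matrix_mult[of "C\<^sup>T" "(Y - Y')\<^sup>T"] by (simp only: norm_transpose)
  finally show "norm ((B\<^sup>T ** X + C\<^sup>T ** Y\<^sup>T) - (B\<^sup>T ** X' + C\<^sup>T ** Y'\<^sup>T)) \<le> norm B * norm (X - X') + norm C * norm (Y - Y')" .
  have "C\<^sup>T ** Z - (\<epsilon> *\<^sub>R (B\<^sup>T ** Y') + C\<^sup>T ** Z') = C\<^sup>T ** (Z - Z') - \<epsilon> *\<^sub>R (B\<^sup>T ** Y')"
    by (simp add: matrix_mult_algebra)
  also have "norm \<dots> \<le> norm (C\<^sup>T ** (Z - Z')) + norm (\<epsilon> *\<^sub>R (B\<^sup>T ** Y'))" by (rule norm_triangle_ineq4)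
  also have "\<dots> \<le> norm C * norm (Z - Z') + \<bar>\<epsilon>\<bar> * (norm B * norm Y')"
    using norm_matrix_mult[of "B\<^sup>T" Y'] norm_matrix_mult[of "C\<^sup>T" "Z - Z'"]
    by (simp only: norm_transpose norm_scaleR) (intro add_mono mult_left_mono, auto)
  finally show "norm (C\<^sup>T ** Z - (\<epsilon> *\<^sub>R (B\<^sup>T ** Y') + C\<^sup>T ** Z')) \<le> norm C * norm (Z - Z') + \<bar>\<epsilon>\<bar> * (norm B * norm Y')" .
qed

lemma loewner_sym_part_quadratic:
  assumes "loewner_le (sym_part S) (mat c)" shows "(S *v v) \<bullet> v \<le> c * (norm v)\<^sup>2"
proof -
  have "v \<bullet> (sym_part S *v v) \<le> v \<bullet> (mat c *v v)" using assms by (simp add: loewner_le_def)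
  moreover have "v \<bullet> (sym_part S *v v) = (S *v v) \<bullet> v"
    using inner_transpose_left[of v S v]
    by (simp add: sym_part_def scaleR_matrix_vector_assoc[symmetric] matrix_vector_mult_add_rdistrib inner_add_right inner_commute[of v "S *v v"] del: transpose_matrix_vector)
  ultimately show ?thesis by (simp add: mat_vector power2_norm_eq_inner)
qed

text \<open>Scaling the blocks by \<open>\<epsilon>\<close> matches the left-hand sides of the fast
  equations, so the derivative of the block matrix consists of the Riccati fields without any
  \<open>1 / \<epsilon>\<close>.\<close>

lemma full_solution_deriv:
  assumes "full_solution G T \<epsilon> P11 P12 P22" and "t \<in> {0..T}"
  shows "((\<lambda>t. blk (P11 t) (\<epsilon> *\<^sub>R P12 t) (\<epsilon> *\<^sub>R (P12 t)\<^sup>T) (\<epsilon> *\<^sub>R P22 t)) has_vector_derivative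
     blk (- riccati_f G (P11 t) (P12 t) (P22 t) \<epsilon>) (- riccati_g1 G (P11 t) (P12 t) (P22 t) \<epsilon>)
        (- (riccati_g1 G (P11 t) (P12 t) (P22 t) \<epsilon>)\<^sup>T) (- riccati_g2 G (P11 t) (P12 t) (P22 t) \<epsilon>)) (at t within {0..T})"
    "continuous (at t within {0..T}) P11" "continuous (at t within {0..T}) P12" "continuous (at t within {0..T}) P22"
proof -
  obtain D11 D12 D22 where D:
    "(P11 has_vector_derivative D11) (at t within {0..T})"
    "(P12 has_vector_derivative D12) (at t within {0..T})"
    "(P22 has_vector_derivative D22) (at t within {0..T})"
    "D11 + riccati_f G (P11 t) (P12 t) (P22 t) \<epsilon> = 0"
    "\<epsilon> *\<^sub>R D12 + riccati_g1 G (P11 t) (P12 t) (P22 t) \<epsilon> = 0"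
    "\<epsilon> *\<^sub>R D22 + riccati_g2 G (P11 t) (P12 t) (P22 t) \<epsilon> = 0"
    using assms unfolding full_solution_def by blast
  show "continuous (at t within {0..T}) P11" "continuous (at t within {0..T}) P12" "continuous (at t within {0..T}) P22"
    using D(1-3) has_vector_derivative_continuous by blast+
  have e: "- riccati_f G (P11 t) (P12 t) (P22 t) \<epsilon> = D11" "- riccati_g1 G (P11 t) (P12 t) (P22 t) \<epsilon> = \<epsilon> *\<^sub>R D12"
     "- riccati_g2 G (P11 t) (P12 t) (P22 t) \<epsilon> = \<epsilon> *\<^sub>R D22"
    using D(4-6) by (simp_all add: add_eq_0_iff)
  have eT: "- (riccati_g1 G (P11 t) (P12 t) (P22 t) \<epsilon>)\<^sup>T = \<epsilon> *\<^sub>R D12\<^sup>T"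
    unfolding transpose_minus[symmetric] e(2) by simp
  show "((\<lambda>t. blk (P11 t) (\<epsilon> *\<^sub>R P12 t) (\<epsilon> *\<^sub>R (P12 t)\<^sup>T) (\<epsilon> *\<^sub>R P22 t)) has_vector_derivative
     blk (- riccati_f G (P11 t) (P12 t) (P22 t) \<epsilon>) (- riccati_g1 G (P11 t) (P12 t) (P22 t) \<epsilon>)
        (- (riccati_g1 G (P11 t) (P12 t) (P22 t) \<epsilon>)\<^sup>T) (- riccati_g2 G (P11 t) (P12 t) (P22 t) \<epsilon>)) (at t within {0..T})"
    unfolding e eT
    by (intro has_vector_derivative_blk D(1) bounded_linear.has_vector_derivative[OF bounded_linear_scaleR_right] has_vector_derivative_transpose D(2,3))
qed

context brownian_pair
begin

text \<open>Symmetry of \<open>Q1 G\<close> and \<open>Q2 G\<close> makes the velocity of the block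
  matrix symmetric, as \<open>cost_identity\<close> demands; the running cost of any continuous
  linear feedback grows quadratically, which gives the integrability.\<close>

lemma cost_formula:
  fixes G :: "('n1::finite,'n2::finite,'k1::finite,'k2::finite,'m1,'m2) lq_game"
    and K11 :: "real \<Rightarrow> real^'n1^'k1" and K12 :: "real \<Rightarrow> real^'n2^'k1" and K21 :: "real \<Rightarrow> real^'n1^'k2" and K22 :: "real \<Rightarrow> real^'n2^'k2"
  assumes \<epsilon>: "0 < \<epsilon>" and sol: "full_solution G T \<epsilon> P11 P12 P22" and Q: "(Q1 G)\<^sup>T = Q1 G" "(Q2 G)\<^sup>T = Q2 G"
    and K: "continuous_on {0..T} K11" "continuous_on {0..T} K12" "continuous_on {0..T} K21" "continuous_on {0..T} K22"
    and X: "white_noise.nonant \<Omega> T (noise (sigma1 G) (sigma2 G) (1 / sqrt \<epsilon>)) X"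
    and eq: "\<And>t \<omega>. t \<in> {0..T} \<Longrightarrow> \<omega> \<in> space \<Omega> \<Longrightarrow> X t \<omega> = noise (sigma1 G) (sigma2 G) (1 / sqrt \<epsilon>) t \<omega>
        + ((x1, x2) + (LINT s:{0..t}|lborel. blinfun_apply (closed_loop_op G \<epsilon> K11 K12 K21 K22 s) (X s \<omega>)))"
  defines "H \<equiv> \<lambda>t. blk (P11 t) (\<epsilon> *\<^sub>R P12 t) (\<epsilon> *\<^sub>R (P12 t)\<^sup>T) (\<epsilon> *\<^sub>R P22 t)"
  shows "set_integrable lborel {0..T} (\<lambda>s. expectation (\<lambda>\<omega>. gain_defect G \<epsilon> (P11 s) (P12 s) (P22 s) (K11 s) (K12 s) (K21 s) (K22 s) (X s \<omega>)))" (is ?int)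
    and "expectation (\<lambda>\<omega>. LINT t:{0..T}|lborel. running_integrand G K11 K12 K21 K22 t (X t \<omega>))
      = (x1, x2) \<bullet> H 0 (x1, x2) + (LINT s:{0..T}|lborel. white_noise.trc (noise_cov (sigma1 G) (sigma2 G) (1 / sqrt \<epsilon>)) (H s))
       + (LINT s:{0..T}|lborel. expectation (\<lambda>\<omega>. gain_defect G \<epsilon> (P11 s) (P12 s) (P22 s) (K11 s) (K12 s) (K21 s) (K22 s) (X s \<omega>)))" (is ?eq)
proof -
  interpret N: white_noise \<Omega> T "noise (sigma1 G) (sigma2 G) (1 / sqrt \<epsilon>)" "noise_cov (sigma1 G) (sigma2 G) (1 / sqrt \<epsilon>)"
    by (rule white_noise_noise)
  obtain C where C: "0 \<le> C" "\<And>t z. t \<in> {0..T} \<Longrightarrow> \<bar>running_integrand G K11 K12 K21 K22 t z\<bar> \<le> C * (norm z)\<^sup>2"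
    using running_integrand_bound[OF K] by blast
  have sym: "(P11 t)\<^sup>T = P11 t" "(P22 t)\<^sup>T = P22 t" if "t \<in> {0..T}" for t
    using sol that unfolding full_solution_def by (auto dest: symmetric_matricesD)
  have Pc: "continuous_on {0..T} P11" "continuous_on {0..T} P12" "continuous_on {0..T} P22"
    unfolding continuous_on_eq_continuous_within using full_solution_deriv(2-4)[OF sol] by blast+
  have 0: "(H has_vector_derivative blk (- riccati_f G (P11 t) (P12 t) (P22 t) \<epsilon>) (- riccati_g1 G (P11 t) (P12 t) (P22 t) \<epsilon>)
        (- (riccati_g1 G (P11 t) (P12 t) (P22 t) \<epsilon>)\<^sup>T) (- riccati_g2 G (P11 t) (P12 t) (P22 t) \<epsilon>)) (at t within {0..T})"
    if "t \<in> {0..T}" for t unfolding H_def by (rule full_solution_deriv(1)[OF sol that])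
  have 1: "continuous_on {0..T} (\<lambda>t. blk (- riccati_f G (P11 t) (P12 t) (P22 t) \<epsilon>) (- riccati_g1 G (P11 t) (P12 t) (P22 t) \<epsilon>)
        (- (riccati_g1 G (P11 t) (P12 t) (P22 t) \<epsilon>)\<^sup>T) (- riccati_g2 G (P11 t) (P12 t) (P22 t) \<epsilon>))"
    unfolding riccati_f_def riccati_g1_def riccati_g2_def by (intro continuous_intros Pc)
  have 2: "blinfun_apply (H t) u \<bullet> v = u \<bullet> blinfun_apply (H t) v" if "t \<in> {0..T}" for t u v
    unfolding H_def by (rule blk_symmetric) (use sym[OF that] in simp_all)
  have 3: "blinfun_apply (blk (- riccati_f G (P11 t) (P12 t) (P22 t) \<epsilon>) (- riccati_g1 G (P11 t) (P12 t) (P22 t) \<epsilon>)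
        (- (riccati_g1 G (P11 t) (P12 t) (P22 t) \<epsilon>)\<^sup>T) (- riccati_g2 G (P11 t) (P12 t) (P22 t) \<epsilon>)) u \<bullet> v
     = u \<bullet> blinfun_apply (blk (- riccati_f G (P11 t) (P12 t) (P22 t) \<epsilon>) (- riccati_g1 G (P11 t) (P12 t) (P22 t) \<epsilon>)
        (- (riccati_g1 G (P11 t) (P12 t) (P22 t) \<epsilon>)\<^sup>T) (- riccati_g2 G (P11 t) (P12 t) (P22 t) \<epsilon>)) v" if "t \<in> {0..T}" for t u v
    by (rule blk_symmetric) (use riccati_f_sym[OF sym(1)[OF that] Q(1)] riccati_g2_sym[OF sym(2)[OF that] Q(2)] in simp_all)
  have 4: "H T = 0" using sol unfolding full_solution_def H_def by (simp add: blk_0)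
  have 5: "running_integrand G K11 K12 K21 K22 t z + (z \<bullet> blk (- riccati_f G (P11 t) (P12 t) (P22 t) \<epsilon>) (- riccati_g1 G (P11 t) (P12 t) (P22 t) \<epsilon>)
        (- (riccati_g1 G (P11 t) (P12 t) (P22 t) \<epsilon>)\<^sup>T) (- riccati_g2 G (P11 t) (P12 t) (P22 t) \<epsilon>) z + 2 * (closed_loop_op G \<epsilon> K11 K12 K21 K22 t z \<bullet> H t z))
    = gain_defect G \<epsilon> (P11 t) (P12 t) (P22 t) (K11 t) (K12 t) (K21 t) (K22 t) z" if "t \<in> {0..T}" for t z
    unfolding gain_defect_def H_def by (rule completing_square[OF sym[OF that] \<epsilon>])
  have 6: "running_integrand G K11 K12 K21 K22 t \<in> borel_measurable borel" for t
    unfolding running_integrand_def[abs_def] by (intro borel_measurable_continuous_onI continuous_intros)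
  have 7: "continuous_on {0..T} (\<lambda>t. running_integrand G K11 K12 K21 K22 t (X t \<omega>))" if "\<omega> \<in> space \<Omega>" for \<omega>
    unfolding running_integrand_def by (intro continuous_intros K N.nonant_cont[OF X that])
  note * = N.cost_identity[where d = "\<lambda>s. gain_defect G \<epsilon> (P11 s) (P12 s) (P22 s) (K11 s) (K12 s) (K21 s) (K22 s)",
      OF X continuous_on_closed_loop_op[OF K] eq 0 1 2 3 4 5 6 7 C(2,1)]
  show ?int by (rule *(1))
  show ?eq by (rule *(2))
qed

text \<open>The constants are fixed before \<open>\<epsilon>\<close>: the gains of the approximate
  loop, the drift bounds and the moment bound \<open>m\<close> do not involve it, and the Riccati
  deviation enters through \<open>Ct\<close>, \<open>c\<close> and \<open>k\<close> only.\<close>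

theorem cost_gap:
  fixes G :: "('n1::finite,'n2::finite,'k1::finite,'k2::finite,'m1,'m2) lq_game"
    and x1 :: "real^'n1" and x2 :: "real^'n2"
  assumes data: "tikhonov_data G Pb22 \<gamma> \<delta> q2 T Pb11 y p c k"
  obtains \<epsilon>s C where "tikhonov_threshold G T Pb22 Pb11 \<epsilon>s"
    "\<And>\<epsilon> P11 P12 P22. 0 < \<epsilon> \<Longrightarrow> \<epsilon> < \<epsilon>s \<Longrightarrow> full_solution G T \<epsilon> P11 P12 P22 \<Longrightarrow>
         (\<exists>uh1 uh2. feedback_controls G T \<Omega> W1 W2 \<epsilon> x1 x2
            (saddle_u1 G \<epsilon> P11 P12 P22) (saddle_u2 G \<epsilon> P11 P12 P22) uh1 uh2)
       \<and> (\<exists>ub1 ub2. feedback_controls G T \<Omega> W1 W2 \<epsilon> x1 x2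
            (approx_u1 G Pb22 Pb11) (approx_u2 G Pb22 Pb11) ub1 ub2)
       \<and> (\<forall>uh1 uh2 ub1 ub2.
            feedback_controls G T \<Omega> W1 W2 \<epsilon> x1 x2
              (saddle_u1 G \<epsilon> P11 P12 P22) (saddle_u2 G \<epsilon> P11 P12 P22) uh1 uh2
            \<and> feedback_controls G T \<Omega> W1 W2 \<epsilon> x1 x2
              (approx_u1 G Pb22 Pb11) (approx_u2 G Pb22 Pb11) ub1 ub2 \<longrightarrow>
            \<bar>cost_J G T \<Omega> W1 W2 \<epsilon> x1 x2 uh1 uh2 - cost_J G T \<Omega> W1 W2 \<epsilon> x1 x2 ub1 ub2\<bar> \<le> C * \<epsilon>)"
proof -
  interpret D: tikhonov_data G Pb22 \<gamma> \<delta> q2 T Pb11 y p c k by (rule data)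
  obtain \<epsilon>s Ct where thr: "tikhonov_threshold G T Pb22 Pb11 \<epsilon>s" and Ct: "0 \<le> Ct"
    and tik: "\<And>\<epsilon> P11 P12 P22 t. 0 < \<epsilon> \<Longrightarrow> \<epsilon> < \<epsilon>s \<Longrightarrow> full_solution G T \<epsilon> P11 P12 P22 \<Longrightarrow> t \<in> {0..T} \<Longrightarrow>
        norm (P11 t - Pb11 t) \<le> Ct * \<epsilon>
      \<and> norm (P12 t - D.h (Pb11 t) - y ((T - t) / \<epsilon>)) \<le> Ct * \<epsilon>
      \<and> norm (P22 t - Pb22 - p ((T - t) / \<epsilon>)) \<le> Ct * \<epsilon>"
    by (rule D.tikhonov) (rule that)
  have \<epsilon>s: "\<epsilon>s \<le> 1" using thr by (simp add: tikhonov_threshold_def)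
  have Pb11_c: "continuous_on {0..T} Pb11"
    unfolding continuous_on_eq_continuous_within
    using D.reduced has_vector_derivative_continuous unfolding reduced_solution_def by blast
  have h_c: "continuous_on {0..T} (\<lambda>t. D.h (Pb11 t))"
    unfolding slow_manifold_def by (intro continuous_intros Pb11_c)
  define L11 where "L11 t = (B11 G)\<^sup>T ** Pb11 t + (B21 G)\<^sup>T ** (D.h (Pb11 t))\<^sup>T" for t
  define L12 where "L12 t = (B21 G)\<^sup>T ** Pb22" for t :: real
  define L21 where "L21 t = - ((B12 G)\<^sup>T ** Pb11 t + (B22 G)\<^sup>T ** (D.h (Pb11 t))\<^sup>T)" for t
  define L22 where "L22 t = - ((B22 G)\<^sup>T ** Pb22)" for t :: real
  have Lc: "continuous_on {0..T} L11" "continuous_on {0..T} L12" "continuous_on {0..T} L21" "continuous_on {0..T} L22"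
    unfolding L11_def[abs_def] L12_def[abs_def] L21_def[abs_def] L22_def[abs_def] by (intro continuous_intros Pb11_c h_c)+
  have approx: "approx_u1 G Pb22 Pb11 = linear_feedback L11 L12" "approx_u2 G Pb22 Pb11 = linear_feedback L21 L22"
    unfolding fun_eq_iff approx_u1_def approx_u2_def linear_feedback_def L11_def L12_def L21_def L22_def minus_matrix_vector
    by simp_all
  define F11 where "F11 t = A11 G + B11 G ** L11 t + B12 G ** L21 t" for t
  define F12 where "F12 t = A12 G + B11 G ** L12 t + B12 G ** L22 t" for t
  define F21 where "F21 t = A21 G + B21 G ** L11 t + B22 G ** L21 t" for t
  have Fc: "continuous_on {0..T} F11" "continuous_on {0..T} F12" "continuous_on {0..T} F21"
    unfolding F11_def[abs_def] F12_def[abs_def] F21_def[abs_def] by (intro continuous_intros Lc)+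
  obtain b1 where b1: "\<And>t. t \<in> {0..T} \<Longrightarrow> norm (F11 t) \<le> b1"
    using compact_imp_bounded[OF compact_continuous_image[OF Fc(1) compact_Icc]] by (metis bounded_iff image_eqI)
  obtain b2 where b2: "\<And>t. t \<in> {0..T} \<Longrightarrow> norm (F12 t) \<le> b2"
    using compact_imp_bounded[OF compact_continuous_image[OF Fc(2) compact_Icc]] by (metis bounded_iff image_eqI)
  obtain b3 where b3: "\<And>t. t \<in> {0..T} \<Longrightarrow> norm (F21 t) \<le> b3"
    using compact_imp_bounded[OF compact_continuous_image[OF Fc(3) compact_Icc]] by (metis bounded_iff image_eqI)
  obtain ch where ch: "\<And>t. t \<in> {0..T} \<Longrightarrow> norm (D.h (Pb11 t)) \<le> ch"
    using compact_imp_bounded[OF compact_continuous_image[OF h_c compact_Icc]] by (metis bounded_iff image_eqI)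
  have ch0: "0 \<le> ch" using order_trans[OF norm_ge_zero ch[of 0]] T0 by simp
  define b where "b = max b1 (max b2 b3)"
  have b: "norm (F11 t) \<le> b" "norm (F12 t) \<le> b" "norm (F21 t) \<le> b" if "t \<in> {0..T}" for t
    using b1[OF that] b2[OF that] b3[OF that] by (auto simp: b_def)
  \<comment> \<open>The approximate gains turn the fast drift matrix into exactly
    \<open>S / \<epsilon>\<close>. This constant dissipative block is what lets the moment bound
    apply to the approximate loop.\<close>
  have loop: "closed_loop_op G \<epsilon> L11 L12 L21 L22 t = blk (F11 t) (F12 t) ((1/\<epsilon>) *\<^sub>R F21 t) ((1/\<epsilon>) *\<^sub>R D.S)" for \<epsilon> t
  proof -
    have "A22 G + B21 G ** L12 t + B22 G ** L22 t = D.S"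
      by (simp add: L12_def L22_def fast_S_def Delta2_def matrix_mult_algebra)
    then show ?thesis by (simp add: closed_loop_op_def F11_def F12_def F21_def)
  qed
  have S: "(D.S *v z) \<bullet> z \<le> - \<gamma> * (norm z)\<^sup>2" for z
    by (rule loewner_sym_part_quadratic) (use D.stable in \<open>simp only: loewner_le_uminus_mat\<close>)
  define C1 where "C1 = (\<Sum>i\<in>Basis. (norm ((sigma1 G)\<^sup>T *v i))\<^sup>2)"
  define C2 where "C2 = (\<Sum>i\<in>Basis. (norm ((sigma2 G)\<^sup>T *v i))\<^sup>2)"
  define V where "V = exp ((2 * b + 4 * b\<^sup>2 / \<gamma>) * T) * ((norm x1)\<^sup>2 + (norm x2)\<^sup>2 + T * (C1 + C2))"
  \<comment> \<open>The \<open>max\<close> spares a separate proof that the bound is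
    nonnegative.\<close>
  define m where "m = max 0 (V + ((norm x2)\<^sup>2 + (b\<^sup>2 * V / \<gamma> + C2) / \<gamma>))"
  have m0: "0 \<le> m" by (simp add: m_def)
  define \<beta> where "\<beta> = norm (B11 G) + norm (B12 G) + norm (B21 G) + norm (B22 G)"
  have \<beta>: "0 \<le> \<beta>" "norm (B11 G) \<le> \<beta>" "norm (B12 G) \<le> \<beta>" "norm (B21 G) \<le> \<beta>" "norm (B22 G) \<le> \<beta>"
    by (simp_all add: \<beta>_def)
  \<comment> \<open>Bounds \<open>P12\<close>, which enters the exact fast gain with the factor
    \<open>\<epsilon>\<close>.\<close>
  define R where "R = ch + Ct + c"
  have R: "0 \<le> R" using ch0 Ct D.c by (simp add: R_def)
  \<comment> \<open>\<open>z1 * \<epsilon>\<close> is the part of the gain defect that persists over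
    the whole horizon, \<open>z2\<close> the part carried by the terminal layer.\<close>
  define z1 where "z1 = \<beta> * (2 * Ct + R)"
  define z2 where "z2 = \<beta> * (2 * c)"
  have z: "0 \<le> z1" "0 \<le> z2" using \<beta>(1) R Ct D.c by (simp_all add: z1_def z2_def)
  \<comment> \<open>\<open>z1 * T + z2 / k\<close> bounds the integral of the gain defect per unit
    of \<open>\<epsilon>\<close>; the prefactor is half of \<open>4 * (z1 + z2) * m\<close>, the
    half coming from the factor \<open>1/2\<close> in the cost.\<close>
  define C where "C = 2 * (z1 + z2) * m * (z1 * T + z2 / k)"
  show thesis
  proof (rule that[OF thr, of C], goal_cases)
    case (1 \<epsilon> P11 P12 P22)
    note \<epsilon> = 1(1,2) and sol = 1(3)
    have \<epsilon>1: "\<epsilon> \<le> 1" using \<epsilon> \<epsilon>s by simp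
    define K11 where "K11 t = (B11 G)\<^sup>T ** P11 t + (B21 G)\<^sup>T ** (P12 t)\<^sup>T" for t
    define K12 where "K12 t = \<epsilon> *\<^sub>R ((B11 G)\<^sup>T ** P12 t) + (B21 G)\<^sup>T ** P22 t" for t
    define K21 where "K21 t = - ((B12 G)\<^sup>T ** P11 t + (B22 G)\<^sup>T ** (P12 t)\<^sup>T)" for t
    define K22 where "K22 t = - (\<epsilon> *\<^sub>R ((B12 G)\<^sup>T ** P12 t) + (B22 G)\<^sup>T ** P22 t)" for t
    have Pc: "continuous_on {0..T} P11" "continuous_on {0..T} P12" "continuous_on {0..T} P22"
      unfolding continuous_on_eq_continuous_within using full_solution_deriv(2-4)[OF sol] by blast+
    have Kc: "continuous_on {0..T} K11" "continuous_on {0..T} K12" "continuous_on {0..T} K21" "continuous_on {0..T} K22"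
      unfolding K11_def[abs_def] K12_def[abs_def] K21_def[abs_def] K22_def[abs_def] by (intro continuous_intros Pc)+
    have saddle: "saddle_u1 G \<epsilon> P11 P12 P22 = linear_feedback K11 K12" "saddle_u2 G \<epsilon> P11 P12 P22 = linear_feedback K21 K22"
      unfolding fun_eq_iff saddle_u1_def saddle_u2_def linear_feedback_def K11_def K12_def K21_def K22_def minus_matrix_vector
      by simp_all
    obtain X where X: "white_noise.nonant \<Omega> T (noise (sigma1 G) (sigma2 G) (1 / sqrt \<epsilon>)) X"
      and Xeq: "\<And>t \<omega>. t \<in> {0..T} \<Longrightarrow> \<omega> \<in> space \<Omega> \<Longrightarrow> X t \<omega> = noise (sigma1 G) (sigma2 G) (1 / sqrt \<epsilon>) t \<omega>
        + ((x1, x2) + (LINT s:{0..t}|lborel. blinfun_apply (closed_loop_op G \<epsilon> L11 L12 L21 L22 s) (X s \<omega>)))"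
      and Xex: "\<exists>u1 u2. feedback_controls G T \<Omega> W1 W2 \<epsilon> x1 x2 (linear_feedback L11 L12) (linear_feedback L21 L22) u1 u2"
      and XJ: "\<And>u1 u2. feedback_controls G T \<Omega> W1 W2 \<epsilon> x1 x2 (linear_feedback L11 L12) (linear_feedback L21 L22) u1 u2 \<Longrightarrow>
       cost_J G T \<Omega> W1 W2 \<epsilon> x1 x2 u1 u2
         = (1/2) * expectation (\<lambda>\<omega>. LINT t:{0..T}|lborel. running_integrand G L11 L12 L21 L22 t (X t \<omega>))"
      by (rule closed_loop[OF Lc, of G \<epsilon> x1 x2]) (rule that)
    obtain Y where Y: "white_noise.nonant \<Omega> T (noise (sigma1 G) (sigma2 G) (1 / sqrt \<epsilon>)) Y"
      and Yeq: "\<And>t \<omega>. t \<in> {0..T} \<Longrightarrow> \<omega> \<in> space \<Omega> \<Longrightarrow> Y t \<omega> = noise (sigma1 G) (sigma2 G) (1 / sqrt \<epsilon>) t \<omega>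
        + ((x1, x2) + (LINT s:{0..t}|lborel. blinfun_apply (closed_loop_op G \<epsilon> K11 K12 K21 K22 s) (Y s \<omega>)))"
      and Yex: "\<exists>u1 u2. feedback_controls G T \<Omega> W1 W2 \<epsilon> x1 x2 (linear_feedback K11 K12) (linear_feedback K21 K22) u1 u2"
      and YJ: "\<And>u1 u2. feedback_controls G T \<Omega> W1 W2 \<epsilon> x1 x2 (linear_feedback K11 K12) (linear_feedback K21 K22) u1 u2 \<Longrightarrow>
       cost_J G T \<Omega> W1 W2 \<epsilon> x1 x2 u1 u2
         = (1/2) * expectation (\<lambda>\<omega>. LINT t:{0..T}|lborel. running_integrand G K11 K12 K21 K22 t (Y t \<omega>))"
      by (rule closed_loop[OF Kc, of G \<epsilon> x1 x2]) (rule that)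
    interpret N: white_noise \<Omega> T "noise (sigma1 G) (sigma2 G) (1 / sqrt \<epsilon>)" "noise_cov (sigma1 G) (sigma2 G) (1 / sqrt \<epsilon>)"
      by (rule white_noise_noise)
    define d where "d s z = gain_defect G \<epsilon> (P11 s) (P12 s) (P22 s) (L11 s) (L12 s) (L21 s) (L22 s) z" for s z
    define c0 where "c0 = (x1, x2) \<bullet> blk (P11 0) (\<epsilon> *\<^sub>R P12 0) (\<epsilon> *\<^sub>R (P12 0)\<^sup>T) (\<epsilon> *\<^sub>R P22 0) (x1, x2)
      + (LINT s:{0..T}|lborel. N.trc (blk (P11 s) (\<epsilon> *\<^sub>R P12 s) (\<epsilon> *\<^sub>R (P12 s)\<^sup>T) (\<epsilon> *\<^sub>R P22 s)))"
    have fX: "set_integrable lborel {0..T} (\<lambda>s. expectation (\<lambda>\<omega>. d s (X s \<omega>)))"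
      unfolding d_def by (rule cost_formula(1)[OF \<epsilon>(1) sol D.Q1_T D.Q2_T Lc X]) (assumption | rule Xeq)+
    have JX: "expectation (\<lambda>\<omega>. LINT t:{0..T}|lborel. running_integrand G L11 L12 L21 L22 t (X t \<omega>))
        = c0 + (LINT s:{0..T}|lborel. expectation (\<lambda>\<omega>. d s (X s \<omega>)))"
      unfolding d_def c0_def by (rule cost_formula(2)[OF \<epsilon>(1) sol D.Q1_T D.Q2_T Lc X]) (assumption | rule Xeq)+
    have JY: "expectation (\<lambda>\<omega>. LINT t:{0..T}|lborel. running_integrand G K11 K12 K21 K22 t (Y t \<omega>))
        = c0 + (LINT s:{0..T}|lborel. expectation (\<lambda>\<omega>. gain_defect G \<epsilon> (P11 s) (P12 s) (P22 s) (K11 s) (K12 s) (K21 s) (K22 s) (Y s \<omega>)))"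
      unfolding c0_def by (rule cost_formula(2)[OF \<epsilon>(1) sol D.Q1_T D.Q2_T Kc Y]) (assumption | rule Yeq)+
    have Y0: "gain_defect G \<epsilon> (P11 s) (P12 s) (P22 s) (K11 s) (K12 s) (K21 s) (K22 s) z = 0" for s z
      by (simp add: gain_defect_def K11_def K12_def K21_def K22_def)
    define \<zeta> where "\<zeta> s = z1 * \<epsilon> + z2 * exp (- k * (T - s) / \<epsilon>)" for s
    have \<zeta>0: "0 \<le> \<zeta> s" for s using z \<epsilon> by (simp add: \<zeta>_def)
    have \<zeta>b: "\<zeta> s \<le> z1 + z2" if "s \<in> {0..T}" for s
    proof -
      have "exp (- k * (T - s) / \<epsilon>) \<le> 1" using D.k \<epsilon> that by (simp add: divide_nonpos_pos mult_nonneg_nonneg)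
      then have "z1 * \<epsilon> + z2 * exp (- k * (T - s) / \<epsilon>) \<le> z1 * 1 + z2 * 1"
        using z \<epsilon>1 by (intro add_mono mult_left_mono)
      then show ?thesis by (simp add: \<zeta>_def)
    qed
    have db: "\<bar>d s z\<bar> \<le> 4 * (\<zeta> s)\<^sup>2 * (norm z)\<^sup>2" if s: "s \<in> {0..T}" for s z
    proof -
      define e where "e = exp (- k * (T - s) / \<epsilon>)"
      define \<eta> where "\<eta> = Ct * \<epsilon> + c * e"
      have e: "0 \<le> e" "e \<le> 1" using D.k \<epsilon> s by (simp_all add: e_def divide_nonpos_pos mult_nonneg_nonneg)
      have n: "norm (p ((T - s) / \<epsilon>)) \<le> c * e" "norm (y ((T - s) / \<epsilon>)) \<le> c * e"
        using D.layer_decay[of \<epsilon> "T - s"] \<epsilon> s by (simp_all add: e_def)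
      have ce: "0 \<le> c * e" "c * e \<le> c" using e D.c mult_left_mono[of e 1 c] by simp_all
      have Ce: "Ct * \<epsilon> \<le> Ct" using Ct \<epsilon>1 mult_left_mono[of \<epsilon> 1 Ct] by simp
      note tk = tik[OF \<epsilon> sol s]
      have 1: "norm (Pb11 s - P11 s) \<le> \<eta>" using tk ce by (simp add: \<eta>_def norm_minus_commute)
      have "norm (P12 s - D.h (Pb11 s)) \<le> \<eta>"
        using norm_triangle_ineq[of "P12 s - D.h (Pb11 s) - y ((T - s) / \<epsilon>)" "y ((T - s) / \<epsilon>)"] tk n by (simp add: \<eta>_def)
      then have 2: "norm (D.h (Pb11 s) - P12 s) \<le> \<eta>" by (simp add: norm_minus_commute)
      have "norm (P22 s - Pb22) \<le> \<eta>"
        using norm_triangle_ineq[of "P22 s - Pb22 - p ((T - s) / \<epsilon>)" "p ((T - s) / \<epsilon>)"] tk n by (simp add: \<eta>_def)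
      then have 3: "norm (Pb22 - P22 s) \<le> \<eta>" by (simp add: norm_minus_commute)
      have 4: "norm (P12 s) \<le> R"
        using norm_triangle_ineq4[of "D.h (Pb11 s)" "D.h (Pb11 s) - P12 s"] 2 ch[OF s] ce Ce by (simp add: R_def \<eta>_def)
      have \<zeta>: "\<zeta> s = \<beta> * (2 * \<eta> + \<epsilon> * R)"
        by (simp add: \<zeta>_def z1_def z2_def \<eta>_def e_def algebra_simps)
      have \<eta>0: "0 \<le> \<eta>" using order_trans[OF norm_ge_zero 1] .
      have g1: "nB * norm (Pb11 s - P11 s) + nC * norm (D.h (Pb11 s) - P12 s) \<le> \<zeta> s"
        if "nB \<le> \<beta>" "nC \<le> \<beta>" "0 \<le> nB" "0 \<le> nC" for nB nC
      proof -
        have "nB * norm (Pb11 s - P11 s) + nC * norm (D.h (Pb11 s) - P12 s) \<le> \<beta> * \<eta> + \<beta> * \<eta>"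
          using that 1 2 \<beta>(1) by (intro add_mono mult_mono) auto
        also have "\<dots> \<le> \<zeta> s" using \<beta>(1) R \<epsilon> by (simp add: \<zeta> distrib_left)
        finally show ?thesis .
      qed
      have g2: "nC * norm (Pb22 - P22 s) + \<bar>\<epsilon>\<bar> * (nB * norm (P12 s)) \<le> \<zeta> s"
        if "nB \<le> \<beta>" "nC \<le> \<beta>" "0 \<le> nB" "0 \<le> nC" for nB nC
      proof -
        have "nC * norm (Pb22 - P22 s) + \<bar>\<epsilon>\<bar> * (nB * norm (P12 s)) \<le> \<beta> * \<eta> + \<epsilon> * (\<beta> * R)"
          using that 3 4 \<beta>(1) \<epsilon> by (intro add_mono mult_mono) auto
        also have "\<dots> \<le> \<zeta> s" using \<beta>(1) \<eta>0 by (simp add: \<zeta> distrib_left mult_ac)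
        finally show ?thesis .
      qed
      show ?thesis unfolding d_def
      proof (rule gain_defect_bound)
        show "norm (L11 s - ((B11 G)\<^sup>T ** P11 s + (B21 G)\<^sup>T ** (P12 s)\<^sup>T)) \<le> \<zeta> s"
          unfolding L11_def by (rule order_trans[OF gain_difference(1) g1]) (use \<beta> in simp_all)
        show "norm (L12 s - (\<epsilon> *\<^sub>R ((B11 G)\<^sup>T ** P12 s) + (B21 G)\<^sup>T ** P22 s)) \<le> \<zeta> s"
          unfolding L12_def by (rule order_trans[OF gain_difference(2) g2]) (use \<beta> in simp_all)
        have "norm (L21 s + ((B12 G)\<^sup>T ** P11 s + (B22 G)\<^sup>T ** (P12 s)\<^sup>T))
           = norm (((B12 G)\<^sup>T ** Pb11 s + (B22 G)\<^sup>T ** (D.h (Pb11 s))\<^sup>T) - ((B12 G)\<^sup>T ** P11 s + (B22 G)\<^sup>T ** (P12 s)\<^sup>T))"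
          unfolding L21_def by (subst norm_minus_commute) (simp only: uminus_add_conv_diff)
        also have "\<dots> \<le> \<zeta> s" by (rule order_trans[OF gain_difference(1) g1]) (use \<beta> in simp_all)
        finally show "norm (L21 s + ((B12 G)\<^sup>T ** P11 s + (B22 G)\<^sup>T ** (P12 s)\<^sup>T)) \<le> \<zeta> s" .
        have "norm (L22 s + (\<epsilon> *\<^sub>R ((B12 G)\<^sup>T ** P12 s) + (B22 G)\<^sup>T ** P22 s))
           = norm ((B22 G)\<^sup>T ** Pb22 - (\<epsilon> *\<^sub>R ((B12 G)\<^sup>T ** P12 s) + (B22 G)\<^sup>T ** P22 s))"
          unfolding L22_def by (subst norm_minus_commute) (simp only: uminus_add_conv_diff)
        also have "\<dots> \<le> \<zeta> s" by (rule order_trans[OF gain_difference(2) g2]) (use \<beta> in simp_all)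
        finally show "norm (L22 s + (\<epsilon> *\<^sub>R ((B12 G)\<^sup>T ** P12 s) + (B22 G)\<^sup>T ** P22 s)) \<le> \<zeta> s" .
      qed
    qed
    have mom: "expectation (\<lambda>\<omega>. (norm (X s \<omega>))\<^sup>2) \<le> m" if s: "s \<in> {0..T}" for s
    proof -
      have "expectation (\<lambda>\<omega>. (norm (X s \<omega>))\<^sup>2) \<le> V + ((norm x2)\<^sup>2 + (b\<^sup>2 * V / \<gamma> + C2) / \<gamma>)"
        by (rule fast_slow_moment_bound[OF \<epsilon>(1) \<epsilon>1 D.gamma S Fc b X _ s C1_def C2_def V_def]) (assumption | rule Xeq[unfolded loop])+
      then show ?thesis unfolding m_def by (rule order_trans[OF _ max.cobounded2])
    qed
    have Ed: "\<bar>expectation (\<lambda>\<omega>. d s (X s \<omega>))\<bar> \<le> 4 * (z1 + z2) * m * \<zeta> s" if s: "s \<in> {0..T}" for s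
    proof -
      have "\<bar>expectation (\<lambda>\<omega>. d s (X s \<omega>))\<bar> \<le> expectation (\<lambda>\<omega>. 4 * (\<zeta> s)\<^sup>2 * (norm (X s \<omega>))\<^sup>2)"
      proof -
        have "norm (expectation (\<lambda>\<omega>. d s (X s \<omega>))) \<le> expectation (\<lambda>\<omega>. norm (d s (X s \<omega>)))" by (rule integral_norm_bound)
        also have "\<dots> \<le> expectation (\<lambda>\<omega>. 4 * (\<zeta> s)\<^sup>2 * (norm (X s \<omega>))\<^sup>2)"
        proof (rule integral_mono')
          show "integrable \<Omega> (\<lambda>\<omega>. 4 * (\<zeta> s)\<^sup>2 * (norm (X s \<omega>))\<^sup>2)"
            by (rule integrable_mult_right[OF N.nonantD(2)[OF X s]])
          show "norm (d s (X s \<omega>)) \<le> 4 * (\<zeta> s)\<^sup>2 * (norm (X s \<omega>))\<^sup>2" for \<omega>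
            unfolding real_norm_def by (rule db[OF s])
        qed simp
        finally show ?thesis by (simp only: real_norm_def)
      qed
      also have "\<dots> = 4 * (\<zeta> s)\<^sup>2 * expectation (\<lambda>\<omega>. (norm (X s \<omega>))\<^sup>2)" by simp
      \<comment> \<open>One factor \<open>\<zeta> s\<close> is bounded by a constant. The other is
        enough, since its integral is already of order \<open>\<epsilon>\<close>; in the layer the
        defect is of order one, so its square would gain nothing there.\<close>
      also have "\<dots> \<le> 4 * ((z1 + z2) * \<zeta> s) * m"
        using mom[OF s] \<zeta>b[OF s] \<zeta>0[of s] m0 z unfolding power2_eq_square
        by (intro mult_mono) auto
      finally show ?thesis by (simp add: mult_ac)
    qed
    have "\<bar>LINT s:{0..T}|lborel. expectation (\<lambda>\<omega>. d s (X s \<omega>))\<bar> \<le> (LINT s:{0..T}|lborel. 4 * (z1 + z2) * m * \<zeta> s)"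
    proof -
      have "norm (LINT s:{0..T}|lborel. expectation (\<lambda>\<omega>. d s (X s \<omega>))) \<le> (LINT s:{0..T}|lborel. norm (expectation (\<lambda>\<omega>. d s (X s \<omega>))))"
        by (rule set_integral_norm_bound[OF fX])
      also have "\<dots> \<le> (LINT s:{0..T}|lborel. 4 * (z1 + z2) * m * \<zeta> s)"
      proof (rule set_integral_mono)
        show "set_integrable lborel {0..T} (\<lambda>s. norm (expectation (\<lambda>\<omega>. d s (X s \<omega>))))"
          by (rule set_integrable_norm[OF fX])
        show "set_integrable lborel {0..T} (\<lambda>s. 4 * (z1 + z2) * m * \<zeta> s)"
          unfolding \<zeta>_def using \<epsilon> by (intro borel_integrable_atLeastAtMost' continuous_intros) auto
      qed (use Ed in simp)
      finally show ?thesis by simp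
    qed
    also have "(LINT s:{0..T}|lborel. 4 * (z1 + z2) * m * \<zeta> s) = 4 * (z1 + z2) * m * (z1 * \<epsilon> * T + z2 * (\<epsilon> / k) * exp (- k * (T - T) / \<epsilon>))
       - 4 * (z1 + z2) * m * (z1 * \<epsilon> * 0 + z2 * (\<epsilon> / k) * exp (- k * (T - 0) / \<epsilon>))"
      unfolding \<zeta>_def using T0 \<epsilon> D.k
      by (intro LINT_FTC) (auto intro!: derivative_eq_intros continuous_intros simp: has_real_derivative_iff_has_vector_derivative[symmetric])
    also have "\<dots> \<le> 2 * C * \<epsilon>"
    proof -
      have "0 \<le> 4 * (z1 + z2) * m * (z1 * \<epsilon> * 0 + z2 * (\<epsilon> / k) * exp (- k * (T - 0) / \<epsilon>))"
        using z m0 \<epsilon> D.k by (intro mult_nonneg_nonneg add_nonneg_nonneg) auto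
      moreover have "4 * (z1 + z2) * m * (z1 * \<epsilon> * T + z2 * (\<epsilon> / k) * exp (- k * (T - T) / \<epsilon>)) = 2 * C * \<epsilon>"
        using \<epsilon> by (simp add: C_def field_simps)
      ultimately show ?thesis by linarith
    qed
    finally have I: "\<bar>LINT s:{0..T}|lborel. expectation (\<lambda>\<omega>. d s (X s \<omega>))\<bar> \<le> 2 * C * \<epsilon>" .
    have diff: "\<bar>cost_J G T \<Omega> W1 W2 \<epsilon> x1 x2 uh1 uh2 - cost_J G T \<Omega> W1 W2 \<epsilon> x1 x2 ub1 ub2\<bar> \<le> C * \<epsilon>"
      if "feedback_controls G T \<Omega> W1 W2 \<epsilon> x1 x2 (linear_feedback K11 K12) (linear_feedback K21 K22) uh1 uh2"
        "feedback_controls G T \<Omega> W1 W2 \<epsilon> x1 x2 (linear_feedback L11 L12) (linear_feedback L21 L22) ub1 ub2" for uh1 uh2 ub1 ub2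
    proof -
      have "cost_J G T \<Omega> W1 W2 \<epsilon> x1 x2 uh1 uh2 - cost_J G T \<Omega> W1 W2 \<epsilon> x1 x2 ub1 ub2
        = - (1/2) * (LINT s:{0..T}|lborel. expectation (\<lambda>\<omega>. d s (X s \<omega>)))"
        unfolding YJ[OF that(1)] XJ[OF that(2)] JX JY Y0 by (simp add: set_lebesgue_integral_def field_simps)
      then show ?thesis using I by (simp add: abs_mult)
    qed
    show ?case
      unfolding saddle approx by (intro conjI allI impI Xex Yex) (elim conjE, rule diff)
  qed
qed

end

theorem theorem5p3:
  fixes G :: "('n1::finite,'n2::finite,'k1::finite,'k2::finite,'m1::finite,'m2::finite) lq_game"
    and T \<gamma> :: real
    and x1 :: "real^'n1" and x2 :: "real^'n2"
    and \<Omega> :: "'o measure"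
    and W1 :: "real \<Rightarrow> 'o \<Rightarrow> real^'m1" and W2 :: "real \<Rightarrow> 'o \<Rightarrow> real^'m2"
    and Pb22 :: "real^'n2^'n2" and Pb11 :: "real \<Rightarrow> real^'n1^'n1"
  assumes "0 < T"
    and Q_sym: "Q1 G \<in> symmetric_matrices" "Q2 G \<in> symmetric_matrices"
    and prob: "prob_space \<Omega>" "complete_measure \<Omega>"
    and BM: "brownian_motion \<Omega> T W1" "brownian_motion \<Omega> T W2"
    and indep: "prob_space.indep_set \<Omega> (sigma_sets (space \<Omega>) (path_events \<Omega> W1 T))
                                       (sigma_sets (space \<Omega>) (path_events \<Omega> W2 T))"
    and i: "invertible (Delta2 G)"
    and ii: "Pb22 \<in> symmetric_matrices" "fast_are G Pb22"
            "\<forall>z. complex_eigenvalue (fast_S G Pb22) z \<longrightarrow> Re z < 0"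
    and iii: "reduced_unique_solution G T Pb11"
    and iv: "0 < \<gamma>" "loewner_le (sym_part (fast_S G Pb22)) (- mat \<gamma>)"
    and v: "\<exists>\<delta> q2. 0 < \<delta> \<and> \<delta> < \<gamma> \<and> largest_ball_radius G Pb22 \<delta> q2
              \<and> - Pb22 \<in> (top_of_set symmetric_matrices) interior_of (sym_cball q2)"
  shows "\<exists>\<epsilon>s. tikhonov_threshold G T Pb22 Pb11 \<epsilon>s
    \<and> (\<exists>C. \<forall>\<epsilon> P11 P12 P22. 0 < \<epsilon> \<and> \<epsilon> < \<epsilon>s \<and> full_solution G T \<epsilon> P11 P12 P22 \<longrightarrow>
         (\<exists>uh1 uh2. feedback_controls G T \<Omega> W1 W2 \<epsilon> x1 x2
            (saddle_u1 G \<epsilon> P11 P12 P22) (saddle_u2 G \<epsilon> P11 P12 P22) uh1 uh2)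
       \<and> (\<exists>ub1 ub2. feedback_controls G T \<Omega> W1 W2 \<epsilon> x1 x2
            (approx_u1 G Pb22 Pb11) (approx_u2 G Pb22 Pb11) ub1 ub2)
       \<and> (\<forall>uh1 uh2 ub1 ub2.
            feedback_controls G T \<Omega> W1 W2 \<epsilon> x1 x2
              (saddle_u1 G \<epsilon> P11 P12 P22) (saddle_u2 G \<epsilon> P11 P12 P22) uh1 uh2
            \<and> feedback_controls G T \<Omega> W1 W2 \<epsilon> x1 x2
              (approx_u1 G Pb22 Pb11) (approx_u2 G Pb22 Pb11) ub1 ub2 \<longrightarrow>
            \<bar>cost_J G T \<Omega> W1 W2 \<epsilon> x1 x2 uh1 uh2 - cost_J G T \<Omega> W1 W2 \<epsilon> x1 x2 ub1 ub2\<bar> \<le> C * \<epsilon>))"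
proof -
  obtain \<delta> q2 where \<delta>: "0 < \<delta>" "\<delta> < \<gamma>" "largest_ball_radius G Pb22 \<delta> q2"
    "- Pb22 \<in> (top_of_set symmetric_matrices) interior_of (sym_cball q2)" using v by blast
  interpret L: layer_data G Pb22 \<gamma> \<delta> q2
    by unfold_locales (rule Q_sym i ii iv \<delta>)+
  obtain y p c k where bl: "boundary_layer_solution G Pb22 y p" "0 < k" "0 \<le> c"
    "\<And>\<tau>. 0 \<le> \<tau> \<Longrightarrow> (p \<tau>)\<^sup>T = p \<tau>"
    "\<And>\<tau>. 0 \<le> \<tau> \<Longrightarrow> norm (p \<tau>) \<le> c * exp (- k * \<tau>)"
    "\<And>\<tau>. 0 \<le> \<tau> \<Longrightarrow> norm (y \<tau>) \<le> c * exp (- k * \<tau>)"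
    by (rule L.boundary_layer_exists) (rule that)
  have red: "reduced_solution G T Pb11" using iii by (simp add: reduced_unique_solution_def)
  have data: "tikhonov_data G Pb22 \<gamma> \<delta> q2 T Pb11 y p c k"
    by unfold_locales (rule \<open>0 < T\<close> red bl; assumption?)+
  interpret prob_space \<Omega> by (rule prob(1))
  interpret B: brownian_pair \<Omega> T W1 W2
    by (intro brownian_pair.intro brownian_pair_axioms.intro prob \<open>0 < T\<close> BM indep)
  show ?thesis
  proof (rule B.cost_gap[OF data, of x1 x2], goal_cases)
    case (1 \<epsilon>s C)
    show ?case
      by (rule exI[of _ \<epsilon>s], rule conjI[OF 1(1)], rule exI[of _ C], intro allI impI, elim conjE, rule 1(2))
  qed
qed

end
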